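(* Let $\alpha>1$, let $[a,b]\subset\mathbb R$ be a compact interval, let $S\in L_1((1/4,1);H^2([a,b]))$, and let $\Phi$ be a function satisfying, for positive constants $C_*,C_0,C_1,C_2,C_3$, the inequalities $$|\Phi(v,\partial_xv,\partial_x^2v,\partial_x^3v)|\le\sum_{k=0}^3C_k|\partial_x^kv|^\alpha+C_*,$$ $$\Phi(v,\partial_xv,\partial_x^2v,\partial_x^3v)\,\partial_x^3v\ge C_3|\partial_x^3v|^{\alpha+1}-\sum_{k=0}^2C_k|\Phi(v,\partial_xv,\partial_x^2v,\partial_x^3v)|\,|\partial_x^kv|.$$ Let $v\in L_\infty([1/4,1]\times[a,b])$ with $\|v\|_{L_\infty([1/4,1]\times[a,b])}\le1$ be a weak solution of $$\partial_\tau v+\partial_x\bigl(\Phi(v,\partial_xv,\partial_x^2v,\partial_x^3v)\bigr)+S(\tau,x)=0,\qquad\tau\in(1/4,1),\ x\in[a,b].$$ Then, for all $x_0\in[a,b]$ and all $\kappa>0$ such that $a<x_0-2\kappa<x_0+2\kappa<b$, $$\int_{1/2}^1\int_{x_0-\kappa}^{x_0+\kappa}|\partial_x^3v|^{\alpha+1}\,dx\,d\tau\le C+C\|S\|_{L_1((1/4,1);H^2([a,b]))},$$ where $C>0$ is a constant depending only on $\alpha$, $\kappa$, $a$, $b$ and the constants $C_*,C_0,\dots,C_3$ (in particular not on $v$ or $S$).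
   Context: A weak solution is a function $v\in L_{\alpha+1}([1/4,1];W^3_{\alpha+1,\mathrm{loc}}([a,b]))$ with $\partial_\tau v\in L_{\frac{\alpha+1}{\alpha}}([1/4,1];(W^1_{\alpha+1,\mathrm{loc}}([a,b]))')$ such that $$\int_{1/4}^1\langle\partial_\tau v,\xi\rangle\,d\tau=\int_{1/4}^1\int_a^b\Phi(v,\partial_xv,\partial_x^2v,\partial_x^3v)\,\partial_x\xi\,dx\,d\tau-\int_{1/4}^1\int_a^bS\,\xi\,dx\,d\tau$$ for all $\xi\in L_{\alpha+1}([1/4,1];W^1_{\alpha+1}([a,b]))$ with $\operatorname{supp}\xi\subset[1/4,1]\times K$ for some compact subinterval $K\subset(a,b)$. Here the subscript "loc" refers to compact subintervals $K\subset(a,b)$: $v\in L_{\alpha+1}([1/4,1];W^3_{\alpha+1}(K))$ for each such $K$, and $\partial_\tau v$ is, for each such $K$, in $L_{\frac{\alpha+1}{\alpha}}$ in time with values in the dual of the space of $W^1_{\alpha+1}$-functions supported in $K$. The function $\Phi$ is a function of four real variables (measurable enough that the compositions are measurable), and the structural inequalities are required for all real values of the arguments $(v,\partial_xv,\partial_x^2v,\partial_x^3v)$. *)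

theory Defs
  imports "HOL-Analysis.Analysis" "HOL-Probability.Essential_Supremum"
begin

section \<open>Sobolev spaces on an open subset of the line\<close>

definition test_function :: "real set \<Rightarrow> (real \<Rightarrow> real) \<Rightarrow> bool" where
  "test_function A \<phi> \<longleftrightarrow>
     (\<forall>n x. (deriv ^^ n) \<phi> differentiable (at x)) \<and>
     compact (closure {x. \<phi> x \<noteq> 0}) \<and> closure {x. \<phi> x \<noteq> 0} \<subseteq> A"

definition locally_integrable :: "real set \<Rightarrow> (real \<Rightarrow> real) \<Rightarrow> bool" where
  "locally_integrable A f \<longleftrightarrow> (\<forall>K. compact K \<and> K \<subseteq> A \<longrightarrow> f absolutely_integrable_on K)"

definition has_weak_deriv :: "nat \<Rightarrow> real set \<Rightarrow> (real \<Rightarrow> real) \<Rightarrow> (real \<Rightarrow> real) \<Rightarrow> bool" where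
  "has_weak_deriv k A f g \<longleftrightarrow>
     locally_integrable A f \<and> locally_integrable A g \<and>
     (\<forall>\<phi>. test_function A \<phi> \<longrightarrow>
        (LINT x:A|lebesgue. f x * (deriv ^^ k) \<phi> x) = (- 1) ^ k * (LINT x:A|lebesgue. g x * \<phi> x))"

text \<open>The weak derivative is unique only up to null sets; \<open>weak_deriv\<close> picks a representative.
  It is used below only inside integrals over \<open>A\<close>.\<close>

definition weak_deriv :: "nat \<Rightarrow> real set \<Rightarrow> (real \<Rightarrow> real) \<Rightarrow> real \<Rightarrow> real" where
  "weak_deriv k A f = (SOME g. has_weak_deriv k A f g)"

definition in_Lp :: "real \<Rightarrow> real set \<Rightarrow> (real \<Rightarrow> real) \<Rightarrow> bool" where
  "in_Lp p A f \<longleftrightarrow> f \<in> borel_measurable (lebesgue_on A) \<and>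
     integrable (lebesgue_on A) (\<lambda>x. \<bar>f x\<bar> powr p)"

text \<open>Elements of function spaces are represented by functions, not by classes modulo null sets.
  The space \<open>W\<^sup>k\<^sub>p\<close> over a compact interval is taken over its interior.\<close>

definition sobolev :: "nat \<Rightarrow> real \<Rightarrow> real set \<Rightarrow> (real \<Rightarrow> real) set" where
  "sobolev k p A = {f. in_Lp p A f \<and> (\<forall>j\<le>k. \<exists>g. has_weak_deriv j A f g \<and> in_Lp p A g)}"

definition sobolev_norm :: "nat \<Rightarrow> real \<Rightarrow> real set \<Rightarrow> (real \<Rightarrow> real) \<Rightarrow> real" where
  "sobolev_norm k p A f = (\<Sum>j\<le>k. LINT x:A|lebesgue. \<bar>weak_deriv j A f x\<bar> powr p) powr (1 / p)"

definition sobolev_supported ::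
    "nat \<Rightarrow> real \<Rightarrow> real set \<Rightarrow> real set \<Rightarrow> (real \<Rightarrow> real) set" where
  "sobolev_supported k p A K = {f \<in> sobolev k p A. AE x in lebesgue_on A. x \<notin> K \<longrightarrow> f x = 0}"

section \<open>Bochner spaces and dual spaces\<close>

text \<open>\<open>L\<^sub>p(M; X)\<close> for a space \<open>X\<close> with (semi)norm \<open>N\<close>: \<open>u\<close> is strongly measurable, i.e. almost
  everywhere the limit in \<open>N\<close> of \<open>X\<close>-valued simple functions, and its norm is in \<open>L\<^sub>p\<close>.\<close>

definition bochner_Lp ::
    "'t measure \<Rightarrow> 'a::minus set \<Rightarrow> ('a \<Rightarrow> real) \<Rightarrow> real \<Rightarrow> ('t \<Rightarrow> 'a) \<Rightarrow> bool" where
  "bochner_Lp M X N p u \<longleftrightarrow>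
     (AE t in M. u t \<in> X) \<and>
     (\<exists>s :: nat \<Rightarrow> 't \<Rightarrow> 'a.
        (\<forall>n. simple_function M (s n) \<and> s n ` space M \<subseteq> X) \<and>
        (AE t in M. (\<lambda>n. N (s n t - u t)) \<longlonglongrightarrow> 0)) \<and>
     integrable M (\<lambda>t. N (u t) powr p)"

definition bochner_norm :: "'t measure \<Rightarrow> ('a \<Rightarrow> real) \<Rightarrow> real \<Rightarrow> ('t \<Rightarrow> 'a) \<Rightarrow> real" where
  "bochner_norm M N p u = (LINT t|M. N (u t) powr p) powr (1 / p)"

text \<open>Functionals are total functions, of which only the values on \<open>X\<close> matter. Boundedness forces
  equal values on almost everywhere equal representatives.\<close>

definition dual_space ::
    "(real \<Rightarrow> real) set \<Rightarrow> ((real \<Rightarrow> real) \<Rightarrow> real) \<Rightarrow> ((real \<Rightarrow> real) \<Rightarrow> real) set" where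
  "dual_space X N = {T.
     (\<forall>f\<in>X. \<forall>g\<in>X. T (\<lambda>x. f x + g x) = T f + T g) \<and>
     (\<forall>f\<in>X. \<forall>c. T (\<lambda>x. c * f x) = c * T f) \<and>
     (\<exists>B. \<forall>f\<in>X. \<bar>T f\<bar> \<le> B * N f)}"

definition dual_norm ::
    "(real \<Rightarrow> real) set \<Rightarrow> ((real \<Rightarrow> real) \<Rightarrow> real) \<Rightarrow> ((real \<Rightarrow> real) \<Rightarrow> real) \<Rightarrow> real" where
  "dual_norm X N T = Sup {\<bar>T f\<bar> | f. f \<in> X \<and> N f \<le> 1}"

section \<open>Weak solutions\<close>

text \<open>A jointly measurable representative of the weak derivative of order \<open>k\<close> in the space
  variable \<open>x\<close> of a function \<open>v\<close> of time and space. For \<open>v \<in> L\<^sub>p(I; W\<^sup>k\<^sub>p\<^sub>,\<^sub>l\<^sub>o\<^sub>c(A))\<close> one exists,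
  and it is unique up to null sets of \<open>I \<times> A\<close>.\<close>

definition weak_dx ::
    "nat \<Rightarrow> real set \<Rightarrow> real set \<Rightarrow> (real \<Rightarrow> real \<Rightarrow> real) \<Rightarrow> real \<Rightarrow> real \<Rightarrow> real" where
  "weak_dx k I A v = (SOME w.
     (\<lambda>(\<tau>, x). w \<tau> x) \<in> borel_measurable (lebesgue_on (I \<times> A)) \<and>
     (AE \<tau> in lebesgue_on I. has_weak_deriv k A (v \<tau>) (w \<tau>)))"

abbreviation time_interval :: "real set" where
  "time_interval \<equiv> {1/4..1}"

abbreviation v_dx :: "nat \<Rightarrow> real \<Rightarrow> real \<Rightarrow> (real \<Rightarrow> real \<Rightarrow> real) \<Rightarrow> real \<Rightarrow> real \<Rightarrow> real" where
  "v_dx k a b v \<equiv> weak_dx k time_interval {a<..<b} v"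

definition flux :: "(real \<Rightarrow> real \<Rightarrow> real \<Rightarrow> real \<Rightarrow> real) \<Rightarrow> real \<Rightarrow> real \<Rightarrow> (real \<Rightarrow> real \<Rightarrow> real)
    \<Rightarrow> real \<Rightarrow> real \<Rightarrow> real" where
  "flux \<Phi> a b v \<tau> x =
     \<Phi> (v \<tau> x) (v_dx 1 a b v \<tau> x) (v_dx 2 a b v \<tau> x) (v_dx 3 a b v \<tau> x)"

text \<open>\<open>vt\<close> is the distributional time derivative of \<open>v\<close>, where \<open>v \<tau>\<close> is identified with the
  functional integrating against \<open>v \<tau>\<close>. One function \<open>vt\<close> serves all \<open>K = [c,d]\<close>, as the spaces
  of functions supported in \<open>K\<close> increase with \<open>K\<close>.\<close>

definition has_weak_dt ::
    "real \<Rightarrow> real \<Rightarrow> real \<Rightarrow> (real \<Rightarrow> real \<Rightarrow> real) \<Rightarrow> (real \<Rightarrow> (real \<Rightarrow> real) \<Rightarrow> real) \<Rightarrow> bool" where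
  "has_weak_dt \<alpha> a b v vt \<longleftrightarrow> (\<forall>c d. a < c \<and> c < d \<and> d < b \<longrightarrow>
     (let X = sobolev_supported 1 (\<alpha> + 1) {a<..<b} {c..d};
          N = sobolev_norm 1 (\<alpha> + 1) {a<..<b}
      in bochner_Lp (lebesgue_on time_interval) (dual_space X N) (dual_norm X N)
           ((\<alpha> + 1) / \<alpha>) vt \<and>
         (\<forall>\<eta>. test_function {1/4<..<1} \<eta> \<longrightarrow> (\<forall>\<phi>\<in>X.
           (LINT \<tau>:time_interval|lebesgue. deriv \<eta> \<tau> * (LINT x:{a..b}|lebesgue. v \<tau> x * \<phi> x))
             = - (LINT \<tau>:time_interval|lebesgue. \<eta> \<tau> * vt \<tau> \<phi>)))))"

definition admissible_test ::
    "real \<Rightarrow> real \<Rightarrow> real \<Rightarrow> (real \<Rightarrow> real \<Rightarrow> real) \<Rightarrow> bool" where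
  "admissible_test \<alpha> a b \<xi> \<longleftrightarrow>
     bochner_Lp (lebesgue_on time_interval)
       (sobolev 1 (\<alpha> + 1) {a<..<b}) (sobolev_norm 1 (\<alpha> + 1) {a<..<b}) (\<alpha> + 1) \<xi> \<and>
     (\<exists>c d. a < c \<and> c < d \<and> d < b \<and>
       (AE \<tau> in lebesgue_on time_interval.
          \<xi> \<tau> \<in> sobolev_supported 1 (\<alpha> + 1) {a<..<b} {c..d}))"

text \<open>The integral of \<open>S * \<xi>\<close> has to be an iterated one: the product need not be integrable over
  the rectangle, as \<open>S\<close> is only integrable in time. The measurability clause on the flux is all
  that is required of \<open>\<Phi>\<close> besides its structural inequalities.\<close>

definition weak_solution ::
    "real \<Rightarrow> real \<Rightarrow> real \<Rightarrow> (real \<Rightarrow> real \<Rightarrow> real \<Rightarrow> real \<Rightarrow> real) \<Rightarrow> (real \<Rightarrow> real \<Rightarrow> real)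
      \<Rightarrow> (real \<Rightarrow> real \<Rightarrow> real) \<Rightarrow> bool" where
  "weak_solution \<alpha> a b \<Phi> S v \<longleftrightarrow>
     (\<forall>c d. a < c \<and> c < d \<and> d < b \<longrightarrow>
        bochner_Lp (lebesgue_on time_interval)
          (sobolev 3 (\<alpha> + 1) {c<..<d}) (sobolev_norm 3 (\<alpha> + 1) {c<..<d}) (\<alpha> + 1) v) \<and>
     (\<lambda>(\<tau>, x). flux \<Phi> a b v \<tau> x) \<in> borel_measurable (lebesgue_on (time_interval \<times> {a<..<b})) \<and>
     (\<exists>vt. has_weak_dt \<alpha> a b v vt \<and>
       (\<forall>\<xi>. admissible_test \<alpha> a b \<xi> \<longrightarrow>
          (LINT \<tau>:time_interval|lebesgue. vt \<tau> (\<xi> \<tau>)) =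
            (LINT \<tau>:time_interval|lebesgue. LINT x:{a..b}|lebesgue.
               flux \<Phi> a b v \<tau> x * weak_deriv 1 {a<..<b} (\<xi> \<tau>) x)
          - (LINT \<tau>:time_interval|lebesgue. LINT x:{a..b}|lebesgue. S \<tau> x * \<xi> \<tau> x)))"

definition structural_ineqs ::
    "real \<Rightarrow> real \<Rightarrow> real \<Rightarrow> real \<Rightarrow> real \<Rightarrow> real
      \<Rightarrow> (real \<Rightarrow> real \<Rightarrow> real \<Rightarrow> real \<Rightarrow> real) \<Rightarrow> bool" where
  "structural_ineqs \<alpha> Cs C0 C1 C2 C3 \<Phi> \<longleftrightarrow> (\<forall>y0 y1 y2 y3.
     \<bar>\<Phi> y0 y1 y2 y3\<bar> \<le> C0 * \<bar>y0\<bar> powr \<alpha> + C1 * \<bar>y1\<bar> powr \<alpha> + C2 * \<bar>y2\<bar> powr \<alpha>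
       + C3 * \<bar>y3\<bar> powr \<alpha> + Cs \<and>
     \<Phi> y0 y1 y2 y3 * y3 \<ge> C3 * \<bar>y3\<bar> powr (\<alpha> + 1)
       - (C0 * \<bar>\<Phi> y0 y1 y2 y3\<bar> * \<bar>y0\<bar> + C1 * \<bar>\<Phi> y0 y1 y2 y3\<bar> * \<bar>y1\<bar>
          + C2 * \<bar>\<Phi> y0 y1 y2 y3\<bar> * \<bar>y2\<bar>))"

text \<open>As \<open>esssup\<close> is \<open>top\<close> on non-measurable functions, a finite \<open>Linf_norm\<close> of \<open>v\<close> entails that
  \<open>\<bar>v\<bar>\<close>, but not \<open>v\<close>, is measurable; hence the separate clause in \<open>in_Linf\<close>.\<close>

definition Linf_norm :: "(real \<times> real) set \<Rightarrow> (real \<Rightarrow> real \<Rightarrow> real) \<Rightarrow> ereal" where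
  "Linf_norm D v = esssup (lebesgue_on D) (\<lambda>(\<tau>, x). ereal \<bar>v \<tau> x\<bar>)"

definition in_Linf :: "(real \<times> real) set \<Rightarrow> (real \<Rightarrow> real \<Rightarrow> real) \<Rightarrow> bool" where
  "in_Linf D v \<longleftrightarrow> (\<lambda>(\<tau>, x). v \<tau> x) \<in> borel_measurable (lebesgue_on D) \<and> Linf_norm D v < \<infinity>"

definition in_L1_H2 :: "real \<Rightarrow> real \<Rightarrow> (real \<Rightarrow> real \<Rightarrow> real) \<Rightarrow> bool" where
  "in_L1_H2 a b S \<longleftrightarrow>
     bochner_Lp (lebesgue_on {1/4<..<1}) (sobolev 2 2 {a<..<b}) (sobolev_norm 2 2 {a<..<b}) 1 S"

definition L1_H2_norm :: "real \<Rightarrow> real \<Rightarrow> (real \<Rightarrow> real \<Rightarrow> real) \<Rightarrow> real" where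
  "L1_H2_norm a b S = bochner_norm (lebesgue_on {1/4<..<1}) (sobolev_norm 2 2 {a<..<b}) 1 S"

end

theory Submission
  imports Defs
begin

text \<open>Formally one tests the equation with \<open>\<xi> = - \<eta>(\<tau>) \<partial>\<^sub>x(\<psi> \<partial>\<^sub>xv)\<close>, where
  \<open>\<psi> = \<chi>\<^sup>m\<close> with \<open>\<chi> = 1 - ((x - x0) / 2\<kappa>)\<^sup>2\<close> and \<open>\<eta>\<close> is a high power of a
  ramp starting at \<open>\<tau> = 3/8\<close>, cut off near \<open>\<tau> = 1\<close>. The time derivative gives the energy
  \<open>\<integral> \<psi> (\<partial>\<^sub>xv)\<^sup>2\<close>, the flux gives \<open>\<integral> \<psi> \<bar>\<partial>\<^sub>x\<^sup>3v\<bar>\<^bsup>\<alpha>+1\<^esup>\<close> up to terms of lower order, and in the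
  source term two integrations by parts move all derivatives to \<open>S\<close>. Since \<open>\<bar>v\<bar> \<le> 1\<close>, the first
  and second derivatives are interpolated pointwise, through Taylor's formula with a step proportional
  to \<open>\<chi>\<^sup>2\<close>; this absorbs all other terms if \<open>m\<close> and the power in \<open>\<eta>\<close> are large, the latter
  because \<open>\<alpha> + 1 > 2\<close>.

  As \<open>\<xi>\<close> lacks regularity in time, the equation is tested instead with
  \<open>\<rho>((\<tau> - s) / \<epsilon>) \<phi>(x)\<close>, where \<open>\<phi> = - \<partial>\<^sub>x(\<psi> \<partial>\<^sub>xv)\<close> is frozen at time \<open>\<tau>\<close>, and then
  integrated against \<open>\<eta>(\<tau>)\<close>. For even \<open>\<rho>\<close> the singular part is antisymmetric in the time shift, so
  that only differences of \<open>\<eta>\<close> remain as \<open>\<epsilon>\<close> tends to zero.\<close>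

section \<open>Smooth functions on the line\<close>

text \<open>The source is only integrable in time, so it has to be paired with something bounded
  there. Freezing the test function at time \<tau> provides this: once all derivatives are on
  \<open>S\<close>, only \<bar>v\<bar> \<le> 1 is used, so one integrable function of time bounds
  the source against every frozen slice, and averaging it with a kernel of mass one preserves its
  integral. The exponents are forced: the step s \<chi>^2 costs \<chi>^(-4(\<alpha>+1)) in the
  second derivative and the derivatives of \<chi>^m another \<chi>^(-(\<alpha>+1)), whence m \<ge>
  5(\<alpha>+1); the derivative of the time weight costs one power of the ramp, which Young's
  inequality repays if the power is at least (\<alpha>+1)/(\<alpha>-1). The cutoff near \<tau> = 1
  decreases and so contributes with the good sign; its slope enters only an error that vanishes with
  \<epsilon>, so it may be arbitrarily steep. A further obstacle is that \<open>weak_dx\<close> is a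
  choice: a jointly measurable derivative must be derived from strong measurability into Sobolev
  spaces. All data are then replaced by Borel functions on the plane vanishing off a rectangle,
  where Fubini and translations apply.\<close>

definition smooth :: "(real \<Rightarrow> real) \<Rightarrow> bool" where
  "smooth f \<longleftrightarrow> (\<forall>n x. (deriv ^^ n) f differentiable (at x))"

text \<open>Induction needs a finite order: \<open>times_diff_Suc\<close> peels off one derivative,
  whereas \<open>smooth\<close> speaks of all orders at once and offers no induction
  variable.\<close>

definition times_diff :: "nat \<Rightarrow> (real \<Rightarrow> real) \<Rightarrow> bool" where
  "times_diff n f \<longleftrightarrow> (\<forall>k\<le>n. \<forall>x. (deriv ^^ k) f differentiable (at x))"

lemma smooth_iff_times_diff: "smooth f \<longleftrightarrow> (\<forall>n. times_diff n f)"
  unfolding smooth_def times_diff_def by blast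

lemma times_diff_0: "times_diff 0 f \<longleftrightarrow> (\<forall>x. f differentiable (at x))"
  by (simp add: times_diff_def)

lemma all_Suc_le_iff: "(\<forall>k\<le>Suc n. P k) \<longleftrightarrow> P 0 \<and> (\<forall>k\<le>n. P (Suc k))"
  by (metis Suc_le_mono not0_implies_Suc zero_le)

lemma times_diff_Suc:
  "times_diff (Suc n) f \<longleftrightarrow> (\<forall>x. f differentiable (at x)) \<and> times_diff n (deriv f)"
proof -
  have "(\<forall>k\<le>Suc n. \<forall>x. (deriv ^^ k) f differentiable (at x)) \<longleftrightarrow>
      (\<forall>x. f differentiable (at x)) \<and> (\<forall>k\<le>n. \<forall>x. (deriv ^^ Suc k) f differentiable (at x))"
    by (simp add: all_Suc_le_iff del: funpow.simps)
  then show ?thesis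
    by (simp add: times_diff_def funpow_swap1)
qed

lemma smooth_imp_deriv: "smooth f \<Longrightarrow> (f has_real_derivative deriv f x) (at x)"
  using smooth_iff_times_diff[of f] times_diff_0[of f] DERIV_deriv_iff_real_differentiable[of f x]
  by blast

lemma smooth_deriv: "smooth f \<Longrightarrow> smooth (deriv f)"
  using smooth_iff_times_diff times_diff_Suc by blast

lemma smoothI:
  assumes "\<And>x. (f has_real_derivative f' x) (at x)" "smooth f'"
  shows "smooth f"
proof -
  have "deriv f = f'"
    using assms(1) DERIV_imp_deriv by blast
  moreover have "f differentiable (at x)" for x
    using assms(1) real_differentiable_def by blast
  ultimately have "times_diff n f" for n
    using assms(2) by (cases n) (auto simp: times_diff_0 times_diff_Suc smooth_iff_times_diff)
  then show ?thesis
    by (simp add: smooth_iff_times_diff)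
qed

lemma smooth_continuous_on: "smooth f \<Longrightarrow> continuous_on S f"
  using smooth_imp_deriv by (meson DERIV_isCont continuous_at_imp_continuous_on)

section \<open>Closure of smooth functions under sums, products and affine substitutions\<close>

lemma deriv_add_fun:
  fixes f g :: "real \<Rightarrow> real"
  assumes "\<And>x. f differentiable (at x)" "\<And>x. g differentiable (at x)"
  shows "deriv (\<lambda>x. f x + g x) = (\<lambda>x. deriv f x + deriv g x)"
proof
  fix x :: real
  show "deriv (\<lambda>x. f x + g x) x = deriv f x + deriv g x"
    by (rule DERIV_imp_deriv) (use assms in \<open>auto intro!: derivative_intros simp: DERIV_deriv_iff_real_differentiable\<close>)
qed

lemma deriv_mult_fun:
  fixes f g :: "real \<Rightarrow> real"
  assumes "\<And>x. f differentiable (at x)" "\<And>x. g differentiable (at x)"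
  shows "deriv (\<lambda>x. f x * g x) = (\<lambda>x. deriv f x * g x + f x * deriv g x)"
proof
  fix x :: real
  have "(f has_real_derivative deriv f x) (at x)" "(g has_real_derivative deriv g x) (at x)"
    using assms by (auto simp: DERIV_deriv_iff_real_differentiable)
  then have "((\<lambda>x. f x * g x) has_real_derivative deriv f x * g x + deriv g x * f x) (at x)"
    by (rule DERIV_mult)
  then show "deriv (\<lambda>x. f x * g x) x = deriv f x * g x + f x * deriv g x"
    by (simp add: DERIV_imp_deriv mult.commute)
qed

lemma times_diff_add: "times_diff n f \<Longrightarrow> times_diff n g \<Longrightarrow> times_diff n (\<lambda>x. f x + g x)"
proof (induction n arbitrary: f g)
  case (Suc n)
  then show ?case by (auto simp: times_diff_Suc deriv_add_fun)
qed (auto simp: times_diff_0)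

lemma times_diff_Suc_D: "times_diff (Suc n) f \<Longrightarrow> times_diff n f"
  unfolding times_diff_def using le_SucI by blast

text \<open>In the derivative of a product each summand is again a product of two functions of order
  n, so the induction has to run over both factors simultaneously.\<close>

lemma times_diff_mult: "times_diff n f \<Longrightarrow> times_diff n g \<Longrightarrow> times_diff n (\<lambda>x. f x * g x)"
proof (induction n arbitrary: f g)
  case (Suc n)
  then have "times_diff n (\<lambda>x. deriv f x * g x)" "times_diff n (\<lambda>x. f x * deriv g x)"
    using times_diff_Suc_D[OF Suc.prems(1)] times_diff_Suc_D[OF Suc.prems(2)]
    by (auto simp: times_diff_Suc intro!: Suc.IH)
  with Suc show ?case by (auto simp: times_diff_Suc deriv_mult_fun times_diff_add)
qed (auto simp: times_diff_0)

lemma smooth_add: "smooth f \<Longrightarrow> smooth g \<Longrightarrow> smooth (\<lambda>x. f x + g x)"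
  and smooth_mult: "smooth f \<Longrightarrow> smooth g \<Longrightarrow> smooth (\<lambda>x. f x * g x)"
  by (auto simp: smooth_iff_times_diff times_diff_add times_diff_mult)

lemma smooth_const: "smooth (\<lambda>x. c)"
proof -
  have "times_diff n (\<lambda>x. c)" for n c
  proof (induction n arbitrary: c)
    case (Suc n)
    have "deriv (\<lambda>x::real. c) = (\<lambda>x. 0)" by auto
    then show ?case using Suc.IH[of 0] by (simp add: times_diff_Suc)
  qed (simp add: times_diff_0)
  then show ?thesis by (simp add: smooth_iff_times_diff)
qed

lemma smooth_affine:
  assumes "smooth f" shows "smooth (\<lambda>x. f (c + m * x))"
proof -
  have "times_diff n f \<Longrightarrow> times_diff n (\<lambda>x. f (c + m * x))" for n and f :: "real \<Rightarrow> real"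
  proof (induction n arbitrary: f)
    case 0
    then show ?case
      using differentiable_chain_at[of "\<lambda>x. c + m * x" _ f]
      by (auto simp: times_diff_0 o_def)
  next
    case (Suc n)
    have d: "((\<lambda>x. f (c + m * x)) has_real_derivative m * deriv f (c + m * x)) (at x)" for x
    proof -
      have "(f has_real_derivative deriv f (c + m * x)) (at (c + m * x))"
        using Suc.prems by (auto simp: times_diff_Suc DERIV_deriv_iff_real_differentiable)
      then have "((\<lambda>x. f (c + m * x)) has_real_derivative deriv f (c + m * x) * m) (at x)"
        by (rule DERIV_chain2) (auto intro!: derivative_eq_intros)
      then show ?thesis by (simp add: mult.commute)
    qed
    then have "deriv (\<lambda>x. f (c + m * x)) = (\<lambda>x. m * deriv f (c + m * x))"
      using DERIV_imp_deriv by blast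
    moreover have "times_diff n (\<lambda>x. m * deriv f (c + m * x))"
      using Suc smooth_const[of m] times_diff_mult
      by (auto simp: smooth_iff_times_diff times_diff_Suc)
    ultimately show ?case
      using d by (auto simp: times_diff_Suc real_differentiable_def)
  qed
  then show ?thesis
    using assms by (simp add: smooth_iff_times_diff)
qed

text \<open>The power k is carried along because differentiation stays within the linear span of
  this family, which makes smoothness an induction over all k at once.\<close>

definition flat_exp :: "nat \<Rightarrow> real \<Rightarrow> real" where
  "flat_exp k x = (if x > 0 then exp (- (1 / x)) / x ^ k else 0)"

text \<open>With y = 1/x this is the decay of y^k exp(-y) at infinity.\<close>

lemma flat_exp_tendsto_0: "(flat_exp k \<longlongrightarrow> 0) (at_right 0)"
proof -
  have "((\<lambda>x::real. x ^ k / exp x) \<longlongrightarrow> 0) at_top"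
    by (rule tendsto_power_div_exp_0)
  then have "((\<lambda>x::real. inverse x ^ k / exp (inverse x)) \<longlongrightarrow> 0) (at_right 0)"
    by (rule filterlim_compose[OF _ filterlim_inverse_at_top_right])
  then show ?thesis
    by (rule Lim_transform_eventually)
       (auto simp: eventually_at_filter flat_exp_def exp_minus field_simps)
qed

lemma flat_exp_deriv:
  "(flat_exp k has_real_derivative flat_exp (k+2) x + (- real k) * flat_exp (k+1) x) (at x)"
proof -
  consider "x > 0" | "x < 0" | "x = 0" by linarith
  then show ?thesis
  proof cases
    case 1
    have e: "\<forall>\<^sub>F y in nhds x. exp (- (1 / y)) / y ^ k = flat_exp k y"
      using eventually_gt_at_top 1
      by (auto simp: flat_exp_def eventually_nhds intro!: exI[of _ "{0<..}"])
    have "((\<lambda>y. exp (- (1 / y)) / y ^ k) has_real_derivative flat_exp (k+2) x + (- real k) * flat_exp (k+1) x) (at x)"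
    proof -
      have "((\<lambda>y. exp (- (1 / y))) has_real_derivative exp (- (1 / x)) * (1 / x ^ 2)) (at x)"
        using 1 by (auto intro!: derivative_eq_intros simp: power2_eq_square)
      moreover have "((\<lambda>y. y ^ k) has_real_derivative real k * x ^ (k - 1)) (at x)"
        using DERIV_pow[of k x UNIV] by simp
      ultimately have "((\<lambda>y. exp (- (1 / y)) / y ^ k) has_real_derivative
          (exp (- (1 / x)) * (1 / x ^ 2) * x ^ k - exp (- (1 / x)) * (real k * x ^ (k - 1)))
            / (x ^ k * x ^ k)) (at x)"
        using 1 by (intro DERIV_divide) auto
      moreover have "(exp (- (1 / x)) * (1 / x ^ 2) * x ^ k - exp (- (1 / x)) * (real k * x ^ (k - 1)))
            / (x ^ k * x ^ k) = flat_exp (k+2) x + (- real k) * flat_exp (k+1) x"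
        using 1 by (cases k) (auto simp: flat_exp_def divide_simps power2_eq_square algebra_simps)
      ultimately show ?thesis by simp
    qed
    then show ?thesis
      using DERIV_cong_ev[OF refl e refl] by simp
  next
    case 2
    have e: "\<forall>\<^sub>F y in nhds x. 0 = flat_exp k y"
      using 2 by (auto simp: flat_exp_def eventually_nhds intro!: exI[of _ "{..<0}"])
    have "((\<lambda>y. 0) has_real_derivative flat_exp (k+2) x + (- real k) * flat_exp (k+1) x) (at x)"
      using 2 by (auto simp: flat_exp_def)
    then show ?thesis
      using DERIV_cong_ev[OF refl e refl] by simp
  next
    case 3
    \<comment> \<open>From the right, the difference quotient at 0 is
      \<open>flat_exp (Suc k)\<close> itself, so the limit known for all k also yields the
      derivative.\<close>
    have "((\<lambda>h. (flat_exp k (0 + h) - flat_exp k 0) / h) \<longlongrightarrow> 0) (at 0)"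
    proof (rule filterlim_split_at)
      show "((\<lambda>h. (flat_exp k (0 + h) - flat_exp k 0) / h) \<longlongrightarrow> 0) (at_left 0)"
        by (rule Lim_transform_eventually[of "\<lambda>_. 0"])
           (auto simp: eventually_at_filter flat_exp_def)
      show "((\<lambda>h. (flat_exp k (0 + h) - flat_exp k 0) / h) \<longlongrightarrow> 0) (at_right 0)"
        by (rule Lim_transform_eventually[OF flat_exp_tendsto_0[of "Suc k"]])
           (auto simp: eventually_at_filter flat_exp_def field_simps)
    qed
    then show ?thesis
      using 3 by (simp add: DERIV_def flat_exp_def)
  qed
qed

lemma smooth_flat_exp: "smooth (flat_exp k)"
proof -
  have "times_diff n (flat_exp k)" for n k
  proof (induction n arbitrary: k)
    case 0
    show ?case using flat_exp_deriv real_differentiable_def by (auto simp: times_diff_0)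
  next
    case (Suc n)
    have "deriv (flat_exp k) = (\<lambda>x. flat_exp (k+2) x + (- real k) * flat_exp (k+1) x)"
      using flat_exp_deriv DERIV_imp_deriv by blast
    moreover have "times_diff n (\<lambda>x. flat_exp (k+2) x + (- real k) * flat_exp (k+1) x)"
      using smooth_const[of "- real k"]
      by (intro times_diff_add times_diff_mult Suc.IH) (auto simp: smooth_iff_times_diff)
    ultimately show ?case
      using flat_exp_deriv real_differentiable_def by (auto simp: times_diff_Suc)
  qed
  then show ?thesis by (simp add: smooth_iff_times_diff)
qed

section \<open>Test functions and bumps\<close>

lemma test_functionI:
  assumes "smooth f" "\<And>x. f x \<noteq> 0 \<Longrightarrow> x \<in> {l..r}" "{l..r} \<subseteq> A"
  shows "test_function A f"
proof -
  have "{x. f x \<noteq> 0} \<subseteq> {l..r}"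
    using assms(2) by auto
  then have "closure {x. f x \<noteq> 0} \<subseteq> {l..r}" "bounded {x. f x \<noteq> 0}"
    by (intro closure_minimal bounded_subset[OF bounded_closed_interval]; simp)+
  then show ?thesis
    using assms compact_closure
    unfolding test_function_def smooth_def by auto
qed

lemma test_function_smooth: "test_function A f \<Longrightarrow> smooth f"
  unfolding test_function_def smooth_def by auto

lemma test_function_support:
  assumes "test_function {a<..<b} f" "a < b"
  obtains c d where "a < c" "c < d" "d < b" "\<And>x. f x \<noteq> 0 \<Longrightarrow> x \<in> {c..d}"
proof -
  let ?K = "closure {x. f x \<noteq> 0}"
  have K: "compact ?K" "?K \<subseteq> {a<..<b}"
    using assms by (auto simp: test_function_def)
  show thesis
  proof (cases "?K = {}")
    case True
    then have "\<And>x. f x = 0"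
      using closure_subset[of "{x. f x \<noteq> 0}"] by auto
    with that[of "(3*a+b)/4" "(a+b)/2"] assms(2) show thesis by auto
  next
    case False
    obtain c where c: "c \<in> ?K" "\<And>x. x \<in> ?K \<Longrightarrow> c \<le> x"
      using compact_attains_inf[OF K(1) False] by auto
    obtain d where d: "d \<in> ?K" "\<And>x. x \<in> ?K \<Longrightarrow> x \<le> d"
      using compact_attains_sup[OF K(1) False] by auto
    have "a < c" "d < b" "c \<le> d" using K(2) c(1) d(1) c(2)[OF d(1)] by auto
    moreover have "x \<in> {c..d}" if "f x \<noteq> 0" for x
    proof -
      have "x \<in> ?K" using that by (intro subsetD[OF closure_subset]) simp
      from c(2)[OF this] d(2)[OF this] show ?thesis by simp
    qed
    \<comment> \<open>Only c \<le> d is known, so the right end is moved to the middle between d and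
      b to make the interval nondegenerate.\<close>
    ultimately show thesis
      using that[of c "(d+b)/2"] by fastforce
  qed
qed

text \<open>Increases to the indicator of \<open>(l,r)\<close> as \<open>n\<close> tends to infinity.\<close>

definition bump :: "real \<Rightarrow> real \<Rightarrow> nat \<Rightarrow> real \<Rightarrow> real" where
  "bump l r n x = flat_exp 0 (real n * (x - l)) * flat_exp 0 (real n * (r - x))"

lemma smooth_bump: "smooth (bump l r n)"
proof -
  have "smooth (\<lambda>x. flat_exp 0 (real n * (x - l)))"
    using smooth_affine[OF smooth_flat_exp, of 0 "- (real n * l)" "real n"] by (simp add: algebra_simps)
  moreover have "smooth (\<lambda>x. flat_exp 0 (real n * (r - x)))"
    using smooth_affine[OF smooth_flat_exp, of 0 "real n * r" "- real n"] by (simp add: algebra_simps)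
  ultimately show ?thesis
    unfolding bump_def by (rule smooth_mult)
qed

lemma flat_exp_0_bounds: "0 \<le> flat_exp 0 x" "flat_exp 0 x \<le> 1"
  by (auto simp: flat_exp_def)

lemma bump_bounds: "0 \<le> bump l r n x" "bump l r n x \<le> 1"
  by (auto simp: bump_def flat_exp_0_bounds mult_le_one)

lemma bump_nonzeroD: "bump l r n x \<noteq> 0 \<Longrightarrow> x \<in> {l<..<r}"
  by (auto simp: bump_def flat_exp_def zero_less_mult_iff split: if_splits)

lemma test_function_bump: "{l..r} \<subseteq> A \<Longrightarrow> test_function A (bump l r n)"
  using bump_nonzeroD by (intro test_functionI[OF smooth_bump, of l r n l r]) fastforce+

lemma flat_exp_tendsto_1: "t > 0 \<Longrightarrow> (\<lambda>n. flat_exp 0 (real n * t)) \<longlonglongrightarrow> 1"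
proof -
  assume t: "t > 0"
  have "(\<lambda>n. exp (- ((1 / t) / real n))) \<longlonglongrightarrow> exp (- 0)"
    by (intro tendsto_intros)
  moreover have "\<forall>\<^sub>F n in sequentially. exp (- ((1 / t) / real n)) = flat_exp 0 (real n * t)"
    using eventually_gt_at_top[of 0] by eventually_elim (use t in \<open>auto simp: flat_exp_def field_simps\<close>)
  ultimately show ?thesis
    by (auto intro: Lim_transform_eventually)
qed

lemma bump_tendsto: "(\<lambda>n. bump l r n x) \<longlonglongrightarrow> indicator {l<..<r} x"
proof (cases "x \<in> {l<..<r}")
  case True
  then have "(\<lambda>n. bump l r n x) \<longlonglongrightarrow> 1 * 1"
    unfolding bump_def by (intro tendsto_mult flat_exp_tendsto_1) auto
  with True show ?thesis by simp
next
  case False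
  then have "bump l r n x = 0" for n using bump_nonzeroD by blast
  with False show ?thesis by simp
qed

section \<open>Absolutely continuous functions\<close>

lemma AE_imp_negligible:
  assumes "AE x in lebesgue. P x" shows "negligible {x. \<not> P x}"
proof -
  from assms obtain N where "negligible N" "{x. \<not> P x} \<subseteq> N"
    by (auto simp: eventually_ae_filter_negligible)
  then show ?thesis by (rule negligible_subset)
qed

text \<open>Fubini and the shift invariance below are used for Borel functions; an absolutely
  integrable function agrees with one off a null set, which no integral sees.\<close>

lemma absolutely_integrable_borel_version:
  fixes f :: "'a::euclidean_space \<Rightarrow> real"
  assumes "f absolutely_integrable_on S"
  obtains g where "integrable lborel g" "AE x in lebesgue. g x = indicator S x * f x"
proof -
  let ?f = "\<lambda>x. indicator S x * f x"
  have f: "integrable lebesgue ?f"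
    using assms by (simp add: set_integrable_def)
  obtain g where g: "g \<in> borel_measurable lborel" "AE x in lborel. ?f x = g x"
    using completion_ex_borel_measurable_real[of ?f lborel] f by auto
  from g(2) have ae: "AE x in lebesgue. ?f x = g x"
    by (rule AE_completion)
  have "integrable lebesgue g"
    using integrable_cong_AE_imp[OF f measurable_completion[OF g(1)]] ae
    by (metis (mono_tags, lifting) AE_mp AE_I2)
  then have "integrable lborel g"
    using g(1) integrable_completion by blast
  moreover have "AE x in lebesgue. g x = ?f x"
    using ae by eventually_elim simp
  ultimately show thesis
    using that by blast
qed

lemma integral_eq_borel_version:
  fixes f :: "real \<Rightarrow> real"
  assumes "integrable lborel g" "AE x in lebesgue. g x = indicator {c..d} x * f x" "{y..x} \<subseteq> {c..d}"
  shows "integral {y..x} f = (LBINT z. indicator {y..x} z * g z)"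
proof -
  have g: "set_integrable lborel {y..x} g"
    unfolding set_integrable_def using integrable_mult_indicator[OF _ assms(1)] by simp
  have "integral {y..x} f = integral {y..x} g"
  proof (rule integral_spike)
    show "negligible {z. g z \<noteq> indicator {c..d} z * f z}"
      using AE_imp_negligible[OF assms(2)] .
  qed (use assms(3) in \<open>auto simp: indicator_def split: if_splits\<close>)
  also have "\<dots> = (LBINT z:{y..x}. g z)"
    using set_borel_integral_eq_integral(2)[OF g] by simp
  finally show ?thesis by (simp add: set_lebesgue_integral_def)
qed

text \<open>The positive and negative parts of a Borel version of \<open>g\<close> are densities of
  two finite measures that agree on all half-lines {x<..}. Half-lines determine a finite measure, so
  the densities coincide almost everywhere. The half-lines are reached from inner intervals by
  dominated convergence.\<close>

lemma AE_eq_0_if_all_integrals_0: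
  fixes g :: "real \<Rightarrow> real"
  assumes g: "g absolutely_integrable_on {c..d}"
    and zero: "\<And>l r. c < l \<Longrightarrow> l < r \<Longrightarrow> r < d \<Longrightarrow> integral {l..r} g = 0"
  shows "AE x in lebesgue. x \<in> {c..d} \<longrightarrow> g x = 0"
proof -
  obtain h where h: "integrable lborel h" "AE x in lebesgue. h x = indicator {c..d} x * g x"
    using absolutely_integrable_borel_version[OF g] .
  note [measurable] = borel_measurable_integrable[OF h(1)]
  have z: "(LBINT z. indicator {x<..} z * h z) = 0" for x
  proof (cases "x < d \<and> c < d")
    case True
    \<comment> \<open>The 3 keeps each of the two margins below a third of the remaining length, so
      that l n < r n from the first index on.\<close>
    define l r where "l = (\<lambda>n. max x c + (d - max x c) / (real n + 3))"
      and "r = (\<lambda>n. d - (d - max x c) / (real n + 3))"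
    have pos: "d - max x c > 0" using True by auto
    have lim0: "(\<lambda>n. (d - max x c) / (real n + 3)) \<longlonglongrightarrow> 0"
      by real_asymp
    have lr: "max x c < l n" "l n < r n" "r n < d" for n
    proof -
      have "(d - max x c) / (real n + 3) \<le> (d - max x c) / 3"
        using pos by (intro divide_left_mono) auto
      moreover have "(d - max x c) / (real n + 3) > 0" using pos by simp
      ultimately show "max x c < l n" "l n < r n" "r n < d"
        using pos unfolding l_def r_def by argo+
    qed
    have "(\<lambda>n. LBINT z. indicator {l n..r n} z * h z) \<longlonglongrightarrow> (LBINT z. indicator {x<..} z * h z)"
    proof (rule integral_dominated_convergence[where w="\<lambda>z. \<bar>h z\<bar>"])
      have "AE z in lborel. h z = indicator {c..d} z * g z"
        using h(2) by (simp add: AE_completion_iff)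
      moreover have "AE z in lborel. z \<noteq> c \<and> z \<noteq> d"
        by (intro AE_conjI AE_lborel_singleton)
      ultimately show "AE z in lborel. (\<lambda>n. indicator {l n..r n} z * h z) \<longlonglongrightarrow> indicator {x<..} z * h z"
      proof eventually_elim
        case (elim z)
        have L: "l \<longlonglongrightarrow> max x c" "r \<longlonglongrightarrow> d"
          unfolding l_def r_def using tendsto_add[OF tendsto_const lim0, of "max x c"]
            tendsto_diff[OF tendsto_const lim0, of d] by auto
        show ?case
        proof (cases "max x c < z \<and> z < d")
          case True
          have "\<forall>\<^sub>F n in sequentially. l n < z" "\<forall>\<^sub>F n in sequentially. z < r n"
            using order_tendstoD[OF L(1)] order_tendstoD[OF L(2)] True by auto
          then have "\<forall>\<^sub>F n in sequentially. indicator {x<..} z * h z = indicator {l n..r n} z * h z"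
            by eventually_elim (use True in auto)
          then show ?thesis by (intro Lim_transform_eventually[OF tendsto_const])
        next
          case False
          then have "indicator {l n..r n} z * h z = 0" for n
            using lr[of n] by (auto simp: indicator_def)
          moreover have "indicator {x<..} z * h z = 0"
            using elim False by (auto simp: indicator_def)
          ultimately show ?thesis by (simp only: tendsto_const)
        qed
      qed
    qed (use h in \<open>auto simp: indicator_def\<close>)
    moreover have "(LBINT z. indicator {l n..r n} z * h z) = 0" for n
      using integral_eq_borel_version[OF h, of "l n" "r n"] zero[of "l n" "r n"] lr[of n] by auto
    ultimately show ?thesis
      using LIMSEQ_unique[OF tendsto_const] by fastforce
  next
    case False
    have "AE z in lborel. z \<noteq> d" by (rule AE_lborel_singleton)
    moreover have "AE z in lborel. h z = indicator {c..d} z * g z"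
      using h(2) by (simp add: AE_completion_iff)
    ultimately have "AE z in lborel. indicator {x<..} z * h z = 0"
      by eventually_elim (use False in \<open>auto simp: indicator_def\<close>)
    then show ?thesis by (simp add: integral_eq_zero_AE)
  qed
  define hp hn where "hp = (\<lambda>x. max (h x) 0)" and "hn = (\<lambda>x. max (- h x) 0)"
  have [measurable]: "hp \<in> borel_measurable borel" "hn \<in> borel_measurable borel"
    unfolding hp_def hn_def by measurable
  have int: "integrable lborel hp" "integrable lborel hn"
    unfolding hp_def hn_def using h by (auto intro!: integrable_max)
  have em: "emeasure (density lborel (\<lambda>x. ennreal (u x))) {x<..} = ennreal (LBINT z. indicator {x<..} z * u z)"
    if u: "integrable lborel u" "\<And>z. u z \<ge> 0" for u :: "real \<Rightarrow> real" and x
  proof -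
    note [measurable] = borel_measurable_integrable[OF u(1)]
    have "integrable lborel (\<lambda>z. indicator {x<..} z * u z)"
      using integrable_mult_indicator[OF _ u(1), of "{x<..}"] by simp
    then show ?thesis using u(2)
      by (subst nn_integral_eq_integral[symmetric])
         (auto simp: emeasure_density ennreal_mult' ennreal_indicator mult.commute intro!: nn_integral_cong)
  qed
  have "density lborel hp = density lborel hn"
  proof (rule measure_eqI_lessThan)
    fix x
    have i: "integrable lborel (\<lambda>z. indicator {x<..} z * hp z)" "integrable lborel (\<lambda>z. indicator {x<..} z * hn z)"
      using integrable_mult_indicator[OF _ int(1), of "{x<..}"] integrable_mult_indicator[OF _ int(2), of "{x<..}"]
      by simp_all
    have "(LBINT z. indicator {x<..} z * hp z) - (LBINT z. indicator {x<..} z * hn z)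
        = (LBINT z. indicator {x<..} z * h z)"
      unfolding Bochner_Integration.integral_diff[OF i, symmetric]
      by (intro Bochner_Integration.integral_cong) (auto simp: hp_def hn_def indicator_def)
    then have "(LBINT z. indicator {x<..} z * hp z) = (LBINT z. indicator {x<..} z * hn z)"
      using z by simp
    then show "emeasure (density lborel hp) {x<..} = emeasure (density lborel hn) {x<..}"
      using em[OF int(1)] em[OF int(2)] by (simp add: hp_def hn_def)
    show "emeasure (density lborel hp) {x<..} < \<infinity>"
      using em[OF int(1)] by (simp add: hp_def)
  qed auto
  then have "AE x in lborel. ennreal (hp x) = ennreal (hn x)"
    by (intro sigma_finite_measure.density_unique[OF sigma_finite_lborel]) auto
  then have "AE x in lborel. h x = 0"
    by eventually_elim (auto simp: hp_def hn_def max_def split: if_splits)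
  then have "AE x in lebesgue. h x = 0" by (rule AE_completion)
  with h(2) show ?thesis
    by eventually_elim (auto simp: indicator_def)
qed

section \<open>Functions that are indefinite integrals\<close>

text \<open>Absolute continuity on {c..d}, with the derivative named explicitly. \<open>g\<close>
  matters only up to null sets, which is what permits the exchange of representatives in
  \<open>primitive_cong_AE\<close>; nothing is said about values off the interval.\<close>

definition primitive :: "real \<Rightarrow> real \<Rightarrow> (real \<Rightarrow> real) \<Rightarrow> (real \<Rightarrow> real) \<Rightarrow> bool" where
  "primitive c d f g \<longleftrightarrow> g absolutely_integrable_on {c..d} \<and>
     (\<forall>x\<in>{c..d}. f x = f c + integral {c..x} g)"

lemma primitive_abs_integrable: "primitive c d f g \<Longrightarrow> g absolutely_integrable_on {c..d}"
  by (simp add: primitive_def)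

lemma primitive_eq: "primitive c d f g \<Longrightarrow> x \<in> {c..d} \<Longrightarrow> f x = f c + integral {c..x} g"
  unfolding primitive_def by blast

lemma primitive_diff:
  assumes "primitive c d f g" "c \<le> x" "x \<le> y" "y \<le> d"
  shows "f y - f x = integral {x..y} g"
proof -
  have "g integrable_on {c..y}"
    by (rule integrable_on_subinterval[OF set_lebesgue_integral_eq_integral(1)[OF primitive_abs_integrable[OF assms(1)]]])
       (use assms in auto)
  then have "integral {c..x} g + integral {x..y} g = integral {c..y} g"
    using assms Henstock_Kurzweil_Integration.integral_combine by blast
  then show ?thesis
    using primitive_eq[OF assms(1), of x] primitive_eq[OF assms(1), of y] assms(2-4) by simp
qed

lemma primitive_continuous_on:
  assumes "primitive c d f g" shows "continuous_on {c..d} f"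
proof -
  have "continuous_on {c..d} (\<lambda>x. f c + integral {c..x} g)"
    using primitive_abs_integrable[OF assms]
    by (intro continuous_intros indefinite_integral_continuous_1 set_lebesgue_integral_eq_integral(1))
  then show ?thesis
    by (rule continuous_on_eq) (rule primitive_eq[OF assms, symmetric])
qed

lemma primitive_subset:
  assumes "primitive c d f g" "c \<le> c'" "d' \<le> d"
  shows "primitive c' d' f g"
  unfolding primitive_def
proof (intro conjI ballI)
  show "g absolutely_integrable_on {c'..d'}"
    by (rule absolutely_integrable_on_subinterval[OF primitive_abs_integrable[OF assms(1)]]) (use assms in auto)
  fix x assume "x \<in> {c'..d'}"
  then show "f x = f c' + integral {c'..x} g"
    using primitive_diff[OF assms(1), of c' x] assms by auto
qed

lemma primitive_C1:
  assumes "\<And>x. x \<in> {c..d} \<Longrightarrow> (f has_real_derivative f' x) (at x)" "continuous_on {c..d} f'"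
  shows "primitive c d f f'"
  unfolding primitive_def
proof (intro conjI ballI)
  show "f' absolutely_integrable_on {c..d}"
    using assms(2) by (rule absolutely_integrable_continuous_real)
  fix x assume x: "x \<in> {c..d}"
  have "(f' has_integral (f x - f c)) {c..x}"
    using x assms(1) by (intro fundamental_theorem_of_calculus)
      (auto simp: has_real_derivative_iff_has_vector_derivative intro: has_vector_derivative_at_within)
  then show "f x = f c + integral {c..x} f'"
    by (simp add: integral_unique)
qed

lemma primitive_add_const:
  assumes "primitive c d f g" shows "primitive c d (\<lambda>x. m + f x) g"
  unfolding primitive_def
proof (intro conjI ballI)
  fix x assume "x \<in> {c..d}"
  from primitive_eq[OF assms this] show "m + f x = m + f c + integral {c..x} g" by simp
qed (use assms in \<open>rule primitive_abs_integrable\<close>)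

lemma primitive_add:
  assumes "primitive c d f g" "primitive c d h k"
  shows "primitive c d (\<lambda>x. f x + h x) (\<lambda>x. g x + k x)"
  unfolding primitive_def
proof (intro conjI ballI)
  show "(\<lambda>x. g x + k x) absolutely_integrable_on {c..d}"
    using assms by (intro set_integral_add(1) primitive_abs_integrable)
  fix x assume x: "x \<in> {c..d}"
  have "g integrable_on {c..x}" "k integrable_on {c..x}"
    using x by (auto intro!: integrable_on_subinterval[OF set_lebesgue_integral_eq_integral(1)[OF primitive_abs_integrable]] assms)
  then show "f x + h x = f c + h c + integral {c..x} (\<lambda>x. g x + k x)"
    using primitive_eq[OF assms(1) x] primitive_eq[OF assms(2) x]
    by (simp add: Henstock_Kurzweil_Integration.integral_add)
qed

lemma primitive_cmult:
  assumes "primitive c d f g"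
  shows "primitive c d (\<lambda>x. m * f x) (\<lambda>x. m * g x)"
  unfolding primitive_def
proof (intro conjI ballI)
  show "(\<lambda>x. m * g x) absolutely_integrable_on {c..d}"
    using primitive_abs_integrable[OF assms] by (simp add: set_integrable_mult_right)
  fix x assume "x \<in> {c..d}"
  from primitive_eq[OF assms this] show "m * f x = m * f c + integral {c..x} (\<lambda>x. m * g x)"
    by (simp add: algebra_simps)
qed

lemma primitive_cong_AE:
  assumes "primitive c d f g" "k absolutely_integrable_on {c..d}" "AE x in lebesgue. x \<in> {c..d} \<longrightarrow> k x = g x"
  shows "primitive c d f k"
  unfolding primitive_def
proof (intro conjI ballI assms(2))
  fix x assume x: "x \<in> {c..d}"
  have "negligible {x. \<not> (x \<in> {c..d} \<longrightarrow> k x = g x)}"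
    using AE_imp_negligible[OF assms(3)] .
  then have "integral {c..x} k = integral {c..x} g"
    by (intro integral_spike[where S="{x. \<not> (x \<in> {c..d} \<longrightarrow> k x = g x)}"]) (use x in auto)
  then show "f x = f c + integral {c..x} k"
    using primitive_eq[OF assms(1) x] by simp
qed

text \<open>The product of the two total integrals is the integral of g(y) k(z) over the plane, cut
  along the diagonal: the half z < y yields g K, the half y \<le> z yields G k. This is the product
  rule for functions vanishing at minus infinity.\<close>

lemma integral_product_fubini:
  fixes g k :: "real \<Rightarrow> real"
  assumes g: "integrable lborel g" and k: "integrable lborel k"
  defines "G \<equiv> \<lambda>x. LBINT y. indicator {..x} y * g y" and "K \<equiv> \<lambda>x. LBINT y. indicator {..x} y * k y"
  shows "(LBINT x. g x * K x + G x * k x) = (LBINT x. g x) * (LBINT x. k x)"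
    and "integrable lborel (\<lambda>x. g x * K x)" "integrable lborel (\<lambda>x. G x * k x)"
proof -
  note [measurable] = borel_measurable_integrable[OF g] borel_measurable_integrable[OF k]
  have gk: "integrable (lborel \<Otimes>\<^sub>M lborel) (\<lambda>(y,z). g y * k z)"
  proof (rule lborel_pair.Fubini_integrable)
    show "integrable lborel (\<lambda>x. LBINT y. norm (case (x, y) of (y, z) \<Rightarrow> g y * k z))"
      using g by (simp add: abs_mult)
  qed (use k in auto)
  have 1: "integrable (lborel \<Otimes>\<^sub>M lborel) (\<lambda>(y,z). indicator {(y,z). y \<le> z} (y,z) * (g y * k z))"
    by (rule Bochner_Integration.integrable_bound[OF gk]) (auto simp: indicator_def)
  have 2: "integrable (lborel \<Otimes>\<^sub>M lborel) (\<lambda>(y,z). indicator {(y,z). z < y} (y,z) * (g y * k z))"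
    by (rule Bochner_Integration.integrable_bound[OF gk]) (auto simp: indicator_def)
  have eq1: "(LBINT y. indicator {(y,z). y \<le> z} (y,z) * (g y * k z)) = G z * k z" for z
  proof -
    have "(LBINT y. indicator {(y,z). y \<le> z} (y,z) * (g y * k z)) = (LBINT y. (indicator {..z} y * g y) * k z)"
      by (intro Bochner_Integration.integral_cong) (auto simp: indicator_def)
    then show ?thesis by (simp add: G_def)
  qed
  have eq2: "(LBINT z. indicator {(y,z). z < y} (y,z) * (g y * k z)) = g y * K y" for y
  proof -
    \<comment> \<open>The half-plane is open while the cumulative integral is closed; the one point
      on the diagonal is a null set.\<close>
    have "AE z in lborel. z \<noteq> y" by (rule AE_lborel_singleton)
    then have "AE z in lborel. indicator {(y,z). z < y} (y,z) * (g y * k z) = g y * (indicator {..y} z * k z)"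
      by eventually_elim (auto simp: indicator_def)
    then have "(LBINT z. indicator {(y,z). z < y} (y,z) * (g y * k z)) = (LBINT z. g y * (indicator {..y} z * k z))"
      by (intro integral_cong_AE) auto
    then show ?thesis by (simp add: K_def)
  qed
  show i1: "integrable lborel (\<lambda>x. g x * K x)"
    using lborel_pair.integrable_fst'[OF 2] by (simp add: eq2)
  show i2: "integrable lborel (\<lambda>x. G x * k x)"
    using lborel_pair.integrable_snd[OF 1] by (simp add: eq1)
  have "(LBINT x. g x * K x + G x * k x) = (LBINT x. g x * K x) + (LBINT x. G x * k x)"
    using i1 i2 by simp
  also have "(LBINT x. g x * K x) = integral\<^sup>L (lborel \<Otimes>\<^sub>M lborel) (\<lambda>(y,z). indicator {(y,z). z < y} (y,z) * (g y * k z))"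
    using lborel_pair.integral_fst'[OF 2] by (simp add: eq2)
  also have "(LBINT x. G x * k x) = integral\<^sup>L (lborel \<Otimes>\<^sub>M lborel) (\<lambda>(y,z). indicator {(y,z). y \<le> z} (y,z) * (g y * k z))"
    using lborel_pair.integral_snd[OF 1] by (simp add: eq1)
  also have "integral\<^sup>L (lborel \<Otimes>\<^sub>M lborel) (\<lambda>(y,z). indicator {(y,z). z < y} (y,z) * (g y * k z)) + \<dots>
     = integral\<^sup>L (lborel \<Otimes>\<^sub>M lborel) (\<lambda>(y,z). g y * k z)"
    unfolding Bochner_Integration.integral_add[OF 2 1, symmetric]
    by (intro Bochner_Integration.integral_cong) (auto simp: indicator_def)
  also have "\<dots> = (LBINT x. g x) * (LBINT x. k x)"
    using lborel_pair.integral_fst'[OF gk] by simp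
  finally show "(LBINT x. g x * K x + G x * k x) = (LBINT x. g x) * (LBINT x. k x)" .
qed

lemma absolutely_integrable_mult_continuous:
  fixes g h :: "real \<Rightarrow> real"
  assumes "g absolutely_integrable_on {c..d}" "continuous_on {c..d} h"
  shows "(\<lambda>x. g x * h x) absolutely_integrable_on {c..d}"
proof -
  have "(\<lambda>x. h x * g x) absolutely_integrable_on {c..d}"
    using assms compact_imp_bounded[OF compact_continuous_image[OF assms(2)]]
    by (intro absolutely_integrable_bounded_measurable_product_real)
       (auto intro: continuous_imp_measurable_on_sets_lebesgue)
  then show ?thesis by (simp add: mult.commute)
qed

text \<open>Subtracting the values at c turns both factors into cumulative integrals, for which the
  product rule is \<open>integral_product_fubini\<close>; the constants are restored linearly at the
  end.\<close>

lemma primitive_mult: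
  assumes f: "primitive c d f g" and h: "primitive c d h k"
  shows "primitive c d (\<lambda>x. f x * h x) (\<lambda>x. g x * h x + f x * k x)"
  unfolding primitive_def
proof (intro conjI ballI)
  have i: "(\<lambda>x. g x * h x) absolutely_integrable_on {c..d}" "(\<lambda>x. f x * k x) absolutely_integrable_on {c..d}"
    using absolutely_integrable_mult_continuous[OF primitive_abs_integrable[OF f] primitive_continuous_on[OF h]]
      absolutely_integrable_mult_continuous[OF primitive_abs_integrable[OF h] primitive_continuous_on[OF f]]
    by (auto simp: mult.commute)
  show gh: "(\<lambda>x. g x * h x + f x * k x) absolutely_integrable_on {c..d}"
    using i by (rule set_integral_add(1))
  fix x assume x: "x \<in> {c..d}"
  obtain g' where g': "integrable lborel g'" "AE y in lebesgue. g' y = indicator {c..x} y * g y"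
  proof (rule absolutely_integrable_borel_version)
    show "g absolutely_integrable_on {c..x}"
      by (rule absolutely_integrable_on_subinterval[OF primitive_abs_integrable[OF f]]) (use x in auto)
  qed
  obtain k' where k': "integrable lborel k'" "AE y in lebesgue. k' y = indicator {c..x} y * k y"
  proof (rule absolutely_integrable_borel_version)
    show "k absolutely_integrable_on {c..x}"
      by (rule absolutely_integrable_on_subinterval[OF primitive_abs_integrable[OF h]]) (use x in auto)
  qed
  note [measurable] = borel_measurable_integrable[OF g'(1)] borel_measurable_integrable[OF k'(1)]
  have cum: "(LBINT y. indicator {..z} y * u' y) = u z - u c" if u: "primitive c d u w"
    and u': "integrable lborel u'" "AE y in lebesgue. u' y = indicator {c..x} y * w y"
    and z: "z \<in> {c..x}" for u u' w z
  proof -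
    note [measurable] = borel_measurable_integrable[OF u'(1)]
    have "AE y in lborel. u' y = indicator {c..x} y * w y"
      using u'(2) by (simp add: AE_completion_iff)
    then have "AE y in lborel. indicator {..z} y * u' y = indicator {c..z} y * u' y"
      by eventually_elim (use z in \<open>auto simp: indicator_def\<close>)
    then have "(LBINT y. indicator {..z} y * u' y) = (LBINT y. indicator {c..z} y * u' y)"
      by (intro integral_cong_AE) auto
    also have "\<dots> = integral {c..z} w"
      using integral_eq_borel_version[OF u'] z by auto
    also have "\<dots> = u z - u c"
      using primitive_diff[OF u, of c z] z x by auto
    finally show ?thesis .
  qed
  have tot: "(LBINT y. u' y) = u x - u c" if u: "primitive c d u w"
    and u': "integrable lborel u'" "AE y in lebesgue. u' y = indicator {c..x} y * w y" for u u' w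
  proof -
    note [measurable] = borel_measurable_integrable[OF u'(1)]
    have "AE y in lborel. u' y = indicator {c..x} y * w y"
      using u'(2) by (simp add: AE_completion_iff)
    then have "AE y in lborel. u' y = indicator {..x} y * u' y"
      by eventually_elim (auto simp: indicator_def)
    then have "(LBINT y. u' y) = (LBINT y. indicator {..x} y * u' y)"
      by (intro integral_cong_AE) auto
    then show ?thesis using cum[OF u u', of x] x by simp
  qed
  \<comment> \<open>\<open>?p\<close> is the integrand with the boundary values removed,
    \<open>?q\<close> the same integrand in terms of the Borel versions cut off at x.\<close>
  let ?p = "\<lambda>z. g z * (h z - h c) + (f z - f c) * k z"
  let ?q = "\<lambda>z. g' z * (LBINT y. indicator {..z} y * k' y) + (LBINT y. indicator {..z} y * g' y) * k' z"
  have pi: "?p absolutely_integrable_on {c..x}"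
  proof (rule absolutely_integrable_on_subinterval)
    have "continuous_on {c..d} (\<lambda>z. h z - h c)" "continuous_on {c..d} (\<lambda>z. f z - f c)"
      using primitive_continuous_on[OF f] primitive_continuous_on[OF h] by (auto intro: continuous_intros)
    from absolutely_integrable_mult_continuous[OF primitive_abs_integrable[OF f] this(1)]
      absolutely_integrable_mult_continuous[OF primitive_abs_integrable[OF h] this(2)]
    show "?p absolutely_integrable_on {c..d}"
      by (intro set_integral_add(1)) (auto simp: mult.commute)
  qed (use x in auto)
  have qm: "?q \<in> borel_measurable lborel"
    using integral_product_fubini(2,3)[OF g'(1) k'(1)] by auto
  have "integral {c..x} ?p = (LINT z|lebesgue. indicator {c..x} z * ?p z)"
    using set_lebesgue_integral_eq_integral(2)[OF pi] by (simp add: set_lebesgue_integral_def)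
  also have "\<dots> = (LINT z|lebesgue. ?q z)"
  proof (rule integral_cong_AE)
    show "AE z in lebesgue. indicator {c..x} z * ?p z = ?q z"
      using g'(2) k'(2)
    proof eventually_elim
      case (elim z)
      then show ?case
        using cum[OF f g', of z] cum[OF h k', of z] by (cases "z \<in> {c..x}") auto
    qed
    show "(\<lambda>z. indicator {c..x} z * ?p z) \<in> borel_measurable lebesgue"
      using pi by (auto simp: set_integrable_def dest: borel_measurable_integrable)
  qed (use qm in \<open>rule measurable_completion\<close>)
  also have "\<dots> = (LBINT z. ?q z)"
    using qm by (rule integral_completion)
  also have "\<dots> = (f x - f c) * (h x - h c)"
    using integral_product_fubini(1)[OF g'(1) k'(1)] tot[OF f g'] tot[OF h k'] by simp
  finally have 1: "integral {c..x} ?p = (f x - f c) * (h x - h c)" .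
  have "integral {c..x} (\<lambda>x. g x * h x + f x * k x)
      = integral {c..x} (\<lambda>z. ?p z + (h c * g z + f c * k z))"
    by (intro integral_cong) (simp add: algebra_simps)
  also have "\<dots> = integral {c..x} ?p + (h c * integral {c..x} g + f c * integral {c..x} k)"
  proof -
    have "g integrable_on {c..x}" "k integrable_on {c..x}"
      using x by (auto intro!: integrable_on_subinterval[OF set_lebesgue_integral_eq_integral(1)[OF primitive_abs_integrable]] f h)
    then have "(\<lambda>z. h c * g z) integrable_on {c..x}" "(\<lambda>z. f c * k z) integrable_on {c..x}"
      by (auto intro: integrable_on_mult_right)
    then show ?thesis
      using set_lebesgue_integral_eq_integral(1)[OF pi] integrable_add
      by (subst Henstock_Kurzweil_Integration.integral_add)
         (simp_all add: Henstock_Kurzweil_Integration.integral_add integrable_add)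
  qed
  also have "\<dots> = f x * h x - f c * h c"
    using 1 primitive_diff[OF f, of c x] primitive_diff[OF h, of c x] x by (auto simp: algebra_simps)
  finally show "f x * h x = f c * h c + integral {c..x} (\<lambda>x. g x * h x + f x * k x)" by simp
qed

lemma primitive_by_parts:
  assumes "primitive c d f g" "primitive c d h k" "c \<le> d" "f c * h c = 0" "f d * h d = 0"
  shows "integral {c..d} (\<lambda>x. g x * h x) = - integral {c..d} (\<lambda>x. f x * k x)"
proof -
  have "(\<lambda>x. g x * h x) absolutely_integrable_on {c..d}" "(\<lambda>x. f x * k x) absolutely_integrable_on {c..d}"
    using absolutely_integrable_mult_continuous[OF primitive_abs_integrable[OF assms(1)] primitive_continuous_on[OF assms(2)]]
      absolutely_integrable_mult_continuous[OF primitive_abs_integrable[OF assms(2)] primitive_continuous_on[OF assms(1)]]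
    by (auto simp: mult.commute)
  then have "integral {c..d} (\<lambda>x. g x * h x + f x * k x)
      = integral {c..d} (\<lambda>x. g x * h x) + integral {c..d} (\<lambda>x. f x * k x)"
    by (intro Henstock_Kurzweil_Integration.integral_add set_lebesgue_integral_eq_integral(1))
  moreover have "integral {c..d} (\<lambda>x. g x * h x + f x * k x) = 0"
    using primitive_diff[OF primitive_mult[OF assms(1,2)], of c d] assms by auto
  ultimately show ?thesis by simp
qed

section \<open>Weak derivatives\<close>

lemma deriv_zero_outside:
  assumes "\<And>x. f x \<noteq> 0 \<Longrightarrow> x \<in> {c..d}" "x \<notin> {c..d}"
  shows "deriv f x = (0::real)"
proof (rule DERIV_imp_deriv)
  have "\<forall>\<^sub>F y in nhds x. y \<in> - {c..d}"
    using assms(2) by (intro eventually_nhds_in_open) auto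
  then have "\<forall>\<^sub>F y in nhds x. 0 = f y"
    by eventually_elim (use assms(1) in force)
  from DERIV_cong_ev[OF refl this refl, of 0] show "(f has_real_derivative 0) (at x)" by simp
qed

lemma deriv_funpow_zero_outside:
  assumes "\<And>x. f x \<noteq> 0 \<Longrightarrow> x \<in> {c..d}" "x \<notin> {c..d}"
  shows "(deriv ^^ k) f x = (0::real)"
  using assms(2)
proof (induction k arbitrary: x)
  case 0
  then show ?case using assms(1) by auto
next
  case (Suc k)
  have "y \<in> {c..d}" if "(deriv ^^ k) f y \<noteq> 0" for y
    using Suc.IH[of y] that by blast
  then have "deriv ((deriv ^^ k) f) x = 0"
    using Suc.prems by (rule deriv_zero_outside)
  then show ?case by simp
qed

lemma test_function_deriv:
  assumes "test_function {a<..<b} f" "a < b"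
  shows "test_function {a<..<b} (deriv f)"
proof -
  obtain c d where cd: "a < c" "c < d" "d < b" "\<And>x. f x \<noteq> 0 \<Longrightarrow> x \<in> {c..d}"
    using test_function_support[OF assms] by blast
  show ?thesis
    using cd deriv_zero_outside[of f c d]
    by (intro test_functionI[of _ c d] smooth_deriv test_function_smooth[OF assms(1)]) auto
qed

section \<open>Uniqueness of weak derivatives\<close>

lemma locally_integrableD:
  "locally_integrable A f \<Longrightarrow> {c..d} \<subseteq> A \<Longrightarrow> f absolutely_integrable_on {c..d}"
  by (auto simp: locally_integrable_def)

lemma set_integral_mult_supported:
  fixes f \<phi> :: "real \<Rightarrow> real"
  assumes f: "f absolutely_integrable_on {c..d}" and \<phi>: "continuous_on {c..d} \<phi>"
    and supp: "\<And>x. \<phi> x \<noteq> 0 \<Longrightarrow> x \<in> {c..d}" and A: "{c..d} \<subseteq> A"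
  shows "set_integrable lebesgue A (\<lambda>x. f x * \<phi> x)"
    and "(LINT x:A|lebesgue. f x * \<phi> x) = integral {c..d} (\<lambda>x. f x * \<phi> x)"
proof -
  have 1: "(\<lambda>x. f x * \<phi> x) absolutely_integrable_on {c..d}"
    using f \<phi> by (rule absolutely_integrable_mult_continuous)
  have 2: "indicator A x *\<^sub>R (f x * \<phi> x) = indicator {c..d} x *\<^sub>R (f x * \<phi> x)" for x
    using supp[of x] A by (auto simp: indicator_def)
  show "set_integrable lebesgue A (\<lambda>x. f x * \<phi> x)"
    using 1 unfolding set_integrable_def 2 .
  show "(LINT x:A|lebesgue. f x * \<phi> x) = integral {c..d} (\<lambda>x. f x * \<phi> x)"
    using set_lebesgue_integral_eq_integral(2)[OF 1] unfolding set_lebesgue_integral_def 2 .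
qed

text \<open>The bumps converge to the indicator of (l,r) and stay below 1, so orthogonality to test
  functions passes to vanishing integrals over all compact subintervals, and these determine the
  function.\<close>

lemma fundamental_lemma:
  assumes g: "locally_integrable {a<..<b} g"
    and orth: "\<And>\<phi>. test_function {a<..<b} \<phi> \<Longrightarrow> (LINT x:{a<..<b}|lebesgue. g x * \<phi> x) = 0"
  shows "AE x in lebesgue. x \<in> {a<..<b} \<longrightarrow> g x = 0"
proof -
  have int0: "integral {l..r} g = 0" if lr: "a < l" "l < r" "r < b" for l r
  proof -
    have sub: "{l..r} \<subseteq> {a<..<b}" using lr by auto
    have gi: "g absolutely_integrable_on {l..r}"
      using locally_integrableD[OF g sub] .
    have "(\<lambda>n. LINT x|lebesgue. indicator {l..r} x * (g x * bump l r n x))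
        \<longlonglongrightarrow> (LINT x|lebesgue. indicator {l..r} x * (g x * indicator {l<..<r} x))"
    proof (rule integral_dominated_convergence[where w="\<lambda>x. indicator {l..r} x * \<bar>g x\<bar>"])
      have cont: "(\<lambda>x. bump l r n x) \<in> borel_measurable borel" for n
        by (intro borel_measurable_continuous_onI smooth_continuous_on smooth_bump)
      have m: "(\<lambda>x. indicator {l..r} x * g x) \<in> borel_measurable lebesgue"
        using gi by (auto simp: set_integrable_def dest: borel_measurable_integrable)
      have "(\<lambda>x. (indicator {l..r} x * g x) * bump l r n x) \<in> borel_measurable lebesgue" for n
        using m measurable_completion[of "bump l r n" lborel borel] cont[of n] by simp
      then show "(\<lambda>x. indicator {l..r} x * (g x * bump l r n x)) \<in> borel_measurable lebesgue" for n
        by (simp add: mult.assoc)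
      have "(\<lambda>x. (indicator {l..r} x * g x) * indicator {l<..<r} x) \<in> borel_measurable lebesgue"
        by (intro borel_measurable_times borel_measurable_indicator m) auto
      then show "(\<lambda>x. indicator {l..r} x * (g x * indicator {l<..<r} x)) \<in> borel_measurable lebesgue"
        by (simp add: mult.assoc)
      show "integrable lebesgue (\<lambda>x. indicator {l..r} x * \<bar>g x\<bar>)"
        using set_integrable_abs[OF gi] by (simp add: set_integrable_def)
      show "AE x in lebesgue. (\<lambda>n. indicator {l..r} x * (g x * bump l r n x))
          \<longlonglongrightarrow> indicator {l..r} x * (g x * indicator {l<..<r} x)"
        by (intro AE_I2 tendsto_intros bump_tendsto)
      show "AE x in lebesgue. norm (indicator {l..r} x * (g x * bump l r n x)) \<le> indicator {l..r} x * \<bar>g x\<bar>" for n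
        using bump_bounds[of l r n] by (intro AE_I2) (auto simp: abs_mult indicator_def intro!: mult_left_le)
    qed
    moreover have "(LINT x|lebesgue. indicator {l..r} x * (g x * bump l r n x)) = 0" for n
    proof -
      have "(LINT x|lebesgue. indicator {l..r} x * (g x * bump l r n x)) = (LINT x:{a<..<b}|lebesgue. g x * bump l r n x)"
        unfolding set_lebesgue_integral_def
      proof (intro Bochner_Integration.integral_cong refl)
        fix x
        show "indicator {l..r} x * (g x * bump l r n x) = indicator {a<..<b} x *\<^sub>R (g x * bump l r n x)"
          using bump_nonzeroD[of l r n x] lr by (cases "bump l r n x = 0") (auto simp: indicator_def)
      qed
      then show ?thesis using orth[OF test_function_bump[OF sub]] by simp
    qed
    ultimately have "(LINT x|lebesgue. indicator {l..r} x * (g x * indicator {l<..<r} x)) = 0"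
      by (simp add: LIMSEQ_const_iff)
    moreover have "(LINT x|lebesgue. indicator {l..r} x * (g x * indicator {l<..<r} x)) = (LINT x|lebesgue. indicator {l..r} x *\<^sub>R g x)"
    proof (rule integral_cong_AE)
      have "AE x in lborel. x \<noteq> l \<and> x \<noteq> r"
        by (intro AE_conjI AE_lborel_singleton)
      then have "AE x in lebesgue. x \<noteq> l \<and> x \<noteq> r" by (rule AE_completion)
      then show "AE x in lebesgue. indicator {l..r} x * (g x * indicator {l<..<r} x) = indicator {l..r} x *\<^sub>R g x"
        by eventually_elim (auto simp: indicator_def)
      have m: "(\<lambda>x. indicator {l..r} x * g x) \<in> borel_measurable lebesgue"
        using gi by (auto simp: set_integrable_def dest: borel_measurable_integrable)
      then show "(\<lambda>x. indicator {l..r} x *\<^sub>R g x) \<in> borel_measurable lebesgue"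
        by simp
      have "(\<lambda>x. (indicator {l..r} x * g x) * indicator {l<..<r} x) \<in> borel_measurable lebesgue"
        by (intro borel_measurable_times borel_measurable_indicator m) auto
      then show "(\<lambda>x. indicator {l..r} x * (g x * indicator {l<..<r} x)) \<in> borel_measurable lebesgue"
        by (simp add: mult.assoc)
    qed
    ultimately show ?thesis
      using set_lebesgue_integral_eq_integral(2)[OF gi] by (simp add: set_lebesgue_integral_def)
  qed
  \<comment> \<open>A countable exhaustion by compact intervals is used because
    \<open>AE_eq_0_if_all_integrals_0\<close> needs integrability up to the endpoints, while
    \<open>g\<close> is only locally integrable.\<close>
  have "AE x in lebesgue. \<forall>n. x \<in> {a + 1 / real (Suc n)..b - 1 / real (Suc n)} \<longrightarrow> g x = 0"
  proof (subst AE_all_countable, rule allI)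
    fix n
    have pos: "1 / real (Suc n) > 0" by simp
    have *: "a < a + 1 / real (Suc n)" "b - 1 / real (Suc n) < b" by simp_all
    show "AE x in lebesgue. x \<in> {a + 1 / real (Suc n)..b - 1 / real (Suc n)} \<longrightarrow> g x = 0"
    proof (rule AE_eq_0_if_all_integrals_0)
      show "g absolutely_integrable_on {a + 1 / real (Suc n)..b - 1 / real (Suc n)}"
      proof (rule locally_integrableD[OF g], rule subsetI)
        fix x assume "x \<in> {a + 1 / real (Suc n)..b - 1 / real (Suc n)}"
        then have "a + 1 / real (Suc n) \<le> x" "x \<le> b - 1 / real (Suc n)" unfolding atLeastAtMost_iff by blast+
        with * show "x \<in> {a<..<b}" unfolding greaterThanLessThan_iff by linarith
      qed
      show "integral {l..r} g = 0"
        if "a + 1 / real (Suc n) < l" "l < r" "r < b - 1 / real (Suc n)" for l r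
        using that * by (intro int0) linarith+
    qed
  qed
  then show ?thesis
  proof eventually_elim
    case (elim x)
    show ?case
    proof
      assume "x \<in> {a<..<b}"
      then have "min (x - a) (b - x) > 0" by simp
      then obtain n where "1 / real (Suc n) < min (x - a) (b - x)"
        using nat_approx_posE by blast
      then have "x \<in> {a + 1 / real (Suc n)..b - 1 / real (Suc n)}" by auto
      with elim show "g x = 0" by blast
    qed
  qed
qed

lemma has_weak_deriv_unique:
  assumes "has_weak_deriv k {a<..<b} f g" "has_weak_deriv k {a<..<b} f g'" "a < b"
  shows "AE x in lebesgue. x \<in> {a<..<b} \<longrightarrow> g x = g' x"
proof -
  have l: "locally_integrable {a<..<b} g" "locally_integrable {a<..<b} g'"
    using assms by (auto simp: has_weak_deriv_def)
  have "AE x in lebesgue. x \<in> {a<..<b} \<longrightarrow> g x - g' x = 0"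
  proof (rule fundamental_lemma)
    show "locally_integrable {a<..<b} (\<lambda>x. g x - g' x)"
      using l unfolding locally_integrable_def by (auto intro: set_integral_diff(1))
    fix \<phi> assume \<phi>: "test_function {a<..<b} \<phi>"
    obtain c d where cd: "a < c" "c < d" "d < b" "\<And>x. \<phi> x \<noteq> 0 \<Longrightarrow> x \<in> {c..d}"
      using test_function_support[OF \<phi> assms(3)] by blast
    have sub: "{c..d} \<subseteq> {a<..<b}" using cd by auto
    note i = set_integral_mult_supported(1)[OF locally_integrableD[OF _ sub] smooth_continuous_on[OF test_function_smooth[OF \<phi>]] cd(4) sub]
    have "(LINT x:{a<..<b}|lebesgue. g x * \<phi> x) = (LINT x:{a<..<b}|lebesgue. g' x * \<phi> x)"
    proof -
      have "(LINT x:{a<..<b}|lebesgue. f x * (deriv ^^ k) \<phi> x) = (- 1) ^ k * (LINT x:{a<..<b}|lebesgue. u x * \<phi> x)"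
        if "has_weak_deriv k {a<..<b} f u" for u
        using that \<phi> unfolding has_weak_deriv_def by blast
      from this[OF assms(1)] this[OF assms(2)] show ?thesis by simp
    qed
    then show "(LINT x:{a<..<b}|lebesgue. (g x - g' x) * \<phi> x) = 0"
      using set_integral_diff(2)[OF i[OF l(1)] i[OF l(2)]] by (simp add: left_diff_distrib)
  qed
  then show ?thesis by simp
qed

section \<open>Functions with a weak derivative are absolutely continuous\<close>

lemma antiderivative_on_UNIV:
  fixes f :: "real \<Rightarrow> real"
  assumes "continuous_on UNIV f"
  obtains F where "\<And>x. (F has_real_derivative f x) (at x)"
proof -
  have "\<exists>F. \<forall>x :: real. (-\<infinity>::ereal) < x \<longrightarrow> x < (\<infinity>::ereal) \<longrightarrow> (F has_vector_derivative f x) (at x)"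
    using assms by (intro einterval_antiderivative) (auto simp: continuous_on_eq_continuous_at)
  then show thesis
    using that by (auto simp: has_real_derivative_iff_has_vector_derivative)
qed

text \<open>Zero mean is what makes an antiderivative take the same constant value on both sides of
  the support, so that subtracting this constant restores compact support.\<close>

lemma test_function_antiderivative:
  assumes \<psi>: "test_function {a<..<b} \<psi>" and ab: "a < b" and mean: "integral {a..b} \<psi> = 0"
  obtains \<phi> where "test_function {a<..<b} \<phi>" "deriv \<phi> = \<psi>"
proof -
  obtain c d where cd: "a < c" "c < d" "d < b" "\<And>x. \<psi> x \<noteq> 0 \<Longrightarrow> x \<in> {c..d}"
    using test_function_support[OF \<psi> ab] by blast
  obtain F where F: "\<And>x. (F has_real_derivative \<psi> x) (at x)"
    using antiderivative_on_UNIV smooth_continuous_on[OF test_function_smooth[OF \<psi>]] by blast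
  have left: "F x = F c" if "x \<le> c" for x
  proof (cases "x = c")
    case False
    have "\<exists>z. z > x \<and> z < c \<and> F c - F x = (c - x) * \<psi> z"
      using that False by (intro MVT2 F) auto
    then obtain z where "z > x" "z < c" "F c - F x = (c - x) * \<psi> z" by blast
    with cd(4)[of z] show ?thesis by force
  qed simp
  have right: "F x = F d" if "x \<ge> d" for x
  proof (cases "x = d")
    case False
    have "\<exists>z. z > d \<and> z < x \<and> F x - F d = (x - d) * \<psi> z"
      using that False by (intro MVT2 F) auto
    then obtain z where "z > d" "z < x" "F x - F d = (x - d) * \<psi> z" by blast
    with cd(4)[of z] show ?thesis by force
  qed simp
  have "primitive a b F \<psi>"
    using F smooth_continuous_on[OF test_function_smooth[OF \<psi>]] by (intro primitive_C1) auto
  then have "F b = F a"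
    using primitive_diff[of a b F \<psi> a b] ab mean by simp
  then have Fdc: "F d = F c"
    using left[of a] right[of b] cd by simp
  let ?\<phi> = "\<lambda>x. F x - F c"
  have d: "(?\<phi> has_real_derivative \<psi> x) (at x)" for x
    using F[of x] by (auto intro!: derivative_eq_intros)
  have "test_function {a<..<b} ?\<phi>"
  proof (rule test_functionI)
    show "smooth ?\<phi>" using d test_function_smooth[OF \<psi>] by (rule smoothI)
    show "x \<in> {c..d}" if "F x - F c \<noteq> 0" for x
      using that left[of x] right[of x] Fdc by force
  qed (use cd in auto)
  moreover have "deriv ?\<phi> = \<psi>"
    using d DERIV_imp_deriv by blast
  ultimately show thesis using that by blast
qed

lemma test_function_mono: "test_function A f \<Longrightarrow> A \<subseteq> B \<Longrightarrow> test_function B f"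
  by (auto simp: test_function_def)

lemma test_function_lincomb:
  assumes "test_function A f" "test_function A g"
  shows "test_function A (\<lambda>x. f x + m * g x)"
proof -
  have *: "smooth (\<lambda>x. f x + m * g x)"
    using assms by (intro smooth_add smooth_mult smooth_const test_function_smooth)
  have sub: "closure {x. f x + m * g x \<noteq> 0} \<subseteq> closure {x. f x \<noteq> 0} \<union> closure {x. g x \<noteq> 0}"
    unfolding closure_Un[symmetric] by (rule closure_mono) auto
  have "compact (closure {x. f x \<noteq> 0} \<union> closure {x. g x \<noteq> 0})"
    using assms by (auto simp: test_function_def)
  with sub have "compact (closure {x. f x + m * g x \<noteq> 0})"
    using compact_Int_closed[OF _ closed_closure, of "closure {x. f x \<noteq> 0} \<union> closure {x. g x \<noteq> 0}"
      "{x. f x + m * g x \<noteq> 0}"] by (simp only: inf_absorb2)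
  with * sub show ?thesis
    using assms unfolding test_function_def smooth_def by blast
qed

lemma set_integral_supported_cong:
  fixes f \<phi> :: "real \<Rightarrow> real"
  assumes "\<And>x. \<phi> x \<noteq> 0 \<Longrightarrow> x \<in> A \<and> x \<in> B"
  shows "(LINT x:A|lebesgue. f x * \<phi> x) = (LINT x:B|lebesgue. f x * \<phi> x)"
  unfolding set_lebesgue_integral_def
  by (intro Bochner_Integration.integral_cong) (use assms in \<open>auto simp: indicator_def\<close>)

lemma bump_integral_pos:
  assumes "l < r" shows "integral {l..r} (bump l r 1) > 0"
proof -
  have c: "continuous_on {l..r} (bump l r 1)"
    by (intro smooth_continuous_on smooth_bump)
  then have i: "(bump l r 1 has_integral integral {l..r} (bump l r 1)) {l..r}"
    by (intro integrable_integral integrable_continuous_real)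
  have ge: "integral {l..r} (bump l r 1) \<ge> 0"
    using i bump_bounds(1) by (intro has_integral_nonneg[OF i]) auto
  have "integral {l..r} (bump l r 1) \<noteq> 0"
  proof
    assume z: "integral {l..r} (bump l r 1) = 0"
    have "bump l r 1 ((l+r)/2) = 0"
      using has_integral_0_cbox_imp_0[of l r "bump l r 1" "(l+r)/2"] c i z assms bump_bounds(1)
      by (auto simp: box_real)
    then show False using assms by (auto simp: bump_def flat_exp_def field_simps split: if_splits)
  qed
  with ge show ?thesis by simp
qed

text \<open>Subtracting the primitive G of the weak derivative leaves a function h orthogonal to all
  derivatives of test functions, that is, to all test functions of mean zero; such an h is constant
  almost everywhere. The argument runs on a larger interval [l,r], since it gives a statement on the
  interior only.\<close>

lemma du_bois_reymond:
  assumes w: "has_weak_deriv 1 {a<..<b} f g" and cd: "a < c" "c \<le> d" "d < b"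
  obtains F where "primitive c d F g" "AE x in lebesgue. x \<in> {c..d} \<longrightarrow> f x = F x"
proof -
  define l r where "l = (a + c) / 2" and "r = (d + b) / 2"
  have lr: "a < l" "l < c" "d < r" "r < b" "l < r" using cd by (auto simp: l_def r_def)
  have sub: "{l..r} \<subseteq> {a<..<b}" using lr by auto
  have gi: "g absolutely_integrable_on {l..r}" and fi: "f absolutely_integrable_on {l..r}"
    using w sub by (auto simp: has_weak_deriv_def intro: locally_integrableD)
  define G where "G = (\<lambda>x. integral {l..x} g)"
  have G: "primitive l r G g"
    using gi by (simp add: primitive_def G_def)
  define h where "h = (\<lambda>x. f x - G x)"
  have hi: "h absolutely_integrable_on {l..r}"
    unfolding h_def using fi absolutely_integrable_continuous_real[OF primitive_continuous_on[OF G]]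
    by (rule set_integral_diff(1))
  have supp: "x \<in> {l<..<r}" if "test_function {l<..<r} \<phi>" "\<phi> x \<noteq> 0" for \<phi> x
  proof -
    have "x \<in> closure {x. \<phi> x \<noteq> 0}"
      using that(2) by (intro subsetD[OF closure_subset]) simp
    then show ?thesis using that by (auto simp: test_function_def)
  qed
  have supp': "\<phi> x \<noteq> 0 \<Longrightarrow> x \<in> {l..r}" if "test_function {l<..<r} \<phi>" for \<phi> x
    using supp[OF that, of x] by auto
  have cont: "continuous_on {l..r} \<phi>" if "test_function {l<..<r} \<phi>" for \<phi>
    using that by (intro smooth_continuous_on test_function_smooth)
  have int: "(\<lambda>x. u x * \<phi> x) integrable_on {l..r}"
    if "test_function {l<..<r} \<phi>" "u absolutely_integrable_on {l..r}" for u \<phi>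
    using absolutely_integrable_mult_continuous[OF that(2) cont[OF that(1)]]
    by (rule set_lebesgue_integral_eq_integral(1))
  have orth: "integral {l..r} (\<lambda>x. h x * deriv \<phi> x) = 0" if \<phi>: "test_function {l<..<r} \<phi>" for \<phi>
  proof -
    have \<phi>': "test_function {l<..<r} (deriv \<phi>)" by (rule test_function_deriv[OF \<phi> lr(5)])
    have "test_function {a<..<b} \<phi>" by (rule test_function_mono[OF \<phi>]) (use lr in auto)
    then have "(LINT x:{a<..<b}|lebesgue. f x * (deriv ^^ 1) \<phi> x) = (- 1) ^ 1 * (LINT x:{a<..<b}|lebesgue. g x * \<phi> x)"
      using w unfolding has_weak_deriv_def by blast
    then have "(LINT x:{a<..<b}|lebesgue. f x * deriv \<phi> x) = - (LINT x:{a<..<b}|lebesgue. g x * \<phi> x)"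
      by simp
    then have 1: "integral {l..r} (\<lambda>x. f x * deriv \<phi> x) = - integral {l..r} (\<lambda>x. g x * \<phi> x)"
      using set_integral_mult_supported(2)[OF fi cont[OF \<phi>'] supp'[OF \<phi>'] sub]
        set_integral_mult_supported(2)[OF gi cont[OF \<phi>] supp'[OF \<phi>] sub] by simp
    have "primitive l r \<phi> (deriv \<phi>)"
      using smooth_imp_deriv[OF test_function_smooth[OF \<phi>]] cont[OF \<phi>'] by (intro primitive_C1)
    moreover have "\<phi> l = 0" "\<phi> r = 0" using supp[OF \<phi>] by force+
    ultimately have "integral {l..r} (\<lambda>x. g x * \<phi> x) = - integral {l..r} (\<lambda>x. G x * deriv \<phi> x)"
      using lr by (intro primitive_by_parts[OF G]) auto
    with 1 have "integral {l..r} (\<lambda>x. f x * deriv \<phi> x) - integral {l..r} (\<lambda>x. G x * deriv \<phi> x) = 0" by simp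
    then show ?thesis
      unfolding h_def left_diff_distrib
      using Henstock_Kurzweil_Integration.integral_diff[OF int[OF \<phi>' fi] int[OF \<phi>' absolutely_integrable_continuous_real[OF primitive_continuous_on[OF G]]]]
      by simp
  qed
  \<comment> \<open>A fixed test function of positive mean: subtracting a multiple of it makes an
    arbitrary \<psi> mean-free and hence the derivative of a test function.\<close>
  define w0 where "w0 = bump ((2*l+r)/3) ((l+2*r)/3) 1"
  have w0: "test_function {l<..<r} w0"
    unfolding w0_def using lr by (intro test_function_bump) auto
  define I where "I = integral {l..r} w0"
  have I: "I > 0"
  proof -
    have "integral {l..r} w0 = integral {(2*l+r)/3..(l+2*r)/3} w0"
    proof (rule integral_spike_set)
      have 0: "{x \<in> {l..r} - {(2*l+r)/3..(l+2*r)/3}. w0 x \<noteq> 0} = {}"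
        using bump_nonzeroD[of "(2*l+r)/3" "(l+2*r)/3" 1] unfolding w0_def by fastforce
      then show "negligible {x \<in> {l..r} - {(2*l+r)/3..(l+2*r)/3}. w0 x \<noteq> 0}" by (simp only: negligible_empty)
      have "{x \<in> {(2*l+r)/3..(l+2*r)/3} - {l..r}. w0 x \<noteq> 0} = {}" using lr by auto
      then show "negligible {x \<in> {(2*l+r)/3..(l+2*r)/3} - {l..r}. w0 x \<noteq> 0}" by (simp only: negligible_empty)
    qed
    then show ?thesis
      using bump_integral_pos[of "(2*l+r)/3" "(l+2*r)/3"] lr unfolding I_def w0_def by auto
  qed
  \<comment> \<open>If h is constant, testing with \<open>w0\<close> shows that its value can only
    be this quotient.\<close>
  define m where "m = integral {l..r} (\<lambda>x. h x * w0 x) / I"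
  have "AE x in lebesgue. x \<in> {l<..<r} \<longrightarrow> h x - m = 0"
  proof (rule fundamental_lemma)
    show "locally_integrable {l<..<r} (\<lambda>x. h x - m)"
      unfolding locally_integrable_def
    proof (intro allI impI)
      fix K assume K: "compact K \<and> K \<subseteq> {l<..<r}"
      have "(\<lambda>x. h x - m) absolutely_integrable_on {l..r}"
        by (rule set_integral_diff(1)[OF hi absolutely_integrable_continuous_real]) auto
      then show "(\<lambda>x. h x - m) absolutely_integrable_on K"
        by (rule set_integrable_subset) (use K in \<open>auto intro: lmeasurable_compact fmeasurableD\<close>)
    qed
    fix \<psi> assume \<psi>: "test_function {l<..<r} \<psi>"
    define q where "q = integral {l..r} \<psi> / I"
    have t: "test_function {l<..<r} (\<lambda>x. \<psi> x + (- q) * w0 x)"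
      using \<psi> w0 by (rule test_function_lincomb)
    have i\<psi>: "\<psi> integrable_on {l..r}" "w0 integrable_on {l..r}"
      using cont[OF \<psi>] cont[OF w0] by (auto intro: integrable_continuous_real)
    have "integral {l..r} (\<lambda>x. \<psi> x + (- q) * w0 x) = integral {l..r} \<psi> + (- q) * I"
      unfolding I_def
      using Henstock_Kurzweil_Integration.integral_add[OF i\<psi>(1) integrable_on_mult_right[OF i\<psi>(2), of "- q"]]
      by simp
    also have "\<dots> = 0" using I by (simp add: q_def)
    finally obtain \<phi> where \<phi>: "test_function {l<..<r} \<phi>" "deriv \<phi> = (\<lambda>x. \<psi> x + (- q) * w0 x)"
      using test_function_antiderivative[OF t lr(5)] by blast
    have "0 = integral {l..r} (\<lambda>x. h x * (\<psi> x + (- q) * w0 x))"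
      using orth[OF \<phi>(1)] \<phi>(2) by simp
    also have "\<dots> = integral {l..r} (\<lambda>x. h x * \<psi> x + (- q) * (h x * w0 x))"
      by (intro integral_cong) (simp add: algebra_simps)
    also have "\<dots> = integral {l..r} (\<lambda>x. h x * \<psi> x) + (- q) * integral {l..r} (\<lambda>x. h x * w0 x)"
      using Henstock_Kurzweil_Integration.integral_add[OF int[OF \<psi> hi] integrable_on_mult_right[OF int[OF w0 hi], of "- q"]]
      by simp
    also have "(- q) * integral {l..r} (\<lambda>x. h x * w0 x) = - integral {l..r} (\<lambda>x. m * \<psi> x)"
      using I by (simp add: q_def m_def)
    finally have 0: "integral {l..r} (\<lambda>x. h x * \<psi> x) - integral {l..r} (\<lambda>x. m * \<psi> x) = 0" by simp
    have "(LINT x:{l<..<r}|lebesgue. (h x - m) * \<psi> x) = (LINT x:{l..r}|lebesgue. (h x - m) * \<psi> x)"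
      using supp[OF \<psi>] by (intro set_integral_supported_cong) force
    also have "\<dots> = integral {l..r} (\<lambda>x. (h x - m) * \<psi> x)"
      using hi by (intro set_integral_mult_supported(2) cont[OF \<psi>] supp'[OF \<psi>]) auto
    also have "\<dots> = integral {l..r} (\<lambda>x. h x * \<psi> x) - integral {l..r} (\<lambda>x. m * \<psi> x)"
      unfolding left_diff_distrib using int[OF \<psi> hi] integrable_on_mult_right[OF i\<psi>(1)]
      by (rule Henstock_Kurzweil_Integration.integral_diff)
    finally show "(LINT x:{l<..<r}|lebesgue. (h x - m) * \<psi> x) = 0"
      using 0 by simp
  qed
  then have "AE x in lebesgue. x \<in> {c..d} \<longrightarrow> f x = m + G x"
    by eventually_elim (use lr in \<open>auto simp: h_def\<close>)
  moreover have "primitive c d (\<lambda>x. m + G x) g"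
    using primitive_subset[OF primitive_add_const[OF G]] lr by auto
  ultimately show thesis using that by blast
qed

text \<open>The derivative of a test function is again one; the identity of order k tested with it
  has the same left-hand side as the identity of order k + 1, and the two signs differ by
  -1.\<close>

lemma has_weak_deriv_Suc:
  assumes "has_weak_deriv k {a<..<b} f g" "has_weak_deriv (Suc k) {a<..<b} f g'" "a < b"
  shows "has_weak_deriv 1 {a<..<b} g g'"
  unfolding has_weak_deriv_def
proof (intro conjI allI impI)
  show "locally_integrable {a<..<b} g" "locally_integrable {a<..<b} g'"
    using assms by (auto simp: has_weak_deriv_def)
  fix \<phi> assume \<phi>: "test_function {a<..<b} \<phi>"
  have "(LINT x:{a<..<b}|lebesgue. f x * (deriv ^^ Suc k) \<phi> x) = (- 1) ^ Suc k * (LINT x:{a<..<b}|lebesgue. g' x * \<phi> x)"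
    using assms(2) \<phi> unfolding has_weak_deriv_def by blast
  moreover have "(LINT x:{a<..<b}|lebesgue. f x * (deriv ^^ k) (deriv \<phi>) x) = (- 1) ^ k * (LINT x:{a<..<b}|lebesgue. g x * deriv \<phi> x)"
    using assms(1) test_function_deriv[OF \<phi> assms(3)] unfolding has_weak_deriv_def by blast
  ultimately show "(LINT x:{a<..<b}|lebesgue. g x * (deriv ^^ 1) \<phi> x) = (- 1) ^ 1 * (LINT x:{a<..<b}|lebesgue. g' x * \<phi> x)"
    by (cases "even k") (simp_all add: funpow_swap1)
qed

lemma locally_integrableI_UNIV:
  assumes "integrable lebesgue f" shows "locally_integrable A (f :: real \<Rightarrow> real)"
  unfolding locally_integrable_def set_integrable_def
  using integrable_mult_indicator[OF _ assms] by (auto intro: lmeasurable_compact fmeasurableD)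

text \<open>The function vanishes at both endpoints, so its extension by zero has no jump and no
  boundary term appears against a test function that need not vanish at c or d.\<close>

lemma primitive_imp_has_weak_deriv:
  assumes p: "primitive c d f g" and cd: "a < c" "c \<le> d" "d < b"
    and f0: "\<And>x. x \<notin> {c<..<d} \<Longrightarrow> f x = 0" and g0: "\<And>x. x \<notin> {c..d} \<Longrightarrow> g x = 0"
  shows "has_weak_deriv 1 {a<..<b} f g" "integrable lebesgue f" "integrable lebesgue g"
proof -
  have sub: "{c..d} \<subseteq> {a<..<b}" using cd by auto
  have fi: "f absolutely_integrable_on {c..d}"
    using primitive_continuous_on[OF p] by (rule absolutely_integrable_continuous_real)
  have f0': "f x = 0" if "x \<notin> {c..d}" for x
    using that by (intro f0) auto
  have "(\<lambda>x. indicator {c..d} x *\<^sub>R f x) = f" "(\<lambda>x. indicator {c..d} x *\<^sub>R g x) = g"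
    using f0' g0 by (auto simp: indicator_def fun_eq_iff)
  then show f: "integrable lebesgue f" and g: "integrable lebesgue g"
    using fi primitive_abs_integrable[OF p] by (simp_all add: set_integrable_def)
  show "has_weak_deriv 1 {a<..<b} f g"
    unfolding has_weak_deriv_def
  proof (intro conjI allI impI locally_integrableI_UNIV f g)
    fix \<phi> assume \<phi>: "test_function {a<..<b} \<phi>"
    have c: "continuous_on S \<phi>" "continuous_on S (deriv \<phi>)" for S
      using test_function_smooth[OF \<phi>] smooth_deriv smooth_continuous_on by blast+
    have \<phi>p: "primitive c d \<phi> (deriv \<phi>)"
      using smooth_imp_deriv[OF test_function_smooth[OF \<phi>]] c by (intro primitive_C1)
    have e: "(LINT x:{a<..<b}|lebesgue. u x * w x) = integral {c..d} (\<lambda>x. u x * w x)"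
      if "u absolutely_integrable_on {c..d}" "continuous_on {c..d} w" "\<And>x. x \<notin> {c..d} \<Longrightarrow> u x = 0" for u w :: "real \<Rightarrow> real"
    proof -
      have "(LINT x:{a<..<b}|lebesgue. u x * w x) = (LINT x:{c..d}|lebesgue. u x * w x)"
        unfolding set_lebesgue_integral_def
      proof (intro Bochner_Integration.integral_cong refl)
        fix x
        show "indicator {a<..<b} x *\<^sub>R (u x * w x) = indicator {c..d} x *\<^sub>R (u x * w x)"
          using that(3)[of x] sub by (cases "x \<in> {c..d}") (auto simp: indicator_def)
      qed
      also have "\<dots> = integral {c..d} (\<lambda>x. u x * w x)"
        using absolutely_integrable_mult_continuous[OF that(1,2)] by (rule set_lebesgue_integral_eq_integral(2))
      finally show ?thesis .
    qed
    have "integral {c..d} (\<lambda>x. g x * \<phi> x) = - integral {c..d} (\<lambda>x. f x * deriv \<phi> x)"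
      using cd f0 by (intro primitive_by_parts[OF p \<phi>p]) auto
    then show "(LINT x:{a<..<b}|lebesgue. f x * (deriv ^^ 1) \<phi> x) = (- 1) ^ 1 * (LINT x:{a<..<b}|lebesgue. g x * \<phi> x)"
      using e[OF fi c(2)] e[OF primitive_abs_integrable[OF p] c(1)] f0' g0 by simp
  qed
qed

section \<open>Joint measurability of weak derivatives\<close>

text \<open>If \<open>w\<^sub>n(t) \<rightarrow> u(t)\<close> in \<open>L\<^sub>1\<close> for almost every \<open>t\<close>, then along a subsequence with summable truncated
  distances the convergence is almost everywhere, so \<open>u\<close> inherits joint measurability.\<close>

lemma jointly_measurable_limit:
  fixes w :: "nat \<Rightarrow> 't \<Rightarrow> 'x \<Rightarrow> real" and u :: "'t \<Rightarrow> 'x \<Rightarrow> real"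
  assumes M: "finite_measure M" and N: "sigma_finite_measure N"
    and w[measurable]: "\<And>n. case_prod (w n) \<in> borel_measurable (M \<Otimes>\<^sub>M N)"
    and u: "AE t in M. u t \<in> borel_measurable N"
    and lim: "AE t in M. (\<lambda>n. \<integral>\<^sup>+x. ennreal \<bar>w n t x - u t x\<bar> \<partial>N) \<longlonglongrightarrow> 0"
  obtains W where "case_prod W \<in> borel_measurable (M \<Otimes>\<^sub>M N)" "AE t in M. AE x in N. W t x = u t x"
proof -
  interpret M: finite_measure M by fact
  interpret N: sigma_finite_measure N by fact
  define d where "d = (\<lambda>n m t. \<integral>\<^sup>+x. ennreal \<bar>w n t x - w m t x\<bar> \<partial>N)"
  define e where "e = (\<lambda>n t. \<integral>\<^sup>+x. ennreal \<bar>w n t x - u t x\<bar> \<partial>N)"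
  \<comment> \<open>\<open>d\<close> compares two approximants and is measurable in t, whereas the
    distance \<open>e\<close> to the limit need not be, since \<open>u\<close> is measurable only
    slice by slice. The measurable \<open>D\<close> dominates \<open>e\<close> almost everywhere and
    still tends to 0.\<close>
  define D where "D = (\<lambda>n t. SUP m\<in>{n..}. d n m t)"
  have dm[measurable]: "d n m \<in> borel_measurable M" for n m
    unfolding d_def by measurable
  have Dm[measurable]: "D n \<in> borel_measurable M" for n
    unfolding D_def by measurable
  have wt: "w n t \<in> borel_measurable N" if "t \<in> space M" for n t
    using measurable_Pair2[OF w[of n] that] by simp
  have tri: "d n m t \<le> e n t + e m t" "e n t \<le> d n m t + e m t"
    if "t \<in> space M" "u t \<in> borel_measurable N" for n m t
  proof -
    note [measurable] = wt[OF that(1)] that(2)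
    have "d n m t \<le> (\<integral>\<^sup>+x. ennreal \<bar>w n t x - u t x\<bar> + ennreal \<bar>w m t x - u t x\<bar> \<partial>N)"
      unfolding d_def by (intro nn_integral_mono) (simp add: ennreal_plus[symmetric] del: ennreal_plus)
    also have "\<dots> = e n t + e m t" unfolding e_def by (rule nn_integral_add) auto
    finally show "d n m t \<le> e n t + e m t" .
    have "e n t \<le> (\<integral>\<^sup>+x. ennreal \<bar>w n t x - w m t x\<bar> + ennreal \<bar>w m t x - u t x\<bar> \<partial>N)"
      unfolding e_def by (intro nn_integral_mono) (simp add: ennreal_plus[symmetric] del: ennreal_plus)
    also have "\<dots> = d n m t + e m t" unfolding e_def d_def by (rule nn_integral_add) auto
    finally show "e n t \<le> d n m t + e m t" .
  qed
  have D0: "AE t in M. (\<lambda>n. D n t) \<longlonglongrightarrow> 0"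
    using u lim AE_space
  proof eventually_elim
    case (elim t)
    show ?case
    proof (rule order_tendstoI)
      fix y :: ennreal assume "0 < y"
      then obtain z where z: "0 < z" "z < y" using dense by blast
      then obtain z' where z': "0 < z'" "z' + z' < z"
      proof -
        obtain r where r: "z \<ge> ennreal r" "r > 0"
          using z(1) by (cases z) (auto intro: that[of 1])
        have "ennreal (r/3) + ennreal (r/3) < ennreal r"
          using r by (simp add: ennreal_plus[symmetric] ennreal_lessI del: ennreal_plus)
        with r that[of "ennreal (r/3)"] show thesis by (meson divide_pos_pos ennreal_less_zero_iff less_le_trans zero_less_numeral)
      qed
      have "\<forall>\<^sub>F n in sequentially. e n t < z'"
        using order_tendstoD(2)[OF elim(2) z'(1)] unfolding e_def .
      then obtain n0 where n0: "\<And>n. n \<ge> n0 \<Longrightarrow> e n t < z'"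
        by (auto simp: eventually_sequentially)
      have "D n t < y" if "n \<ge> n0" for n
      proof -
        have "D n t \<le> z"
          unfolding D_def
        proof (rule SUP_least)
          fix m assume "m \<in> {n..}"
          then have "d n m t \<le> z' + z'"
            using tri(1)[OF elim(3,1), of n m] n0[of n] n0[of m] that
            by (auto intro: order_trans add_mono less_imp_le)
          with z'(2) show "d n m t \<le> z" by simp
        qed
        with z(2) show ?thesis by simp
      qed
      then show "\<forall>\<^sub>F n in sequentially. D n t < y"
        by (auto simp: eventually_sequentially)
    qed simp
  qed
  have eD: "AE t in M. \<forall>n. e n t \<le> D n t"
    using u lim AE_space
  proof eventually_elim
    case (elim t)
    show ?case
    proof
      fix n
      have "(\<lambda>m. D n t + e m t) \<longlonglongrightarrow> D n t + 0"
        using elim(2) unfolding e_def by (intro tendsto_intros)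
      moreover have "e n t \<le> D n t + e m t" if "m \<ge> n" for m
      proof -
        have "d n m t \<le> D n t"
          unfolding D_def using that by (intro SUP_upper) auto
        then show ?thesis
          using tri(2)[OF elim(3,1), of n m] by (meson add_right_mono order_trans)
      qed
      ultimately show "e n t \<le> D n t"
        by (intro tendsto_lowerbound[of "\<lambda>m. D n t + e m t" "D n t" sequentially])
           (auto simp: eventually_sequentially)
    qed
  qed
  \<comment> \<open>Truncation at 1 supplies the dominating function on a finite measure; along the
    subsequence it becomes inactive as soon as the summands drop below 1.\<close>
  have "(\<lambda>n. \<integral>\<^sup>+t. min 1 (D n t) \<partial>M) \<longlonglongrightarrow> (\<integral>\<^sup>+t. 0 \<partial>M)"
  proof (rule nn_integral_dominated_convergence[where w="\<lambda>_. 1"])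
    show "AE t in M. (\<lambda>n. min 1 (D n t)) \<longlonglongrightarrow> 0"
      using D0
    proof eventually_elim
      case (elim t)
      have "(\<lambda>n. min 1 (D n t)) \<longlonglongrightarrow> min 1 0"
        using elim by (intro tendsto_min tendsto_const)
      then show ?case by simp
    qed
    show "(\<integral>\<^sup>+t. 1 \<partial>M) < \<infinity>"
      using M.emeasure_finite[of "space M"] by (simp only: nn_integral_const mult_1_left infinity_ennreal_def top.not_eq_extremum[symmetric] not_False_eq_True)
  qed auto
  then have "(\<lambda>n. \<integral>\<^sup>+t. min 1 (D n t) \<partial>M) \<longlonglongrightarrow> 0" by simp
  then have "\<exists>n. (\<integral>\<^sup>+t. min 1 (D n t) \<partial>M) < ennreal ((1/2)^k)" for k
    by (rule eventually_happens'[OF sequentially_bot order_tendstoD(2)]) simp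
  then obtain r where r: "\<And>k. (\<integral>\<^sup>+t. min 1 (D (r k) t) \<partial>M) < ennreal ((1/2)^k)" by metis
  have "(\<integral>\<^sup>+t. (\<Sum>k. min 1 (D (r k) t)) \<partial>M) = (\<Sum>k. \<integral>\<^sup>+t. min 1 (D (r k) t) \<partial>M)"
    by (rule nn_integral_suminf) measurable
  also have "\<dots> \<le> (\<Sum>k. ennreal ((1/2)^k))"
    by (intro suminf_le) (auto intro: less_imp_le[OF r])
  also have "\<dots> < \<infinity>"
    by (simp add: suminf_ennreal2 summable_geometric)
  finally have "AE t in M. (\<Sum>k. min 1 (D (r k) t)) \<noteq> \<infinity>"
    by (intro nn_integral_noteq_infinite) auto
  with eD u AE_space have "AE t in M. AE x in N. (\<lambda>k. w (r k) t x) \<longlonglongrightarrow> u t x"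
  proof eventually_elim
    case (elim t)
    note [measurable] = wt[OF elim(3)] elim(2)
    have "(\<lambda>k. min 1 (D (r k) t)) \<longlonglongrightarrow> 0"
    proof -
      have "(\<Sum>k. ennreal (enn2real (min 1 (D (r k) t)))) = (\<Sum>k. min 1 (D (r k) t))"
        by (intro suminf_cong) (simp add: ennreal_enn2real_if min_def)
      then have "summable (\<lambda>k. enn2real (min 1 (D (r k) t)))"
        using elim(4) by (intro summable_suminf_not_top) auto
      then have "(\<lambda>k. ennreal (enn2real (min 1 (D (r k) t)))) \<longlonglongrightarrow> ennreal 0"
        by (intro tendsto_ennrealI summable_LIMSEQ_zero)
      moreover have "ennreal (enn2real (min 1 (D (r k) t))) = min 1 (D (r k) t)" for k
        by (simp add: ennreal_enn2real_if min_def)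
      ultimately show ?thesis by simp
    qed
    then have "\<forall>\<^sub>F k in sequentially. min 1 (D (r k) t) < 1"
      by (rule order_tendstoD) simp
    then obtain K where K: "\<And>k. k \<ge> K \<Longrightarrow> min 1 (D (r k) t) < 1"
      by (auto simp: eventually_sequentially)
    have le: "e (r (k + K)) t \<le> min 1 (D (r (k + K)) t)" for k
      using K[of "k+K"] elim(1) by (auto simp: min_def split: if_splits)
    have "(\<integral>\<^sup>+x. (\<Sum>k. ennreal \<bar>w (r (k+K)) t x - u t x\<bar>) \<partial>N) = (\<Sum>k. e (r (k + K)) t)"
      unfolding e_def by (rule nn_integral_suminf) measurable
    also have "\<dots> \<le> (\<Sum>k. min 1 (D (r (k+K)) t))"
      by (intro suminf_le le) auto
    also have "\<dots> \<le> (\<Sum>k. min 1 (D (r k) t))"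
      using suminf_offset[of "\<lambda>k. min 1 (D (r k) t)" K] by (simp add: add_increasing)
    also have "\<dots> < \<infinity>" using elim(4) by (simp add: less_top)
    finally have "AE x in N. (\<Sum>k. ennreal \<bar>w (r (k+K)) t x - u t x\<bar>) \<noteq> \<infinity>"
      by (intro nn_integral_noteq_infinite) auto
    then show ?case
    proof eventually_elim
      case (elim x)
      then have "summable (\<lambda>k. \<bar>w (r (k+K)) t x - u t x\<bar>)"
        by (intro summable_suminf_not_top) auto
      then have "(\<lambda>k. \<bar>w (r (k+K)) t x - u t x\<bar>) \<longlonglongrightarrow> 0"
        by (rule summable_LIMSEQ_zero)
      then have "(\<lambda>k. w (r (k+K)) t x) \<longlonglongrightarrow> u t x"
        by (simp add: LIM_zero_iff tendsto_rabs_zero_iff)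
      then show ?case
        by (rule LIMSEQ_offset)
    qed
  qed
  then have "AE t in M. AE x in N. lim (\<lambda>k. w (r k) t x) = u t x"
    by eventually_elim (auto intro: limI)
  moreover have "(\<lambda>(t,x). lim (\<lambda>k. w (r k) t x)) \<in> borel_measurable (M \<Otimes>\<^sub>M N)"
  proof -
    have "(\<lambda>p. lim (\<lambda>k. case_prod (w (r k)) p)) \<in> borel_measurable (M \<Otimes>\<^sub>M N)"
      by measurable
    then show ?thesis by (simp add: case_prod_beta')
  qed
  ultimately show thesis using that[of "\<lambda>t x. lim (\<lambda>k. w (r k) t x)"] by blast
qed

section \<open>Measurability with respect to the completed plane measure\<close>

lemma null_set_times_UNIV:
  fixes N :: "real set"
  assumes "N \<in> null_sets lborel"
  shows "N \<times> (UNIV :: real set) \<in> null_sets lborel" "(UNIV :: real set) \<times> N \<in> null_sets lborel"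
proof -
  have N: "N \<in> sets borel" "emeasure lborel N = 0" using assms by auto
  have s: "N \<times> (UNIV :: real set) \<in> sets (lborel \<Otimes>\<^sub>M lborel)" "(UNIV :: real set) \<times> N \<in> sets (lborel \<Otimes>\<^sub>M lborel)"
    using N by auto
  have "emeasure (lborel \<Otimes>\<^sub>M lborel) (N \<times> (UNIV :: real set)) = emeasure lborel N * emeasure lborel (UNIV :: real set)"
    "emeasure (lborel \<Otimes>\<^sub>M lborel) ((UNIV :: real set) \<times> N) = emeasure lborel (UNIV :: real set) * emeasure lborel N"
    using N by (intro lborel.emeasure_pair_measure_Times; simp)+
  with s N show "N \<times> (UNIV :: real set) \<in> null_sets lborel" "(UNIV :: real set) \<times> N \<in> null_sets lborel"
    unfolding lborel_prod by (auto simp: null_sets_def)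
qed

text \<open>For the completions, Borel measurability of the projections does not suffice: a null set
  on the line also has to pull back to a null strip, which is what
  \<open>null_set_times_UNIV\<close> provides.\<close>

lemma measurable_fst_lebesgue: "fst \<in> (lebesgue :: (real \<times> real) measure) \<rightarrow>\<^sub>M (lebesgue :: real measure)"
  and measurable_snd_lebesgue: "snd \<in> (lebesgue :: (real \<times> real) measure) \<rightarrow>\<^sub>M (lebesgue :: real measure)"
proof -
  have "fst -` A \<in> sets (lebesgue :: (real \<times> real) measure) \<and> snd -` A \<in> sets (lebesgue :: (real \<times> real) measure)"
    if A: "A \<in> sets lebesgue" for A :: "real set"
  proof -
    obtain S N N' where *: "A = S \<union> N" "S \<in> sets lborel" "N' \<in> null_sets lborel" "N \<subseteq> N'"
      by (rule sets_completionE[OF A]) (rule that)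
    have e: "fst -` B = B \<times> (UNIV :: real set)" "snd -` B = (UNIV :: real set) \<times> B" for B :: "real set"
      by auto
    have "S \<times> (UNIV::real set) \<in> sets lborel" "(UNIV::real set) \<times> S \<in> sets lborel"
      using *(2) by (auto simp: borel_Times)
    then have "S \<times> (UNIV::real set) \<union> N \<times> UNIV \<in> sets lebesgue" "(UNIV::real set) \<times> S \<union> UNIV \<times> N \<in> sets lebesgue"
      using null_set_times_UNIV[OF *(3)] *(4)
      by (intro sets_completionI[of _ "S \<times> UNIV" "N \<times> UNIV" "N' \<times> UNIV"]
          sets_completionI[of _ "UNIV \<times> S" "UNIV \<times> N" "UNIV \<times> N'"]; auto)+
    moreover have "A \<times> (UNIV::real set) = S \<times> UNIV \<union> N \<times> UNIV" "(UNIV::real set) \<times> A = UNIV \<times> S \<union> UNIV \<times> N"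
      using *(1) by auto
    ultimately have "A \<times> (UNIV::real set) \<in> sets lebesgue" "(UNIV::real set) \<times> A \<in> sets lebesgue"
      by auto
    then show ?thesis by (simp add: e)
  qed
  then show "fst \<in> (lebesgue :: (real \<times> real) measure) \<rightarrow>\<^sub>M (lebesgue :: real measure)"
    "snd \<in> (lebesgue :: (real \<times> real) measure) \<rightarrow>\<^sub>M (lebesgue :: real measure)"
    by (auto intro!: measurableI)
qed

lemma measurable_lebesgue_on_pair:
  fixes W :: "real \<Rightarrow> real \<Rightarrow> real"
  assumes W: "case_prod W \<in> borel_measurable (lebesgue_on I \<Otimes>\<^sub>M lebesgue_on A)"
  shows "case_prod W \<in> borel_measurable (lebesgue_on (I \<times> A))"
proof -
  have "(\<lambda>p. (fst p, snd p)) \<in> lebesgue_on (I \<times> A) \<rightarrow>\<^sub>M lebesgue_on I \<Otimes>\<^sub>M lebesgue_on A"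
    by (intro measurable_Pair measurable_restrict_space2 measurable_restrict_space1
        measurable_fst_lebesgue measurable_snd_lebesgue) (auto simp: space_restrict_space)
  from measurable_compose[OF this W] show ?thesis by simp
qed

section \<open>Representatives of the weak derivatives of Sobolev functions\<close>

lemma AE_lebesgue_on:
  "A \<in> sets lebesgue \<Longrightarrow> (AE x in lebesgue_on A. P x) \<longleftrightarrow> (AE x in lebesgue. x \<in> A \<longrightarrow> P x)"
  by (simp add: AE_restrict_space_iff)

lemma set_integral_lebesgue_on:
  "A \<in> sets lebesgue \<Longrightarrow> (LINT x:A|lebesgue. f x) = (LINT x|lebesgue_on A. f x :: real)"
  by (simp add: set_lebesgue_integral_def integral_restrict_space)

lemma interval_exhaustion:
  fixes a b :: real
  assumes "a < c" "d < b" "a < b"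
  obtains n :: nat where "a + (b - a) / real (n + 3) < c" "d < b - (b - a) / real (n + 3)"
proof -
  obtain n where n: "1 / real (Suc n) < min (c - a) (b - d) / (b - a)"
    using nat_approx_posE[of "min (c - a) (b - d) / (b - a)"] assms by (auto simp: divide_pos_pos)
  have "(b - a) / real (n + 3) \<le> (b - a) / real (Suc n)"
    using assms by (intro divide_left_mono) auto
  also have "\<dots> = (b - a) * (1 / real (Suc n))" by simp
  also have "\<dots> < (b - a) * (min (c - a) (b - d) / (b - a))"
    using n assms by (intro mult_strict_left_mono) auto
  also have "\<dots> = min (c - a) (b - d)" using assms by simp
  finally show thesis using that[of n] by linarith
qed

text \<open>Local integrability controls compact subintervals only; the function is the pointwise
  limit of its restrictions to an exhausting sequence of these.\<close>

lemma locally_integrable_measurable: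
  assumes f: "locally_integrable {a<..<b} f"
  shows "f \<in> borel_measurable (lebesgue_on {a<..<b})"
proof -
  have pos: "1 / real (Suc n) > 0" for n by simp
  let ?K = "\<lambda>n. {a + 1 / real (Suc n)..b - 1 / real (Suc n)}"
  have K: "?K n \<subseteq> {a<..<b}" for n
    using pos[of n] by (intro subsetI) (simp only: atLeastAtMost_iff greaterThanLessThan_iff, linarith)
  have m: "(\<lambda>x. indicator (?K n) x * f x) \<in> borel_measurable lebesgue" for n
    using locally_integrableD[OF f K] by (auto simp: set_integrable_def dest: borel_measurable_integrable)
  have "(\<lambda>x. indicator {a<..<b} x * f x) \<in> borel_measurable lebesgue"
  proof (rule borel_measurable_LIMSEQ_real[OF _ m])
    fix x
    show "(\<lambda>n. indicator (?K n) x * f x) \<longlonglongrightarrow> indicator {a<..<b} x * f x"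
    proof (cases "x \<in> {a<..<b}")
      case True
      then have "min (x - a) (b - x) > 0" by simp
      then have "\<forall>\<^sub>F n in sequentially. 1 / real (Suc n) < min (x - a) (b - x)"
        by (rule order_tendstoD(2)[OF LIMSEQ_Suc[OF lim_1_over_n]])
      then have "\<forall>\<^sub>F n in sequentially. indicator {a<..<b} x * f x = indicator (?K n) x * f x"
      proof eventually_elim
        case (elim n)
        then have "x \<in> ?K n"
          unfolding atLeastAtMost_iff min_less_iff_conj by linarith
        with True show ?case by (simp only: indicator_simps)
      qed
      then show ?thesis by (rule Lim_transform_eventually[OF tendsto_const])
    next
      case False
      then have "x \<notin> ?K n" for n using K[of n] by blast
      with False show ?thesis by simp
    qed
  qed
  then show ?thesis by (subst borel_measurable_restrict_space_iff) auto
qed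

lemma has_weak_deriv_lincomb:
  assumes f: "has_weak_deriv k {a<..<b} f g" and f': "has_weak_deriv k {a<..<b} f' g'" and ab: "a < b"
  shows "has_weak_deriv k {a<..<b} (\<lambda>x. f x + m * f' x) (\<lambda>x. g x + m * g' x)"
proof -
  have l: "locally_integrable {a<..<b} f" "locally_integrable {a<..<b} g"
    "locally_integrable {a<..<b} f'" "locally_integrable {a<..<b} g'"
    using f f' by (auto simp: has_weak_deriv_def)
  have ll: "locally_integrable {a<..<b} (\<lambda>x. u x + m * u' x)"
    if "locally_integrable {a<..<b} u" "locally_integrable {a<..<b} u'" for u u'
    using that unfolding locally_integrable_def
    by (auto intro!: set_integral_add(1) set_integrable_mult_right)
  have key: "(LINT x:{a<..<b}|lebesgue. (u x + m * u' x) * \<phi> x) =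
      (LINT x:{a<..<b}|lebesgue. u x * \<phi> x) + m * (LINT x:{a<..<b}|lebesgue. u' x * \<phi> x)"
    if u: "locally_integrable {a<..<b} u" "locally_integrable {a<..<b} u'" and \<phi>: "test_function {a<..<b} \<phi>" for u u' \<phi>
  proof -
    obtain c d where cd: "a < c" "c < d" "d < b" "\<And>x. \<phi> x \<noteq> 0 \<Longrightarrow> x \<in> {c..d}"
      using test_function_support[OF \<phi> ab] by blast
    have sub: "{c..d} \<subseteq> {a<..<b}" using cd by auto
    note i = set_integral_mult_supported(1)[OF locally_integrableD[OF _ sub]
        smooth_continuous_on[OF test_function_smooth[OF \<phi>]] cd(4) sub]
    have "(LINT x:{a<..<b}|lebesgue. (u x + m * u' x) * \<phi> x) = (LINT x:{a<..<b}|lebesgue. u x * \<phi> x + m * (u' x * \<phi> x))"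
      by (simp add: algebra_simps)
    then show ?thesis
      using i[OF u(1)] i[OF u(2)] by (simp add: set_integral_add(2) set_integrable_mult_right)
  qed
  have tk: "test_function {a<..<b} ((deriv ^^ k) \<phi>)" if "test_function {a<..<b} \<phi>" for \<phi>
    using that by (induction k) (auto intro: test_function_deriv ab)
  show ?thesis
    unfolding has_weak_deriv_def
  proof (intro conjI allI impI ll l)
    fix \<phi> assume \<phi>: "test_function {a<..<b} \<phi>"
    have "(LINT x:{a<..<b}|lebesgue. f x * (deriv ^^ k) \<phi> x) = (- 1) ^ k * (LINT x:{a<..<b}|lebesgue. g x * \<phi> x)"
      "(LINT x:{a<..<b}|lebesgue. f' x * (deriv ^^ k) \<phi> x) = (- 1) ^ k * (LINT x:{a<..<b}|lebesgue. g' x * \<phi> x)"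
      using f f' \<phi> unfolding has_weak_deriv_def by blast+
    then show "(LINT x:{a<..<b}|lebesgue. (f x + m * f' x) * (deriv ^^ k) \<phi> x) =
        (- 1) ^ k * (LINT x:{a<..<b}|lebesgue. (g x + m * g' x) * \<phi> x)"
      using key[OF l(1,3) tk[OF \<phi>]] key[OF l(2,4) \<phi>] by (simp add: algebra_simps)
  qed
qed

lemma has_weak_deriv_weak_deriv:
  "has_weak_deriv k A f g \<Longrightarrow> has_weak_deriv k A f (weak_deriv k A f)"
  unfolding weak_deriv_def by (rule someI[of "has_weak_deriv k A f"])

lemma in_Lp_cong_AE:
  assumes f: "in_Lp p {a<..<b} f" and g: "g \<in> borel_measurable (lebesgue_on {a<..<b})"
    and eq: "AE x in lebesgue. x \<in> {a<..<b} \<longrightarrow> f x = g x"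
  shows "in_Lp p {a<..<b} g"
proof -
  have [measurable]: "f \<in> borel_measurable (lebesgue_on {a<..<b})" using f by (simp add: in_Lp_def)
  note [measurable] = g
  have ae: "AE x in lebesgue_on {a<..<b}. \<bar>f x\<bar> powr p = \<bar>g x\<bar> powr p"
    unfolding AE_lebesgue_on[OF lmeasurable_interval(2)[THEN fmeasurableD]]
    using eq by eventually_elim auto
  have "integrable (lebesgue_on {a<..<b}) (\<lambda>x. \<bar>f x\<bar> powr p)"
    using f by (simp add: in_Lp_def)
  moreover have "(\<lambda>x. \<bar>g x\<bar> powr p) \<in> borel_measurable (lebesgue_on {a<..<b})"
    by measurable
  ultimately have "integrable (lebesgue_on {a<..<b}) (\<lambda>x. \<bar>g x\<bar> powr p)"
    using ae by (rule integrable_cong_AE_imp)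
  with g show ?thesis by (simp add: in_Lp_def)
qed

text \<open>Membership in \<open>sobolev\<close> supplies some derivative in L_p;
  \<open>weak_deriv\<close> is a possibly different choice, which equals it almost everywhere by
  uniqueness and so inherits integrability.\<close>

lemma sobolev_weak_deriv:
  assumes f: "f \<in> sobolev k p {a<..<b}" and "j \<le> k" "a < b"
  shows "has_weak_deriv j {a<..<b} f (weak_deriv j {a<..<b} f)" "in_Lp p {a<..<b} (weak_deriv j {a<..<b} f)"
proof -
  obtain g where g: "has_weak_deriv j {a<..<b} f g" "in_Lp p {a<..<b} g"
    using assms(1,2) unfolding sobolev_def by blast
  show w: "has_weak_deriv j {a<..<b} f (weak_deriv j {a<..<b} f)"
    using has_weak_deriv_weak_deriv[OF g(1)] .
  then have "weak_deriv j {a<..<b} f \<in> borel_measurable (lebesgue_on {a<..<b})"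
    by (intro locally_integrable_measurable) (auto simp: has_weak_deriv_def)
  then show "in_Lp p {a<..<b} (weak_deriv j {a<..<b} f)"
    using in_Lp_cong_AE[OF g(2) _ has_weak_deriv_unique[OF g(1) w assms(3)]] by blast
qed

text \<open>\<open>weak_deriv\<close> chooses a representative for each function separately, so
  linearity survives only almost everywhere.\<close>

lemma weak_deriv_diff_AE:
  assumes "f \<in> sobolev k p {a<..<b}" "g \<in> sobolev k p {a<..<b}" "j \<le> k" "a < b"
  shows "AE x in lebesgue. x \<in> {a<..<b} \<longrightarrow>
    weak_deriv j {a<..<b} (f - g) x = weak_deriv j {a<..<b} f x - weak_deriv j {a<..<b} g x"
proof -
  have "has_weak_deriv j {a<..<b} (\<lambda>x. f x + (-1) * g x)
      (\<lambda>x. weak_deriv j {a<..<b} f x + (-1) * weak_deriv j {a<..<b} g x)"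
    using assms by (intro has_weak_deriv_lincomb sobolev_weak_deriv)
  moreover have "f - g = (\<lambda>x. f x + (-1) * g x)" by auto
  ultimately have "has_weak_deriv j {a<..<b} (f - g) (\<lambda>x. weak_deriv j {a<..<b} f x - weak_deriv j {a<..<b} g x)"
    by simp
  from has_weak_deriv_unique[OF has_weak_deriv_weak_deriv[OF this] this assms(4)] show ?thesis .
qed

lemma sobolev_norm_powr_ge:
  assumes "p > 0" "j \<le> k"
  shows "(LINT x:A|lebesgue. \<bar>weak_deriv j A f x\<bar> powr p) \<le> sobolev_norm k p A f powr p"
    and "sobolev_norm k p A f powr p = (\<Sum>j\<le>k. LINT x:A|lebesgue. \<bar>weak_deriv j A f x\<bar> powr p)"
    and "sobolev_norm k p A f \<ge> 0"
proof -
  have nn: "(LINT x:A|lebesgue. \<bar>weak_deriv j A f x\<bar> powr p) \<ge> 0" for j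
    unfolding set_lebesgue_integral_def by (intro integral_nonneg_AE AE_I2) auto
  show "sobolev_norm k p A f powr p = (\<Sum>j\<le>k. LINT x:A|lebesgue. \<bar>weak_deriv j A f x\<bar> powr p)"
    unfolding sobolev_norm_def using assms nn by (simp add: powr_powr sum_nonneg)
  then show "(LINT x:A|lebesgue. \<bar>weak_deriv j A f x\<bar> powr p) \<le> sobolev_norm k p A f powr p"
    using member_le_sum[of j "{..k}" "\<lambda>j. LINT x:A|lebesgue. \<bar>weak_deriv j A f x\<bar> powr p"] nn assms by auto
  show "sobolev_norm k p A f \<ge> 0" by (simp add: sobolev_norm_def)
qed

text \<open>A substitute for Hoelder's inequality on bounded sets: the threshold \<delta> is free,
  and integrating the bound and adjusting \<delta> compares L_1 with L_p norms.\<close>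

lemma le_add_powr:
  fixes y \<delta> p :: real
  assumes "\<delta> > 0" "p \<ge> 1" "y \<ge> 0"
  shows "y \<le> \<delta> + \<delta> powr (1 - p) * y powr p"
proof (cases "y \<le> \<delta>")
  case True
  then show ?thesis by (simp add: add_increasing2)
next
  case False
  then have "y = y powr (1 - p) * y powr p" using assms by (simp flip: powr_add)
  also have "\<dots> \<le> \<delta> powr (1 - p) * y powr p"
    using False assms by (intro mult_right_mono powr_mono2') auto
  finally show ?thesis using assms by linarith
qed

text \<open>A simple function with values in the Sobolev space takes finitely many values, so its
  derivatives form a finite sum of products of a function of t and a function of x. Convergence in
  the Sobolev norm gives convergence of these derivatives in L_1 of the bounded interval, as
  \<open>jointly_measurable_limit\<close> requires.\<close>

lemma bochner_sobolev_joint_version: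
  assumes v: "bochner_Lp (lebesgue_on I) (sobolev k p {c<..<d}) (sobolev_norm k p {c<..<d}) q v"
    and I: "I \<in> lmeasurable" and cd: "c < d" and jk: "j \<le> k" and p: "p \<ge> 1"
  obtains W where "case_prod W \<in> borel_measurable (lebesgue_on I \<Otimes>\<^sub>M lebesgue_on {c<..<d})"
    "AE t in lebesgue_on I. AE x in lebesgue_on {c<..<d}. W t x = weak_deriv j {c<..<d} (v t) x"
proof -
  let ?A = "{c<..<d}"
  have fin: "finite_measure (lebesgue_on I)" "finite_measure (lebesgue_on ?A)"
    using I by (auto intro!: finite_measure_lebesgue_on)
  obtain s where s: "\<And>n. simple_function (lebesgue_on I) (s n)"
      "\<And>n. s n ` space (lebesgue_on I) \<subseteq> sobolev k p ?A"
      "AE t in lebesgue_on I. (\<lambda>n. sobolev_norm k p ?A (s n t - v t)) \<longlonglongrightarrow> 0"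
    and vX: "AE t in lebesgue_on I. v t \<in> sobolev k p ?A"
    using v unfolding bochner_Lp_def by blast
  define w where "w = (\<lambda>n t. if t \<in> I then weak_deriv j ?A (s n t) else (\<lambda>_. 0))"
  have meas: "weak_deriv j ?A f \<in> borel_measurable (lebesgue_on ?A)" if "f \<in> sobolev k p ?A" for f
    using sobolev_weak_deriv(2)[OF that jk cd] by (simp add: in_Lp_def)
  show thesis
  proof (rule jointly_measurable_limit[OF fin(1), of "lebesgue_on ?A" w "\<lambda>t. weak_deriv j ?A (v t)"])
    show "sigma_finite_measure (lebesgue_on ?A)" using fin(2) by (rule finite_measure.axioms(1))
    show "AE t in lebesgue_on I. weak_deriv j ?A (v t) \<in> borel_measurable (lebesgue_on ?A)"
      using vX by eventually_elim (rule meas)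
    show "case_prod (w n) \<in> borel_measurable (lebesgue_on I \<Otimes>\<^sub>M lebesgue_on ?A)" for n
    proof -
      have f: "finite (s n ` I)" and sets: "\<And>f. f \<in> s n ` I \<Longrightarrow> s n -` {f} \<inter> I \<in> sets (lebesgue_on I)"
        using s(1)[of n] by (auto simp: simple_function_def)
      have "(\<lambda>p. \<Sum>f\<in>s n ` I. indicator (s n -` {f} \<inter> I) (fst p) * weak_deriv j ?A f (snd p))
          \<in> borel_measurable (lebesgue_on I \<Otimes>\<^sub>M lebesgue_on ?A)"
      proof (intro borel_measurable_sum borel_measurable_times)
        fix f assume fI: "f \<in> s n ` I"
        show "(\<lambda>p. indicator (s n -` {f} \<inter> I) (fst p)) \<in> borel_measurable (lebesgue_on I \<Otimes>\<^sub>M lebesgue_on ?A)"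
          using sets[OF fI] by (intro measurable_compose[OF measurable_fst borel_measurable_indicator])
        have "f \<in> sobolev k p ?A" using s(2)[of n] fI by auto
        then show "(\<lambda>p. weak_deriv j ?A f (snd p)) \<in> borel_measurable (lebesgue_on I \<Otimes>\<^sub>M lebesgue_on ?A)"
          by (intro measurable_compose[OF measurable_snd meas])
      qed
      moreover have "(\<Sum>f\<in>s n ` I. indicator (s n -` {f} \<inter> I) t * weak_deriv j ?A f x) = w n t x" for t x
      proof (cases "t \<in> I")
        case True
        have "(\<Sum>f\<in>s n ` I. indicator (s n -` {f} \<inter> I) t * weak_deriv j ?A f x)
            = (\<Sum>f\<in>s n ` I. if f = s n t then weak_deriv j ?A f x else 0)"
          using True by (intro sum.cong) (auto simp: indicator_def)
        then show ?thesis using True f by (simp add: w_def sum.delta)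
      qed (simp add: w_def)
      ultimately show ?thesis by (simp add: case_prod_beta')
    qed
    have "AE t in lebesgue_on I. t \<in> I" using AE_space[of "lebesgue_on I"] by simp
    then show "AE t in lebesgue_on I. (\<lambda>n. \<integral>\<^sup>+x. ennreal \<bar>w n t x - weak_deriv j ?A (v t) x\<bar> \<partial>lebesgue_on ?A) \<longlonglongrightarrow> 0"
      using s(3) vX
    proof eventually_elim
      case (elim t)
      define r where "r = (\<lambda>n. sobolev_norm k p ?A (s n t - v t))"
      have sn: "s n t \<in> sobolev k p ?A" for n using s(2)[of n] elim(1) by auto
      have bound: "(\<integral>\<^sup>+x. ennreal \<bar>w n t x - weak_deriv j ?A (v t) x\<bar> \<partial>lebesgue_on ?A)
          \<le> ennreal (\<delta> * (d - c) + \<delta> powr (1 - p) * r n powr p)" if \<delta>: "\<delta> > 0" for n \<delta>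
      proof -
        let ?z = "weak_deriv j ?A (s n t - v t)"
        have ae: "AE x in lebesgue_on ?A. ?z x = w n t x - weak_deriv j ?A (v t) x"
          using weak_deriv_diff_AE[OF sn elim(3) jk cd] elim(1) by (subst AE_lebesgue_on) (auto simp: w_def)
        have m[measurable]: "weak_deriv j ?A (s n t) \<in> borel_measurable (lebesgue_on ?A)"
            "weak_deriv j ?A (v t) \<in> borel_measurable (lebesgue_on ?A)"
          using meas[OF sn] meas[OF elim(3)] by auto
        have mz[measurable]: "?z \<in> borel_measurable (lebesgue_on ?A)"
        proof -
          have "has_weak_deriv j ?A (\<lambda>x. s n t x + (-1) * v t x)
              (\<lambda>x. weak_deriv j ?A (s n t) x + (-1) * weak_deriv j ?A (v t) x)"
            using sn elim(3) jk cd by (intro has_weak_deriv_lincomb sobolev_weak_deriv)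
          moreover have "s n t - v t = (\<lambda>x. s n t x + (-1) * v t x)" by auto
          ultimately have "has_weak_deriv j ?A (s n t - v t) ?z"
            using has_weak_deriv_weak_deriv by metis
          then show ?thesis by (intro locally_integrable_measurable) (simp add: has_weak_deriv_def)
        qed
        have int: "integrable (lebesgue_on ?A) (\<lambda>x. \<bar>?z x\<bar> powr p)"
        proof -
          have "integrable (lebesgue_on ?A) (\<lambda>x. 2 powr p * (\<bar>weak_deriv j ?A (s n t) x\<bar> powr p + \<bar>weak_deriv j ?A (v t) x\<bar> powr p))"
            using sobolev_weak_deriv(2)[OF sn jk cd] sobolev_weak_deriv(2)[OF elim(3) jk cd]
            by (intro integrable_mult_right Bochner_Integration.integrable_add) (auto simp: in_Lp_def)
          then show ?thesis
          proof (rule Bochner_Integration.integrable_bound)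
            show "AE x in lebesgue_on ?A. norm (\<bar>?z x\<bar> powr p)
              \<le> norm (2 powr p * (\<bar>weak_deriv j ?A (s n t) x\<bar> powr p + \<bar>weak_deriv j ?A (v t) x\<bar> powr p))"
              using ae
            proof eventually_elim
              case (elim x)
              define y z where "y = \<bar>weak_deriv j ?A (s n t) x\<bar>" and "z = \<bar>weak_deriv j ?A (v t) x\<bar>"
              have "\<bar>?z x\<bar> \<le> 2 * max y z"
                using elim \<open>t \<in> I\<close> unfolding y_def z_def w_def by auto
              then have "\<bar>?z x\<bar> powr p \<le> (2 * max y z) powr p"
                using p by (intro powr_mono2) auto
              also have "\<dots> = 2 powr p * (max y z) powr p"
                by (simp add: powr_mult y_def z_def)
              also have "(max y z) powr p \<le> y powr p + z powr p"
                by (simp add: max_def)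
              finally show ?case by (simp add: y_def z_def)
            qed
          qed simp
        qed
        have "(\<integral>\<^sup>+x. ennreal \<bar>w n t x - weak_deriv j ?A (v t) x\<bar> \<partial>lebesgue_on ?A) = (\<integral>\<^sup>+x. ennreal \<bar>?z x\<bar> \<partial>lebesgue_on ?A)"
          by (rule nn_integral_cong_AE) (use ae in \<open>auto elim!: eventually_mono\<close>)
        also have "\<dots> \<le> (\<integral>\<^sup>+x. ennreal (\<delta> + \<delta> powr (1 - p) * \<bar>?z x\<bar> powr p) \<partial>lebesgue_on ?A)"
          using le_add_powr[OF \<delta> p] by (intro nn_integral_mono ennreal_leI) auto
        also have "\<dots> = ennreal (LINT x|lebesgue_on ?A. \<delta> + \<delta> powr (1 - p) * \<bar>?z x\<bar> powr p)"
          using int \<delta> fin(2) by (intro nn_integral_eq_integral) (auto simp: finite_measure.integrable_const)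
        also have "(LINT x|lebesgue_on ?A. \<delta> + \<delta> powr (1 - p) * \<bar>?z x\<bar> powr p)
            = \<delta> * (d - c) + \<delta> powr (1 - p) * (LINT x|lebesgue_on ?A. \<bar>?z x\<bar> powr p)"
          using int fin(2) cd by (subst Bochner_Integration.integral_add)
            (auto simp: finite_measure.integrable_const measure_restrict_space)
        also have "\<dots> \<le> \<delta> * (d - c) + \<delta> powr (1 - p) * r n powr p"
          unfolding r_def using sobolev_norm_powr_ge(1)[of p j k ?A "s n t - v t"] p jk
          by (intro add_left_mono mult_left_mono) (auto simp: set_integral_lebesgue_on)
        finally show ?thesis by (simp add: ennreal_leI)
      qed
      have r0: "r \<longlonglongrightarrow> 0" using elim(2) by (simp add: r_def)
      show ?case
      proof (rule order_tendstoI)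
        fix y :: ennreal assume "0 < y"
        then obtain e where e: "e > 0" "ennreal e \<le> y"
          by (cases y) (auto intro: that[of 1])
        \<comment> \<open>This turns the first term of \<open>bound\<close> into e/2; for fixed
          \<delta> the second tends to 0 with the Sobolev distance.\<close>
        define \<delta> where "\<delta> = e / (2 * (d - c))"
        have \<delta>: "\<delta> > 0" using e cd by (simp add: \<delta>_def)
        have "(\<lambda>n. \<delta> * (d - c) + \<delta> powr (1 - p) * r n powr p) \<longlonglongrightarrow> \<delta> * (d - c) + \<delta> powr (1 - p) * 0 powr p"
          using r0 p by (intro tendsto_intros tendsto_powr2) (auto simp: r_def sobolev_norm_def)
        moreover have "\<delta> * (d - c) = e / 2"
          using cd by (simp add: \<delta>_def field_simps)
        then have "\<delta> * (d - c) + \<delta> powr (1 - p) * 0 powr p < e"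
          using e by simp
        ultimately have "\<forall>\<^sub>F n in sequentially. \<delta> * (d - c) + \<delta> powr (1 - p) * r n powr p < e"
          by (rule order_tendstoD)
        then show "\<forall>\<^sub>F n in sequentially. (\<integral>\<^sup>+x. ennreal \<bar>w n t x - weak_deriv j ?A (v t) x\<bar> \<partial>lebesgue_on ?A) < y"
        proof eventually_elim
          case (elim n)
          then show ?case
            using bound[OF \<delta>, of n] e
            by (meson ennreal_lessI le_less_trans less_le_trans)
        qed
      qed simp
    qed
  qed (use that in blast)
qed

section \<open>Gluing weak derivatives over an exhaustion\<close>

lemma absolutely_integrable_cong_AE:
  fixes f g :: "real \<Rightarrow> real"
  assumes f: "f absolutely_integrable_on K" and eq: "AE x in lebesgue. x \<in> K \<longrightarrow> g x = f x"
  shows "g absolutely_integrable_on K"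
  by (rule absolutely_integrable_spike[OF f AE_imp_negligible[OF eq]]) auto

text \<open>Lebesgue measure is complete, so equality almost everywhere transfers integrability
  without any measurability assumption; if integrability fails, both integrals have the default
  value 0.\<close>

lemma integral_lebesgue_cong_AE:
  fixes f g :: "real \<Rightarrow> real"
  assumes eq: "AE x in lebesgue. g x = f x"
  shows "(LINT x|lebesgue. g x) = (LINT x|lebesgue. f x)"
proof -
  have "f absolutely_integrable_on UNIV \<longleftrightarrow> g absolutely_integrable_on UNIV"
    by (rule absolutely_integrable_spike_eq[OF AE_imp_negligible[OF eq]]) auto
  then have iff: "integrable lebesgue f \<longleftrightarrow> integrable lebesgue g"
    by (simp add: set_integrable_def)
  show ?thesis
  proof (cases "integrable lebesgue f")
    case True
    then show ?thesis using iff eq by (intro integral_cong_AE) auto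
  next
    case False
    then show ?thesis using iff by (simp add: not_integrable_integral_eq)
  qed
qed

lemma set_integral_cong_AE_lebesgue:
  fixes f g h :: "real \<Rightarrow> real"
  assumes eq: "AE x in lebesgue. x \<in> K \<longrightarrow> g x = f x"
  shows "(LINT x:K|lebesgue. g x * h x) = (LINT x:K|lebesgue. f x * h x)"
  unfolding set_lebesgue_integral_def
  by (rule integral_lebesgue_cong_AE) (use eq in \<open>eventually_elim, auto simp: indicator_def\<close>)

text \<open>A compact support lies in a single interval of the exhaustion, where the local identity
  applies; the same holds for the compact sets on which integrability has to be checked.\<close>

lemma has_weak_deriv_exhaust:
  fixes a b :: real and f :: "real \<Rightarrow> real"
  assumes ab: "a < b"
    and cd: "\<And>n. a < c n" "\<And>n. d n < b"
    and exh: "\<And>l r. a < l \<Longrightarrow> r < b \<Longrightarrow> \<exists>n. c n < l \<and> r < d n"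
    and mono: "\<And>m n. m \<le> n \<Longrightarrow> c n \<le> c m \<and> d m \<le> d n"
    and w: "\<And>n. has_weak_deriv k {c n<..<d n} f (G n)"
    and g: "AE x in lebesgue. \<forall>n. x \<in> {c n<..<d n} \<longrightarrow> g x = G n x"
  shows "has_weak_deriv k {a<..<b} f g"
proof -
  have li: "locally_integrable {a<..<b} h" if h: "\<And>n. \<exists>h'. locally_integrable {c n<..<d n} h' \<and> (AE x in lebesgue. x \<in> {c n<..<d n} \<longrightarrow> h x = h' x)" for h :: "real \<Rightarrow> real"
    unfolding locally_integrable_def
  proof (intro allI impI)
    fix K assume K: "compact K \<and> K \<subseteq> {a<..<b}"
    obtain n where n: "K \<subseteq> {c n<..<d n}"
    proof (cases "K = {}")
      case False
      obtain l where l: "l \<in> K" "\<forall>x\<in>K. l \<le> x" using compact_attains_inf[of K] K False by blast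
      obtain r where r: "r \<in> K" "\<forall>x\<in>K. x \<le> r" using compact_attains_sup[of K] K False by blast
      have "a < l" "r < b" using K l(1) r(1) by auto
      then obtain n where "c n < l" "r < d n" using exh by blast
      with l(2) r(2) have "K \<subseteq> {c n<..<d n}" by fastforce
      then show thesis by (rule that)
    qed (use that in blast)
    obtain h' where h': "locally_integrable {c n<..<d n} h'" "AE x in lebesgue. x \<in> {c n<..<d n} \<longrightarrow> h x = h' x"
      using h by blast
    show "h absolutely_integrable_on K"
    proof (rule absolutely_integrable_cong_AE)
      show "h' absolutely_integrable_on K" using h'(1) n K unfolding locally_integrable_def by blast
      show "AE x in lebesgue. x \<in> K \<longrightarrow> h x = h' x"
        using h'(2) by eventually_elim (use n in auto)
    qed
  qed
  have gG: "AE x in lebesgue. x \<in> {c n<..<d n} \<longrightarrow> g x = G n x" for n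
    using g by eventually_elim auto
  show ?thesis
    unfolding has_weak_deriv_def
  proof (intro conjI allI impI)
    show "locally_integrable {a<..<b} f"
      using w by (intro li) (auto simp: has_weak_deriv_def)
    show "locally_integrable {a<..<b} g"
      using w gG by (intro li) (auto simp: has_weak_deriv_def)
    fix \<phi> assume \<phi>: "test_function {a<..<b} \<phi>"
    obtain l r where lr: "a < l" "l < r" "r < b" "\<And>x. \<phi> x \<noteq> 0 \<Longrightarrow> x \<in> {l..r}"
      using test_function_support[OF \<phi> ab] by blast
    obtain n where n: "c n < l" "r < d n" using exh lr by blast
    have "test_function {c n<..<d n} \<phi>"
      using test_function_smooth[OF \<phi>] lr(4) by (rule test_functionI) (use n in auto)
    then have 1: "(LINT x:{c n<..<d n}|lebesgue. f x * (deriv ^^ k) \<phi> x) = (- 1) ^ k * (LINT x:{c n<..<d n}|lebesgue. G n x * \<phi> x)"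
      using w[of n] unfolding has_weak_deriv_def by blast
    have 2: "(LINT x:{a<..<b}|lebesgue. u x * h x) = (LINT x:{c n<..<d n}|lebesgue. u x * h x)"
      if "\<And>x. x \<notin> {l..r} \<Longrightarrow> h x = 0" for u h :: "real \<Rightarrow> real"
    proof (rule set_integral_supported_cong)
      fix x assume "h x \<noteq> 0"
      then have "x \<in> {l..r}" using that by blast
      then show "x \<in> {a<..<b} \<and> x \<in> {c n<..<d n}" using lr(1,3) n by auto
    qed
    have 3: "(deriv ^^ k) \<phi> x = 0" "\<phi> x = 0" if "x \<notin> {l..r}" for x
      using deriv_funpow_zero_outside[OF lr(4) that, where k=k] lr(4)[of x] that by blast+
    show "(LINT x:{a<..<b}|lebesgue. f x * (deriv ^^ k) \<phi> x) = (- 1) ^ k * (LINT x:{a<..<b}|lebesgue. g x * \<phi> x)"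
      using 1 2[of "(deriv ^^ k) \<phi>" f] 2[of \<phi> g] 3 set_integral_cong_AE_lebesgue[OF gG, of n \<phi>] by simp
  qed
qed

lemma has_weak_deriv_subinterval:
  assumes w: "has_weak_deriv k {a<..<b} f g" and cd: "a \<le> c" "d \<le> b"
  shows "has_weak_deriv k {c<..<d} f g"
proof (cases "c < d")
  case True
  have sub: "{c<..<d} \<subseteq> {a<..<b}" using cd by auto
  show ?thesis
    unfolding has_weak_deriv_def
  proof (intro conjI allI impI)
    show "locally_integrable {c<..<d} f" "locally_integrable {c<..<d} g"
      using w sub unfolding has_weak_deriv_def locally_integrable_def by blast+
    fix \<phi> assume \<phi>: "test_function {c<..<d} \<phi>"
    obtain l r where lr: "c < l" "l < r" "r < d" "\<And>x. \<phi> x \<noteq> 0 \<Longrightarrow> x \<in> {l..r}"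
      using test_function_support[OF \<phi> True] by blast
    have 1: "(LINT x:{a<..<b}|lebesgue. f x * (deriv ^^ k) \<phi> x) = (- 1) ^ k * (LINT x:{a<..<b}|lebesgue. g x * \<phi> x)"
      using w test_function_mono[OF \<phi> sub] unfolding has_weak_deriv_def by blast
    have 2: "(LINT x:{a<..<b}|lebesgue. u x * h x) = (LINT x:{c<..<d}|lebesgue. u x * h x)"
      if "\<And>x. x \<notin> {l..r} \<Longrightarrow> h x = 0" for u h :: "real \<Rightarrow> real"
    proof (rule set_integral_supported_cong)
      fix x assume "h x \<noteq> 0"
      then have "x \<in> {l..r}" using that by blast
      then show "x \<in> {a<..<b} \<and> x \<in> {c<..<d}" using lr(1,3) cd by auto
    qed
    have 3: "(deriv ^^ k) \<phi> x = 0" "\<phi> x = 0" if "x \<notin> {l..r}" for x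
      using deriv_funpow_zero_outside[OF lr(4) that, where k=k] lr(4)[of x] that by blast+
    show "(LINT x:{c<..<d}|lebesgue. f x * (deriv ^^ k) \<phi> x) = (- 1) ^ k * (LINT x:{c<..<d}|lebesgue. g x * \<phi> x)"
      using 1 2[of "(deriv ^^ k) \<phi>" f] 2[of \<phi> g] 3 by simp
  qed
qed (auto simp: has_weak_deriv_def locally_integrable_def set_lebesgue_integral_def set_integrable_def)

text \<open>\<open>weak_dx\<close> is a choice, so the content is that a suitable function exists.
  Sobolev regularity is given on smaller intervals only; the jointly measurable derivatives found
  there are glued along an exhaustion.\<close>

lemma weak_dx_props:
  assumes ab: "a < b" and I: "I \<in> lmeasurable" and jk: "j \<le> k" and p: "p \<ge> 1"
    and v: "\<And>c d. a < c \<Longrightarrow> c < d \<Longrightarrow> d < b \<Longrightarrow>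
      bochner_Lp (lebesgue_on I) (sobolev k p {c<..<d}) (sobolev_norm k p {c<..<d}) q v"
  shows "case_prod (weak_dx j I {a<..<b} v) \<in> borel_measurable (lebesgue_on (I \<times> {a<..<b}))"
    and "AE \<tau> in lebesgue_on I. has_weak_deriv j {a<..<b} (v \<tau>) (weak_dx j I {a<..<b} v \<tau>)"
proof -
  \<comment> \<open>With n + 3 in the denominator the margins are at most a third of the length, so
    every interval of the exhaustion is nondegenerate.\<close>
  define c d where "c = (\<lambda>n::nat. a + (b - a) / real (n + 3))" and "d = (\<lambda>n::nat. b - (b - a) / real (n + 3))"
  define A where "A = (\<lambda>n. {c n<..<d n})"
  have cd: "a < c n" "c n < d n" "d n < b" for n
  proof -
    have "(b - a) / real (n + 3) \<le> (b - a) / 3"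
      using ab by (intro divide_left_mono) auto
    moreover have "(b - a) / real (n + 3) > 0" using ab by simp
    ultimately show "a < c n" "c n < d n" "d n < b"
      using ab unfolding c_def d_def by argo+
  qed
  have mono: "c n \<le> c m \<and> d m \<le> d n" if "m \<le> n" for m n
  proof -
    have "(b - a) / real (n + 3) \<le> (b - a) / real (m + 3)"
      using ab that by (intro divide_left_mono) auto
    then show ?thesis by (simp add: c_def d_def)
  qed
  have exh: "\<exists>n. c n < l \<and> r < d n" if "a < l" "r < b" for l r
    using interval_exhaustion[OF that ab] unfolding c_def d_def by blast
  have ex: "\<exists>W. case_prod W \<in> borel_measurable (lebesgue_on I \<Otimes>\<^sub>M lebesgue_on (A n)) \<and>
    (AE t in lebesgue_on I. AE x in lebesgue_on (A n). W t x = weak_deriv j (A n) (v t) x)" for n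
    unfolding A_def using bochner_sobolev_joint_version[OF v[OF cd] I cd(2) jk p, of n] by blast
  define W where "W = (\<lambda>n. SOME W. case_prod W \<in> borel_measurable (lebesgue_on I \<Otimes>\<^sub>M lebesgue_on (A n)) \<and>
    (AE t in lebesgue_on I. AE x in lebesgue_on (A n). W t x = weak_deriv j (A n) (v t) x))"
  have W': "case_prod (W n) \<in> borel_measurable (lebesgue_on I \<Otimes>\<^sub>M lebesgue_on (A n)) \<and>
    (AE t in lebesgue_on I. AE x in lebesgue_on (A n). W n t x = weak_deriv j (A n) (v t) x)" for n
    unfolding W_def by (rule someI_ex[OF ex])
  have W: "case_prod (W n) \<in> borel_measurable (lebesgue_on I \<Otimes>\<^sub>M lebesgue_on (A n))"
    "AE t in lebesgue_on I. AE x in lebesgue_on (A n). W n t x = weak_deriv j (A n) (v t) x" for n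
    using W'[of n] by blast+
  \<comment> \<open>Gluing by the first interval that contains x is a countable case distinction and
    so keeps joint measurability.\<close>
  define N where "N = (\<lambda>x. LEAST n. x \<in> A n)"
  define V where "V = (\<lambda>t x. if x \<in> A (N x) then W (N x) t x else 0)"
  have Imeas: "I \<in> sets lebesgue" using I by (simp add: fmeasurableD)
  have rect: "I \<times> A n \<in> sets (lebesgue :: (real \<times> real) measure)" for n
  proof -
    have "I \<times> A n = (fst -` I \<inter> space (lebesgue :: (real\<times>real) measure)) \<inter> (snd -` A n \<inter> space (lebesgue :: (real\<times>real) measure))"
      by auto
    also have "\<dots> \<in> sets lebesgue"
      using Imeas by (intro sets.Int measurable_sets[OF measurable_fst_lebesgue] measurable_sets[OF measurable_snd_lebesgue])
        (auto simp: A_def)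
    finally show ?thesis .
  qed
  have m1: "(\<lambda>p. indicator (I \<times> A n) p *\<^sub>R case_prod (W n) p) \<in> borel_measurable (lebesgue :: (real\<times>real) measure)" for n
    using measurable_lebesgue_on_pair[OF W(1), of n] rect[of n]
    by (subst (asm) borel_measurable_restrict_space_iff) auto
  have Nm: "(\<lambda>p::real\<times>real. N (snd p)) \<in> measurable lebesgue (count_space UNIV)"
  proof -
    have "N \<in> measurable borel (count_space UNIV)"
      unfolding N_def A_def by measurable
    then have "N \<in> measurable lebesgue (count_space UNIV)"
      by (simp add: measurable_completion)
    from measurable_compose[OF measurable_snd_lebesgue this] show ?thesis .
  qed
  have "(\<lambda>p. indicator (I \<times> A (N (snd p))) p *\<^sub>R case_prod (W (N (snd p))) p) \<in> borel_measurable (lebesgue :: (real\<times>real) measure)"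
    by (rule measurable_compose_countable[OF m1 Nm])
  then have "(\<lambda>p. indicator (I \<times> A (N (snd p))) p *\<^sub>R case_prod (W (N (snd p))) p) \<in> borel_measurable (lebesgue_on (I \<times> {a<..<b}))"
    by (rule measurable_restrict_space1)
  then have Vm: "case_prod V \<in> borel_measurable (lebesgue_on (I \<times> {a<..<b}))"
    by (rule measurable_cong[THEN iffD1, rotated])
       (simp add: V_def space_restrict_space indicator_def split_beta mem_Times_iff)
  have vX: "AE t in lebesgue_on I. v t \<in> sobolev k p (A n)" for n
    using v[OF cd, of n] unfolding bochner_Lp_def A_def by blast
  have "AE t in lebesgue_on I. \<forall>n. v t \<in> sobolev k p (A n)"
    using vX by (subst AE_all_countable) blast
  moreover have "AE t in lebesgue_on I. \<forall>n. AE x in lebesgue_on (A n). W n t x = weak_deriv j (A n) (v t) x"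
    using W(2) by (subst AE_all_countable) blast
  ultimately have wd: "AE t in lebesgue_on I. has_weak_deriv j {a<..<b} (v t) (V t)"
  proof eventually_elim
    case (elim t)
    define G where "G = (\<lambda>n. weak_deriv j (A n) (v t))"
    have G: "has_weak_deriv j {c n<..<d n} (v t) (G n)" for n
      using sobolev_weak_deriv(1)[of "v t" k p "c n" "d n" j] elim(1) jk cd[of n] by (auto simp: G_def A_def)
    have AEW: "AE x in lebesgue. \<forall>n. x \<in> A n \<longrightarrow> W n t x = G n x"
    proof (subst AE_all_countable, rule allI)
      fix n
      have "AE x in lebesgue_on (A n). W n t x = G n x" using elim(2) unfolding G_def by blast
      then show "AE x in lebesgue. x \<in> A n \<longrightarrow> W n t x = G n x"
        by (subst (asm) AE_lebesgue_on) (auto simp: A_def)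
    qed
    \<comment> \<open>The local derivatives were chosen independently; on overlaps they agree by
      uniqueness.\<close>
    have "AE x in lebesgue. \<forall>m. \<forall>n. m \<le> n \<longrightarrow> x \<in> A m \<longrightarrow> G m x = G n x"
      unfolding AE_all_countable
    proof (intro allI)
      fix m n
      show "AE x in lebesgue. m \<le> n \<longrightarrow> x \<in> A m \<longrightarrow> G m x = G n x"
      proof (cases "m \<le> n")
        case True
        have "has_weak_deriv j {c m<..<d m} (v t) (G n)"
          using has_weak_deriv_subinterval[OF G, of n "c m" "d m"] mono[OF True] by blast
        from has_weak_deriv_unique[OF G this cd(2)] show ?thesis
          by eventually_elim (auto simp: A_def)
      qed simp
    qed
    with AEW have "AE x in lebesgue. \<forall>n. x \<in> {c n<..<d n} \<longrightarrow> V t x = G n x"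
    proof eventually_elim
      case (elim x)
      show ?case
      proof (intro allI impI)
        fix n assume "x \<in> {c n<..<d n}"
        then have xn: "x \<in> A n" by (simp add: A_def)
        then have "x \<in> A (N x)" "N x \<le> n" unfolding N_def by (auto intro: LeastI Least_le)
        then show "V t x = G n x" using elim unfolding V_def by simp
      qed
    qed
    from has_weak_deriv_exhaust[where c=c and d=d and G=G and g="V t", OF ab cd(1) cd(3) exh mono G this]
    show ?case .
  qed
  have "case_prod (weak_dx j I {a<..<b} v) \<in> borel_measurable (lebesgue_on (I \<times> {a<..<b})) \<and>
     (AE \<tau> in lebesgue_on I. has_weak_deriv j {a<..<b} (v \<tau>) (weak_dx j I {a<..<b} v \<tau>))"
    unfolding weak_dx_def
    by (rule someI[of "\<lambda>w. case_prod w \<in> borel_measurable (lebesgue_on (I \<times> {a<..<b})) \<and>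
     (AE \<tau> in lebesgue_on I. has_weak_deriv j {a<..<b} (v \<tau>) (w \<tau>))" V]) (use Vm wd in blast)
  then show "case_prod (weak_dx j I {a<..<b} v) \<in> borel_measurable (lebesgue_on (I \<times> {a<..<b}))"
    and "AE \<tau> in lebesgue_on I. has_weak_deriv j {a<..<b} (v \<tau>) (weak_dx j I {a<..<b} v \<tau>)"
    by blast+
qed

section \<open>Continuity of translations in mean\<close>

lemma lborel_integral_shift:
  fixes f :: "'a::euclidean_space \<Rightarrow> real"
  shows "(\<integral>x. f (x + h) \<partial>lborel) = (\<integral>x. f x \<partial>lborel)"
    and "integrable lborel f \<Longrightarrow> integrable lborel (\<lambda>x. f (x + h))"
proof -
  have d: "distr lborel borel (\<lambda>x. h + x) = (lborel :: 'a measure)"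
    using lborel_distr_plus[of h] by simp
  show i: "integrable lborel f \<Longrightarrow> integrable lborel (\<lambda>x. f (x + h))" for f :: "'a \<Rightarrow> real" and h
  proof -
    assume f: "integrable lborel f"
    then have "integrable (distr lborel borel (\<lambda>x. h + x)) f"
      by (simp add: lborel_distr_plus)
    then show ?thesis
      by (subst (asm) integrable_distr_eq) (use f in \<open>auto simp: add.commute dest: borel_measurable_integrable\<close>)
  qed
  show "(\<integral>x. f (x + h) \<partial>lborel) = (\<integral>x. f x \<partial>lborel)"
  proof (cases "f \<in> borel_measurable borel")
    case True
    have "(\<integral>x. f x \<partial>lborel) = (\<integral>x. f x \<partial>distr lborel borel (\<lambda>x. h + x))" by (simp add: d)
    also have "\<dots> = (\<integral>x. f (h + x) \<partial>lborel)"
      using True by (subst integral_distr) auto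
    finally show ?thesis by (simp add: add.commute)
  next
    case False
    then have 1: "\<not> integrable lborel f" by (auto dest: borel_measurable_integrable)
    have "\<not> integrable lborel (\<lambda>x. f (x + h))"
    proof
      assume "integrable lborel (\<lambda>x. f (x + h))"
      from i[OF this, of "- h"] 1 show False by simp
    qed
    with 1 show ?thesis by (simp add: not_integrable_integral_eq)
  qed
qed

text \<open>Openness gives pointwise convergence of the translates only at points of U. That is
  enough: U and its translate have equal measure, so the mass gained outside U equals the mass lost
  inside.\<close>

lemma translation_continuous_open:
  fixes U :: "'a::euclidean_space set"
  assumes U: "open U" "emeasure lborel U < \<infinity>" and h: "h \<longlonglongrightarrow> 0"
  shows "(\<lambda>n. \<integral>x. \<bar>indicator U (x + h n) - indicator U x :: real\<bar> \<partial>lborel) \<longlonglongrightarrow> 0"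
proof -
  have iU: "integrable lborel (indicator U :: 'a \<Rightarrow> real)"
    using U by (intro integrable_real_indicator) auto
  let ?g = "\<lambda>n x. indicator U x * (1 - indicator U (x + h n)) :: real"
  have meas: "?g n \<in> borel_measurable lborel" for n
  proof -
    have [measurable]: "U \<in> sets borel" using U by simp
    show ?thesis by measurable
  qed
  have "(\<lambda>n. \<integral>x. ?g n x \<partial>lborel) \<longlonglongrightarrow> (\<integral>x. 0 \<partial>(lborel::'a measure))"
  proof (rule integral_dominated_convergence[where w="indicator U"])
    show "AE x in lborel. (\<lambda>n. ?g n x) \<longlonglongrightarrow> 0"
    proof (rule AE_I2)
      fix x :: 'a
      show "(\<lambda>n. ?g n x) \<longlonglongrightarrow> 0"
      proof (cases "x \<in> U")
        case True
        have "(\<lambda>n. x + h n) \<longlonglongrightarrow> x + 0" using h by (intro tendsto_intros)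
        then have "\<forall>\<^sub>F n in sequentially. x + h n \<in> U"
          using topological_tendstoD[of _ x sequentially U] U(1) True by simp
        then have "\<forall>\<^sub>F n in sequentially. 0 = ?g n x" by eventually_elim simp
        then show ?thesis by (rule Lim_transform_eventually[OF tendsto_const])
      qed simp
    qed
    show "AE x in lborel. norm (?g n x) \<le> indicator U x" for n
      by (intro AE_I2) (auto simp: indicator_def)
  qed (use iU meas in auto)
  then have lim: "(\<lambda>n. 2 * (\<integral>x. ?g n x \<partial>lborel)) \<longlonglongrightarrow> 0"
    using tendsto_mult_right_zero by force
  have "(\<integral>x. \<bar>indicator U (x + h n) - indicator U x\<bar> \<partial>lborel) = 2 * (\<integral>x. ?g n x \<partial>lborel)" for n
  proof -
    have ig: "integrable lborel (?g n)"
      by (rule Bochner_Integration.integrable_bound[OF iU meas]) (auto simp: indicator_def)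
    note sh = lborel_integral_shift[of "indicator U :: 'a \<Rightarrow> real" "h n"]
    have "(\<integral>x. \<bar>indicator U (x + h n) - indicator U x\<bar> \<partial>lborel)
        = (\<integral>x. 2 * ?g n x + (indicator U (x + h n) - indicator U x) \<partial>lborel)"
      by (intro Bochner_Integration.integral_cong) (auto simp: indicator_def)
    also have "\<dots> = 2 * (\<integral>x. ?g n x \<partial>lborel) + ((\<integral>x. indicator U (x + h n) \<partial>lborel) - (\<integral>x. indicator U x \<partial>lborel))"
      using ig sh(2)[OF iU] iU
      by (subst Bochner_Integration.integral_add) (auto simp del: integral_indicator)
    finally show ?thesis using sh(1) by simp
  qed
  with lim show ?thesis by simp
qed

text \<open>By outer regularity a Borel set is close in measure to an open set, which settles
  indicators; sums and limits follow by the triangle inequality and shift invariance.\<close>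

lemma translation_continuous_L1:
  fixes f :: "'a::euclidean_space \<Rightarrow> real"
  assumes "integrable lborel f" and h: "h \<longlonglongrightarrow> 0"
  shows "(\<lambda>n. \<integral>x. \<bar>f (x + h n) - f x\<bar> \<partial>lborel) \<longlonglongrightarrow> 0"
  using assms(1)
proof (induction f rule: integrable_induct)
  have nn: "0 \<le> (\<integral>x. \<bar>f (x + h n) - f x\<bar> \<partial>lborel)" for f :: "'a \<Rightarrow> real" and n
    by (intro integral_nonneg_AE AE_I2) simp
  note shift = lborel_integral_shift
  {
    case (base A c)
    show ?case
    proof (rule LIMSEQ_I, goal_cases)
      case (1 e)
      \<comment> \<open>The estimate costs three terms of size e', each with the factor
        \<bar>c\<bar>; the 4 makes their sum smaller than e, and the added 1 covers c = 0.\<close>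
      define e' where "e' = e / (4 * (\<bar>c\<bar> + 1))"
      have e': "e' > 0" using 1 by (simp add: e'_def add_pos_nonneg)
      obtain U where U: "open U" "A \<subseteq> U" "emeasure lborel (U - A) < ennreal e'"
        using outer_regular_lborel[of A e'] base e' by auto
      have [measurable]: "A \<in> sets borel" "U \<in> sets borel" using base U by auto
      have fin: "emeasure lborel U < \<infinity>"
      proof -
        have "emeasure lborel U = emeasure lborel A + emeasure lborel (U - A)"
          using U(2) by (subst plus_emeasure) (auto simp: Un_absorb1)
        also have "\<dots> < \<infinity>" using base U(3) by (auto simp: ennreal_add_less_top intro: less_trans)
        finally show ?thesis .
      qed
      have iU: "integrable lborel (indicator U :: 'a \<Rightarrow> real)"
        using fin by (intro integrable_real_indicator) auto
      have iD: "integrable lborel (indicator (U - A) :: 'a \<Rightarrow> real)"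
        using U(3) by (intro integrable_real_indicator) (auto intro: less_trans)
      have mD: "(\<integral>x. indicator (U - A) x \<partial>lborel) < e'"
        using U(3) e' by (simp add: measure_def) (metis enn2real_less_iff less_eq_real_def top.not_eq_extremum less_trans ennreal_less_top)
      have ev: "\<forall>\<^sub>F n in sequentially. (\<integral>x. \<bar>indicator U (x + h n) - indicator U x :: real\<bar> \<partial>lborel) < e'"
        using translation_continuous_open[OF U(1) fin h] e' by (rule order_tendstoD)
      have b: "(\<integral>x. \<bar>indicator A (x + h n) *\<^sub>R c - indicator A x *\<^sub>R c\<bar> \<partial>lborel)
          \<le> \<bar>c\<bar> * ((\<integral>x. \<bar>indicator U (x + h n) - indicator U x :: real\<bar> \<partial>lborel) + 2 * (\<integral>x. indicator (U - A) x \<partial>lborel))" for n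
      proof -
        have i1: "integrable lborel (\<lambda>x. \<bar>indicator U (x + h n) - indicator U x :: real\<bar>)"
          using shift(2)[OF iU, of "h n"] iU by auto
        have i2: "integrable lborel (\<lambda>x. indicator (U - A) (x + h n) :: real)"
          using shift(2)[OF iD, of "h n"] .
        have "(\<integral>x. \<bar>indicator A (x + h n) *\<^sub>R c - indicator A x *\<^sub>R c\<bar> \<partial>lborel)
          \<le> (\<integral>x. \<bar>c\<bar> * (\<bar>indicator U (x + h n) - indicator U x :: real\<bar> + indicator (U - A) (x + h n) + indicator (U - A) x) \<partial>lborel)"
        proof (rule integral_mono')
          show "integrable lborel (\<lambda>x. \<bar>c\<bar> * (\<bar>indicator U (x + h n) - indicator U x :: real\<bar> + indicator (U - A) (x + h n) + indicator (U - A) x))"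
            using i1 i2 iD by (intro integrable_mult_right Bochner_Integration.integrable_add)
          show "\<bar>indicator A (x + h n) *\<^sub>R c - indicator A x *\<^sub>R c\<bar>
            \<le> \<bar>c\<bar> * (\<bar>indicator U (x + h n) - indicator U x :: real\<bar> + indicator (U - A) (x + h n) + indicator (U - A) x)" for x
            using U(2) by (auto simp: indicator_def)
        qed auto
        also have "\<dots> = \<bar>c\<bar> * ((\<integral>x. \<bar>indicator U (x + h n) - indicator U x :: real\<bar> \<partial>lborel) + 2 * (\<integral>x. indicator (U - A) x \<partial>lborel))"
          using i1 i2 iD shift(1)[of "indicator (U - A) :: 'a \<Rightarrow> real" "h n"]
          by (simp del: integral_indicator)
        finally show ?thesis .
      qed
      from ev obtain N where N: "\<And>n. n \<ge> N \<Longrightarrow> (\<integral>x. \<bar>indicator U (x + h n) - indicator U x :: real\<bar> \<partial>lborel) < e'"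
        by (auto simp: eventually_sequentially)
      have "norm ((\<integral>x. \<bar>indicator A (x + h n) *\<^sub>R c - indicator A x *\<^sub>R c\<bar> \<partial>lborel) - 0) < e" if "n \<ge> N" for n
      proof -
        have "(\<integral>x. \<bar>indicator A (x + h n) *\<^sub>R c - indicator A x *\<^sub>R c\<bar> \<partial>lborel) \<le> \<bar>c\<bar> * (e' + 2 * e')"
          using N[OF that] mD b[of n] by (intro order_trans[OF b] mult_left_mono) auto
        also have "\<dots> < e"
        proof -
          have "\<bar>c\<bar> * (e' + 2 * e') = e * (3 * \<bar>c\<bar> / (4 * (\<bar>c\<bar> + 1)))" by (simp add: e'_def)
          also have "3 * \<bar>c\<bar> / (4 * (\<bar>c\<bar> + 1)) < 1" by (subst divide_less_eq) auto
          finally show ?thesis using 1 by simp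
        qed
        finally show ?thesis using nn[of "\<lambda>x. indicator A x *\<^sub>R c" n] by simp
      qed
      then show ?case by blast
    qed
  next
    case (add f g)
    have "(\<lambda>n. (\<integral>x. \<bar>f (x + h n) - f x\<bar> \<partial>lborel) + (\<integral>x. \<bar>g (x + h n) - g x\<bar> \<partial>lborel)) \<longlonglongrightarrow> 0 + 0"
      using add.IH by (intro tendsto_add) auto
    then have lim: "(\<lambda>n. (\<integral>x. \<bar>f (x + h n) - f x\<bar> \<partial>lborel) + (\<integral>x. \<bar>g (x + h n) - g x\<bar> \<partial>lborel)) \<longlonglongrightarrow> 0" by simp
    show ?case
    proof (rule tendsto_sandwich[OF _ _ tendsto_const lim])
      show "\<forall>\<^sub>F n in sequentially. (\<integral>x. \<bar>f (x + h n) + g (x + h n) - (f x + g x)\<bar> \<partial>lborel)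
        \<le> (\<integral>x. \<bar>f (x + h n) - f x\<bar> \<partial>lborel) + (\<integral>x. \<bar>g (x + h n) - g x\<bar> \<partial>lborel)"
      proof (rule always_eventually, rule allI)
        fix n
        have i: "integrable lborel (\<lambda>x. \<bar>f (x + h n) - f x\<bar>)" "integrable lborel (\<lambda>x. \<bar>g (x + h n) - g x\<bar>)"
          using shift(2)[OF add.hyps(1), of "h n"] shift(2)[OF add.hyps(2), of "h n"] add.hyps by auto
        show "(\<integral>x. \<bar>f (x + h n) + g (x + h n) - (f x + g x)\<bar> \<partial>lborel)
        \<le> (\<integral>x. \<bar>f (x + h n) - f x\<bar> \<partial>lborel) + (\<integral>x. \<bar>g (x + h n) - g x\<bar> \<partial>lborel)"
          unfolding Bochner_Integration.integral_add[OF i, symmetric]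
          using i by (intro integral_mono') auto
      qed
    qed (use nn[of "\<lambda>x. f x + g x"] in auto)
  next
    case (lim f s)
    have sf: "(\<lambda>i. \<integral>x. \<bar>s i x - f x\<bar> \<partial>lborel) \<longlonglongrightarrow> (\<integral>x. 0 \<partial>(lborel::'a measure))"
    proof (rule integral_dominated_convergence[where w="\<lambda>x. 3 * \<bar>f x\<bar>"])
      show "AE x in lborel. (\<lambda>i. \<bar>s i x - f x\<bar>) \<longlonglongrightarrow> 0"
        using lim.hyps(2) by (intro AE_I2) (auto simp: LIM_zero_iff tendsto_rabs_zero_iff)
      show "AE x in lborel. norm \<bar>s i x - f x\<bar> \<le> 3 * \<bar>f x\<bar>" for i
      proof (rule AE_I2)
        fix x :: 'a
        have "\<bar>s i x\<bar> \<le> 2 * \<bar>f x\<bar>" using lim.hyps(3)[of x i] by simp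
        then show "norm \<bar>s i x - f x\<bar> \<le> 3 * \<bar>f x\<bar>" by simp
      qed
    qed (use lim.hyps(1,4) in auto)
    show ?case
    proof (rule LIMSEQ_I, goal_cases)
      case (1 e)
      have "\<forall>\<^sub>F i in sequentially. (\<integral>x. \<bar>s i x - f x\<bar> \<partial>lborel) < e / 4"
        using sf 1 by (intro order_tendstoD) auto
      then obtain i where i: "(\<integral>x. \<bar>s i x - f x\<bar> \<partial>lborel) < e / 4"
        using eventually_happens'[OF sequentially_bot] by blast
      have "\<forall>\<^sub>F n in sequentially. (\<integral>x. \<bar>s i (x + h n) - s i x\<bar> \<partial>lborel) < e / 4"
        using lim.IH[of i] 1 by (intro order_tendstoD) auto
      then obtain N where N: "\<And>n. n \<ge> N \<Longrightarrow> (\<integral>x. \<bar>s i (x + h n) - s i x\<bar> \<partial>lborel) < e / 4"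
        by (auto simp: eventually_sequentially)
      have "norm ((\<integral>x. \<bar>f (x + h n) - f x\<bar> \<partial>lborel) - 0) < e" if "n \<ge> N" for n
      proof -
        have i1: "integrable lborel (\<lambda>x. \<bar>s i x - f x\<bar>)" using lim.hyps(1,4) by auto
        have i2: "integrable lborel (\<lambda>x. \<bar>s i (x + h n) - f (x + h n)\<bar>)"
          using shift(2)[OF i1, of "h n"] .
        have i3: "integrable lborel (\<lambda>x. \<bar>s i (x + h n) - s i x\<bar>)"
          using shift(2)[OF lim.hyps(1)[of i], of "h n"] lim.hyps(1)[of i] by auto
        have "(\<integral>x. \<bar>f (x + h n) - f x\<bar> \<partial>lborel)
          \<le> (\<integral>x. \<bar>s i (x + h n) - f (x + h n)\<bar> + \<bar>s i (x + h n) - s i x\<bar> + \<bar>s i x - f x\<bar> \<partial>lborel)"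
          using i1 i2 i3 by (intro integral_mono') auto
        also have "\<dots> = (\<integral>x. \<bar>s i x - f x\<bar> \<partial>lborel) + (\<integral>x. \<bar>s i (x + h n) - s i x\<bar> \<partial>lborel) + (\<integral>x. \<bar>s i x - f x\<bar> \<partial>lborel)"
          using i1 i2 i3 shift(1)[of "\<lambda>x. \<bar>s i x - f x\<bar>" "h n"] by simp
        also have "\<dots> < e" using i N[OF that] 1 by simp
        finally show ?thesis using nn[of f n] by simp
      qed
      then show ?case by blast
    qed
  }
qed

section \<open>Translations in dual pairings\<close>

lemma powr_superadditive:
  fixes x y q :: real
  assumes "x \<ge> 0" "y \<ge> 0" "q \<ge> 1"
  shows "x powr q + y powr q \<le> (x + y) powr q"
proof (cases "x = 0 \<or> y = 0")
  case False
  then have pos: "x > 0" "y > 0" using assms by auto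
  have "x powr q + y powr q = x * x powr (q - 1) + y * y powr (q - 1)"
    using pos by (simp add: powr_mult_base)
  also have "\<dots> \<le> x * (x + y) powr (q - 1) + y * (x + y) powr (q - 1)"
    using pos assms by (intro add_mono mult_left_mono powr_mono2) auto
  also have "\<dots> = (x + y) powr q"
    using pos by (simp add: powr_mult_base flip: distrib_right)
  finally show ?thesis .
qed auto

lemma powr_sum_le:
  fixes x y q :: real
  assumes "x \<ge> 0" "y \<ge> 0" "q \<ge> 0"
  shows "(x + y) powr q \<le> 2 powr q * (x powr q + y powr q)"
proof -
  have "(x + y) powr q \<le> (2 * max x y) powr q"
    using assms by (intro powr_mono2) auto
  also have "\<dots> = 2 powr q * (max x y) powr q"
    using assms by (simp add: powr_mult)
  also have "(max x y) powr q \<le> x powr q + y powr q"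
    by (simp add: max_def)
  finally show ?thesis by simp
qed

text \<open>The signed power sgn x \<bar>x\<bar>^q maps L_q to L_1, and differences of its values
  dominate q-th powers of differences. Thus continuity of translations in L_q reduces to the case of
  L_1.\<close>

lemma powr_diff_le_signed_powr_diff:
  fixes x y q :: real
  assumes "q \<ge> 1"
  shows "\<bar>x - y\<bar> powr q \<le> 2 powr q * \<bar>sgn x * \<bar>x\<bar> powr q - sgn y * \<bar>y\<bar> powr q\<bar>"
proof -
  have mono: "(s - t) powr q \<le> s powr q - t powr q" if "0 \<le> t" "t \<le> s" for s t
    using powr_superadditive[of "s - t" t q] that assms by simp
  have ge1: "2 powr q \<ge> 1" using assms by (simp add: ge_one_powr_ge_zero)
  have scale: "z \<le> 2 powr q * w" if "z \<le> w" "0 \<le> w" for z w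
    using mult_right_mono[OF ge1 that(2)] that by simp
  have nn: "t powr q \<le> s powr q" if "0 \<le> t" "t \<le> s" for s t
    using that assms by (intro powr_mono2) auto
  consider "x \<ge> 0" "y \<ge> 0" "x \<ge> y" | "x \<ge> 0" "y \<ge> 0" "x \<le> y" | "x \<le> 0" "y \<le> 0" "x \<ge> y" | "x \<le> 0" "y \<le> 0" "x \<le> y"
    | "x > 0" "y < 0" | "x < 0" "y > 0" by linarith
  then show ?thesis
  proof cases
    case 1
    then show ?thesis using scale[OF mono[of y x]] nn[of y x] by (cases "y = 0"; cases "x = 0") auto
  next
    case 2
    then show ?thesis using scale[OF mono[of x y]] nn[of x y] by (cases "y = 0"; cases "x = 0") auto
  next
    case 3
    then show ?thesis using scale[OF mono[of "-x" "-y"]] nn[of "-x" "-y"] by (cases "y = 0"; cases "x = 0") auto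
  next
    case 4
    then show ?thesis using scale[OF mono[of "-y" "-x"]] nn[of "-y" "-x"] by (cases "y = 0"; cases "x = 0") auto
  next
    case 5
    then show ?thesis using powr_sum_le[of x "-y" q] assms by auto
  next
    case 6
    then have "\<bar>sgn x * \<bar>x\<bar> powr q - sgn y * \<bar>y\<bar> powr q\<bar> = (-x) powr q + y powr q"
      by (simp, smt (verit) powr_ge_zero)
    moreover have "\<bar>x - y\<bar> = -x + y" using 6 by simp
    ultimately show ?thesis using powr_sum_le[of "-x" y q] 6 assms by simp
  qed
qed

text \<open>The free factor \<open>lam\<close> shifts weight between the two factors, so that the
  contribution of one can be made small at the expense of the other.\<close>

lemma young_scaled:
  fixes s t lam p q :: real
  assumes "p > 1" "q > 1" "1/p + 1/q = 1" "s \<ge> 0" "t \<ge> 0" "lam > 0"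
  shows "s * t \<le> (s / lam) powr q + (lam * t) powr p"
proof -
  have "s * t = (s / lam) * (lam * t)" using assms by simp
  also have "\<dots> \<le> (s / lam) powr q / q + (lam * t) powr p / p"
    using assms by (intro Youngs_inequality) (auto simp: add.commute)
  also have "\<dots> \<le> (s / lam) powr q + (lam * t) powr p"
  proof -
    have "z / r \<le> z" if "r > 1" "z \<ge> 0" for r z :: real
      using that by (simp add: divide_le_eq mult_le_cancel_left1)
    then show ?thesis using assms by (intro add_mono) auto
  qed
  finally show ?thesis .
qed

text \<open>A small \<open>lam\<close> in Young's inequality makes the contribution of
  \<open>G\<close> small; with \<open>lam\<close> fixed, the other contribution vanishes with the
  shift, by L_1 continuity for the signed power of \<open>F\<close>.\<close>

lemma translation_continuous_pairing:
  fixes F G :: "'a::euclidean_space \<Rightarrow> real"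
  assumes [measurable]: "F \<in> borel_measurable borel" "G \<in> borel_measurable borel"
    and pq: "p > 1" "q > 1" "1/p + 1/q = 1"
    and F: "integrable lborel (\<lambda>x. \<bar>F x\<bar> powr q)" and G: "integrable lborel (\<lambda>x. \<bar>G x\<bar> powr p)"
  shows "integrable lborel (\<lambda>x. \<bar>F (x + h) - F x\<bar> * \<bar>G x\<bar>)"
    and "e > 0 \<Longrightarrow> \<exists>\<delta>>0. \<forall>h. norm h < \<delta> \<longrightarrow> (\<integral>x. \<bar>F (x + h) - F x\<bar> * \<bar>G x\<bar> \<partial>lborel) < e"
proof -
  let ?\<Phi> = "\<lambda>x. sgn (F x) * \<bar>F x\<bar> powr q"
  have \<Phi>: "integrable lborel ?\<Phi>"
    by (rule Bochner_Integration.integrable_bound[OF F]) (auto simp: abs_mult abs_sgn_eq)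
  have i\<Phi>: "integrable lborel (\<lambda>x. \<bar>?\<Phi> (x + h) - ?\<Phi> x\<bar>)" for h
    using lborel_integral_shift(2)[OF \<Phi>, of h] \<Phi> by (intro integrable_abs Bochner_Integration.integrable_diff)
  have bound: "\<bar>F (x + h) - F x\<bar> * \<bar>G x\<bar> \<le> (2 / lam) powr q * \<bar>?\<Phi> (x + h) - ?\<Phi> x\<bar> + lam powr p * \<bar>G x\<bar> powr p"
    if "lam > 0" for lam x h
  proof -
    have "\<bar>F (x + h) - F x\<bar> * \<bar>G x\<bar> \<le> (\<bar>F (x + h) - F x\<bar> / lam) powr q + (lam * \<bar>G x\<bar>) powr p"
      using pq that by (intro young_scaled) auto
    also have "\<dots> = \<bar>F (x + h) - F x\<bar> powr q / lam powr q + lam powr p * \<bar>G x\<bar> powr p"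
      using that by (simp add: powr_mult powr_divide)
    also have "\<dots> \<le> (2 powr q * \<bar>?\<Phi> (x + h) - ?\<Phi> x\<bar>) / lam powr q + lam powr p * \<bar>G x\<bar> powr p"
      using powr_diff_le_signed_powr_diff[of q "F (x + h)" "F x"] pq
      by (intro add_right_mono divide_right_mono) auto
    finally show ?thesis using that by (simp add: powr_divide)
  qed
  have ib: "integrable lborel (\<lambda>x. (2 / lam) powr q * \<bar>?\<Phi> (x + h) - ?\<Phi> x\<bar> + lam powr p * \<bar>G x\<bar> powr p)" for lam h
    using i\<Phi> G by (intro Bochner_Integration.integrable_add integrable_mult_right)
  show "integrable lborel (\<lambda>x. \<bar>F (x + h) - F x\<bar> * \<bar>G x\<bar>)" for h
  proof (rule Bochner_Integration.integrable_bound[OF ib[of 1 h]])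
    show "AE x in lborel. norm (\<bar>F (x + h) - F x\<bar> * \<bar>G x\<bar>)
      \<le> norm ((2 / 1) powr q * \<bar>?\<Phi> (x + h) - ?\<Phi> x\<bar> + 1 powr p * \<bar>G x\<bar> powr p)"
      using bound[of 1 _ h] by (intro AE_I2) (simp add: abs_mult order_trans[OF _ abs_ge_self])
  qed simp
  show "\<exists>\<delta>>0. \<forall>h. norm h < \<delta> \<longrightarrow> (\<integral>x. \<bar>F (x + h) - F x\<bar> * \<bar>G x\<bar> \<partial>lborel) < e" if e: "e > 0"
  proof -
    define IG where "IG = (\<integral>x. \<bar>G x\<bar> powr p \<partial>lborel)"
    have IG: "IG \<ge> 0" unfolding IG_def by (intro integral_nonneg_AE AE_I2) simp
    \<comment> \<open>Chosen such that the contribution of \<open>G\<close> is at most e/2; the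
      added 1 covers a vanishing integral.\<close>
    define lam where "lam = (e / (2 * (IG + 1))) powr (1 / p)"
    have lam: "lam > 0" using e IG by (simp add: lam_def)
    have lp: "lam powr p * IG < e / 2 \<or> IG = 0 \<or> lam powr p * IG \<le> e / 2"
    proof -
      have "lam powr p = e / (2 * (IG + 1))" using e IG pq by (simp add: lam_def powr_powr)
      then have "lam powr p * IG = (e / 2) * (IG / (IG + 1))" by (simp add: field_simps)
      also have "\<dots> \<le> (e / 2) * 1" using e IG by (intro mult_left_mono) auto
      finally show ?thesis by simp
    qed
    have "((\<lambda>h. \<integral>x. \<bar>?\<Phi> (x + h) - ?\<Phi> x\<bar> \<partial>lborel) \<longlongrightarrow> 0) (at 0)"
      unfolding tendsto_at_iff_sequentially using translation_continuous_L1[OF \<Phi>] by (simp add: o_def)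
    moreover have "e / 2 / ((2 / lam) powr q) > 0" using e lam by simp
    ultimately have "\<forall>\<^sub>F h in at 0. (\<integral>x. \<bar>?\<Phi> (x + h) - ?\<Phi> x\<bar> \<partial>lborel) < e / 2 / ((2 / lam) powr q)"
      by (rule order_tendstoD)
    then obtain \<delta> where \<delta>: "\<delta> > 0" "\<And>h. h \<noteq> 0 \<Longrightarrow> norm h < \<delta> \<Longrightarrow>
       (\<integral>x. \<bar>?\<Phi> (x + h) - ?\<Phi> x\<bar> \<partial>lborel) < e / 2 / ((2 / lam) powr q)"
      unfolding eventually_at by (auto simp: dist_norm)
    have "(\<integral>x. \<bar>F (x + h) - F x\<bar> * \<bar>G x\<bar> \<partial>lborel) < e" if "norm h < \<delta>" for h
    proof -
      have 1: "(\<integral>x. \<bar>?\<Phi> (x + h) - ?\<Phi> x\<bar> \<partial>lborel) < e / 2 / ((2 / lam) powr q)"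
        using \<delta>(2)[OF _ that] e lam by (cases "h = 0") auto
      have "(\<integral>x. \<bar>F (x + h) - F x\<bar> * \<bar>G x\<bar> \<partial>lborel)
         \<le> (\<integral>x. (2 / lam) powr q * \<bar>?\<Phi> (x + h) - ?\<Phi> x\<bar> + lam powr p * \<bar>G x\<bar> powr p \<partial>lborel)"
        using bound[OF lam] by (intro integral_mono'[OF ib]) auto
      also have "\<dots> = (2 / lam) powr q * (\<integral>x. \<bar>?\<Phi> (x + h) - ?\<Phi> x\<bar> \<partial>lborel) + lam powr p * IG"
        using i\<Phi> G unfolding IG_def by (subst Bochner_Integration.integral_add) auto
      also have "(2 / lam) powr q * (\<integral>x. \<bar>?\<Phi> (x + h) - ?\<Phi> x\<bar> \<partial>lborel) < e / 2"
        using 1 lam by (simp add: field_simps)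
      also have "e / 2 + lam powr p * IG \<le> e" using lp e by auto
      finally show ?thesis by simp
    qed
    with \<delta>(1) show ?thesis by blast
  qed
qed

section \<open>Interpolation and coercivity at a fixed time\<close>

lemma primitive_increment_bound:
  assumes f: "primitive c d f g" and "c \<le> x" "x \<le> y" "y \<le> d"
    and M: "\<And>z. z \<in> {x..y} \<Longrightarrow> \<bar>g z\<bar> \<le> M" and M0: "M \<ge> 0"
  shows "\<bar>f y - f x\<bar> \<le> M * (y - x)"
proof -
  have "g integrable_on {x..y}"
    using primitive_abs_integrable[OF primitive_subset[OF f assms(2,4)]]
    by (rule set_lebesgue_integral_eq_integral(1))
  then have "(g has_integral (f y - f x)) (cbox x y)"
    unfolding primitive_diff[OF f assms(2-4)] by (simp add: integrable_integral)
  from has_integral_bound[OF M0 this] M assms(3) show ?thesis by simp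
qed

text \<open>Taylor's formula at \<open>x + l/2\<close> and \<open>x + l\<close>, solved for the first and second derivatives.\<close>

lemma pointwise_interpolation:
  assumes p0: "primitive c d f0 f1" and p1: "primitive c d f1 f2" and p2: "primitive c d f2 f3"
    and x: "c \<le> x" "x + l \<le> d" "l > 0"
    and f0: "\<And>y. y \<in> {c..d} \<Longrightarrow> \<bar>f0 y\<bar> \<le> 1"
    and T: "T = integral {x..x + l} (\<lambda>y. \<bar>f3 y\<bar>)"
  shows "\<bar>f2 x\<bar> \<le> 16 / l\<^sup>2 + 6 * T" "\<bar>f1 x\<bar> \<le> 10 / l + 4 * l * T"
proof -
  have f3i: "f3 absolutely_integrable_on {x..x+l}"
    using primitive_abs_integrable[OF primitive_subset[OF p2]] x by auto
  then have f3n: "(\<lambda>y. \<bar>f3 y\<bar>) integrable_on {x..x+l}" "f3 integrable_on {x..x+l}"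
    using set_lebesgue_integral_eq_integral(1)[OF set_integrable_abs[OF f3i]]
      set_lebesgue_integral_eq_integral(1)[OF f3i] by auto
  have T0: "T \<ge> 0" unfolding T by (intro integral_nonneg f3n) auto
  have b2: "\<bar>f2 y - f2 x\<bar> \<le> T" if "y \<in> {x..x+l}" for y
  proof -
    have sub: "{x..y} \<subseteq> {x..x+l}" using that by auto
    have "\<bar>f2 y - f2 x\<bar> = \<bar>integral {x..y} f3\<bar>"
      using primitive_diff[OF p2, of x y] x that by auto
    also have "\<dots> \<le> integral {x..y} (\<lambda>y. \<bar>f3 y\<bar>)"
      using integral_norm_bound_integral[of f3 "{x..y}" "\<lambda>y. \<bar>f3 y\<bar>"]
        integrable_on_subinterval[OF f3n(1) sub] integrable_on_subinterval[OF f3n(2) sub] by simp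
    also have "\<dots> \<le> T" unfolding T
      by (intro integral_subset_le sub integrable_on_subinterval[OF f3n(1)] f3n) auto
    finally show ?thesis .
  qed
  have q1: "primitive c d (\<lambda>z. f1 z + (- f2 x) * z) (\<lambda>z. f2 z + (- f2 x) * 1)"
    by (intro primitive_add p1 primitive_cmult primitive_C1) (auto intro!: derivative_eq_intros)
  have b1: "\<bar>f1 y - f1 x - f2 x * (y - x)\<bar> \<le> T * (y - x)" if "y \<in> {x..x+l}" for y
  proof -
    have "\<bar>(f1 y + (- f2 x) * y) - (f1 x + (- f2 x) * x)\<bar> \<le> T * (y - x)"
      using b2 that x T0 by (intro primitive_increment_bound[OF q1]) auto
    then show ?thesis by (simp add: algebra_simps)
  qed
  have q0: "primitive c d (\<lambda>z. f0 z + (- 1) * (f1 x * z + f2 x * (z - x)\<^sup>2 / 2)) (\<lambda>z. f1 z + (- 1) * (f1 x + f2 x * (z - x)))"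
    by (intro primitive_add p0 primitive_cmult primitive_C1) (auto intro!: derivative_eq_intros continuous_intros)
  have b0: "\<bar>f0 y - f0 x - f1 x * (y - x) - f2 x * (y - x)\<^sup>2 / 2\<bar> \<le> T * (y - x)\<^sup>2" if y: "y \<in> {x..x+l}" for y
  proof -
    have "\<bar>f1 z + (- 1) * (f1 x + f2 x * (z - x))\<bar> \<le> T * (y - x)" if "z \<in> {x..y}" for z
    proof -
      have "\<bar>f1 z - f1 x - f2 x * (z - x)\<bar> \<le> T * (z - x)" using that y by (intro b1) auto
      also have "\<dots> \<le> T * (y - x)" using that T0 by (intro mult_left_mono) auto
      finally show ?thesis by (simp add: algebra_simps)
    qed
    then have "\<bar>(f0 y + (- 1) * (f1 x * y + f2 x * (y - x)\<^sup>2 / 2)) - (f0 x + (- 1) * (f1 x * x + f2 x * (x - x)\<^sup>2 / 2))\<bar> \<le> T * (y - x) * (y - x)"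
      using y x T0 by (intro primitive_increment_bound[OF q0]) auto
    moreover have "(f0 y + (- 1) * (f1 x * y + f2 x * (y - x)\<^sup>2 / 2)) - (f0 x + (- 1) * (f1 x * x + f2 x * (x - x)\<^sup>2 / 2))
        = f0 y - f0 x - f1 x * (y - x) - f2 x * (y - x)\<^sup>2 / 2"
      by (simp add: algebra_simps)
    ultimately show ?thesis by (simp only: power2_eq_square mult.assoc)
  qed
  define a where "a = f0 (x + l) - f0 x - f1 x * l - f2 x * l\<^sup>2 / 2"
  define b where "b = f0 (x + l / 2) - f0 x - f1 x * (l / 2) - f2 x * (l / 2)\<^sup>2 / 2"
  have a: "\<bar>a\<bar> \<le> T * l\<^sup>2" using b0[of "x + l"] x by (simp add: a_def)
  have b: "\<bar>b\<bar> \<le> T * (l / 2)\<^sup>2" using b0[of "x + l / 2"] x by (simp add: b_def)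
  have v: "\<bar>f0 (x + l)\<bar> \<le> 1" "\<bar>f0 (x + l / 2)\<bar> \<le> 1" "\<bar>f0 x\<bar> \<le> 1" using x by (auto intro!: f0)
  \<comment> \<open>The second difference at x, x + l/2 and x + l eliminates the first derivative.
    Its three values contribute at most 4 and the remainders T l^2 (1 + 1/2); multiplication by 4
    gives the 16 and the 6.\<close>
  have "f2 x * l\<^sup>2 / 4 = f0 (x + l) - 2 * f0 (x + l / 2) + f0 x - a + 2 * b"
    by (simp add: a_def b_def field_simps power2_eq_square)
  then have e2: "\<bar>f2 x * l\<^sup>2\<bar> \<le> 16 + 6 * T * l\<^sup>2"
    using a b v by (simp add: power2_eq_square)
  then have "\<bar>f2 x\<bar> * l\<^sup>2 \<le> 16 + 6 * T * l\<^sup>2" by (simp add: abs_mult)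
  then show "\<bar>f2 x\<bar> \<le> 16 / l\<^sup>2 + 6 * T" using x by (simp add: field_simps)
  have "f1 x * l = f0 (x + l) - f0 x - f2 x * l\<^sup>2 / 2 - a" by (simp add: a_def)
  then have "\<bar>f1 x * l\<bar> \<le> 10 + 4 * T * l\<^sup>2" using a v e2 by linarith
  then have "\<bar>f1 x\<bar> * l \<le> 10 + 4 * T * l\<^sup>2" using x by (simp add: abs_mult)
  then show "\<bar>f1 x\<bar> \<le> 10 / l + 4 * l * T" using x by (simp add: field_simps power2_eq_square)
qed

text \<open>Jensen's inequality up to the factor 2^p: the bound of \<open>le_add_powr\<close> is
  integrated with a constant threshold t instead of invoking convexity.\<close>

lemma integral_powr_le_powr_integral:
  fixes w :: "real \<Rightarrow> real"
  assumes l: "l > 0" and p: "p > 1"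
    and w: "(\<lambda>y. \<bar>w y\<bar>) integrable_on {x..x+l}" and wp: "(\<lambda>y. \<bar>w y\<bar> powr p) integrable_on {x..x+l}"
  defines "T \<equiv> integral {x..x+l} (\<lambda>y. \<bar>w y\<bar>)" and "A \<equiv> integral {x..x+l} (\<lambda>y. \<bar>w y\<bar> powr p)"
  shows "T powr p \<le> 2 powr p * (l powr (p - 1) * A)"
proof -
  have T0: "T \<ge> 0" and A0: "A \<ge> 0"
    unfolding T_def A_def by (auto intro!: integral_nonneg w wp)
  have le: "T \<le> l * t + t powr (1 - p) * A" if t: "t > 0" for t
  proof -
    have "T \<le> integral {x..x+l} (\<lambda>y. t + t powr (1 - p) * \<bar>w y\<bar> powr p)"
      unfolding T_def using t p le_add_powr[OF t, of p] by (intro integral_le w integrable_add integrable_on_mult_right wp) auto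
    also have "\<dots> = l * t + t powr (1 - p) * A"
      unfolding A_def using l wp by (subst Henstock_Kurzweil_Integration.integral_add) (auto intro: integrable_on_mult_right)
    finally show ?thesis .
  qed
  show ?thesis
  proof (cases "A = 0")
    case True
    have "T \<le> 0"
    proof (rule field_le_epsilon)
      fix e :: real assume "e > 0"
      then show "T \<le> 0 + e" using le[of "e / l"] l True by simp
    qed
    with T0 True show ?thesis by simp
  next
    case False
    \<comment> \<open>This threshold makes the two terms l t and t^(1-p) A equal, which is the
      origin of the factor 2.\<close>
    define t where "t = (A / l) powr (1 / p)"
    have t: "t > 0" using False A0 l by (simp add: t_def)
    have "t powr p = A / l" using False A0 l p by (simp add: t_def powr_powr)
    then have "t powr (1 - p) * A = t * l"
      using t l False A0 by (simp add: powr_diff field_simps)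
    then have "T \<le> 2 * (l * t)" using le[OF t] by simp
    then have "T powr p \<le> (2 * (l * t)) powr p" using T0 p by (intro powr_mono2) auto
    also have "\<dots> = 2 powr p * (l powr p * (A / l))"
      using l t \<open>t powr p = A / l\<close> by (simp add: powr_mult)
    also have "\<dots> = 2 powr p * (l powr (p - 1) * A)"
      using l by (simp add: powr_diff)
    finally show ?thesis .
  qed
qed

section \<open>The spatial cutoff and weighted interpolation\<close>

text \<open>The function \<chi> of the overview. Near its zeros it is comparable to the distance to
  them, so that the room left for a step to the right can be measured by \<chi> itself.\<close>

definition parab :: "real \<Rightarrow> real \<Rightarrow> real \<Rightarrow> real" where
  "parab \<kappa> x0 x = 1 - ((x - x0) / (2 * \<kappa>))\<^sup>2"

lemma parab_pos_iff:
  assumes "\<kappa> > 0" shows "parab \<kappa> x0 x > 0 \<longleftrightarrow> x \<in> {x0 - 2 * \<kappa><..<x0 + 2 * \<kappa>}"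
proof -
  have "parab \<kappa> x0 x > 0 \<longleftrightarrow> \<bar>(x - x0) / (2 * \<kappa>)\<bar> < 1"
    unfolding parab_def using abs_square_less_1[of "(x - x0) / (2 * \<kappa>)"] by simp
  also have "\<dots> \<longleftrightarrow> \<bar>x - x0\<bar> < 2 * \<kappa>" using assms by (simp add: abs_divide)
  finally show ?thesis by auto
qed

lemma parab_nonneg:
  assumes "\<kappa> > 0" "x \<in> {x0 - 2 * \<kappa>..x0 + 2 * \<kappa>}" shows "parab \<kappa> x0 x \<ge> 0"
proof -
  have "\<bar>(x - x0) / (2 * \<kappa>)\<bar> \<le> 1" using assms by (auto simp: abs_divide)
  then show ?thesis unfolding parab_def using abs_square_le_1[of "(x - x0) / (2 * \<kappa>)"] by simp
qed

lemma parab_le_1: "parab \<kappa> x0 x \<le> 1"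
  by (simp add: parab_def)

text \<open>The step length \<open>s \<chi>(x)\<^sup>2\<close> keeps the interval inside the support of \<open>\<chi>\<close>, and the
  exponent 2 makes all powers of \<open>\<chi>\<close> that occur in the interpolation inequality nonnegative.\<close>

lemma parab_step:
  assumes \<kappa>: "\<kappa> > 0" and x: "x \<in> {x0 - 2 * \<kappa><..<x0 + 2 * \<kappa>}"
    and s: "0 < s" "s \<le> \<kappa> / 2" and y: "y \<in> {x..x + s * (parab \<kappa> x0 x)\<^sup>2}"
  shows "y \<in> {x0 - 2 * \<kappa>..x0 + 2 * \<kappa>}" "parab \<kappa> x0 y \<ge> parab \<kappa> x0 x / 2"
proof -
  define X where "X = parab \<kappa> x0 x"
  define u v where "u = (x - x0) / (2 * \<kappa>)" and "v = (y - x0) / (2 * \<kappa>)"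
  have X: "0 < X" "X \<le> 1" using parab_pos_iff[OF \<kappa>] x parab_le_1 by (auto simp: X_def)
  have u: "-1 < u" "u < 1" using x \<kappa> by (auto simp: u_def field_simps)
  have Xu: "X = (1 - u) * (1 + u)" by (simp add: X_def parab_def u_def algebra_simps power2_eq_square)
  have "X\<^sup>2 \<le> X" using X by (simp add: power2_eq_square mult_left_le)
  have "y - x \<le> s * X\<^sup>2" using y by (simp add: X_def)
  also have "\<dots> \<le> (\<kappa> / 2) * X" using s X \<open>X\<^sup>2 \<le> X\<close> by (intro mult_mono) auto
  finally have yx: "y - x \<le> \<kappa> / 2 * X" .
  have vu: "u \<le> v" "v - u \<le> X / 4"
    using y yx \<kappa> by (auto simp: u_def v_def field_simps)
  \<comment> \<open>\<chi> is at most twice the normalised distance 1 - u to the right end of the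
    support, so a normalised step of at most \<chi>/4 stays inside.\<close>
  have "X \<le> 2 * (1 - u)" unfolding Xu using u by (intro order_trans[OF mult_left_mono[of "1 + u" 2 "1 - u"]]) auto
  then have "X / 4 \<le> (1 - u) / 2" by simp
  with vu(2) have "v \<le> u + (1 - u) / 2" by argo
  moreover have "u + (1 - u) / 2 \<le> 1" using u(2) by (simp add: field_simps)
  ultimately have v1: "v \<le> 1" by simp
  then show "y \<in> {x0 - 2 * \<kappa>..x0 + 2 * \<kappa>}"
    using vu u \<kappa> by (auto simp: u_def v_def field_simps)
  have "v\<^sup>2 - u\<^sup>2 = (v - u) * (v + u)" by (simp add: power2_eq_square algebra_simps)
  also have "\<dots> \<le> (v - u) * 2" using vu v1 u by (intro mult_left_mono) auto
  also have "\<dots> \<le> X / 2" using vu by simp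
  finally show "parab \<kappa> x0 y \<ge> parab \<kappa> x0 x / 2"
    unfolding X_def parab_def u_def v_def by simp
qed

lemma powr_ge_exponent:
  fixes X :: real
  assumes "0 < X" "X \<le> 1" "r \<ge> 0" shows "X powr r \<le> 1"
  using assms by (simp add: powr_le1)

text \<open>The lower order derivatives are weighted by powers of the cutoff function as they occur next
  to the derivatives of \<open>\<chi>\<^sup>m\<close>.\<close>

lemma weighted_interpolation:
  fixes m :: nat
  assumes p: "p \<ge> 2" and m: "real m \<ge> 5 * p" and \<kappa>: "\<kappa> > 0" and s: "0 < s" "s \<le> \<kappa> / 2"
    and p0: "primitive (x0 - 2 * \<kappa>) (x0 + 2 * \<kappa>) f0 f1"
    and p1: "primitive (x0 - 2 * \<kappa>) (x0 + 2 * \<kappa>) f1 f2"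
    and p2: "primitive (x0 - 2 * \<kappa>) (x0 + 2 * \<kappa>) f2 f3"
    and f0: "\<And>y. y \<in> {x0 - 2 * \<kappa>..x0 + 2 * \<kappa>} \<Longrightarrow> \<bar>f0 y\<bar> \<le> 1"
    and f3: "(\<lambda>y. \<bar>f3 y\<bar> powr p) integrable_on {x0 - 2 * \<kappa>..x0 + 2 * \<kappa>}"
    and x: "x \<in> {x0 - 2 * \<kappa><..<x0 + 2 * \<kappa>}"
  defines "E \<equiv> integral {x0 - 2 * \<kappa>..x0 + 2 * \<kappa>} (\<lambda>y. parab \<kappa> x0 y ^ m * \<bar>f3 y\<bar> powr p)"
  shows "parab \<kappa> x0 x ^ m * (\<bar>f2 x\<bar> / parab \<kappa> x0 x) powr p
      \<le> 32 powr p * s powr (- 2 * p) + 24 powr p * 2 ^ m * s powr (p - 1) * E" (is ?T2)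
    and "parab \<kappa> x0 x ^ m * (\<bar>f1 x\<bar> / (parab \<kappa> x0 x)\<^sup>2) powr p
      \<le> 20 powr p * s powr (- p) + 16 powr p * 2 ^ m * s powr (2 * p - 1) * E" (is ?T1)
    and "E \<ge> 0"
proof -
  let ?c = "x0 - 2 * \<kappa>" and ?d = "x0 + 2 * \<kappa>"
  define X where "X = parab \<kappa> x0 x"
  define l where "l = s * X\<^sup>2"
  have X: "0 < X" "X \<le> 1" using parab_pos_iff[OF \<kappa>] x parab_le_1 by (auto simp: X_def)
  have l: "l > 0" using s X by (simp add: l_def)
  note step = parab_step[OF \<kappa> x s, folded X_def, folded l_def]
  have xl: "?c \<le> x" "x + l \<le> ?d" using x step(1)[of "x + l"] l by auto
  have sub: "{x..x+l} \<subseteq> {?c..?d}" using xl by auto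
  define T where "T = integral {x..x + l} (\<lambda>y. \<bar>f3 y\<bar>)"
  define A where "A = integral {x..x + l} (\<lambda>y. \<bar>f3 y\<bar> powr p)"
  have f3i: "f3 absolutely_integrable_on {?c..?d}" using primitive_abs_integrable[OF p2] .
  have f3n: "(\<lambda>y. \<bar>f3 y\<bar>) integrable_on {x..x+l}"
    using set_lebesgue_integral_eq_integral(1)[OF set_integrable_abs[OF f3i]] sub
    by (rule integrable_on_subinterval)
  have f3p: "(\<lambda>y. \<bar>f3 y\<bar> powr p) integrable_on {x..x+l}"
    using f3 sub by (rule integrable_on_subinterval)
  have Ei: "(\<lambda>y. parab \<kappa> x0 y ^ m * \<bar>f3 y\<bar> powr p) integrable_on {?c..?d}"
  proof -
    have "(\<lambda>y. \<bar>f3 y\<bar> powr p) absolutely_integrable_on {?c..?d}"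
      using f3 by (intro nonnegative_absolutely_integrable_1) auto
    moreover have "continuous_on {?c..?d} (\<lambda>y. parab \<kappa> x0 y ^ m)"
      unfolding parab_def using \<kappa> by (intro continuous_intros) auto
    ultimately have "(\<lambda>y. \<bar>f3 y\<bar> powr p * parab \<kappa> x0 y ^ m) absolutely_integrable_on {?c..?d}"
      by (rule absolutely_integrable_mult_continuous)
    then show ?thesis by (simp add: mult.commute set_lebesgue_integral_eq_integral(1))
  qed
  have nn: "0 \<le> parab \<kappa> x0 y ^ m * \<bar>f3 y\<bar> powr p" if "y \<in> {?c..?d}" for y
    using parab_nonneg[OF \<kappa> that] by simp
  show E0: "E \<ge> 0" unfolding E_def using Ei nn by (intro integral_nonneg) auto
  have T0: "T \<ge> 0" unfolding T_def by (intro integral_nonneg f3n) auto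
  \<comment> \<open>Along the step \<chi> is at least half its value at x, so the unweighted
    integral over the step is bounded by the weighted energy \<open>E\<close> at the cost of
    (2/\<chi>)^m.\<close>
  have AE: "(X / 2) ^ m * A \<le> E"
  proof -
    have "(X / 2) ^ m * A = integral {x..x+l} (\<lambda>y. (X / 2) ^ m * \<bar>f3 y\<bar> powr p)"
      by (simp add: A_def)
    also have "\<dots> \<le> integral {x..x+l} (\<lambda>y. parab \<kappa> x0 y ^ m * \<bar>f3 y\<bar> powr p)"
    proof (rule integral_le)
      show "(\<lambda>y. parab \<kappa> x0 y ^ m * \<bar>f3 y\<bar> powr p) integrable_on {x..x+l}"
        using Ei sub by (rule integrable_on_subinterval)
      show "(X / 2) ^ m * \<bar>f3 y\<bar> powr p \<le> parab \<kappa> x0 y ^ m * \<bar>f3 y\<bar> powr p" if "y \<in> {x..x+l}" for y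
        using step(2)[OF that] X by (intro mult_right_mono power_mono) auto
    qed (intro integrable_on_mult_right f3p)
    also have "\<dots> \<le> E"
      unfolding E_def using nn by (intro integral_subset_le sub Ei integrable_on_subinterval[OF Ei sub]) auto
    finally show ?thesis .
  qed
  have A: "A \<le> 2 ^ m * X powr (- real m) * E"
    using AE X by (simp add: powr_minus powr_realpow field_simps)
  have Tp: "T powr p \<le> 2 powr p * 2 ^ m * l powr (p - 1) * X powr (- real m) * E"
  proof -
    have "T powr p \<le> 2 powr p * (l powr (p - 1) * A)"
      unfolding T_def A_def using l p f3n f3p by (intro integral_powr_le_powr_integral) auto
    also have "\<dots> \<le> 2 powr p * (l powr (p - 1) * (2 ^ m * X powr (- real m) * E))"
      using A by (intro mult_left_mono) auto
    finally show ?thesis by (simp add: mult_ac)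
  qed
  have lp: "l powr r = s powr r * X powr (2 * r)" for r
    using s X by (simp add: l_def powr_mult powr_powr flip: powr_numeral)
  note pw = pointwise_interpolation[OF p0 p1 p2 xl l f0 T_def]
  have Xm: "X ^ m = X powr real m" using X by (simp add: powr_realpow)
  have le1: "X powr r \<le> 1" if "r \<ge> 0" for r using powr_ge_exponent[OF X that] .
  have split: "X ^ m * ((u + v) / X powr q) powr p \<le> 2 powr p * (X powr (real m - q * p) * u powr p + X powr (real m - q * p) * v powr p)"
    if "u \<ge> 0" "v \<ge> 0" for u v q
  proof -
    have "X ^ m * ((u + v) / X powr q) powr p = X powr (real m - q * p) * (u + v) powr p"
      using that X by (simp add: Xm powr_divide powr_powr powr_diff)
    also have "\<dots> \<le> X powr (real m - q * p) * (2 powr p * (u powr p + v powr p))"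
      using powr_sum_le[OF that, of p] p by (intro mult_left_mono) auto
    finally show ?thesis by (simp add: algebra_simps)
  qed
  have "X ^ m * (\<bar>f2 x\<bar> / X) powr p \<le> X ^ m * ((16 / l\<^sup>2 + 6 * T) / X powr 1) powr p"
    using pw(1) X p by (intro mult_left_mono powr_mono2) (auto simp: divide_right_mono)
  also have "\<dots> \<le> 2 powr p * (X powr (real m - 1 * p) * (16 / l\<^sup>2) powr p + X powr (real m - 1 * p) * (6 * T) powr p)"
    using T0 by (intro split) auto
  \<comment> \<open>Division by \<chi> takes p powers and l^(-2p) another 4p; this is where m \<ge>
    5p enters.\<close>
  also have "X powr (real m - 1 * p) * (16 / l\<^sup>2) powr p = 16 powr p * s powr (- 2 * p) * X powr (real m - 5 * p)"
  proof -
    have "(16 / l\<^sup>2) powr p = 16 powr p * l powr (- 2 * p)"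
      using l by (simp add: powr_divide powr_powr powr_minus field_simps flip: powr_numeral)
    then show ?thesis
      using X by (simp add: lp mult_ac flip: powr_add)
  qed
  also have "\<dots> \<le> 16 powr p * s powr (- 2 * p) * 1"
    using m by (intro mult_left_mono le1) auto
  \<comment> \<open>The loss \<chi>^(-m) from the comparison with \<open>E\<close> cancels the
    weight; l^(p-1) returns 2(p-1) powers against the p lost by division, and p - 2 \<ge> 0 of them
    remain.\<close>
  also have "X powr (real m - 1 * p) * (6 * T) powr p \<le> 12 powr p * 2 ^ m * s powr (p - 1) * E"
  proof -
    have "X powr (real m - 1 * p) * (6 * T) powr p \<le> X powr (real m - p) * (6 powr p * (2 powr p * 2 ^ m * l powr (p - 1) * X powr (- real m) * E))"
      using T0 Tp by (simp add: powr_mult mult_left_mono)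
    also have "\<dots> = 12 powr p * 2 ^ m * s powr (p - 1) * E * X powr (p - 2)"
    proof -
      have "X powr (real m - p) * X powr (2 * (p - 1)) * X powr (- real m) = X powr (p - 2)"
        by (simp flip: powr_add)
      moreover have "(12::real) powr p = 6 powr p * 2 powr p" by (simp flip: powr_mult)
      ultimately show ?thesis by (simp add: lp mult_ac)
    qed
    also have "\<dots> \<le> 12 powr p * 2 ^ m * s powr (p - 1) * E * 1"
      using p E0 by (intro mult_left_mono le1) auto
    finally show ?thesis by simp
  qed
  finally have "X ^ m * (\<bar>f2 x\<bar> / X) powr p \<le> 2 powr p * (16 powr p * s powr (- 2 * p) * 1 + 12 powr p * 2 ^ m * s powr (p - 1) * E)"
    by simp
  moreover have "(32::real) powr p = 2 powr p * 16 powr p" "(24::real) powr p = 2 powr p * 12 powr p"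
    by (simp_all flip: powr_mult)
  ultimately show ?T2 unfolding X_def[symmetric] by (simp add: algebra_simps)
  have "X ^ m * (\<bar>f1 x\<bar> / X\<^sup>2) powr p \<le> X ^ m * ((10 / l + 4 * l * T) / X powr 2) powr p"
    using pw(2) X p by (intro mult_left_mono powr_mono2) (auto simp: divide_right_mono)
  also have "\<dots> \<le> 2 powr p * (X powr (real m - 2 * p) * (10 / l) powr p + X powr (real m - 2 * p) * (4 * l * T) powr p)"
    using T0 l by (intro split) auto
  also have "X powr (real m - 2 * p) * (10 / l) powr p = 10 powr p * s powr (- p) * X powr (real m - 4 * p)"
  proof -
    have "(10 / l) powr p = 10 powr p * l powr (- p)"
      using l by (simp add: powr_divide powr_minus field_simps)
    then show ?thesis
      using X by (simp add: lp mult_ac flip: powr_add)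
  qed
  also have "\<dots> \<le> 10 powr p * s powr (- p) * 1"
    using m p by (intro mult_left_mono le1) auto
  \<comment> \<open>Here the step occurs to the powers p and p - 1, so the count of powers of \<chi>
    is m - 2p + 2p + 2(p-1) - m = 2p - 2.\<close>
  also have "X powr (real m - 2 * p) * (4 * l * T) powr p \<le> 8 powr p * 2 ^ m * s powr (2 * p - 1) * E"
  proof -
    have "X powr (real m - 2 * p) * (4 * l * T) powr p \<le> X powr (real m - 2 * p) * (4 powr p * l powr p * (2 powr p * 2 ^ m * l powr (p - 1) * X powr (- real m) * E))"
      using T0 Tp l by (simp add: powr_mult mult_left_mono)
    also have "\<dots> = 8 powr p * 2 ^ m * s powr (2 * p - 1) * E * X powr (2 * p - 2)"
    proof -
      have e1: "X powr (real m - 2 * p) * X powr (2 * p) * X powr (2 * (p - 1)) * X powr (- real m) = X powr (2 * p - 2)"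
        by (simp flip: powr_add)
      have e2: "(8::real) powr p = 4 powr p * 2 powr p" by (simp flip: powr_mult)
      have e3: "s powr p * s powr (p - 1) = s powr (2 * p - 1)" by (simp flip: powr_add)
      show ?thesis
        unfolding lp[of p] lp[of "p - 1"] e2 e1[symmetric] e3[symmetric] by (simp only: mult_ac)
    qed
    also have "\<dots> \<le> 8 powr p * 2 ^ m * s powr (2 * p - 1) * E * 1"
      using p E0 by (intro mult_left_mono le1) auto
    finally show ?thesis by simp
  qed
  finally have "X ^ m * (\<bar>f1 x\<bar> / X\<^sup>2) powr p \<le> 2 powr p * (10 powr p * s powr (- p) * 1 + 8 powr p * 2 ^ m * s powr (2 * p - 1) * E)"
    by simp
  moreover have "(20::real) powr p = 2 powr p * 10 powr p" "(16::real) powr p = 2 powr p * 8 powr p"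
    by (simp_all flip: powr_mult)
  ultimately show ?T1 unfolding X_def[symmetric] by (simp add: algebra_simps)
qed

section \<open>Elementary absorption inequalities\<close>

text \<open>Both coefficients of the energy in the interpolation inequalities carry a positive power
  of the step, so a short step makes them as small as the absorption requires.\<close>

lemma small_step_exists:
  fixes p \<delta> \<kappa> M1 M2 :: real
  assumes "p > 1" "\<delta> > 0" "\<kappa> > 0"
  obtains s where "0 < s" "s \<le> \<kappa> / 2" "M1 * s powr (p - 1) + M2 * s powr (2 * p - 1) \<le> \<delta>"
proof -
  have "((\<lambda>s. M1 * s powr (p - 1) + M2 * s powr (2 * p - 1)) \<longlongrightarrow> M1 * 0 powr (p - 1) + M2 * 0 powr (2 * p - 1)) (at_right 0)"
    using assms by (intro tendsto_intros tendsto_powr2) (auto simp: eventually_at_filter)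
  then have "((\<lambda>s. M1 * s powr (p - 1) + M2 * s powr (2 * p - 1)) \<longlongrightarrow> 0) (at_right 0)" by simp
  then have "\<forall>\<^sub>F s in at_right 0. M1 * s powr (p - 1) + M2 * s powr (2 * p - 1) < \<delta>"
    using assms by (intro order_tendstoD)
  moreover have "\<forall>\<^sub>F s::real in at_right 0. s > 0" by (simp add: eventually_at_filter)
  moreover have "\<forall>\<^sub>F s in at_right 0. s < \<kappa> / 2"
    using assms by (intro order_tendstoD(2)[OF tendsto_ident_at]) auto
  ultimately have "\<forall>\<^sub>F s in at_right 0. 0 < s \<and> s \<le> \<kappa> / 2 \<and> M1 * s powr (p - 1) + M2 * s powr (2 * p - 1) \<le> \<delta>"
    by eventually_elim auto
  then show thesis
    using eventually_happens'[OF trivial_limit_at_right_real] that by blast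
qed

text \<open>Every lower order term, including \<open>Z\<close> from the derivatives of the cutoff,
  is at most \<bar>F\<bar> times a multiple of G = 1 + g1 + g2. The growth bound turns \<bar>F\<bar>
  G into a power of G and a mixed term \<bar>y3\<bar>^\<alpha> G, and the latter is absorbed.
  Majorants g1, g2 stand in for \<bar>y1\<bar>, \<bar>y2\<bar> because the cutoff terms are
  controlled only by derivatives divided by powers of \<chi>.\<close>

lemma pointwise_coercivity:
  fixes \<alpha> Cs C0 C1 C2 C3 D :: real
  assumes \<alpha>: "\<alpha> > 1" and C: "Cs > 0" "C0 > 0" "C1 > 0" "C2 > 0" "C3 > 0" and D: "D \<ge> 0"
  obtains K where "K > 0" "\<And>F y0 y1 y2 y3 g1 g2 Z.
    \<lbrakk>\<bar>y0\<bar> \<le> 1; \<bar>y1\<bar> \<le> g1; \<bar>y2\<bar> \<le> g2; \<bar>Z\<bar> \<le> D * (g1 + g2);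
     \<bar>F\<bar> \<le> C0 * \<bar>y0\<bar> powr \<alpha> + C1 * \<bar>y1\<bar> powr \<alpha> + C2 * \<bar>y2\<bar> powr \<alpha> + C3 * \<bar>y3\<bar> powr \<alpha> + Cs;
     F * y3 \<ge> C3 * \<bar>y3\<bar> powr (\<alpha> + 1) - (C0 * \<bar>F\<bar> * \<bar>y0\<bar> + C1 * \<bar>F\<bar> * \<bar>y1\<bar> + C2 * \<bar>F\<bar> * \<bar>y2\<bar>)\<rbrakk>
    \<Longrightarrow> C3 / 2 * \<bar>y3\<bar> powr (\<alpha> + 1) \<le> F * (y3 + Z) + K * (1 + g1 powr (\<alpha> + 1) + g2 powr (\<alpha> + 1))"
proof -
  define M where "M = C0 + C1 + C2 + Cs"
  define L where "L = C0 + C1 + C2 + D"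
  have MLp: "M > 0" "L > 0" using C D by (auto simp: M_def L_def)
  \<comment> \<open>With this \<delta> the mixed term returns exactly half of the leading power,
    since L C3 \<delta> = C3/2.\<close>
  define \<delta> where "\<delta> = 1 / (2 * L)"
  have \<delta>: "\<delta> > 0" using MLp by (simp add: \<delta>_def)
  define K0 where "K0 = L * M + L * C3 * \<delta> powr (- \<alpha>)"
  define K where "K = K0 * 4 powr (\<alpha> + 1)"
  have K0: "K0 > 0" using MLp C by (auto simp: K0_def intro!: add_pos_nonneg)
  then have "K > 0" by (simp add: K_def)
  moreover have "C3 / 2 * \<bar>y3\<bar> powr (\<alpha> + 1) \<le> F * (y3 + Z) + K * (1 + g1 powr (\<alpha> + 1) + g2 powr (\<alpha> + 1))"
    if y: "\<bar>y0\<bar> \<le> 1" "\<bar>y1\<bar> \<le> g1" "\<bar>y2\<bar> \<le> g2" "\<bar>Z\<bar> \<le> D * (g1 + g2)"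
     and F: "\<bar>F\<bar> \<le> C0 * \<bar>y0\<bar> powr \<alpha> + C1 * \<bar>y1\<bar> powr \<alpha> + C2 * \<bar>y2\<bar> powr \<alpha> + C3 * \<bar>y3\<bar> powr \<alpha> + Cs"
     and co: "F * y3 \<ge> C3 * \<bar>y3\<bar> powr (\<alpha> + 1) - (C0 * \<bar>F\<bar> * \<bar>y0\<bar> + C1 * \<bar>F\<bar> * \<bar>y1\<bar> + C2 * \<bar>F\<bar> * \<bar>y2\<bar>)"
    for F y0 y1 y2 y3 g1 g2 Z
  proof -
    define G where "G = 1 + g1 + g2"
    have g: "g1 \<ge> 0" "g2 \<ge> 0" using y(2,3) by linarith+
    have G: "G \<ge> 1" "\<bar>y0\<bar> \<le> G" "\<bar>y1\<bar> \<le> G" "\<bar>y2\<bar> \<le> G" "g1 + g2 \<le> G" using y g by (auto simp: G_def)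
    have Fb: "\<bar>F\<bar> \<le> M * G powr \<alpha> + C3 * \<bar>y3\<bar> powr \<alpha>"
    proof -
      have "C0 * \<bar>y0\<bar> powr \<alpha> \<le> C0 * G powr \<alpha>" "C1 * \<bar>y1\<bar> powr \<alpha> \<le> C1 * G powr \<alpha>"
        "C2 * \<bar>y2\<bar> powr \<alpha> \<le> C2 * G powr \<alpha>"
        using C G \<alpha> by (auto intro!: mult_left_mono powr_mono2)
      moreover have "Cs * 1 \<le> Cs * G powr \<alpha>"
        using C G \<alpha> by (intro mult_left_mono ge_one_powr_ge_zero) auto
      ultimately show ?thesis using F by (simp add: M_def algebra_simps)
    qed
    have rest: "C0 * \<bar>F\<bar> * \<bar>y0\<bar> + C1 * \<bar>F\<bar> * \<bar>y1\<bar> + C2 * \<bar>F\<bar> * \<bar>y2\<bar> + \<bar>F\<bar> * \<bar>Z\<bar> \<le> L * (\<bar>F\<bar> * G)"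
    proof -
      have "C0 * \<bar>F\<bar> * \<bar>y0\<bar> \<le> C0 * \<bar>F\<bar> * G" "C1 * \<bar>F\<bar> * \<bar>y1\<bar> \<le> C1 * \<bar>F\<bar> * G" "C2 * \<bar>F\<bar> * \<bar>y2\<bar> \<le> C2 * \<bar>F\<bar> * G"
        using C G by (auto intro!: mult_left_mono)
      moreover have "\<bar>F\<bar> * \<bar>Z\<bar> \<le> \<bar>F\<bar> * (D * G)"
        using y(4) mult_left_mono[OF G(5) D] by (intro mult_left_mono) auto
      ultimately show ?thesis by (simp add: L_def algebra_simps)
    qed
    have GG: "G powr \<alpha> * G = G powr (\<alpha> + 1)" "\<bar>y3\<bar> powr \<alpha> * \<bar>y3\<bar> = \<bar>y3\<bar> powr (\<alpha> + 1)"
      using G by (auto simp: powr_add)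
    have young: "\<bar>y3\<bar> powr \<alpha> * G \<le> \<delta> * \<bar>y3\<bar> powr (\<alpha> + 1) + \<delta> powr (- \<alpha>) * G powr (\<alpha> + 1)"
    proof (cases "G \<le> \<delta> * \<bar>y3\<bar>")
      case True
      have "\<bar>y3\<bar> powr \<alpha> * G \<le> \<bar>y3\<bar> powr \<alpha> * (\<delta> * \<bar>y3\<bar>)" using True by (intro mult_left_mono) auto
      also have "\<dots> = \<delta> * \<bar>y3\<bar> powr (\<alpha> + 1)" by (simp flip: GG(2))
      finally show ?thesis by (simp add: add_increasing2)
    next
      case False
      then have "\<bar>y3\<bar> \<le> G / \<delta>" using \<delta> by (simp add: field_simps)
      then have "\<bar>y3\<bar> powr \<alpha> \<le> (G / \<delta>) powr \<alpha>" using \<alpha> by (intro powr_mono2) auto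
      also have "\<dots> = \<delta> powr (- \<alpha>) * G powr \<alpha>" using G \<delta> by (simp add: powr_divide powr_minus field_simps)
      finally have "\<bar>y3\<bar> powr \<alpha> * G \<le> \<delta> powr (- \<alpha>) * G powr \<alpha> * G" using G by (intro mult_right_mono) auto
      also have "\<dots> = \<delta> powr (- \<alpha>) * G powr (\<alpha> + 1)" by (simp add: mult.assoc GG(1))
      finally show ?thesis using \<delta> by (simp add: add_increasing)
    qed
    have "L * (\<bar>F\<bar> * G) \<le> L * ((M * G powr \<alpha> + C3 * \<bar>y3\<bar> powr \<alpha>) * G)"
      using Fb MLp G by (intro mult_left_mono mult_right_mono) auto
    also have "\<dots> = L * M * G powr (\<alpha> + 1) + L * C3 * (\<bar>y3\<bar> powr \<alpha> * G)"
      unfolding GG(1)[symmetric] by (simp only: algebra_simps)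
    also have "\<dots> \<le> L * M * G powr (\<alpha> + 1) + L * C3 * (\<delta> * \<bar>y3\<bar> powr (\<alpha> + 1) + \<delta> powr (- \<alpha>) * G powr (\<alpha> + 1))"
      using young MLp C by (intro add_left_mono mult_left_mono) auto
    also have "\<dots> = K0 * G powr (\<alpha> + 1) + C3 / 2 * \<bar>y3\<bar> powr (\<alpha> + 1)"
      using MLp by (simp add: K0_def \<delta>_def algebra_simps)
    also have "G powr (\<alpha> + 1) \<le> 4 powr (\<alpha> + 1) * (1 + g1 powr (\<alpha> + 1) + g2 powr (\<alpha> + 1))"
    proof -
      have "G powr (\<alpha> + 1) \<le> (4 * max 1 (max g1 g2)) powr (\<alpha> + 1)"
        using g \<alpha> by (intro powr_mono2) (auto simp: G_def)
      also have "\<dots> = 4 powr (\<alpha> + 1) * (max 1 (max g1 g2)) powr (\<alpha> + 1)"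
        by (simp add: powr_mult)
      also have "(max 1 (max g1 g2)) powr (\<alpha> + 1) \<le> 1 + g1 powr (\<alpha> + 1) + g2 powr (\<alpha> + 1)"
        by (auto simp: max_def)
      finally show ?thesis by simp
    qed
    finally have up: "L * (\<bar>F\<bar> * G) \<le> K * (1 + g1 powr (\<alpha> + 1) + g2 powr (\<alpha> + 1)) + C3 / 2 * \<bar>y3\<bar> powr (\<alpha> + 1)"
      using K0 by (simp add: K_def mult_ac)
    have "- (\<bar>F\<bar> * \<bar>Z\<bar>) \<le> F * Z" by (metis abs_ge_minus_self abs_mult minus_le_iff)
    then show ?thesis using co rest up by (simp add: algebra_simps)
  qed
  ultimately show thesis using that by blast
qed

text \<open>If y^(p-2) is at least k/(\<delta> \<sigma>), the power on the right absorbs the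
  left-hand side. Otherwise y^2 is at most a multiple of \<sigma>^(-2/(p-2)), and \<sigma>^(k-1)
  compensates this as soon as k - 1 \<ge> 2/(p-2), which is the assumption on k.\<close>

lemma time_weight_young:
  fixes p \<delta> :: real and k :: nat
  assumes p: "p > 2" and k: "real k \<ge> p / (p - 2)" and \<delta>: "\<delta> > 0"
  obtains K where "K \<ge> 0" "\<And>\<sigma> y. 0 \<le> \<sigma> \<Longrightarrow> \<sigma> \<le> 1 \<Longrightarrow> 0 \<le> y \<Longrightarrow>
    real k * \<sigma> ^ (k - 1) * y\<^sup>2 \<le> \<delta> * \<sigma> ^ k * y powr p + K"
proof -
  define r where "r = 2 / (p - 2)"
  have "p / (p - 2) > 1" using p by simp
  then have k1: "real k > 1" using k by (rule less_le_trans)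
  have r: "r > 0" "real (k - 1) - r \<ge> 0"
  proof -
    show "r > 0" using p by (simp add: r_def)
    have "p / (p - 2) = 1 + r" using p by (simp add: r_def field_simps)
    then show "real (k - 1) - r \<ge> 0" using k k1 by (simp add: of_nat_diff)
  qed
  define K where "K = real k * (real k / \<delta>) powr r"
  have "K \<ge> 0" by (simp add: K_def)
  moreover have "real k * \<sigma> ^ (k - 1) * y\<^sup>2 \<le> \<delta> * \<sigma> ^ k * y powr p + K"
    if \<sigma>: "0 \<le> \<sigma>" "\<sigma> \<le> 1" and y: "0 \<le> y" for \<sigma> y
  proof (cases "\<sigma> = 0 \<or> y = 0")
    case True
    have "\<sigma> ^ (k - 1) = 0 \<or> y = 0" using True k1 by auto
    then have z: "real k * \<sigma> ^ (k - 1) * y\<^sup>2 = 0" by auto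
    show ?thesis unfolding z using \<open>K \<ge> 0\<close> \<delta> \<sigma> by (intro add_nonneg_nonneg mult_nonneg_nonneg) auto
  next
    case False
    then have pos: "\<sigma> > 0" "y > 0" using \<sigma> y by auto
    have yp: "y powr p = y\<^sup>2 * y powr (p - 2)"
      using pos by (simp flip: powr_add powr_numeral)
    have \<sigma>k: "\<sigma> ^ k = \<sigma> * \<sigma> ^ (k - 1)" using k1 by (cases k) auto
    show ?thesis
    proof (cases "real k \<le> \<delta> * \<sigma> * y powr (p - 2)")
      case True
      have "real k * \<sigma> ^ (k - 1) * y\<^sup>2 \<le> (\<delta> * \<sigma> * y powr (p - 2)) * \<sigma> ^ (k - 1) * y\<^sup>2"
        using True \<sigma> by (intro mult_right_mono) auto
      also have "\<dots> = \<delta> * \<sigma> ^ k * y powr p" by (simp add: yp \<sigma>k)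
      finally show ?thesis using \<open>K \<ge> 0\<close> by simp
    next
      case False
      then have "y powr (p - 2) \<le> real k / (\<delta> * \<sigma>)" using \<delta> pos by (simp add: field_simps)
      then have "(y powr (p - 2)) powr r \<le> (real k / (\<delta> * \<sigma>)) powr r" using r by (intro powr_mono2) auto
      moreover have "(y powr (p - 2)) powr r = y\<^sup>2"
      proof -
        have "(p - 2) * r = 2" unfolding r_def times_divide_eq_right using p by (intro nonzero_mult_div_cancel_left) simp
        then show ?thesis using pos by (simp add: powr_powr)
      qed
      ultimately have "y\<^sup>2 \<le> (real k / \<delta>) powr r * \<sigma> powr (- r)"
        using \<delta> pos by (simp add: powr_divide powr_mult powr_minus field_simps)
      then have "real k * \<sigma> ^ (k - 1) * y\<^sup>2 \<le> real k * \<sigma> ^ (k - 1) * ((real k / \<delta>) powr r * \<sigma> powr (- r))"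
        using \<sigma> by (intro mult_left_mono) auto
      also have "\<dots> = K * \<sigma> powr (real (k - 1) - r)"
        using pos by (simp add: K_def powr_diff powr_minus powr_realpow field_simps)
      also have "\<dots> \<le> K * 1" using pos \<sigma> r \<open>K \<ge> 0\<close> by (intro mult_left_mono powr_le1) auto
      finally show ?thesis using \<delta> \<sigma> by (simp add: add_increasing)
    qed
  qed
  ultimately show thesis using that by blast
qed

section \<open>Powers of the cutoff and their derivatives\<close>

definition parab_deriv :: "real \<Rightarrow> real \<Rightarrow> real \<Rightarrow> real" where
  "parab_deriv \<kappa> x0 x = - (x - x0) / (2 * \<kappa>\<^sup>2)"

definition cutoff :: "nat \<Rightarrow> real \<Rightarrow> real \<Rightarrow> real \<Rightarrow> real" where
  "cutoff m \<kappa> x0 x = parab \<kappa> x0 x ^ m"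

definition cutoff1 :: "nat \<Rightarrow> real \<Rightarrow> real \<Rightarrow> real \<Rightarrow> real" where
  "cutoff1 m \<kappa> x0 x = real m * parab \<kappa> x0 x ^ (m - 1) * parab_deriv \<kappa> x0 x"

definition cutoff2 :: "nat \<Rightarrow> real \<Rightarrow> real \<Rightarrow> real \<Rightarrow> real" where
  "cutoff2 m \<kappa> x0 x = real m * real (m - 1) * parab \<kappa> x0 x ^ (m - 2) * (parab_deriv \<kappa> x0 x)\<^sup>2
     - real m * parab \<kappa> x0 x ^ (m - 1) / (2 * \<kappa>\<^sup>2)"

lemma DERIV_parab: "\<kappa> \<noteq> 0 \<Longrightarrow> (parab \<kappa> x0 has_real_derivative parab_deriv \<kappa> x0 x) (at x)"
  unfolding parab_def[abs_def] parab_deriv_def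
  by (auto intro!: derivative_eq_intros simp: field_simps power2_eq_square)

lemma DERIV_cutoff:
  assumes "\<kappa> \<noteq> 0"
  shows "(cutoff m \<kappa> x0 has_real_derivative cutoff1 m \<kappa> x0 x) (at x)"
    and "(cutoff1 m \<kappa> x0 has_real_derivative cutoff2 m \<kappa> x0 x) (at x)"
proof -
  have pw: "((\<lambda>x. parab \<kappa> x0 x ^ n) has_real_derivative real n * parab \<kappa> x0 x ^ (n - 1) * parab_deriv \<kappa> x0 x) (at x)" for n
    using DERIV_power[OF DERIV_parab[OF assms], where n=n] by (simp add: mult_ac)
  show "(cutoff m \<kappa> x0 has_real_derivative cutoff1 m \<kappa> x0 x) (at x)"
    unfolding cutoff_def[abs_def] cutoff1_def by (rule pw)
  have d: "(parab_deriv \<kappa> x0 has_real_derivative - (1 / (2 * \<kappa>\<^sup>2))) (at x)"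
    unfolding parab_deriv_def[abs_def] by (auto intro!: derivative_eq_intros simp: assms field_simps)
  have "((\<lambda>x. real m * (parab \<kappa> x0 x ^ (m - 1) * parab_deriv \<kappa> x0 x)) has_real_derivative
     real m * (real (m - 1) * parab \<kappa> x0 x ^ (m - 1 - 1) * parab_deriv \<kappa> x0 x * parab_deriv \<kappa> x0 x
       + (- (1 / (2 * \<kappa>\<^sup>2))) * parab \<kappa> x0 x ^ (m - 1))) (at x)"
    by (intro DERIV_cmult DERIV_mult pw d)
  moreover have "m - 1 - 1 = m - 2" by simp
  ultimately show "(cutoff1 m \<kappa> x0 has_real_derivative cutoff2 m \<kappa> x0 x) (at x)"
    unfolding cutoff1_def[abs_def] cutoff2_def
    by (simp add: algebra_simps power2_eq_square)
qed

lemma continuous_on_cutoff: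
  assumes "\<kappa> \<noteq> 0"
  shows "continuous_on S (cutoff m \<kappa> x0)" "continuous_on S (cutoff1 m \<kappa> x0)" "continuous_on S (cutoff2 m \<kappa> x0)"
  using assms unfolding cutoff_def[abs_def] cutoff1_def[abs_def] cutoff2_def[abs_def] parab_def parab_deriv_def
  by (auto intro!: continuous_intros)

lemma cutoff_boundary:
  assumes "\<kappa> > 0" "m \<ge> 3"
  shows "cutoff m \<kappa> x0 (x0 - 2 * \<kappa>) = 0" "cutoff m \<kappa> x0 (x0 + 2 * \<kappa>) = 0"
    "cutoff1 m \<kappa> x0 (x0 - 2 * \<kappa>) = 0" "cutoff1 m \<kappa> x0 (x0 + 2 * \<kappa>) = 0"
proof -
  have "parab \<kappa> x0 (x0 - 2 * \<kappa>) = 0" "parab \<kappa> x0 (x0 + 2 * \<kappa>) = 0"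
    using assms by (auto simp: parab_def power2_eq_square)
  then show "cutoff m \<kappa> x0 (x0 - 2 * \<kappa>) = 0" "cutoff m \<kappa> x0 (x0 + 2 * \<kappa>) = 0"
    "cutoff1 m \<kappa> x0 (x0 - 2 * \<kappa>) = 0" "cutoff1 m \<kappa> x0 (x0 + 2 * \<kappa>) = 0"
    using assms by (auto simp: cutoff_def cutoff1_def)
qed

lemma cutoff_bounds:
  assumes "\<kappa> > 0" "x \<in> {x0 - 2 * \<kappa>..x0 + 2 * \<kappa>}"
  shows "0 \<le> cutoff m \<kappa> x0 x" "cutoff m \<kappa> x0 x \<le> 1"
  using parab_nonneg[OF assms] parab_le_1[of \<kappa> x0 x] by (auto simp: cutoff_def power_le_one)

text \<open>The sum of the two factors in \<open>cutoff_deriv_bounds\<close>, the first one doubled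
  because \<psi>' occurs twice in the second derivative of \<psi> times a function.\<close>

definition cutoff_const :: "nat \<Rightarrow> real \<Rightarrow> real" where
  "cutoff_const m \<kappa> = 2 * real m / \<kappa> + ((real m)\<^sup>2 + real m) / \<kappa>\<^sup>2"

lemma cutoff_deriv_bounds:
  assumes \<kappa>: "\<kappa> > 0" and x: "x \<in> {x0 - 2 * \<kappa>..x0 + 2 * \<kappa>}" and m: "m \<ge> 3"
  shows "\<bar>cutoff1 m \<kappa> x0 x\<bar> \<le> real m / \<kappa> * parab \<kappa> x0 x ^ (m - 1)"
    and "\<bar>cutoff2 m \<kappa> x0 x\<bar> \<le> ((real m)\<^sup>2 + real m) / \<kappa>\<^sup>2 * parab \<kappa> x0 x ^ (m - 2)"
proof -
  define X where "X = parab \<kappa> x0 x"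
  have X: "0 \<le> X" "X \<le> 1" using parab_nonneg[OF \<kappa> x] parab_le_1 by (auto simp: X_def)
  have d: "\<bar>parab_deriv \<kappa> x0 x\<bar> \<le> 1 / \<kappa>"
  proof -
    have "\<bar>x - x0\<bar> \<le> 2 * \<kappa>" using x by auto
    then have "\<bar>x - x0\<bar> / (2 * \<kappa>\<^sup>2) \<le> 2 * \<kappa> / (2 * \<kappa>\<^sup>2)" using \<kappa> by (intro divide_right_mono) auto
    also have "\<dots> = 1 / \<kappa>" using \<kappa> by (simp add: power2_eq_square)
    finally show ?thesis using \<kappa> by (simp add: parab_deriv_def abs_divide abs_minus_commute)
  qed
  have "real m * X ^ (m - 1) * \<bar>parab_deriv \<kappa> x0 x\<bar> \<le> real m * X ^ (m - 1) * (1 / \<kappa>)"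
    using d X by (intro mult_left_mono) auto
  then show "\<bar>cutoff1 m \<kappa> x0 x\<bar> \<le> real m / \<kappa> * parab \<kappa> x0 x ^ (m - 1)"
    using X by (simp add: cutoff1_def abs_mult X_def)
  have "(parab_deriv \<kappa> x0 x)\<^sup>2 \<le> (1 / \<kappa>)\<^sup>2" using d power_mono[OF d, of 2] by simp
  then have 1: "real m * real (m - 1) * X ^ (m - 2) * (parab_deriv \<kappa> x0 x)\<^sup>2 \<le> real m * real m * X ^ (m - 2) * (1 / \<kappa>)\<^sup>2"
    using X by (intro mult_mono) auto
  have "X ^ (m - 1) \<le> X ^ (m - 2)" using X by (intro power_decreasing) auto
  then have 2: "real m * X ^ (m - 1) / (2 * \<kappa>\<^sup>2) \<le> real m * X ^ (m - 2) / \<kappa>\<^sup>2"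
    using \<kappa> X by (intro frac_le mult_left_mono) auto
  have nn: "0 \<le> real m * real (m - 1) * X ^ (m - 2) * (parab_deriv \<kappa> x0 x)\<^sup>2" "0 \<le> real m * X ^ (m - 1) / (2 * \<kappa>\<^sup>2)"
    using X by auto
  have "\<bar>cutoff2 m \<kappa> x0 x\<bar> \<le> real m * real m * X ^ (m - 2) * (1 / \<kappa>)\<^sup>2 + real m * X ^ (m - 2) / \<kappa>\<^sup>2"
  proof -
    have "\<bar>u - v\<bar> \<le> u' + v'" if "u \<le> u'" "v \<le> v'" "0 \<le> u" "0 \<le> v" for u v u' v' :: real
      using that by linarith
    from this[OF 1 2 nn] show ?thesis unfolding cutoff2_def X_def[symmetric] .
  qed
  then show "\<bar>cutoff2 m \<kappa> x0 x\<bar> \<le> ((real m)\<^sup>2 + real m) / \<kappa>\<^sup>2 * parab \<kappa> x0 x ^ (m - 2)"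
    unfolding X_def by (simp add: power2_eq_square add_divide_distrib algebra_simps)
qed

text \<open>Each derivative of \<chi>^m costs one power of \<chi>. Factoring \<chi>^m out therefore
  leaves y2 divided by \<chi> and y1 divided by \<chi>^2, the very quantities that
  \<open>weighted_interpolation\<close> controls.\<close>

lemma cutoff_terms_bound:
  assumes \<kappa>: "\<kappa> > 0" and x: "x \<in> {x0 - 2 * \<kappa><..<x0 + 2 * \<kappa>}" and m: "m \<ge> 3"
  shows "\<bar>2 * cutoff1 m \<kappa> x0 x * y2 + cutoff2 m \<kappa> x0 x * y1\<bar>
    \<le> cutoff m \<kappa> x0 x * (cutoff_const m \<kappa> * (\<bar>y1\<bar> / (parab \<kappa> x0 x)\<^sup>2 + \<bar>y2\<bar> / parab \<kappa> x0 x))"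
proof -
  define X where "X = parab \<kappa> x0 x"
  have X: "0 < X" using parab_pos_iff[OF \<kappa>] x by (simp add: X_def)
  have e: "X ^ (m - 1) = X ^ m / X" "X ^ (m - 2) = X ^ m / X\<^sup>2"
    using X m by (auto simp: power_diff)
  have x': "x \<in> {x0 - 2 * \<kappa>..x0 + 2 * \<kappa>}" using x by auto
  note b = cutoff_deriv_bounds[OF \<kappa> x' m, folded X_def]
  define A B where "A = 2 * real m / \<kappa>" and "B = ((real m)\<^sup>2 + real m) / \<kappa>\<^sup>2"
  have AB: "A \<ge> 0" "B \<ge> 0" "cutoff_const m \<kappa> = A + B" "2 * (real m / \<kappa>) = A"
    using \<kappa> by (auto simp: A_def B_def cutoff_const_def)
  have "\<bar>2 * cutoff1 m \<kappa> x0 x * y2 + cutoff2 m \<kappa> x0 x * y1\<bar> \<le> 2 * \<bar>cutoff1 m \<kappa> x0 x\<bar> * \<bar>y2\<bar> + \<bar>cutoff2 m \<kappa> x0 x\<bar> * \<bar>y1\<bar>"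
    by (rule order_trans[OF abs_triangle_ineq]) (simp add: abs_mult)
  also have "\<dots> \<le> 2 * (real m / \<kappa> * X ^ (m - 1)) * \<bar>y2\<bar> + (B * X ^ (m - 2)) * \<bar>y1\<bar>"
    using b unfolding B_def by (intro add_mono mult_right_mono mult_left_mono) auto
  also have "\<dots> = X ^ m * (A * (\<bar>y2\<bar> / X) + B * (\<bar>y1\<bar> / X\<^sup>2))"
    unfolding e AB(4)[symmetric] by (simp add: algebra_simps)
  also have "\<dots> \<le> X ^ m * (cutoff_const m \<kappa> * (\<bar>y1\<bar> / X\<^sup>2 + \<bar>y2\<bar> / X))"
  proof (rule mult_left_mono)
    have "0 \<le> B * (\<bar>y2\<bar> / X)" "0 \<le> A * (\<bar>y1\<bar> / X\<^sup>2)" using AB X by (auto intro!: mult_nonneg_nonneg)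
    then show "A * (\<bar>y2\<bar> / X) + B * (\<bar>y1\<bar> / X\<^sup>2) \<le> cutoff_const m \<kappa> * (\<bar>y1\<bar> / X\<^sup>2 + \<bar>y2\<bar> / X)"
      unfolding AB(3) by (simp add: algebra_simps add_divide_distrib)
  qed (use X in auto)
  finally show ?thesis by (simp add: X_def cutoff_def)
qed

section \<open>Estimates on a time slice\<close>

lemma absolutely_integral_le_AE:
  fixes f g :: "real \<Rightarrow> real"
  assumes f: "f absolutely_integrable_on S" and g: "g absolutely_integrable_on S"
    and le: "AE x in lebesgue. x \<in> S \<longrightarrow> f x \<le> g x"
  shows "integral S f \<le> integral S g"
proof -
  have "(LINT x:S|lebesgue. f x) \<le> (LINT x:S|lebesgue. g x)"
    unfolding set_lebesgue_integral_def
    by (intro integral_mono_AE) (use f g le in \<open>auto simp: set_integrable_def indicator_def\<close>)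
  then show ?thesis
    using set_lebesgue_integral_eq_integral(2)[OF f] set_lebesgue_integral_eq_integral(2)[OF g] by simp
qed

text \<open>Two bounds with one constant independent of the slice: the tested flux dominates the
  weighted third derivative, which in turn dominates the energy term coming from the slope of the
  time weight. In the first bound interpolation spends 1/8 of the coefficient 1/2 of C3, leaving
  3/8; the second spends 1/4. As only half the energy term enters the balance, 3/8 - 1/8 stays
  positive.\<close>

lemma slice_estimate:
  fixes \<alpha> \<kappa> Cs C0 C1 C2 C3 :: real and m k :: nat
  assumes \<alpha>: "\<alpha> > 1" and \<kappa>: "\<kappa> > 0" and C: "Cs > 0" "C0 > 0" "C1 > 0" "C2 > 0" "C3 > 0"
    and m: "real m \<ge> 5 * (\<alpha> + 1)" and k: "real k \<ge> (\<alpha> + 1) / (\<alpha> - 1)"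
  obtains K where "K \<ge> 0"
    "\<And>x0 f0 f1 f2 f3 F.
      \<lbrakk>primitive (x0 - 2 * \<kappa>) (x0 + 2 * \<kappa>) f0 f1; primitive (x0 - 2 * \<kappa>) (x0 + 2 * \<kappa>) f1 f2;
       primitive (x0 - 2 * \<kappa>) (x0 + 2 * \<kappa>) f2 f3;
       \<And>y. y \<in> {x0 - 2 * \<kappa>..x0 + 2 * \<kappa>} \<Longrightarrow> \<bar>f0 y\<bar> \<le> 1;
       (\<lambda>y. \<bar>f3 y\<bar> powr (\<alpha> + 1)) integrable_on {x0 - 2 * \<kappa>..x0 + 2 * \<kappa>};
       (\<lambda>x. F x * (cutoff m \<kappa> x0 x * f3 x + 2 * cutoff1 m \<kappa> x0 x * f2 x + cutoff2 m \<kappa> x0 x * f1 x))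
         absolutely_integrable_on {x0 - 2 * \<kappa>..x0 + 2 * \<kappa>};
       AE x in lebesgue. x \<in> {x0 - 2 * \<kappa>..x0 + 2 * \<kappa>} \<longrightarrow>
         \<bar>F x\<bar> \<le> C0 * \<bar>f0 x\<bar> powr \<alpha> + C1 * \<bar>f1 x\<bar> powr \<alpha> + C2 * \<bar>f2 x\<bar> powr \<alpha> + C3 * \<bar>f3 x\<bar> powr \<alpha> + Cs \<and>
         F x * f3 x \<ge> C3 * \<bar>f3 x\<bar> powr (\<alpha> + 1)
           - (C0 * \<bar>F x\<bar> * \<bar>f0 x\<bar> + C1 * \<bar>F x\<bar> * \<bar>f1 x\<bar> + C2 * \<bar>F x\<bar> * \<bar>f2 x\<bar>)\<rbrakk> \<Longrightarrow>
      3 / 8 * C3 * integral {x0 - 2 * \<kappa>..x0 + 2 * \<kappa>} (\<lambda>y. cutoff m \<kappa> x0 y * \<bar>f3 y\<bar> powr (\<alpha> + 1))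
        \<le> integral {x0 - 2 * \<kappa>..x0 + 2 * \<kappa>}
            (\<lambda>x. F x * (cutoff m \<kappa> x0 x * f3 x + 2 * cutoff1 m \<kappa> x0 x * f2 x + cutoff2 m \<kappa> x0 x * f1 x)) + K"
    "\<And>x0 f0 f1 f2 f3 \<sigma>.
      \<lbrakk>primitive (x0 - 2 * \<kappa>) (x0 + 2 * \<kappa>) f0 f1; primitive (x0 - 2 * \<kappa>) (x0 + 2 * \<kappa>) f1 f2;
       primitive (x0 - 2 * \<kappa>) (x0 + 2 * \<kappa>) f2 f3;
       \<And>y. y \<in> {x0 - 2 * \<kappa>..x0 + 2 * \<kappa>} \<Longrightarrow> \<bar>f0 y\<bar> \<le> 1;
       (\<lambda>y. \<bar>f3 y\<bar> powr (\<alpha> + 1)) integrable_on {x0 - 2 * \<kappa>..x0 + 2 * \<kappa>}; 0 \<le> \<sigma>; \<sigma> \<le> 1\<rbrakk> \<Longrightarrow>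
      real k * \<sigma> ^ (k - 1) * integral {x0 - 2 * \<kappa>..x0 + 2 * \<kappa>} (\<lambda>y. cutoff m \<kappa> x0 y * (f1 y)\<^sup>2)
        \<le> C3 / 4 * \<sigma> ^ k * integral {x0 - 2 * \<kappa>..x0 + 2 * \<kappa>} (\<lambda>y. cutoff m \<kappa> x0 y * \<bar>f3 y\<bar> powr (\<alpha> + 1)) + K"
proof -
  define p where "p = \<alpha> + 1"
  have p: "p > 2" using \<alpha> by (simp add: p_def)
  have "real m \<ge> 3" using m \<alpha> by simp
  then have m3: "m \<ge> 3" by simp
  have mp: "real m \<ge> 5 * p" using m by (simp add: p_def)
  obtain K1 where K1: "K1 > 0" "\<And>F y0 y1 y2 y3 g1 g2 Z.
    \<lbrakk>\<bar>y0\<bar> \<le> 1; \<bar>y1\<bar> \<le> g1; \<bar>y2\<bar> \<le> g2; \<bar>Z\<bar> \<le> cutoff_const m \<kappa> * (g1 + g2);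
     \<bar>F\<bar> \<le> C0 * \<bar>y0\<bar> powr \<alpha> + C1 * \<bar>y1\<bar> powr \<alpha> + C2 * \<bar>y2\<bar> powr \<alpha> + C3 * \<bar>y3\<bar> powr \<alpha> + Cs;
     F * y3 \<ge> C3 * \<bar>y3\<bar> powr p - (C0 * \<bar>F\<bar> * \<bar>y0\<bar> + C1 * \<bar>F\<bar> * \<bar>y1\<bar> + C2 * \<bar>F\<bar> * \<bar>y2\<bar>)\<rbrakk>
    \<Longrightarrow> C3 / 2 * \<bar>y3\<bar> powr p \<le> F * (y3 + Z) + K1 * (1 + g1 powr p + g2 powr p)"
  proof -
    have "cutoff_const m \<kappa> \<ge> 0" using \<kappa> by (simp add: cutoff_const_def)
    from pointwise_coercivity[OF \<alpha> C this] that show thesis unfolding p_def by blast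
  qed
  \<comment> \<open>Integration over the interval of length 4\<kappa> turns K1 \<delta> E into C3 E
    / 8; the value of \<delta>' below is chosen so that 4\<kappa> \<delta>' = 1.\<close>
  define \<delta> where "\<delta> = C3 / (32 * \<kappa> * K1)"
  have \<delta>: "\<delta> > 0" using C \<kappa> K1 by (simp add: \<delta>_def)
  define \<delta>' where "\<delta>' = 1 / (4 * \<kappa>)"
  have \<delta>': "\<delta>' > 0" using \<kappa> by (simp add: \<delta>'_def)
  obtain s where s: "0 < s" "s \<le> \<kappa> / 2"
    "(24 powr p * 2 ^ m) * s powr (p - 1) + (16 powr p * 2 ^ m) * s powr (2 * p - 1) \<le> min \<delta> \<delta>'"
    using small_step_exists[of p "min \<delta> \<delta>'" \<kappa> "24 powr p * 2 ^ m" "16 powr p * 2 ^ m"] p \<delta> \<delta>' \<kappa> by auto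
  define K2 where "K2 = 32 powr p * s powr (- 2 * p) + 20 powr p * s powr (- p)"
  have K2: "K2 \<ge> 0" by (simp add: K2_def)
  have kk: "real k \<ge> p / (p - 2)" using k by (simp add: p_def)
  obtain K3 where K3: "K3 \<ge> 0" "\<And>\<sigma> y. 0 \<le> \<sigma> \<Longrightarrow> \<sigma> \<le> 1 \<Longrightarrow> 0 \<le> y \<Longrightarrow>
    real k * \<sigma> ^ (k - 1) * y\<^sup>2 \<le> C3 / 4 * \<sigma> ^ k * y powr p + K3"
    using time_weight_young[OF p kk, of "C3 / 4"] C by auto
  define K where "K = 4 * \<kappa> * K1 * (1 + K2) + 4 * \<kappa> * (C3 / 4 * K2 + K3)"
  have Kparts: "4 * \<kappa> * K1 * (1 + K2) \<le> K" "4 * \<kappa> * (C3 / 4 * K2 + K3) \<le> K" "K \<ge> 0"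
    using \<kappa> K1(1) K2 K3(1) C by (auto simp: K_def)
  have interp: "cutoff m \<kappa> x0 x * ((\<bar>f1 x\<bar> / (parab \<kappa> x0 x)\<^sup>2) powr p + (\<bar>f2 x\<bar> / parab \<kappa> x0 x) powr p)
      \<le> K2 + min \<delta> \<delta>' * integral {x0 - 2 * \<kappa>..x0 + 2 * \<kappa>} (\<lambda>y. cutoff m \<kappa> x0 y * \<bar>f3 y\<bar> powr p)"
      "0 \<le> integral {x0 - 2 * \<kappa>..x0 + 2 * \<kappa>} (\<lambda>y. cutoff m \<kappa> x0 y * \<bar>f3 y\<bar> powr p)"
    if h: "primitive (x0 - 2 * \<kappa>) (x0 + 2 * \<kappa>) f0 f1" "primitive (x0 - 2 * \<kappa>) (x0 + 2 * \<kappa>) f1 f2"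
       "primitive (x0 - 2 * \<kappa>) (x0 + 2 * \<kappa>) f2 f3" "\<And>y. y \<in> {x0 - 2 * \<kappa>..x0 + 2 * \<kappa>} \<Longrightarrow> \<bar>f0 y\<bar> \<le> 1"
       "(\<lambda>y. \<bar>f3 y\<bar> powr p) integrable_on {x0 - 2 * \<kappa>..x0 + 2 * \<kappa>}"
      and x: "x \<in> {x0 - 2 * \<kappa><..<x0 + 2 * \<kappa>}" for x0 f0 f1 f2 f3 x
  proof -
    define E where "E = integral {x0 - 2 * \<kappa>..x0 + 2 * \<kappa>} (\<lambda>y. parab \<kappa> x0 y ^ m * \<bar>f3 y\<bar> powr p)"
    note w = weighted_interpolation[OF less_imp_le[OF p] mp \<kappa> s(1,2) h x, folded E_def]
    have "((24 powr p * 2 ^ m) * s powr (p - 1) + (16 powr p * 2 ^ m) * s powr (2 * p - 1)) * E \<le> min \<delta> \<delta>' * E"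
      using s(3) w(3) by (intro mult_right_mono)
    with w(1,2) show "cutoff m \<kappa> x0 x * ((\<bar>f1 x\<bar> / (parab \<kappa> x0 x)\<^sup>2) powr p + (\<bar>f2 x\<bar> / parab \<kappa> x0 x) powr p)
      \<le> K2 + min \<delta> \<delta>' * integral {x0 - 2 * \<kappa>..x0 + 2 * \<kappa>} (\<lambda>y. cutoff m \<kappa> x0 y * \<bar>f3 y\<bar> powr p)"
      unfolding cutoff_def E_def[symmetric] K2_def by (simp add: algebra_simps)
    show "0 \<le> integral {x0 - 2 * \<kappa>..x0 + 2 * \<kappa>} (\<lambda>y. cutoff m \<kappa> x0 y * \<bar>f3 y\<bar> powr p)"
      using w(3) by (simp add: cutoff_def E_def)
  qed
  \<comment> \<open>The endpoints are removed because \<chi> vanishes there and the argument divides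
    by it.\<close>
  have endpoints: "AE x in lebesgue. x \<noteq> x0 - 2 * \<kappa> \<and> x \<noteq> x0 + 2 * \<kappa>" for x0
    by (rule AE_completion) (intro AE_conjI AE_lborel_singleton)
  show thesis
  proof (rule that[OF Kparts(3)], goal_cases)
    case (1 x0 f0 f1 f2 f3 F)
    let ?J = "{x0 - 2 * \<kappa>..x0 + 2 * \<kappa>}"
    let ?D = "\<lambda>x. F x * (cutoff m \<kappa> x0 x * f3 x + 2 * cutoff1 m \<kappa> x0 x * f2 x + cutoff2 m \<kappa> x0 x * f1 x)"
    define E where "E = integral ?J (\<lambda>y. cutoff m \<kappa> x0 y * \<bar>f3 y\<bar> powr p)"
    note h = 1(1-4) 1(5)[folded p_def]
    have E0: "E \<ge> 0" using interp(2)[OF h, of x0] \<kappa> by (simp add: E_def)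
    have i3: "(\<lambda>y. cutoff m \<kappa> x0 y * \<bar>f3 y\<bar> powr p) absolutely_integrable_on ?J"
    proof -
      have "(\<lambda>y. \<bar>f3 y\<bar> powr p) absolutely_integrable_on ?J"
        using h(5) by (intro nonnegative_absolutely_integrable_1) auto
      from absolutely_integrable_mult_continuous[OF this continuous_on_cutoff(1)] \<kappa>
      show ?thesis by (simp add: mult.commute)
    qed
    have "integral ?J (\<lambda>x. C3 / 2 * (cutoff m \<kappa> x0 x * \<bar>f3 x\<bar> powr p)) \<le> integral ?J (\<lambda>x. ?D x + K1 * (1 + (K2 + \<delta> * E)))"
    proof (rule absolutely_integral_le_AE)
      show "(\<lambda>x. C3 / 2 * (cutoff m \<kappa> x0 x * \<bar>f3 x\<bar> powr p)) absolutely_integrable_on ?J"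
        using i3 by (intro set_integrable_mult_right) auto
      show "(\<lambda>x. ?D x + K1 * (1 + (K2 + \<delta> * E))) absolutely_integrable_on ?J"
        using 1(6) by (rule set_integral_add(1)) (intro absolutely_integrable_continuous_real continuous_intros)
      show "AE x in lebesgue. x \<in> ?J \<longrightarrow> C3 / 2 * (cutoff m \<kappa> x0 x * \<bar>f3 x\<bar> powr p) \<le> ?D x + K1 * (1 + (K2 + \<delta> * E))"
        using 1(7) endpoints[of x0]
      proof eventually_elim
        case (elim x)
        show ?case
        proof
          assume xJ: "x \<in> ?J"
          then have x: "x \<in> {x0 - 2 * \<kappa><..<x0 + 2 * \<kappa>}" using elim(2) by auto
          define X where "X = parab \<kappa> x0 x"
          have X: "0 < X" "X \<le> 1" using parab_pos_iff[OF \<kappa>] x parab_le_1 by (auto simp: X_def)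
          define P where "P = cutoff m \<kappa> x0 x"
          have P: "0 < P" "P \<le> 1" using X cutoff_bounds[OF \<kappa> xJ, of m] by (auto simp: P_def cutoff_def X_def)
          define g1 g2 where "g1 = \<bar>f1 x\<bar> / X\<^sup>2" and "g2 = \<bar>f2 x\<bar> / X"
          \<comment> \<open>Dividing the cutoff terms by the weight \<open>P\<close> lets the
            pointwise inequality be applied to the unweighted quantities and multiplied by
            \<open>P\<close> afterwards.\<close>
          define Z where "Z = (2 * cutoff1 m \<kappa> x0 x * f2 x + cutoff2 m \<kappa> x0 x * f1 x) / P"
          have "X\<^sup>2 \<le> 1" using X by (simp add: power_le_one)
          then have g: "\<bar>f1 x\<bar> \<le> g1" "\<bar>f2 x\<bar> \<le> g2"
            using X unfolding g1_def g2_def by (auto simp: field_simps mult_left_le mult_left_le_one_le)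
          have "\<bar>Z\<bar> = \<bar>2 * cutoff1 m \<kappa> x0 x * f2 x + cutoff2 m \<kappa> x0 x * f1 x\<bar> / P"
            using P by (simp add: Z_def abs_divide)
          also have "\<dots> \<le> cutoff_const m \<kappa> * (g1 + g2)"
            using cutoff_terms_bound[OF \<kappa> x m3, of "f2 x" "f1 x"] P
            by (simp add: P_def g1_def g2_def X_def divide_le_eq mult_ac)
          finally have Z: "\<bar>Z\<bar> \<le> cutoff_const m \<kappa> * (g1 + g2)" .
          have st: "C3 / 2 * \<bar>f3 x\<bar> powr p \<le> F x * (f3 x + Z) + K1 * (1 + g1 powr p + g2 powr p)"
            using elim(1) xJ 1(4)[OF xJ] g Z by (intro K1(2)[of "f0 x" "f1 x" g1 "f2 x" g2]) (auto simp: p_def)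
          have ip: "P * (g1 powr p + g2 powr p) \<le> K2 + \<delta> * E"
          proof -
            have "P * (g1 powr p + g2 powr p) \<le> K2 + min \<delta> \<delta>' * E"
              using interp(1)[OF h x] by (simp add: P_def g1_def g2_def X_def E_def)
            also have "\<dots> \<le> K2 + \<delta> * E" using E0 by (intro add_left_mono mult_right_mono) auto
            finally show ?thesis .
          qed
          have "C3 / 2 * (P * \<bar>f3 x\<bar> powr p) = P * (C3 / 2 * \<bar>f3 x\<bar> powr p)" by simp
          also have "\<dots> \<le> P * (F x * (f3 x + Z) + K1 * (1 + g1 powr p + g2 powr p))"
            using st P by (intro mult_left_mono) auto
          also have "\<dots> = F x * (P * f3 x + P * Z) + K1 * (P + P * (g1 powr p + g2 powr p))"
            by (simp add: algebra_simps)
          also have "P * Z = 2 * cutoff1 m \<kappa> x0 x * f2 x + cutoff2 m \<kappa> x0 x * f1 x"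
            using P by (simp add: Z_def)
          also have "K1 * (P + P * (g1 powr p + g2 powr p)) \<le> K1 * (1 + (K2 + \<delta> * E))"
            using ip P K1(1) by (intro mult_left_mono add_mono) auto
          finally show "C3 / 2 * (cutoff m \<kappa> x0 x * \<bar>f3 x\<bar> powr p) \<le> ?D x + K1 * (1 + (K2 + \<delta> * E))"
            by (simp add: P_def add.assoc)
        qed
      qed
    qed
    also have "integral ?J (\<lambda>x. ?D x + K1 * (1 + (K2 + \<delta> * E))) = integral ?J ?D + 4 * \<kappa> * (K1 * (1 + (K2 + \<delta> * E)))"
      using set_lebesgue_integral_eq_integral(1)[OF 1(6)] \<kappa>
      by (subst Henstock_Kurzweil_Integration.integral_add) auto
    also have "4 * \<kappa> * (K1 * (1 + (K2 + \<delta> * E))) = 4 * \<kappa> * K1 * (1 + K2) + C3 / 8 * E"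
      using \<kappa> K1(1) by (simp add: \<delta>_def divide_simps) (simp add: algebra_simps)
    also have "integral ?J (\<lambda>x. C3 / 2 * (cutoff m \<kappa> x0 x * \<bar>f3 x\<bar> powr p)) = C3 / 2 * E"
      unfolding E_def by (rule integral_mult_right)
    finally have "C3 / 2 * E \<le> integral ?J ?D + (4 * \<kappa> * K1 * (1 + K2) + C3 / 8 * E)" .
    then have "3 / 8 * C3 * E \<le> integral ?J ?D + K" using Kparts(1) by simp
    then show ?case by (simp add: E_def p_def)
  next
    case (2 x0 f0 f1 f2 f3 \<sigma>)
    let ?J = "{x0 - 2 * \<kappa>..x0 + 2 * \<kappa>}"
    define E where "E = integral ?J (\<lambda>y. cutoff m \<kappa> x0 y * \<bar>f3 y\<bar> powr p)"
    note h = 2(1-4) 2(5)[folded p_def]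
    have E0: "E \<ge> 0" using interp(2)[OF h, of x0] \<kappa> by (simp add: E_def)
    have c1: "continuous_on ?J f1" using primitive_continuous_on[OF h(2)] .
    have "integral ?J (\<lambda>x. real k * \<sigma> ^ (k - 1) * (cutoff m \<kappa> x0 x * (f1 x)\<^sup>2))
        \<le> integral ?J (\<lambda>x. C3 / 4 * \<sigma> ^ k * (K2 + \<delta>' * E) + K3)"
    proof (rule absolutely_integral_le_AE)
      show "(\<lambda>x. real k * \<sigma> ^ (k - 1) * (cutoff m \<kappa> x0 x * (f1 x)\<^sup>2)) absolutely_integrable_on ?J"
        using c1 continuous_on_cutoff(1)[of \<kappa> ?J m x0] \<kappa>
        by (intro absolutely_integrable_continuous_real continuous_intros) auto
      show "(\<lambda>x. C3 / 4 * \<sigma> ^ k * (K2 + \<delta>' * E) + K3) absolutely_integrable_on ?J"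
        by (intro absolutely_integrable_continuous_real continuous_intros)
      show "AE x in lebesgue. x \<in> ?J \<longrightarrow> real k * \<sigma> ^ (k - 1) * (cutoff m \<kappa> x0 x * (f1 x)\<^sup>2) \<le> C3 / 4 * \<sigma> ^ k * (K2 + \<delta>' * E) + K3"
        using endpoints[of x0]
      proof eventually_elim
        case (elim x)
        show ?case
        proof
          assume xJ: "x \<in> ?J"
          then have x: "x \<in> {x0 - 2 * \<kappa><..<x0 + 2 * \<kappa>}" using elim by auto
          define X where "X = parab \<kappa> x0 x"
          have X: "0 < X" "X \<le> 1" using parab_pos_iff[OF \<kappa>] x parab_le_1 by (auto simp: X_def)
          define P where "P = cutoff m \<kappa> x0 x"
          have P: "0 \<le> P" "P \<le> 1" using cutoff_bounds[OF \<kappa> xJ, of m] by (auto simp: P_def)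
          have "X\<^sup>2 \<le> 1" using X by (simp add: power_le_one)
          then have "\<bar>f1 x\<bar> \<le> \<bar>f1 x\<bar> / X\<^sup>2" using X by (simp add: field_simps mult_left_le)
          then have "P * \<bar>f1 x\<bar> powr p \<le> P * (\<bar>f1 x\<bar> / X\<^sup>2) powr p"
            using P p by (intro mult_left_mono powr_mono2) auto
          also have "\<dots> \<le> P * ((\<bar>f1 x\<bar> / X\<^sup>2) powr p + (\<bar>f2 x\<bar> / X) powr p)"
            using P by (intro mult_left_mono) auto
          also have "\<dots> \<le> K2 + min \<delta> \<delta>' * E"
            using interp(1)[OF h x] by (simp add: P_def X_def E_def)
          also have "\<dots> \<le> K2 + \<delta>' * E" using E0 by (intro add_left_mono mult_right_mono) auto
          finally have ip: "P * \<bar>f1 x\<bar> powr p \<le> K2 + \<delta>' * E" .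
          have "real k * \<sigma> ^ (k - 1) * (P * (f1 x)\<^sup>2) = P * (real k * \<sigma> ^ (k - 1) * \<bar>f1 x\<bar>\<^sup>2)" by simp
          also have "\<dots> \<le> P * (C3 / 4 * \<sigma> ^ k * \<bar>f1 x\<bar> powr p + K3)"
            using P 2(6,7) by (intro mult_left_mono K3(2)) auto
          also have "\<dots> = C3 / 4 * \<sigma> ^ k * (P * \<bar>f1 x\<bar> powr p) + P * K3" by (simp add: algebra_simps)
          also have "\<dots> \<le> C3 / 4 * \<sigma> ^ k * (K2 + \<delta>' * E) + 1 * K3"
            using ip P C 2(6) K3(1) by (intro add_mono mult_left_mono mult_right_mono) auto
          finally show "real k * \<sigma> ^ (k - 1) * (cutoff m \<kappa> x0 x * (f1 x)\<^sup>2) \<le> C3 / 4 * \<sigma> ^ k * (K2 + \<delta>' * E) + K3"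
            by (simp add: P_def)
        qed
      qed
    qed
    also have "\<dots> = C3 / 4 * \<sigma> ^ k * E + 4 * \<kappa> * (C3 / 4 * \<sigma> ^ k * K2 + K3)"
      using \<kappa> by (simp add: \<delta>'_def field_simps)
    also have "\<dots> \<le> C3 / 4 * \<sigma> ^ k * E + 4 * \<kappa> * (C3 / 4 * 1 * K2 + K3)"
      using \<kappa> C K2 2(6,7) by (intro add_left_mono mult_left_mono add_right_mono mult_right_mono) (auto simp: power_le_one)
    also have "\<dots> \<le> C3 / 4 * \<sigma> ^ k * E + K" using Kparts(2) by simp
    finally show ?case by (simp add: E_def p_def)
  qed
qed

section \<open>Mollification in time\<close>

lemma lborel_integral_supported:
  fixes f :: "real \<Rightarrow> real"
  assumes "continuous_on UNIV f" "\<And>x. x \<notin> {c..d} \<Longrightarrow> f x = 0"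
  shows "integrable lborel f" "(LBINT x. f x) = integral {c..d} f"
proof -
  have s: "set_integrable lborel {c..d} f"
    using assms(1) by (intro borel_integrable_atLeastAtMost') (auto intro: continuous_on_subset)
  have e: "(\<lambda>x. indicator {c..d} x *\<^sub>R f x) = f"
    using assms(2) by (auto simp: indicator_def fun_eq_iff)
  show "integrable lborel f" using s unfolding set_integrable_def e .
  show "(LBINT x. f x) = integral {c..d} f"
    using set_borel_integral_eq_integral(2)[OF s] unfolding set_lebesgue_integral_def e .
qed

text \<open>A normalised \<open>bump\<close> on [-1,1]. It is even because reflection exchanges the
  two factors of \<open>bump\<close>, and the first moment of its derivative follows from its mass
  by parts.\<close>

lemma mollifier_exists:
  obtains \<rho> :: "real \<Rightarrow> real" where "smooth \<rho>" "\<And>x. x \<notin> {-1..1} \<Longrightarrow> \<rho> x = 0" "\<And>x. 0 \<le> \<rho> x"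
    "\<And>x. deriv \<rho> (- x) = - deriv \<rho> x" "\<And>x. x > 0 \<Longrightarrow> deriv \<rho> x \<le> 0"
    "\<And>x. x \<notin> {-1..1} \<Longrightarrow> deriv \<rho> x = 0"
    "(LBINT x. \<rho> x) = 1" "(LBINT x. x * deriv \<rho> x) = -1"
proof -
  define I where "I = integral {-1..1} (bump (-1) 1 1)"
  have I: "I > 0" unfolding I_def by (intro bump_integral_pos) simp
  define \<rho> where "\<rho> = (\<lambda>x. (1 / I) * bump (-1) 1 1 x)"
  have sm: "smooth \<rho>" unfolding \<rho>_def by (intro smooth_mult smooth_const smooth_bump)
  have supp: "\<rho> x = 0" if "x \<notin> {-1<..<1}" for x
    using bump_nonzeroD[of "-1" 1 1 x] that by (auto simp: \<rho>_def)
  have supp': "\<rho> x = 0" if "x \<notin> {-1..1}" for x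
    using that by (intro supp) auto
  have d: "(\<rho> has_real_derivative deriv \<rho> x) (at x)" for x by (rule smooth_imp_deriv[OF sm])
  have even: "\<rho> (- x) = \<rho> x" for x by (simp add: \<rho>_def bump_def mult.commute add.commute)
  have odd: "deriv \<rho> (- x) = - deriv \<rho> x" for x
  proof -
    have "((\<lambda>x. \<rho> (- x)) has_real_derivative deriv \<rho> (- x) * (- 1)) (at x)"
      by (rule DERIV_chain2[OF d]) (auto intro!: derivative_eq_intros)
    then have "(\<rho> has_real_derivative - deriv \<rho> (- x)) (at x)" by (simp add: even)
    then show ?thesis using DERIV_unique[OF d] by fastforce
  qed
  have dsupp: "deriv \<rho> x = 0" if "x \<notin> {-1..1}" for x
    using deriv_zero_outside[of \<rho> "-1" 1 x] supp' that by blast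
  \<comment> \<open>On (0,1) the bump equals exp(-2/(1 - x^2)), which decreases; a positive
    derivative would force an increase to the right of x.\<close>
  have neg: "deriv \<rho> x \<le> 0" if x: "x > 0" for x
  proof (rule ccontr)
    assume "\<not> deriv \<rho> x \<le> 0"
    then have pos: "deriv \<rho> x > 0" by simp
    obtain e where e: "e > 0" "\<And>h. 0 < h \<Longrightarrow> h < e \<Longrightarrow> \<rho> x < \<rho> (x + h)"
      using DERIV_pos_inc_right[OF d pos] by blast
    define h where "h = e / 2"
    have "\<rho> x < \<rho> (x + h)" using e by (intro e(2)) (auto simp: h_def)
    moreover have "\<rho> (x + h) \<le> \<rho> x"
    proof (cases "x + h < 1")
      case True
      have h: "h > 0" using e by (simp add: h_def)
      have b: "bump (-1) 1 1 y = exp (- (2 / (1 - y\<^sup>2)))" if "0 < y" "y < 1" for y :: real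
      proof -
        have y: "1 + y > 0" "1 - y > 0" "1 - y\<^sup>2 > 0" using that by (auto simp: power_less_one_iff abs_square_less_1)
        have "1 / (1 + y) + 1 / (1 - y) = 2 / (1 - y\<^sup>2)"
          using y by (simp add: field_simps power2_eq_square)
        then show ?thesis using y
          by (simp add: bump_def flat_exp_def add.commute flip: exp_add minus_add_distrib)
      qed
      have "(x + h)\<^sup>2 \<ge> x\<^sup>2" "(x + h)\<^sup>2 < 1" "x\<^sup>2 < 1"
        using x h True by (auto intro!: power_mono simp: power_less_one_iff abs_square_less_1)
      then have "2 / (1 - x\<^sup>2) \<le> 2 / (1 - (x + h)\<^sup>2)" by (intro divide_left_mono mult_pos_pos) auto
      then have "bump (-1) 1 1 (x + h) \<le> bump (-1) 1 1 x" using b[of x] b[of "x + h"] x h True by simp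
      then show ?thesis using I by (simp add: \<rho>_def divide_right_mono)
    next
      case False
      then have "\<rho> (x + h) = 0" by (intro supp) auto
      then show ?thesis using I bump_bounds(1)[of "-1" 1 1 x] by (simp add: \<rho>_def)
    qed
    ultimately show False by simp
  qed
  have c: "continuous_on S \<rho>" "continuous_on S (deriv \<rho>)" for S
    using smooth_continuous_on[OF sm] smooth_continuous_on[OF smooth_deriv[OF sm]] by auto
  have int1: "integral {-1..1} \<rho> = 1"
    using I by (simp add: \<rho>_def I_def)
  have p: "primitive (-1) 1 \<rho> (deriv \<rho>)" by (intro primitive_C1 d c)
  have pid: "primitive (-1) 1 (\<lambda>x. x) (\<lambda>x. 1)" by (intro primitive_C1) (auto intro!: derivative_eq_intros)
  have "\<rho> (-1) = 0" "\<rho> 1 = 0" by (auto intro!: supp)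
  then have "integral {-1..1} (\<lambda>x. 1 * \<rho> x) = - integral {-1..1} (\<lambda>x. x * deriv \<rho> x)"
    by (intro primitive_by_parts[OF pid p]) auto
  with int1 have int2: "integral {-1..1} (\<lambda>x. x * deriv \<rho> x) = -1" by simp
  have L1: "(LBINT x. \<rho> x) = 1"
    using lborel_integral_supported(2)[OF c(1) supp'] int1 by simp
  have L2: "(LBINT x. x * deriv \<rho> x) = -1"
  proof -
    have "continuous_on UNIV (\<lambda>x. x * deriv \<rho> x)" using c(2) by (intro continuous_intros)
    from lborel_integral_supported(2)[OF this, of "-1" 1] int2 dsupp show ?thesis by simp
  qed
  have "\<rho> x \<ge> 0" for x using I bump_bounds(1)[of "-1" 1 1 x] by (simp add: \<rho>_def)
  then show thesis using that[OF sm supp' _ odd neg dsupp L1 L2] by blast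
qed

section \<open>Fubini for pairings averaged over time shifts\<close>

lemma pairing_integrable:
  fixes P Q :: "real \<times> real \<Rightarrow> real"
  assumes [measurable]: "P \<in> borel_measurable borel" "Q \<in> borel_measurable borel"
    and pq: "p > 1" "q > 1" "1/p + 1/q = 1"
    and P: "integrable lborel (\<lambda>z. \<bar>P z\<bar> powr q)" and Q: "integrable lborel (\<lambda>z. \<bar>Q z\<bar> powr p)"
  shows "integrable lborel (\<lambda>z. P (z + h) * Q z)"
    "(\<integral>z. \<bar>P (z + h) * Q z\<bar> \<partial>lborel) \<le> (\<integral>z. \<bar>P z\<bar> powr q \<partial>lborel) + (\<integral>z. \<bar>Q z\<bar> powr p \<partial>lborel)"
proof -
  have P': "integrable lborel (\<lambda>z. \<bar>P (z + h)\<bar> powr q)"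
    using lborel_integral_shift(2)[OF P] .
  have b: "\<bar>P (z + h) * Q z\<bar> \<le> \<bar>P (z + h)\<bar> powr q + \<bar>Q z\<bar> powr p" for z
    using young_scaled[OF pq, of "\<bar>P (z + h)\<bar>" "\<bar>Q z\<bar>" 1] by (simp add: abs_mult)
  show i: "integrable lborel (\<lambda>z. P (z + h) * Q z)"
    by (rule Bochner_Integration.integrable_bound[OF Bochner_Integration.integrable_add[OF P' Q]])
       (use b in \<open>auto intro!: AE_I2 intro: order_trans[OF _ abs_ge_self]\<close>)
  have "(\<integral>z. \<bar>P (z + h) * Q z\<bar> \<partial>lborel) \<le> (\<integral>z. \<bar>P (z + h)\<bar> powr q + \<bar>Q z\<bar> powr p \<partial>lborel)"
    using b i P' Q by (intro integral_mono) auto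
  also have "\<dots> = (\<integral>z. \<bar>P z\<bar> powr q \<partial>lborel) + (\<integral>z. \<bar>Q z\<bar> powr p \<partial>lborel)"
    using P' Q lborel_integral_shift(1)[of "\<lambda>z. \<bar>P z\<bar> powr q" h] by simp
  finally show "(\<integral>z. \<bar>P (z + h) * Q z\<bar> \<partial>lborel) \<le> (\<integral>z. \<bar>P z\<bar> powr q \<partial>lborel) + (\<integral>z. \<bar>Q z\<bar> powr p \<partial>lborel)" .
qed

text \<open>The bound on the pairing by the L_q and L_p integrals is independent of the shift, which
  gives joint integrability in (y,t); after integration in time only the dependence on the shift is
  left, through \<Phi>.\<close>

lemma mollified_pairing_fubini:
  fixes P Q :: "real \<times> real \<Rightarrow> real" and g :: "real \<Rightarrow> real"
  assumes [measurable]: "P \<in> borel_measurable borel" "Q \<in> borel_measurable borel"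
    and pq: "p > 1" "q > 1" "1/p + 1/q = 1"
    and P: "integrable lborel (\<lambda>z. \<bar>P z\<bar> powr q)" and Q: "integrable lborel (\<lambda>z. \<bar>Q z\<bar> powr p)"
    and g: "integrable lborel g"
  defines "\<Phi> \<equiv> \<lambda>h. \<integral>z. P (z + (- h, 0)) * Q z \<partial>lborel"
  shows "integrable lborel (\<lambda>t. LBINT y. g y * (LBINT x. P (t - \<epsilon> * y, x) * Q (t, x)))"
    and "(LBINT t. LBINT y. g y * (LBINT x. P (t - \<epsilon> * y, x) * Q (t, x))) = (LBINT y. g y * \<Phi> (\<epsilon> * y))"
    and "integrable lborel (\<lambda>y. g y * \<Phi> (\<epsilon> * y))"
proof -
  note [measurable] = borel_measurable_integrable[OF g]
  have [measurable]: "P \<in> borel_measurable (borel \<Otimes>\<^sub>M borel)" "Q \<in> borel_measurable (borel \<Otimes>\<^sub>M borel)"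
    using assms(1,2) by (simp_all add: borel_prod)
  define M where "M = (\<integral>z. \<bar>P z\<bar> powr q \<partial>lborel) + (\<integral>z. \<bar>Q z\<bar> powr p \<partial>lborel)"
  define H where "H = (\<lambda>y t. LBINT x. P (t - \<epsilon> * y, x) * Q (t, x))"
  have pi: "integrable (lborel \<Otimes>\<^sub>M lborel) (\<lambda>z. P (z + (- (\<epsilon> * y), 0)) * Q z)" for y
    using pairing_integrable(1)[OF assms(1,2) pq P Q] by (simp add: lborel_prod)
  have e: "P ((t, x) + (- (\<epsilon> * y), 0)) * Q (t, x) = P (t - \<epsilon> * y, x) * Q (t, x)" for t x y by simp
  have Hi: "integrable lborel (H y)" for y
    using lborel_pair.integrable_fst'[OF pi[of y]] unfolding H_def e .
  have H\<Phi>: "(LBINT t. H y t) = \<Phi> (\<epsilon> * y)" for y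
    using lborel_pair.integral_fst'[OF pi[of y]] unfolding H_def \<Phi>_def e lborel_prod .
  have Hb: "(LBINT t. \<bar>H y t\<bar>) \<le> M" for y
  proof -
    have ni: "integrable (lborel \<Otimes>\<^sub>M lborel) (\<lambda>z. \<bar>P (z + (- (\<epsilon> * y), 0)) * Q z\<bar>)"
      using pi[of y] by (rule integrable_abs)
    have "(LBINT t. \<bar>H y t\<bar>) \<le> (LBINT t. LBINT x. \<bar>P (t - \<epsilon> * y, x) * Q (t, x)\<bar>)"
    proof (rule integral_mono)
      show "integrable lborel (\<lambda>t. \<bar>H y t\<bar>)" using Hi by (rule integrable_abs)
      show "integrable lborel (\<lambda>t. LBINT x. \<bar>P (t - \<epsilon> * y, x) * Q (t, x)\<bar>)"
        using lborel_pair.integrable_fst'[OF ni] unfolding e .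
      show "\<bar>H y t\<bar> \<le> (LBINT x. \<bar>P (t - \<epsilon> * y, x) * Q (t, x)\<bar>)" for t
        unfolding H_def by (rule integral_abs_bound)
    qed
    also have "\<dots> = (\<integral>z. \<bar>P (z + (- (\<epsilon> * y), 0)) * Q z\<bar> \<partial>lborel)"
      using lborel_pair.integral_fst'[OF ni] unfolding e lborel_prod .
    also have "\<dots> \<le> M" unfolding M_def by (rule pairing_integrable(2)[OF assms(1,2) pq P Q])
    finally show ?thesis .
  qed
  have Hm[measurable]: "(\<lambda>(y, t). H y t) \<in> borel_measurable (lborel \<Otimes>\<^sub>M lborel)"
    unfolding H_def by measurable
  have gH: "integrable (lborel \<Otimes>\<^sub>M lborel) (\<lambda>(y, t). g y * H y t)"
  proof (rule lborel_pair.Fubini_integrable)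
    show "integrable lborel (\<lambda>y. LBINT t. norm (case (y, t) of (y, t) \<Rightarrow> g y * H y t))"
    proof (rule Bochner_Integration.integrable_bound[where f="\<lambda>y. M * g y"])
      show "integrable lborel (\<lambda>y. M * g y)" using g by (rule integrable_mult_right)
      show "AE y in lborel. norm (LBINT t. norm (case (y, t) of (y, t) \<Rightarrow> g y * H y t)) \<le> norm (M * g y)"
      proof (rule AE_I2)
        fix y
        have "(LBINT t. norm (case (y, t) of (y, t) \<Rightarrow> g y * H y t)) = \<bar>g y\<bar> * (LBINT t. \<bar>H y t\<bar>)"
          by (simp add: abs_mult)
        moreover have "0 \<le> (LBINT t. \<bar>H y t\<bar>)" by simp
        ultimately show "norm (LBINT t. norm (case (y, t) of (y, t) \<Rightarrow> g y * H y t)) \<le> norm (M * g y)"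
          using mult_left_mono[OF order_trans[OF Hb[of y] abs_ge_self], of "\<bar>g y\<bar>"] by (simp add: abs_mult mult.commute)
      qed
    qed measurable
    show "AE y in lborel. integrable lborel (\<lambda>t. case (y, t) of (y, t) \<Rightarrow> g y * H y t)"
      using Hi by (intro AE_I2) auto
  qed measurable
  have H': "(LBINT y. g y * (LBINT x. P (t - \<epsilon> * y, x) * Q (t, x))) = (LBINT y. g y * H y t)" for t
    by (simp add: H_def)
  show "integrable lborel (\<lambda>t. LBINT y. g y * (LBINT x. P (t - \<epsilon> * y, x) * Q (t, x)))"
    unfolding H' using lborel_pair.integrable_snd[OF gH] .
  show "(LBINT t. LBINT y. g y * (LBINT x. P (t - \<epsilon> * y, x) * Q (t, x))) = (LBINT y. g y * \<Phi> (\<epsilon> * y))"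
    unfolding H' using lborel_pair.Fubini_integral[OF gH] by (simp add: H\<Phi>)
  show "integrable lborel (\<lambda>y. g y * \<Phi> (\<epsilon> * y))"
    using lborel_pair.integrable_fst'[OF gH] by (simp add: H\<Phi>)
qed

text \<open>Averaging in time keeps the total integral of \<open>n\<close>, which is why the source
  enters the final bound with its L_1 norm in time and no factor depending on \<epsilon>.\<close>

lemma mollified_mass:
  fixes n \<rho> :: "real \<Rightarrow> real"
  assumes n: "integrable lborel n" and \<rho>: "integrable lborel \<rho>"
  shows "integrable lborel (\<lambda>t. LBINT y. \<rho> y * n (t - \<epsilon> * y))"
    "(LBINT t. LBINT y. \<rho> y * n (t - \<epsilon> * y)) = (LBINT y. \<rho> y) * (LBINT t. n t)"
proof -
  note [measurable] = borel_measurable_integrable[OF n] borel_measurable_integrable[OF \<rho>]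
  have sh: "integrable lborel (\<lambda>t. n (t - \<epsilon> * y))" "(LBINT t. n (t - \<epsilon> * y)) = (LBINT t. n t)"
    "(LBINT t. \<bar>n (t - \<epsilon> * y)\<bar>) = (LBINT t. \<bar>n t\<bar>)" for y
    using lborel_integral_shift(2)[OF n, of "- (\<epsilon> * y)"] lborel_integral_shift(1)[of n "- (\<epsilon> * y)"]
      lborel_integral_shift(1)[of "\<lambda>t. \<bar>n t\<bar>" "- (\<epsilon> * y)"] by simp_all
  have i: "integrable (lborel \<Otimes>\<^sub>M lborel) (\<lambda>(y, t). \<rho> y * n (t - \<epsilon> * y))"
    by (rule lborel_pair.Fubini_integrable) (use sh \<rho> in \<open>auto simp: abs_mult\<close>)
  show "integrable lborel (\<lambda>t. LBINT y. \<rho> y * n (t - \<epsilon> * y))"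
    using lborel_pair.integrable_snd[OF i] .
  show "(LBINT t. LBINT y. \<rho> y * n (t - \<epsilon> * y)) = (LBINT y. \<rho> y) * (LBINT t. n t)"
    using lborel_pair.Fubini_integral[OF i] by (simp add: sh)
qed

text \<open>Oddness of \<open>\<rho>'\<close> turns \<open>b(h)\<close> into \<open>b(h) - b(-h)\<close>, in which the time
  difference falls on the weight \<open>\<eta>\<close>. This replaces the chain rule for the time derivative
  of the energy, without any differentiability of \<open>w\<close> in time.\<close>

lemma mollified_energy_inequality:
  fixes w F U :: "real \<times> real \<Rightarrow> real" and \<eta> lam n \<rho> :: "real \<Rightarrow> real"
  assumes meas[measurable]: "w \<in> borel_measurable borel" "F \<in> borel_measurable borel" "U \<in> borel_measurable borel"
      "\<eta> \<in> borel_measurable borel" "lam \<in> borel_measurable borel"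
    and pq: "p > 1" "q > 1" "1/p + 1/q = 1"
    and w: "integrable lborel (\<lambda>z. (w z)\<^sup>2)" and F: "integrable lborel (\<lambda>z. \<bar>F z\<bar> powr q)"
    and U: "integrable lborel (\<lambda>z. \<bar>U z\<bar> powr p)"
    and \<eta>: "\<And>t. 0 \<le> \<eta> t" "\<And>t. \<eta> t \<le> 1"
    and lip: "\<And>t h. \<bar>\<eta> t - \<eta> (t - h)\<bar> \<le> Lip * \<bar>h\<bar>"
    and lam: "\<And>t. 0 \<le> lam t" "\<And>t. lam t \<le> Lb" "\<And>t h. h > 0 \<Longrightarrow> \<eta> t - \<eta> (t - h) \<le> h * lam t"
    and n: "integrable lborel n" "\<And>t. 0 \<le> n t"
    and \<rho>: "smooth \<rho>" "\<And>x. x \<notin> {-1..1} \<Longrightarrow> \<rho> x = 0" "\<And>x. 0 \<le> \<rho> x"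
      "\<And>x. deriv \<rho> (- x) = - deriv \<rho> x" "\<And>x. x > 0 \<Longrightarrow> deriv \<rho> x \<le> 0"
      "\<And>x. x \<notin> {-1..1} \<Longrightarrow> deriv \<rho> x = 0"
      "(LBINT x. \<rho> x) = 1" "(LBINT x. x * deriv \<rho> x) = -1"
    and \<epsilon>0: "\<epsilon>0 > 0"
    and eqn: "\<And>\<epsilon>. 0 < \<epsilon> \<Longrightarrow> \<epsilon> < \<epsilon>0 \<Longrightarrow> AE t in lborel. \<eta> t \<noteq> 0 \<longrightarrow>
       \<bar>(LBINT y. \<rho> y * (LBINT x. F (t - \<epsilon> * y, x) * U (t, x)))
         + (LBINT y. deriv \<rho> y * (LBINT x. w (t - \<epsilon> * y, x) * w (t, x))) / \<epsilon>\<bar>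
       \<le> (LBINT y. \<rho> y * n (t - \<epsilon> * y))"
  shows "(\<integral>z. \<eta> (fst z) * (F z * U z) \<partial>lborel)
      \<le> 1 / 2 * (\<integral>z. lam (fst z) * (w z)\<^sup>2 \<partial>lborel) + (LBINT t. n t)"
proof -
  have fst_m[measurable]: "fst \<in> borel_measurable (borel :: (real \<times> real) measure)"
    by (intro borel_measurable_continuous_onI continuous_intros)
  define \<eta>U \<eta>w where "\<eta>U = (\<lambda>z. \<eta> (fst z) * U z)" and "\<eta>w = (\<lambda>z. \<eta> (fst z) * w z)"
  have [measurable]: "\<eta>U \<in> borel_measurable borel" "\<eta>w \<in> borel_measurable borel"
    unfolding \<eta>U_def \<eta>w_def by measurable
  have two: "(2::real) > 1" "1 / (2::real) + 1 / 2 = 1" by auto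
  have p2: "\<bar>y\<bar> powr 2 = y\<^sup>2" for y :: real by (cases "y = 0") auto
  have w2: "integrable lborel (\<lambda>z. \<bar>w z\<bar> powr 2)" using w by (simp add: p2)
  have \<eta>w2: "integrable lborel (\<lambda>z. \<bar>\<eta>w z\<bar> powr 2)"
  proof (rule Bochner_Integration.integrable_bound[OF w])
    show "AE z in lborel. norm (\<bar>\<eta>w z\<bar> powr 2) \<le> norm ((w z)\<^sup>2)"
      using \<eta> by (intro AE_I2) (auto simp: p2 \<eta>w_def power_mult_distrib mult_left_le_one_le power_le_one)
  qed (simp add: p2)
  have \<eta>Up: "integrable lborel (\<lambda>z. \<bar>\<eta>U z\<bar> powr p)"
  proof (rule Bochner_Integration.integrable_bound[OF U])
    show "AE z in lborel. norm (\<bar>\<eta>U z\<bar> powr p) \<le> norm (\<bar>U z\<bar> powr p)"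
      using \<eta> pq by (intro AE_I2) (auto simp: \<eta>U_def abs_mult mult_left_le_one_le intro!: powr_mono2)
  qed simp
  define f b where "f = (\<lambda>h. \<integral>z. F (z + (- h, 0)) * \<eta>U z \<partial>lborel)"
    and "b = (\<lambda>h. \<integral>z. w (z + (- h, 0)) * \<eta>w z \<partial>lborel)"
  have \<rho>i: "integrable lborel \<rho>" "integrable lborel (deriv \<rho>)"
    using \<rho>(2,6) smooth_continuous_on[OF \<rho>(1)] smooth_continuous_on[OF smooth_deriv[OF \<rho>(1)]]
    by (auto intro: lborel_integral_supported(1)[of _ "-1" 1])
  have fh: "f h = (\<integral>z. F (z + (- h, 0)) * \<eta>U z \<partial>lborel)" and bh: "b h = (\<integral>z. w (z + (- h, 0)) * \<eta>w z \<partial>lborel)" for h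
    by (simp_all add: f_def b_def)
  note fubF = mollified_pairing_fubini[OF \<open>F \<in> _\<close> \<open>\<eta>U \<in> _\<close> pq F \<eta>Up \<rho>i(1), folded fh]
  note fubw = mollified_pairing_fubini[OF \<open>w \<in> _\<close> \<open>\<eta>w \<in> _\<close> two(1) two(1) two(2) w2 \<eta>w2 \<rho>i(2), folded bh]
  define L where "L = (\<integral>z. lam (fst z) * (w z)\<^sup>2 \<partial>lborel)"
  have Li: "integrable lborel (\<lambda>z. lam (fst z) * (w z)\<^sup>2)"
  proof (rule Bochner_Integration.integrable_bound[OF integrable_mult_right[OF w, of Lb]])
    show "AE z in lborel. norm (lam (fst z) * (w z)\<^sup>2) \<le> norm (Lb * (w z)\<^sup>2)"
      using lam(1,2) by (intro AE_I2) (auto simp: abs_mult intro!: mult_right_mono order_trans[OF lam(2) abs_ge_self])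
  qed measurable
  have f0: "f 0 = (\<integral>z. \<eta> (fst z) * (F z * U z) \<partial>lborel)"
    unfolding f_def \<eta>U_def by (intro Bochner_Integration.integral_cong) (auto simp: zero_prod_def[symmetric])
  have Lip0: "Lip \<ge> 0" using lip[of 0 1] by simp
  have main: "f 0 \<le> 1 / 2 * L + (LBINT t. n t) + 2 * \<delta>" if \<delta>: "\<delta> > 0" for \<delta>
  proof -
    obtain \<delta>1 where \<delta>1: "\<delta>1 > 0" "\<And>h. norm h < \<delta>1 \<Longrightarrow> (\<integral>z. \<bar>F (z + h) - F z\<bar> * \<bar>\<eta>U z\<bar> \<partial>lborel) < \<delta>"
      using translation_continuous_pairing(2)[OF \<open>F \<in> _\<close> \<open>\<eta>U \<in> _\<close> pq F \<eta>Up \<delta>] by blast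
    \<comment> \<open>The error from translating w carries the Lipschitz constant of \<eta>; the
      division compensates it, and the added 1 covers Lip = 0.\<close>
    have \<delta>': "\<delta> / (Lip + 1) > 0" using \<delta> Lip0 by simp
    obtain \<delta>2 where \<delta>2: "\<delta>2 > 0" "\<And>h. norm h < \<delta>2 \<Longrightarrow> (\<integral>z. \<bar>w (z + h) - w z\<bar> * \<bar>w z\<bar> \<partial>lborel) < \<delta> / (Lip + 1)"
      using translation_continuous_pairing(2)[OF \<open>w \<in> _\<close> \<open>w \<in> _\<close> two(1) two(1) two(2) w2 w2 \<delta>'] by blast
    define \<epsilon> where "\<epsilon> = min \<epsilon>0 (min \<delta>1 \<delta>2) / 2"
    have \<epsilon>: "0 < \<epsilon>" "\<epsilon> < \<epsilon>0" "\<epsilon> < \<delta>1" "\<epsilon> < \<delta>2" using \<epsilon>0 \<delta>1(1) \<delta>2(1) by (auto simp: \<epsilon>_def)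
    have nh: "norm ((- h, 0) :: real \<times> real) = \<bar>h\<bar>" for h by (simp add: norm_Pair)
    have fc: "f h \<ge> f 0 - \<delta>" if h: "\<bar>h\<bar> \<le> \<epsilon>" for h
    proof -
      note pi = pairing_integrable(1)[OF \<open>F \<in> _\<close> \<open>\<eta>U \<in> _\<close> pq F \<eta>Up]
      have "f 0 - f h = (\<integral>z. F (z + (- 0, 0)) * \<eta>U z - F (z + (- h, 0)) * \<eta>U z \<partial>lborel)"
        unfolding f_def by (rule Bochner_Integration.integral_diff[symmetric, OF pi pi])
      also have "\<dots> \<le> (\<integral>z. \<bar>F (z + (- h, 0)) - F z\<bar> * \<bar>\<eta>U z\<bar> \<partial>lborel)"
      proof (rule integral_mono)
        show "integrable lborel (\<lambda>z. F (z + (- 0, 0)) * \<eta>U z - F (z + (- h, 0)) * \<eta>U z)"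
          by (rule Bochner_Integration.integrable_diff[OF pi pi])
        show "integrable lborel (\<lambda>z. \<bar>F (z + (- h, 0)) - F z\<bar> * \<bar>\<eta>U z\<bar>)"
          by (rule translation_continuous_pairing(1)[OF \<open>F \<in> _\<close> \<open>\<eta>U \<in> _\<close> pq F \<eta>Up])
        show "F (z + (- 0, 0)) * \<eta>U z - F (z + (- h, 0)) * \<eta>U z \<le> \<bar>F (z + (- h, 0)) - F z\<bar> * \<bar>\<eta>U z\<bar>" for z
        proof -
          have "F (z + (- 0, 0)) * \<eta>U z - F (z + (- h, 0)) * \<eta>U z = - ((F (z + (- h, 0)) - F z) * \<eta>U z)"
            by (simp add: left_diff_distrib zero_prod_def[symmetric])
          also have "\<dots> \<le> \<bar>(F (z + (- h, 0)) - F z) * \<eta>U z\<bar>" by linarith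
          finally show ?thesis by (simp only: abs_mult)
        qed
      qed
      also have "\<dots> < \<delta>" using h \<epsilon> by (intro \<delta>1(2)) (simp add: nh)
      finally show ?thesis by simp
    qed
    \<comment> \<open>A shift of the plane by h moves the weight in b(-h) to time t - h, so that the
      difference has \<eta>(t) - \<eta>(t - h) as a common factor in front of the product of w with
      its translate.\<close>
    have bd: "b h - b (- h) \<le> h * (L + \<delta>)" if h: "0 < h" "h \<le> \<epsilon>" for h
    proof -
      note pi = pairing_integrable(1)[OF \<open>w \<in> _\<close> \<open>\<eta>w \<in> _\<close> two(1) two(1) two(2) w2 \<eta>w2]
      have bm: "b (- h) = (\<integral>z. w z * (\<eta> (fst z - h) * w (z + (- h, 0))) \<partial>lborel)"
        "integrable lborel (\<lambda>z. w z * (\<eta> (fst z - h) * w (z + (- h, 0))))"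
      proof -
        have e: "w (z + (- h, 0) + (- (- h), 0)) * \<eta>w (z + (- h, 0)) = w z * (\<eta> (fst z - h) * w (z + (- h, 0 :: real)))" for z
          by (cases z) (simp add: \<eta>w_def)
        show "b (- h) = (\<integral>z. w z * (\<eta> (fst z - h) * w (z + (- h, 0))) \<partial>lborel)"
          unfolding b_def using lborel_integral_shift(1)[of "\<lambda>z. w (z + (- (- h), 0)) * \<eta>w z" "(- h, 0) :: real \<times> real"] unfolding e by simp
        show "integrable lborel (\<lambda>z. w z * (\<eta> (fst z - h) * w (z + (- h, 0))))"
          using lborel_integral_shift(2)[OF pi[of "(- (- h), 0)"], of "(- h, 0)"] unfolding e .
      qed
      have ti: "integrable lborel (\<lambda>z. \<bar>w (z + (- h, 0)) - w z\<bar> * \<bar>w z\<bar>)"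
        by (rule translation_continuous_pairing(1)[OF \<open>w \<in> _\<close> \<open>w \<in> _\<close> two(1) two(1) two(2) w2 w2])
      have "b h - b (- h) = (\<integral>z. w (z + (- h, 0)) * \<eta>w z - w z * (\<eta> (fst z - h) * w (z + (- h, 0))) \<partial>lborel)"
        unfolding bm(1) unfolding b_def by (rule Bochner_Integration.integral_diff[symmetric, OF pi bm(2)])
      also have "\<dots> \<le> (\<integral>z. h * (lam (fst z) * (w z)\<^sup>2) + (Lip * h) * (\<bar>w (z + (- h, 0)) - w z\<bar> * \<bar>w z\<bar>) \<partial>lborel)"
      proof (rule integral_mono)
        show "integrable lborel (\<lambda>z. w (z + (- h, 0)) * \<eta>w z - w z * (\<eta> (fst z - h) * w (z + (- h, 0))))"
          by (rule Bochner_Integration.integrable_diff[OF pi bm(2)])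
        show "integrable lborel (\<lambda>z. h * (lam (fst z) * (w z)\<^sup>2) + (Lip * h) * (\<bar>w (z + (- h, 0)) - w z\<bar> * \<bar>w z\<bar>))"
          using Li ti by (intro Bochner_Integration.integrable_add integrable_mult_right)
        fix z :: "real \<times> real"
        \<comment> \<open>The increment of \<eta> multiplies w^2, where the one-sided bound by
          \<open>lam\<close> applies, plus an error in which the two-sided Lipschitz bound meets the
          translation error of w.\<close>
        define q where "q = \<eta> (fst z) - \<eta> (fst z - h)"
        have "w (z + (- h, 0)) * \<eta>w z - w z * (\<eta> (fst z - h) * w (z + (- h, 0)))
            = q * (w z)\<^sup>2 + q * ((w (z + (- h, 0)) - w z) * w z)"
          by (simp add: q_def \<eta>w_def algebra_simps power2_eq_square)
        also have "q * (w z)\<^sup>2 \<le> h * lam (fst z) * (w z)\<^sup>2"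
          using lam(3)[OF h(1)] by (intro mult_right_mono) (auto simp: q_def)
        also have "q * ((w (z + (- h, 0)) - w z) * w z) \<le> (Lip * h) * (\<bar>w (z + (- h, 0)) - w z\<bar> * \<bar>w z\<bar>)"
        proof -
          have "q * ((w (z + (- h, 0)) - w z) * w z) \<le> \<bar>q\<bar> * (\<bar>w (z + (- h, 0)) - w z\<bar> * \<bar>w z\<bar>)"
            by (metis abs_ge_self abs_mult)
          also have "\<dots> \<le> (Lip * h) * (\<bar>w (z + (- h, 0)) - w z\<bar> * \<bar>w z\<bar>)"
            using lip[of "fst z" h] h by (intro mult_right_mono) (auto simp: q_def)
          finally show ?thesis .
        qed
        finally show "w (z + (- h, 0)) * \<eta>w z - w z * (\<eta> (fst z - h) * w (z + (- h, 0)))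
          \<le> h * (lam (fst z) * (w z)\<^sup>2) + (Lip * h) * (\<bar>w (z + (- h, 0)) - w z\<bar> * \<bar>w z\<bar>)" by (simp add: mult.assoc)
      qed
      also have "\<dots> = h * L + (Lip * h) * (\<integral>z. \<bar>w (z + (- h, 0)) - w z\<bar> * \<bar>w z\<bar> \<partial>lborel)"
        unfolding L_def using Li ti by (subst Bochner_Integration.integral_add) auto
      also have "\<dots> \<le> h * L + (Lip * h) * (\<delta> / (Lip + 1))"
        using \<delta>2(2)[of "(- h, 0)"] h \<epsilon> Lip0 by (intro add_left_mono mult_left_mono) (auto simp: nh)
      also have "\<dots> \<le> h * L + h * \<delta>"
      proof -
        have "Lip * (\<delta> / (Lip + 1)) \<le> \<delta>" using Lip0 \<delta> by (simp add: field_simps)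
        then have "h * (Lip * (\<delta> / (Lip + 1))) \<le> h * \<delta>" using h by (intro mult_left_mono) auto
        then show ?thesis by (simp add: mult_ac)
      qed
      finally show ?thesis by (simp add: algebra_simps)
    qed
    \<comment> \<open>Averaging over y and -y produces the factor 1/2; the first moment -1 of
      \<rho>' converts the bound h (L + \<delta>) into the factor \<epsilon> that cancels the
      1/\<epsilon> of the equation.\<close>
    have odd_part: "(LBINT y. deriv \<rho> y * b (\<epsilon> * y)) \<ge> - (\<epsilon> * (L + \<delta>)) / 2"
    proof -
      have i1: "integrable lborel (\<lambda>y. deriv \<rho> y * b (\<epsilon> * y))" using fubw(3)[of \<epsilon>] .
      have i2: "integrable lborel (\<lambda>y. deriv \<rho> y * b (- (\<epsilon> * y)))" using fubw(3)[of "- \<epsilon>"] by simp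
      have r: "(LBINT y. deriv \<rho> y * b (\<epsilon> * y)) = - (LBINT y. deriv \<rho> y * b (- (\<epsilon> * y)))"
        using lborel_integral_real_affine[of "-1" "\<lambda>y. deriv \<rho> y * b (\<epsilon> * y)" 0] \<rho>(4) by simp
      have i3: "integrable lborel (\<lambda>y. y * deriv \<rho> y)"
        using \<rho>(6) smooth_continuous_on[OF smooth_deriv[OF \<rho>(1)]]
        by (intro lborel_integral_supported(1)[of _ "-1" 1] continuous_intros) auto
      have "- (\<epsilon> * (L + \<delta>)) = (LBINT y. (\<epsilon> * (L + \<delta>)) * (y * deriv \<rho> y))" using \<rho>(8) by simp
      also have "\<dots> \<le> (LBINT y. deriv \<rho> y * b (\<epsilon> * y) - deriv \<rho> y * b (- (\<epsilon> * y)))"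
      proof (rule integral_mono)
        show "integrable lborel (\<lambda>y. (\<epsilon> * (L + \<delta>)) * (y * deriv \<rho> y))" using i3 by (rule integrable_mult_right)
        show "integrable lborel (\<lambda>y. deriv \<rho> y * b (\<epsilon> * y) - deriv \<rho> y * b (- (\<epsilon> * y)))"
          using i1 i2 by (rule Bochner_Integration.integrable_diff)
        show "(\<epsilon> * (L + \<delta>)) * (y * deriv \<rho> y) \<le> deriv \<rho> y * b (\<epsilon> * y) - deriv \<rho> y * b (- (\<epsilon> * y))" for y
        proof -
          consider "y \<notin> {-1..1} \<or> y = 0" | "0 < y" "y \<le> 1" | "y < 0" "- 1 \<le> y" by force
          then show ?thesis
          proof cases
            case 1
            then have "deriv \<rho> y = 0 \<or> y = 0" using \<rho>(6) by blast
            then show ?thesis by auto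
          next
            case 2
            have "b (\<epsilon> * y) - b (- (\<epsilon> * y)) \<le> (\<epsilon> * y) * (L + \<delta>)"
              using 2 \<epsilon>(1) by (intro bd) (auto simp: mult_left_le)
            from mult_left_mono_neg[OF this \<rho>(5)[OF 2(1)]] show ?thesis by (simp add: algebra_simps)
          next
            case 3
            have "0 < \<epsilon> * (- y)" using 3 \<epsilon>(1) by (intro mult_pos_pos) auto
            moreover have "\<epsilon> * (- y) \<le> \<epsilon> * 1" using 3 \<epsilon>(1) by (intro mult_left_mono) auto
            ultimately have "b (\<epsilon> * (- y)) - b (- (\<epsilon> * (- y))) \<le> (\<epsilon> * (- y)) * (L + \<delta>)"
              by (intro bd) auto
            moreover have "0 \<le> deriv \<rho> y" using \<rho>(5)[of "- y"] \<rho>(4)[of y] 3 by simp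
            ultimately have "deriv \<rho> y * (b (\<epsilon> * (- y)) - b (- (\<epsilon> * (- y)))) \<le> deriv \<rho> y * ((\<epsilon> * (- y)) * (L + \<delta>))"
              by (rule mult_left_mono)
            then show ?thesis by (simp add: algebra_simps)
          qed
        qed
      qed
      also have "\<dots> = 2 * (LBINT y. deriv \<rho> y * b (\<epsilon> * y))"
        unfolding Bochner_Integration.integral_diff[OF i1 i2] using r by simp
      finally show ?thesis by simp
    qed
    have even_part: "(LBINT y. \<rho> y * f (\<epsilon> * y)) \<ge> f 0 - \<delta>"
    proof -
      have "f 0 - \<delta> = (LBINT y. (f 0 - \<delta>) * \<rho> y)" using \<rho>(7) by simp
      also have "\<dots> \<le> (LBINT y. \<rho> y * f (\<epsilon> * y))"
      proof (rule integral_mono)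
        show "integrable lborel (\<lambda>y. (f 0 - \<delta>) * \<rho> y)" using \<rho>i(1) by (rule integrable_mult_right)
        show "integrable lborel (\<lambda>y. \<rho> y * f (\<epsilon> * y))" by (rule fubF(3))
        show "(f 0 - \<delta>) * \<rho> y \<le> \<rho> y * f (\<epsilon> * y)" for y
        proof (cases "y \<in> {-1..1}")
          case True
          then have "\<bar>\<epsilon> * y\<bar> \<le> \<epsilon>" using \<epsilon>(1) by (auto simp: abs_mult mult_left_le)
          then have "f 0 - \<delta> \<le> f (\<epsilon> * y)" by (rule fc)
          from mult_right_mono[OF this \<rho>(3)] show ?thesis by (simp add: mult.commute)
        next
          case False
          then show ?thesis using \<rho>(2) by simp
        qed
      qed
      finally show ?thesis .
    qed
    have "(LBINT y. \<rho> y * f (\<epsilon> * y)) + (LBINT y. deriv \<rho> y * b (\<epsilon> * y)) / \<epsilon> \<le> (LBINT t. n t)"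
    proof -
      let ?A = "\<lambda>t. LBINT y. \<rho> y * (LBINT x. F (t - \<epsilon> * y, x) * \<eta>U (t, x))"
      let ?B = "\<lambda>t. LBINT y. deriv \<rho> y * (LBINT x. w (t - \<epsilon> * y, x) * \<eta>w (t, x))"
      let ?N = "\<lambda>t. LBINT y. \<rho> y * n (t - \<epsilon> * y)"
      have A: "?A t = \<eta> t * (LBINT y. \<rho> y * (LBINT x. F (t - \<epsilon> * y, x) * U (t, x)))" for t
        by (simp add: \<eta>U_def mult.left_commute[of _ "\<eta> t"])
      have B: "?B t = \<eta> t * (LBINT y. deriv \<rho> y * (LBINT x. w (t - \<epsilon> * y, x) * w (t, x)))" for t
        by (simp add: \<eta>w_def mult.left_commute[of _ "\<eta> t"])
      have N0: "?N t \<ge> 0" for t using \<rho>(3) n(2) by (intro integral_nonneg_AE AE_I2) auto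
      have iA: "integrable lborel ?A" and iB: "integrable lborel ?B"
        using fubF(1)[of \<epsilon>] fubw(1)[of \<epsilon>] .
      have "(LBINT y. \<rho> y * f (\<epsilon> * y)) + (LBINT y. deriv \<rho> y * b (\<epsilon> * y)) / \<epsilon> = (LBINT t. ?A t + ?B t / \<epsilon>)"
        using iA iB fubF(2)[of \<epsilon>] fubw(2)[of \<epsilon>] by simp
      also have "\<dots> \<le> (LBINT t. ?N t)"
      proof (rule integral_mono_AE)
        show "integrable lborel (\<lambda>t. ?A t + ?B t / \<epsilon>)" using iA iB by auto
        show "integrable lborel ?N" by (rule mollified_mass(1)[OF n(1) \<rho>i(1)])
        show "AE t in lborel. ?A t + ?B t / \<epsilon> \<le> ?N t"
          using eqn[OF \<epsilon>(1,2)]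
        proof eventually_elim
          case (elim t)
          show ?case
          \<comment> \<open>The equation is available only where \<eta> is nonzero; elsewhere the
            left-hand side vanishes together with \<eta>.\<close>
          proof (cases "\<eta> t = 0")
            case True
            then show ?thesis using A[of t] B[of t] N0[of t] by simp
          next
            case False
            define G where "G = (LBINT y. \<rho> y * (LBINT x. F (t - \<epsilon> * y, x) * U (t, x)))
              + (LBINT y. deriv \<rho> y * (LBINT x. w (t - \<epsilon> * y, x) * w (t, x))) / \<epsilon>"
            have G: "\<bar>G\<bar> \<le> ?N t" using elim False unfolding G_def by blast
            have "?A t + ?B t / \<epsilon> = \<eta> t * G" unfolding A B G_def by (simp add: algebra_simps)
            also have "\<dots> \<le> \<eta> t * ?N t" using G \<eta>(1) by (intro mult_left_mono) auto
            also have "\<dots> \<le> ?N t" using \<eta> N0[of t] by (intro mult_left_le_one_le) auto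
            finally show ?thesis .
          qed
        qed
      qed
      also have "\<dots> = (LBINT t. n t)" using mollified_mass(2)[OF n(1) \<rho>i(1)] \<rho>(7) by simp
      finally show ?thesis .
    qed
    moreover have "(LBINT y. deriv \<rho> y * b (\<epsilon> * y)) / \<epsilon> \<ge> - (L + \<delta>) / 2"
    proof -
      have "- (\<epsilon> * X) / 2 / \<epsilon> = - X / 2" for X using \<epsilon>(1) by simp
      from this[of "L + \<delta>"] have "- (\<epsilon> * (L + \<delta>)) / 2 / \<epsilon> = - (L + \<delta>) / 2" .
      then show ?thesis
        using divide_right_mono[OF odd_part less_imp_le[OF \<epsilon>(1)]] by (simp only:)
    qed
    ultimately show ?thesis using even_part \<delta> by argo
  qed
  have "f 0 \<le> 1 / 2 * L + (LBINT t. n t)"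
  proof (rule field_le_epsilon)
    fix e :: real assume "e > 0"
    then show "f 0 \<le> 1 / 2 * L + (LBINT t. n t) + e" using main[of "e / 2"] by simp
  qed
  then show ?thesis unfolding f0 L_def .
qed

section \<open>The weak formulation with product test functions\<close>

lemma has_weak_deriv_cmult:
  assumes "has_weak_deriv k {a<..<b} f g" "a < b"
  shows "has_weak_deriv k {a<..<b} (\<lambda>x. c * f x) (\<lambda>x. c * g x)"
  using has_weak_deriv_lincomb[OF assms(1,1,2), of "c - 1"] by (simp add: algebra_simps)

lemma in_Lp_cmult:
  assumes "in_Lp p A f" shows "in_Lp p A (\<lambda>x. c * f x)"
  using assms unfolding in_Lp_def by (auto simp: abs_mult powr_mult)

lemma sobolev_cmult:
  assumes f: "f \<in> sobolev k p {a<..<b}" and ab: "a < b"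
  shows "(\<lambda>x. c * f x) \<in> sobolev k p {a<..<b}"
  unfolding sobolev_def mem_Collect_eq
proof (intro conjI allI impI)
  show "in_Lp p {a<..<b} (\<lambda>x. c * f x)" using f by (intro in_Lp_cmult) (simp add: sobolev_def)
  fix j assume "j \<le> k"
  then obtain g where "has_weak_deriv j {a<..<b} f g" "in_Lp p {a<..<b} g" using f unfolding sobolev_def by blast
  then show "\<exists>g. has_weak_deriv j {a<..<b} (\<lambda>x. c * f x) g \<and> in_Lp p {a<..<b} g"
    using has_weak_deriv_cmult[OF _ ab] in_Lp_cmult by blast
qed

lemma sobolev_norm_cmult:
  assumes f: "f \<in> sobolev k p {a<..<b}" and ab: "a < b" and p: "p > 0"
  shows "sobolev_norm k p {a<..<b} (\<lambda>x. c * f x) = \<bar>c\<bar> * sobolev_norm k p {a<..<b} f"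
proof -
  let ?A = "{a<..<b}"
  have "(LINT x:?A|lebesgue. \<bar>weak_deriv j ?A (\<lambda>x. c * f x) x\<bar> powr p)
      = \<bar>c\<bar> powr p * (LINT x:?A|lebesgue. \<bar>weak_deriv j ?A f x\<bar> powr p)" if "j \<le> k" for j
  proof -
    note w = has_weak_deriv_cmult[OF sobolev_weak_deriv(1)[OF f that ab] ab, of c]
    have ae: "AE x in lebesgue. x \<in> ?A \<longrightarrow> weak_deriv j ?A (\<lambda>x. c * f x) x = c * weak_deriv j ?A f x"
      using has_weak_deriv_unique[OF has_weak_deriv_weak_deriv[OF w] w ab] .
    have "(LINT x:?A|lebesgue. \<bar>weak_deriv j ?A (\<lambda>x. c * f x) x\<bar> powr p)
       = (LINT x:?A|lebesgue. \<bar>c\<bar> powr p * \<bar>weak_deriv j ?A f x\<bar> powr p)"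
      unfolding set_lebesgue_integral_def
      by (rule integral_lebesgue_cong_AE) (use ae in \<open>eventually_elim, auto simp: indicator_def abs_mult powr_mult\<close>)
    then show ?thesis by simp
  qed
  then have "sobolev_norm k p ?A (\<lambda>x. c * f x)
      = (\<bar>c\<bar> powr p * (\<Sum>j\<le>k. LINT x:?A|lebesgue. \<bar>weak_deriv j ?A f x\<bar> powr p)) powr (1 / p)"
    unfolding sobolev_norm_def by (simp add: sum_distrib_left)
  also have "\<dots> = \<bar>c\<bar> * sobolev_norm k p ?A f"
  proof -
    have "0 \<le> (\<Sum>j\<le>k. LINT x:?A|lebesgue. \<bar>weak_deriv j ?A f x\<bar> powr p)"
      unfolding set_lebesgue_integral_def by (intro sum_nonneg integral_nonneg_AE AE_I2) auto
    then show ?thesis unfolding sobolev_norm_def using p by (simp add: powr_mult powr_powr)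
  qed
  finally show ?thesis .
qed

lemma sobolev_supported_cmult:
  assumes "f \<in> sobolev_supported k p {a<..<b} K" "a < b"
  shows "(\<lambda>x. c * f x) \<in> sobolev_supported k p {a<..<b} K"
  using assms sobolev_cmult[of f k p a b c] unfolding sobolev_supported_def by auto

text \<open>Strong measurability comes from approximating the scalar factor by simple functions:
  their multiples of \<phi> are simple with values in the Sobolev space, and the norm is
  homogeneous.\<close>

lemma admissible_tensor:
  assumes ab: "a < c" "c < d" "d < b" and \<alpha>: "\<alpha> > 1" and \<theta>: "test_function {1/4<..<1} \<theta>"
    and \<phi>: "\<phi> \<in> sobolev_supported 1 (\<alpha> + 1) {a<..<b} {c..d}"
  shows "admissible_test \<alpha> a b (\<lambda>\<tau> x. \<theta> \<tau> * \<phi> x)"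
proof -
  let ?A = "{a<..<b}" and ?M = "lebesgue_on time_interval" and ?p = "\<alpha> + 1"
  let ?X = "sobolev 1 ?p ?A" and ?N = "sobolev_norm 1 ?p ?A"
  have ab': "a < b" using ab by simp
  have p: "?p > 0" using \<alpha> by simp
  have \<phi>X: "\<phi> \<in> ?X" using \<phi> by (simp add: sobolev_supported_def)
  have fin: "finite_measure ?M" by (intro finite_measure_lebesgue_on) auto
  have \<theta>c: "continuous_on UNIV \<theta>" using smooth_continuous_on[OF test_function_smooth[OF \<theta>]] .
  have \<theta>m: "\<theta> \<in> borel_measurable ?M"
    using borel_measurable_continuous_onI[OF \<theta>c] by (intro measurable_restrict_space1 measurable_completion) simp
  obtain r where r: "\<And>n. simple_function ?M (r n)" "\<And>t. t \<in> space ?M \<Longrightarrow> (\<lambda>n. r n t) \<longlonglongrightarrow> \<theta> t"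
    using borel_measurable_implies_sequence_metric[OF \<theta>m, of 0] by blast
  have "bochner_Lp ?M ?X ?N ?p (\<lambda>\<tau> x. \<theta> \<tau> * \<phi> x)"
    unfolding bochner_Lp_def
  proof (intro conjI exI[of _ "\<lambda>n \<tau> x. r n \<tau> * \<phi> x"] allI)
    show "AE t in ?M. (\<lambda>x. \<theta> t * \<phi> x) \<in> ?X" using sobolev_cmult[OF \<phi>X ab'] by (intro AE_I2) auto
    show "simple_function ?M (\<lambda>\<tau> x. r n \<tau> * \<phi> x)" for n
      using simple_function_compose1[OF r(1), of "\<lambda>y x. y * \<phi> x" n] by simp
    show "(\<lambda>\<tau> x. r n \<tau> * \<phi> x) ` space ?M \<subseteq> ?X" for n
      using sobolev_cmult[OF \<phi>X ab'] by auto
    show "AE t in ?M. (\<lambda>n. ?N ((\<lambda>x. r n t * \<phi> x) - (\<lambda>x. \<theta> t * \<phi> x))) \<longlonglongrightarrow> 0"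
      using AE_space
    proof eventually_elim
      case (elim t)
      have "?N ((\<lambda>x. r n t * \<phi> x) - (\<lambda>x. \<theta> t * \<phi> x)) = \<bar>r n t - \<theta> t\<bar> * ?N \<phi>" for n
        using sobolev_norm_cmult[OF \<phi>X ab' p, of "r n t - \<theta> t"] by (simp add: fun_diff_def left_diff_distrib)
      moreover have "(\<lambda>n. \<bar>r n t - \<theta> t\<bar> * ?N \<phi>) \<longlonglongrightarrow> \<bar>\<theta> t - \<theta> t\<bar> * ?N \<phi>"
        using r(2)[OF elim] by (intro tendsto_intros)
      ultimately show ?case by simp
    qed
    have e: "?N (\<lambda>x. \<theta> t * \<phi> x) powr ?p = \<bar>\<theta> t\<bar> powr ?p * ?N \<phi> powr ?p" for t
      unfolding sobolev_norm_cmult[OF \<phi>X ab' p] using sobolev_norm_powr_ge(3)[of ?p 1 1] p by (simp add: powr_mult)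
    have "bounded (\<theta> ` time_interval)"
      by (rule compact_imp_bounded[OF compact_continuous_image[OF continuous_on_subset[OF \<theta>c subset_UNIV] compact_Icc]])
    then obtain B where "\<forall>y\<in>\<theta> ` time_interval. norm y \<le> B" unfolding bounded_iff by blast
    then have B: "\<And>t. t \<in> time_interval \<Longrightarrow> \<bar>\<theta> t\<bar> \<le> B" by simp
    have "integrable ?M (\<lambda>t. \<bar>\<theta> t\<bar> powr ?p * ?N \<phi> powr ?p)"
    proof (rule finite_measure.integrable_const_bound[OF fin, where B="B powr ?p * ?N \<phi> powr ?p"])
      show "AE t in ?M. norm (\<bar>\<theta> t\<bar> powr ?p * ?N \<phi> powr ?p) \<le> B powr ?p * ?N \<phi> powr ?p"
        using AE_space
      proof eventually_elim
        case (elim t)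
        then show ?case using B[of t] p by (auto simp: abs_mult intro!: mult_right_mono powr_mono2)
      qed
      show "(\<lambda>t. \<bar>\<theta> t\<bar> powr ?p * ?N \<phi> powr ?p) \<in> borel_measurable ?M" using \<theta>m by measurable
    qed
    then show "integrable ?M (\<lambda>t. ?N (\<lambda>x. \<theta> t * \<phi> x) powr ?p)" unfolding e .
  qed
  moreover have "AE \<tau> in ?M. (\<lambda>x. \<theta> \<tau> * \<phi> x) \<in> sobolev_supported 1 ?p ?A {c..d}"
    using sobolev_supported_cmult[OF \<phi> ab'] by (intro AE_I2) auto
  ultimately show ?thesis unfolding admissible_test_def using ab by blast
qed

text \<open>Testing with \<open>\<theta>(\<tau>) \<phi>(x)\<close> eliminates the functional-valued time derivative.\<close>

lemma weak_solution_tensor: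
  assumes ws: "weak_solution \<alpha> a b \<Phi> S v"
    and ab: "a < c" "c < d" "d < b" and \<alpha>: "\<alpha> > 1" and \<theta>: "test_function {1/4<..<1} \<theta>"
    and \<phi>: "\<phi> \<in> sobolev_supported 1 (\<alpha> + 1) {a<..<b} {c..d}" and \<phi>': "has_weak_deriv 1 {a<..<b} \<phi> \<phi>'"
  shows "(LINT \<tau>:time_interval|lebesgue. deriv \<theta> \<tau> * (LINT x:{a..b}|lebesgue. v \<tau> x * \<phi> x))
    = - (LINT \<tau>:time_interval|lebesgue. \<theta> \<tau> * (LINT x:{a..b}|lebesgue. flux \<Phi> a b v \<tau> x * \<phi>' x))
      + (LINT \<tau>:time_interval|lebesgue. \<theta> \<tau> * (LINT x:{a..b}|lebesgue. S \<tau> x * \<phi> x))"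
proof -
  let ?A = "{a<..<b}" and ?M = "lebesgue_on time_interval" and ?p = "\<alpha> + 1"
  let ?X = "sobolev_supported 1 ?p ?A {c..d}" and ?N = "sobolev_norm 1 ?p ?A"
  have ab': "a < b" using ab by simp
  obtain vt where vt: "has_weak_dt \<alpha> a b v vt"
    and eqn: "\<And>\<xi>. admissible_test \<alpha> a b \<xi> \<Longrightarrow>
          (LINT \<tau>:time_interval|lebesgue. vt \<tau> (\<xi> \<tau>)) =
            (LINT \<tau>:time_interval|lebesgue. LINT x:{a..b}|lebesgue.
               flux \<Phi> a b v \<tau> x * weak_deriv 1 {a<..<b} (\<xi> \<tau>) x)
          - (LINT \<tau>:time_interval|lebesgue. LINT x:{a..b}|lebesgue. S \<tau> x * \<xi> \<tau> x)"
    using ws unfolding weak_solution_def by blast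
  have dual: "AE \<tau> in ?M. vt \<tau> \<in> dual_space ?X ?N"
    and dt: "(LINT \<tau>:time_interval|lebesgue. deriv \<theta> \<tau> * (LINT x:{a..b}|lebesgue. v \<tau> x * \<phi> x))
             = - (LINT \<tau>:time_interval|lebesgue. \<theta> \<tau> * vt \<tau> \<phi>)"
    using vt ab \<theta> \<phi> unfolding has_weak_dt_def bochner_Lp_def Let_def by blast+
  \<comment> \<open>Homogeneity of the functional pulls \<theta>(\<tau>) out, but only at those
    \<tau> for which \<open>vt \<tau>\<close> lies in the dual space.\<close>
  have 1: "(LINT \<tau>:time_interval|lebesgue. vt \<tau> (\<lambda>x. \<theta> \<tau> * \<phi> x)) = (LINT \<tau>:time_interval|lebesgue. \<theta> \<tau> * vt \<tau> \<phi>)"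
    unfolding set_lebesgue_integral_def
  proof (rule integral_lebesgue_cong_AE)
    have "AE \<tau> in lebesgue. \<tau> \<in> time_interval \<longrightarrow> vt \<tau> \<in> dual_space ?X ?N"
      using dual by (subst (asm) AE_lebesgue_on) auto
    then show "AE \<tau> in lebesgue. indicator time_interval \<tau> *\<^sub>R vt \<tau> (\<lambda>x. \<theta> \<tau> * \<phi> x) = indicator time_interval \<tau> *\<^sub>R (\<theta> \<tau> * vt \<tau> \<phi>)"
    proof eventually_elim
      case (elim \<tau>)
      then show ?case using \<phi> by (cases "\<tau> \<in> time_interval") (auto simp: dual_space_def)
    qed
  qed
  have 2: "(LINT x:{a..b}|lebesgue. flux \<Phi> a b v \<tau> x * weak_deriv 1 ?A (\<lambda>x. \<theta> \<tau> * \<phi> x) x)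
     = \<theta> \<tau> * (LINT x:{a..b}|lebesgue. flux \<Phi> a b v \<tau> x * \<phi>' x)" for \<tau>
  proof -
    note w = has_weak_deriv_cmult[OF \<phi>' ab', of "\<theta> \<tau>"]
    have ae: "AE x in lebesgue. x \<in> ?A \<longrightarrow> weak_deriv 1 ?A (\<lambda>x. \<theta> \<tau> * \<phi> x) x = \<theta> \<tau> * \<phi>' x"
      using has_weak_deriv_unique[OF has_weak_deriv_weak_deriv[OF w] w ab'] .
    have ends: "AE x in lebesgue. x \<noteq> a \<and> x \<noteq> b"
      by (rule AE_completion) (intro AE_conjI AE_lborel_singleton)
    have "(LINT x:{a..b}|lebesgue. flux \<Phi> a b v \<tau> x * weak_deriv 1 ?A (\<lambda>x. \<theta> \<tau> * \<phi> x) x)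
      = (LINT x:{a..b}|lebesgue. \<theta> \<tau> * (flux \<Phi> a b v \<tau> x * \<phi>' x))"
      unfolding set_lebesgue_integral_def
    proof (rule integral_lebesgue_cong_AE)
      show "AE x in lebesgue. indicator {a..b} x *\<^sub>R (flux \<Phi> a b v \<tau> x * weak_deriv 1 ?A (\<lambda>x. \<theta> \<tau> * \<phi> x) x)
        = indicator {a..b} x *\<^sub>R (\<theta> \<tau> * (flux \<Phi> a b v \<tau> x * \<phi>' x))"
        using ae ends by eventually_elim (auto simp: indicator_def)
    qed
    then show ?thesis by simp
  qed
  have 3: "(LINT x:{a..b}|lebesgue. S \<tau> x * (\<theta> \<tau> * \<phi> x)) = \<theta> \<tau> * (LINT x:{a..b}|lebesgue. S \<tau> x * \<phi> x)" for \<tau>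
    by (simp add: mult.left_commute)
  show ?thesis
    using eqn[OF admissible_tensor[OF ab \<alpha> \<theta> \<phi>]] unfolding 1 2 3 dt by simp
qed

section \<open>Borel versions and continuous representatives\<close>

lemma lborel_pair_AE_of_lebesgue:
  fixes P :: "real \<times> real \<Rightarrow> bool"
  assumes "AE z in lebesgue. P z"
  shows "AE t in lborel. AE x in lborel. P (t, x)"
proof -
  have "AE z in lborel. P z" using assms by (simp add: AE_completion_iff)
  then have "AE z in lborel \<Otimes>\<^sub>M lborel. P z" unfolding lborel_prod .
  then show ?thesis by (rule lborel_pair.AE_pair)
qed

text \<open>Vanishing off the smaller rectangle lets all later integrals run over the whole plane,
  where shifts in time leave no boundary terms.\<close>

lemma borel_version_rectangle:
  fixes f :: "real \<times> real \<Rightarrow> real"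
  assumes f: "f \<in> borel_measurable (lebesgue_on (I \<times> A))" and I: "I \<in> sets borel" and A: "A \<in> sets borel"
    and J: "J \<in> sets borel" "J \<subseteq> A"
  obtains g where "g \<in> borel_measurable borel" "\<And>z. z \<notin> I \<times> J \<Longrightarrow> g z = 0"
    "AE t in lborel. AE x in lborel. t \<in> I \<longrightarrow> x \<in> J \<longrightarrow> g (t, x) = f (t, x)"
proof -
  have IA: "I \<times> A \<in> sets borel" "I \<times> J \<in> sets borel" using I A J by (auto intro: borel_Times)
  have "(\<lambda>z. indicator (I \<times> A) z * f z) \<in> borel_measurable lebesgue"
    using f IA by (subst (asm) borel_measurable_restrict_space_iff) auto
  then obtain g0 where g0: "g0 \<in> borel_measurable lborel" "AE z in lborel. indicator (I \<times> A) z * f z = g0 z"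
    using completion_ex_borel_measurable_real by blast
  define g where "g = (\<lambda>z. indicator (I \<times> J) z * g0 z)"
  have "g \<in> borel_measurable borel" unfolding g_def using g0(1) IA by auto
  moreover have "g z = 0" if "z \<notin> I \<times> J" for z using that by (simp add: g_def)
  moreover have "AE t in lborel. AE x in lborel. t \<in> I \<longrightarrow> x \<in> J \<longrightarrow> g (t, x) = f (t, x)"
  proof -
    have "AE t in lborel. AE x in lborel. indicator (I \<times> A) (t, x) * f (t, x) = g0 (t, x)"
      using AE_completion[OF g0(2)] by (rule lborel_pair_AE_of_lebesgue)
    then show ?thesis
    proof eventually_elim
      case (elim t)
      then show ?case by eventually_elim (use J(2) in \<open>auto simp: g_def\<close>)
    qed
  qed
  ultimately show thesis by (rule that)
qed

text \<open>The set in the open interval where a continuous function exceeds the bound is open, and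
  a nonempty open set is not null; the endpoints follow by continuity.\<close>

lemma continuous_AE_bound:
  fixes f :: "real \<Rightarrow> real"
  assumes f: "continuous_on {c..d} f" and cd: "c < d" and ae: "AE x in lebesgue. x \<in> {c..d} \<longrightarrow> \<bar>f x\<bar> \<le> B"
    and x: "x \<in> {c..d}"
  shows "\<bar>f x\<bar> \<le> B"
proof -
  have in1: "\<bar>f y\<bar> \<le> B" if y: "y \<in> {c<..<d}" for y
  proof (rule ccontr)
    assume "\<not> \<bar>f y\<bar> \<le> B"
    define U where "U = {z \<in> {c<..<d}. \<bar>f z\<bar> \<in> {B<..}}"
    have "continuous_on {c<..<d} (\<lambda>z. \<bar>f z\<bar>)"
      using f by (intro continuous_intros continuous_on_subset[OF f]) auto
    then have "open U"
      unfolding U_def using continuous_open_preimage[of "{c<..<d}" "\<lambda>z. \<bar>f z\<bar>" "{B<..}"]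
      by (simp add: vimage_def Int_def conj_commute)
    moreover have "y \<in> U" using y \<open>\<not> \<bar>f y\<bar> \<le> B\<close> by (auto simp: U_def)
    ultimately have "\<not> negligible U" using open_not_negligible by blast
    moreover have "negligible U"
      by (rule negligible_subset[OF AE_imp_negligible[OF ae]]) (auto simp: U_def)
    ultimately show False by blast
  qed
  have "closure {c<..<d} = {c..d}" using cd by (rule closure_greaterThanLessThan)
  then have "norm (f x) \<le> B"
    using f in1 x by (intro continuous_on_closure_norm_le[of "{c<..<d}" f B x]) auto
  then show ?thesis by simp
qed

text \<open>For each order \<open>du_bois_reymond\<close> gives an absolutely continuous version
  whose derivative is still an arbitrary representative; it is exchanged for the continuous version
  of the next order. At order three no continuous version exists in general, so \<open>w3\<close>
  stays.\<close>

lemma sobolev_slice_representatives: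
  assumes w: "has_weak_deriv 1 {a<..<b} f w1" "has_weak_deriv 2 {a<..<b} f w2" "has_weak_deriv 3 {a<..<b} f w3"
    and ab: "a < c" "c < d" "d < b"
  obtains f0 f1 f2 where "primitive c d f0 f1" "primitive c d f1 f2" "primitive c d f2 w3"
    "AE x in lebesgue. x \<in> {c..d} \<longrightarrow> f x = f0 x" "AE x in lebesgue. x \<in> {c..d} \<longrightarrow> w1 x = f1 x"
    "AE x in lebesgue. x \<in> {c..d} \<longrightarrow> w2 x = f2 x"
proof -
  have ab': "a < b" and cd: "c \<le> d" using ab by auto
  have n: "2 = Suc 1" "3 = Suc 2" by auto
  have w12: "has_weak_deriv 1 {a<..<b} w1 w2" and w23: "has_weak_deriv 1 {a<..<b} w2 w3"
    using has_weak_deriv_Suc[OF w(1) w(2)[unfolded n(1)] ab'] has_weak_deriv_Suc[OF w(2) w(3)[unfolded n(2)] ab'] .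
  obtain f2 where f2: "primitive c d f2 w3" "AE x in lebesgue. x \<in> {c..d} \<longrightarrow> w2 x = f2 x"
    using du_bois_reymond[OF w23 ab(1) cd ab(3)] .
  obtain f1 where f1: "primitive c d f1 w2" "AE x in lebesgue. x \<in> {c..d} \<longrightarrow> w1 x = f1 x"
    using du_bois_reymond[OF w12 ab(1) cd ab(3)] .
  obtain f0 where f0: "primitive c d f0 w1" "AE x in lebesgue. x \<in> {c..d} \<longrightarrow> f x = f0 x"
    using du_bois_reymond[OF w(1) ab(1) cd ab(3)] .
  have 1: "primitive c d f1 f2"
  proof (rule primitive_cong_AE[OF f1(1)])
    show "f2 absolutely_integrable_on {c..d}"
      using primitive_continuous_on[OF f2(1)] by (rule absolutely_integrable_continuous_real)
    show "AE x in lebesgue. x \<in> {c..d} \<longrightarrow> f2 x = w2 x" using f2(2) by eventually_elim auto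
  qed
  have 0: "primitive c d f0 f1"
  proof (rule primitive_cong_AE[OF f0(1)])
    show "f1 absolutely_integrable_on {c..d}"
      using primitive_continuous_on[OF 1] by (rule absolutely_integrable_continuous_real)
    show "AE x in lebesgue. x \<in> {c..d} \<longrightarrow> f1 x = w1 x" using f1(2) by eventually_elim auto
  qed
  show thesis using that[OF 0 1 f2(1) f0(2) f1(2) f2(2)] .
qed

lemma in_Lp_supported:
  fixes g :: "real \<Rightarrow> real"
  assumes g: "integrable lebesgue g" and gp: "(\<lambda>x. \<bar>g x\<bar> powr p) absolutely_integrable_on {c..d}"
    and g0: "\<And>x. x \<notin> {c..d} \<Longrightarrow> g x = 0" and sub: "{c..d} \<subseteq> {a<..<b}"
  shows "in_Lp p {a<..<b} g"
proof -
  have "g \<in> borel_measurable (lebesgue_on {a<..<b})"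
    using g by (intro measurable_restrict_space1) auto
  moreover have "integrable (lebesgue_on {a<..<b}) (\<lambda>x. \<bar>g x\<bar> powr p)"
  proof -
    have e: "indicator {c..d} x *\<^sub>R \<bar>g x\<bar> powr p = indicator {a<..<b} x *\<^sub>R \<bar>g x\<bar> powr p" for x
      using g0[of x] sub by (cases "x \<in> {c..d}") (auto simp: indicator_def)
    have "integrable lebesgue (\<lambda>x. indicator {a<..<b} x *\<^sub>R \<bar>g x\<bar> powr p)"
      using gp unfolding set_integrable_def e .
    then show ?thesis by (subst integrable_restrict_space) auto
  qed
  ultimately show ?thesis by (simp add: in_Lp_def)
qed

lemma abs_powr_integrable_continuous:
  fixes g :: "real \<Rightarrow> real"
  assumes "continuous_on {c..d} g" "p > 0"
  shows "(\<lambda>x. \<bar>g x\<bar> powr p) absolutely_integrable_on {c..d}"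
  using assms by (intro absolutely_integrable_continuous_real continuous_on_powr' continuous_intros) auto

section \<open>The spatial test function\<close>

text \<open>This is -(\<psi> f1)' with \<psi> = \<open>cutoff m \<kappa> x0\<close>, when f2 is the
  derivative of f1, extended by zero.\<close>

definition test_fn :: "nat \<Rightarrow> real \<Rightarrow> real \<Rightarrow> (real \<Rightarrow> real) \<Rightarrow> (real \<Rightarrow> real) \<Rightarrow> real \<Rightarrow> real" where
  "test_fn m \<kappa> x0 f1 f2 x = (if x \<in> {x0 - 2 * \<kappa>..x0 + 2 * \<kappa>}
     then - (cutoff1 m \<kappa> x0 x * f1 x + cutoff m \<kappa> x0 x * f2 x) else 0)"

text \<open>This is -(\<psi> f1)'' when f2 and f3 are the derivatives of f1 and f2, extended by
  zero.\<close>

definition test_fn_deriv ::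
    "nat \<Rightarrow> real \<Rightarrow> real \<Rightarrow> (real \<Rightarrow> real) \<Rightarrow> (real \<Rightarrow> real) \<Rightarrow> (real \<Rightarrow> real) \<Rightarrow> real \<Rightarrow> real" where
  "test_fn_deriv m \<kappa> x0 f1 f2 f3 x = (if x \<in> {x0 - 2 * \<kappa>..x0 + 2 * \<kappa>}
     then - (cutoff m \<kappa> x0 x * f3 x + 2 * cutoff1 m \<kappa> x0 x * f2 x + cutoff2 m \<kappa> x0 x * f1 x) else 0)"

lemma primitive_cutoff:
  assumes "\<kappa> > 0"
  shows "primitive c d (cutoff m \<kappa> x0) (cutoff1 m \<kappa> x0)" "primitive c d (cutoff1 m \<kappa> x0) (cutoff2 m \<kappa> x0)"
  using assms by (auto intro!: primitive_C1 DERIV_cutoff continuous_on_cutoff)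

lemma primitive_cong:
  assumes "primitive c d f g" "\<And>x. x \<in> {c..d} \<Longrightarrow> f' x = f x" "\<And>x. x \<in> {c..d} \<Longrightarrow> g' x = g x" "c \<le> d"
  shows "primitive c d f' g'"
  unfolding primitive_def
proof (intro conjI ballI)
  show "g' absolutely_integrable_on {c..d}"
    by (rule absolutely_integrable_cong_AE[OF primitive_abs_integrable[OF assms(1)]])
      (intro AE_I2 impI assms(3))
  fix x assume x: "x \<in> {c..d}"
  have "integral {c..x} g' = integral {c..x} g" using assms(3) x by (intro integral_cong) auto
  then show "f' x = f' c + integral {c..x} g'"
    using primitive_eq[OF assms(1) x] assms(2)[OF x] assms(2)[of c] assms(4) by simp
qed

lemma absolutely_integrable_powr_sum:
  fixes f g :: "real \<Rightarrow> real"
  assumes f: "f \<in> borel_measurable (lebesgue_on K)" and g: "g \<in> borel_measurable (lebesgue_on K)" and K: "K \<in> sets lebesgue"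
    and fp: "(\<lambda>x. \<bar>f x\<bar> powr p) absolutely_integrable_on K" and gp: "(\<lambda>x. \<bar>g x\<bar> powr p) absolutely_integrable_on K"
    and p: "p \<ge> 0"
  shows "(\<lambda>x. \<bar>f x + g x\<bar> powr p) absolutely_integrable_on K"
proof -
  have "integrable (lebesgue_on K) (\<lambda>x. 2 powr p * (\<bar>f x\<bar> powr p + \<bar>g x\<bar> powr p))"
    using fp gp K by (intro integrable_mult_right Bochner_Integration.integrable_add)
      (auto simp: integrable_restrict_space set_integrable_def)
  then have "integrable (lebesgue_on K) (\<lambda>x. \<bar>f x + g x\<bar> powr p)"
  proof (rule Bochner_Integration.integrable_bound)
    show "AE x in lebesgue_on K. norm (\<bar>f x + g x\<bar> powr p) \<le> norm (2 powr p * (\<bar>f x\<bar> powr p + \<bar>g x\<bar> powr p))"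
    proof (rule AE_I2)
      fix x
      have "\<bar>f x + g x\<bar> powr p \<le> (\<bar>f x\<bar> + \<bar>g x\<bar>) powr p" using p by (intro powr_mono2) auto
      also have "\<dots> \<le> 2 powr p * (\<bar>f x\<bar> powr p + \<bar>g x\<bar> powr p)" using p by (intro powr_sum_le) auto
      finally show "norm (\<bar>f x + g x\<bar> powr p) \<le> norm (2 powr p * (\<bar>f x\<bar> powr p + \<bar>g x\<bar> powr p))" by simp
    qed
    show "(\<lambda>x. \<bar>f x + g x\<bar> powr p) \<in> borel_measurable (lebesgue_on K)" using f g by measurable
  qed
  then show ?thesis using K by (simp add: integrable_restrict_space set_integrable_def)
qed

text \<open>For m \<ge> 3 both \<psi> and \<psi>' vanish at the ends of the interval, so the
  extension by zero has no jump. The third derivative f3 enters linearly with a bounded factor, so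
  its p-th power integrability suffices for the Sobolev space.\<close>

lemma test_fn_props:
  assumes \<kappa>: "\<kappa> > 0" and m: "m \<ge> 3" and p: "p > 0" and ab: "a < x0 - 2 * \<kappa>" "x0 + 2 * \<kappa> < b"
    and p1: "primitive (x0 - 2 * \<kappa>) (x0 + 2 * \<kappa>) f1 f2" and p2: "primitive (x0 - 2 * \<kappa>) (x0 + 2 * \<kappa>) f2 f3"
    and f3: "(\<lambda>x. \<bar>f3 x\<bar> powr p) absolutely_integrable_on {x0 - 2 * \<kappa>..x0 + 2 * \<kappa>}"
  shows "test_fn m \<kappa> x0 f1 f2 \<in> sobolev_supported 1 p {a<..<b} {x0 - 2 * \<kappa>..x0 + 2 * \<kappa>}"
    and "has_weak_deriv 1 {a<..<b} (test_fn m \<kappa> x0 f1 f2) (test_fn_deriv m \<kappa> x0 f1 f2 f3)"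
proof -
  let ?c = "x0 - 2 * \<kappa>" and ?d = "x0 + 2 * \<kappa>"
  let ?u = "test_fn m \<kappa> x0 f1 f2" and ?g = "test_fn_deriv m \<kappa> x0 f1 f2 f3"
  have cd: "?c \<le> ?d" and sub: "{?c..?d} \<subseteq> {a<..<b}" using \<kappa> ab by auto
  note pc = primitive_cutoff[OF \<kappa>, of ?c ?d m x0]
  have "primitive ?c ?d (\<lambda>x. (-1) * (cutoff1 m \<kappa> x0 x * f1 x + cutoff m \<kappa> x0 x * f2 x))
     (\<lambda>x. (-1) * ((cutoff2 m \<kappa> x0 x * f1 x + cutoff1 m \<kappa> x0 x * f2 x) + (cutoff1 m \<kappa> x0 x * f2 x + cutoff m \<kappa> x0 x * f3 x)))"
    by (intro primitive_cmult primitive_add primitive_mult pc p1 p2)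
  then have pr: "primitive ?c ?d ?u ?g"
    by (rule primitive_cong) (auto simp: test_fn_def test_fn_deriv_def cd)
  have u0: "?u x = 0" if "x \<notin> {?c<..<?d}" for x
  proof -
    have "x \<notin> {?c..?d} \<or> x = ?c \<or> x = ?d" using that by auto
    then show ?thesis using cutoff_boundary[OF \<kappa> m, of x0] by (auto simp: test_fn_def)
  qed
  have g0: "?g x = 0" if "x \<notin> {?c..?d}" for x using that unfolding test_fn_deriv_def by argo
  note W = primitive_imp_has_weak_deriv[OF pr ab(1) cd ab(2) u0 g0]
  show "has_weak_deriv 1 {a<..<b} ?u ?g" using W(1) .
  have uc: "continuous_on {?c..?d} ?u" using primitive_continuous_on[OF pr] .
  have uL: "in_Lp p {a<..<b} ?u"
    using W(2) abs_powr_integrable_continuous[OF uc p] _ sub by (rule in_Lp_supported) (auto intro!: u0)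
  have gp: "(\<lambda>x. \<bar>?g x\<bar> powr p) absolutely_integrable_on {?c..?d}"
  proof -
    let ?h = "\<lambda>x. 2 * cutoff1 m \<kappa> x0 x * f2 x + cutoff2 m \<kappa> x0 x * f1 x"
    have hc: "continuous_on {?c..?d} ?h" using \<kappa> primitive_continuous_on[OF p1] primitive_continuous_on[OF p2]
      by (intro continuous_intros continuous_on_cutoff) auto
    have f3m: "f3 \<in> borel_measurable (lebesgue_on {?c..?d})"
      using primitive_abs_integrable[OF p2]
      by (subst borel_measurable_restrict_space_iff) (auto simp: set_integrable_def dest: borel_measurable_integrable)
    have cm: "cutoff m \<kappa> x0 \<in> borel_measurable (lebesgue_on {?c..?d})"
      using \<kappa> by (intro continuous_imp_measurable_on_sets_lebesgue continuous_on_cutoff) auto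
    have hm: "?h \<in> borel_measurable (lebesgue_on {?c..?d})"
      using hc by (intro continuous_imp_measurable_on_sets_lebesgue) auto
    have i1: "(\<lambda>x. \<bar>cutoff m \<kappa> x0 x * f3 x\<bar> powr p) absolutely_integrable_on {?c..?d}"
    proof -
      have "continuous_on {?c..?d} (\<lambda>x. \<bar>cutoff m \<kappa> x0 x\<bar> powr p)"
        using \<kappa> p by (intro continuous_on_powr' continuous_intros continuous_on_cutoff) auto
      from absolutely_integrable_mult_continuous[OF f3 this]
      show ?thesis by (simp add: abs_mult powr_mult mult.commute)
    qed
    have "(\<lambda>x. \<bar>cutoff m \<kappa> x0 x * f3 x + ?h x\<bar> powr p) absolutely_integrable_on {?c..?d}"
      by (rule absolutely_integrable_powr_sum[OF borel_measurable_times[OF cm f3m] hm _ i1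
          abs_powr_integrable_continuous[OF hc p] less_imp_le[OF p]]) simp
    then show ?thesis
    proof (rule absolutely_integrable_cong_AE, intro AE_I2 impI)
      fix x assume x: "x \<in> {?c..?d}"
      have "\<bar>?g x\<bar> = \<bar>cutoff m \<kappa> x0 x * f3 x + ?h x\<bar>"
        using x unfolding test_fn_deriv_def by (simp only: if_True abs_minus_cancel add.assoc)
      then show "\<bar>?g x\<bar> powr p = \<bar>cutoff m \<kappa> x0 x * f3 x + ?h x\<bar> powr p" by (simp only:)
    qed
  qed
  have gL: "in_Lp p {a<..<b} ?g"
    using W(3) gp g0 sub by (rule in_Lp_supported)
  have w0: "has_weak_deriv 0 {a<..<b} ?u ?u"
    using W(1) by (simp add: has_weak_deriv_def)
  have "\<exists>g. has_weak_deriv j {a<..<b} ?u g \<and> in_Lp p {a<..<b} g" if "j \<le> 1" for j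
  proof -
    have "j = 0 \<or> j = 1" using that by auto
    then show ?thesis using w0 uL W(1) gL by blast
  qed
  then have "?u \<in> sobolev 1 p {a<..<b}" using uL by (auto simp: sobolev_def)
  moreover have "AE x in lebesgue_on {a<..<b}. x \<notin> {?c..?d} \<longrightarrow> ?u x = 0"
    by (intro AE_I2 impI u0) auto
  ultimately show "?u \<in> sobolev_supported 1 p {a<..<b} {?c..?d}"
    by (simp add: sobolev_supported_def)
qed

text \<open>Serves two purposes: with v it produces the symmetric form \<integral> \<psi> f1 h1
  behind the energy, and with the source it is the first of the two integrations by parts.\<close>

lemma pairing_by_parts:
  assumes \<kappa>: "\<kappa> > 0" and m: "m \<ge> 3" and ab: "a < x0 - 2 * \<kappa>" "x0 + 2 * \<kappa> < b"
    and p1: "primitive (x0 - 2 * \<kappa>) (x0 + 2 * \<kappa>) f1 f2" and h: "primitive (x0 - 2 * \<kappa>) (x0 + 2 * \<kappa>) h0 h1"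
    and eq: "AE x in lebesgue. x \<in> {x0 - 2 * \<kappa>..x0 + 2 * \<kappa>} \<longrightarrow> g x = h0 x"
  shows "(LINT x:{a..b}|lebesgue. g x * test_fn m \<kappa> x0 f1 f2 x)
    = integral {x0 - 2 * \<kappa>..x0 + 2 * \<kappa>} (\<lambda>x. cutoff m \<kappa> x0 x * f1 x * h1 x)"
proof -
  let ?c = "x0 - 2 * \<kappa>" and ?d = "x0 + 2 * \<kappa>"
  have cd: "?c \<le> ?d" and sub: "{?c..?d} \<subseteq> {a..b}" using \<kappa> ab by auto
  have p: "primitive ?c ?d (\<lambda>x. cutoff m \<kappa> x0 x * f1 x) (\<lambda>x. cutoff1 m \<kappa> x0 x * f1 x + cutoff m \<kappa> x0 x * f2 x)"
    by (intro primitive_mult primitive_cutoff \<kappa> p1)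
  have i: "(\<lambda>x. (cutoff1 m \<kappa> x0 x * f1 x + cutoff m \<kappa> x0 x * f2 x) * h0 x) absolutely_integrable_on {?c..?d}"
    using absolutely_integrable_mult_continuous[OF primitive_abs_integrable[OF p] primitive_continuous_on[OF h]] .
  have "(LINT x:{a..b}|lebesgue. g x * test_fn m \<kappa> x0 f1 f2 x)
     = (LINT x:{?c..?d}|lebesgue. (-1) * ((cutoff1 m \<kappa> x0 x * f1 x + cutoff m \<kappa> x0 x * f2 x) * h0 x))"
    unfolding set_lebesgue_integral_def
  proof (rule integral_lebesgue_cong_AE)
    show "AE x in lebesgue. indicator {a..b} x *\<^sub>R (g x * test_fn m \<kappa> x0 f1 f2 x)
      = indicator {?c..?d} x *\<^sub>R ((-1) * ((cutoff1 m \<kappa> x0 x * f1 x + cutoff m \<kappa> x0 x * f2 x) * h0 x))"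
      using eq
    proof eventually_elim
      case (elim x)
      then show ?case using sub by (cases "x \<in> {?c..?d}") (auto simp: test_fn_def indicator_def algebra_simps)
    qed
  qed
  also have "\<dots> = - integral {?c..?d} (\<lambda>x. (cutoff1 m \<kappa> x0 x * f1 x + cutoff m \<kappa> x0 x * f2 x) * h0 x)"
    unfolding set_integral_mult_right set_lebesgue_integral_eq_integral(2)[OF i] by simp
  also have "\<dots> = integral {?c..?d} (\<lambda>x. cutoff m \<kappa> x0 x * f1 x * h1 x)"
    using primitive_by_parts[OF p h cd] cutoff_boundary[OF \<kappa> m, of x0] by simp
  finally show ?thesis .
qed

text \<open>After two integrations by parts the factor taken from the solution is f0, bounded by 1.
  What remains are the L_1 norms of the first two derivatives of the source over the support of
  \<psi>, which its H^2 norm controls.\<close>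

lemma source_estimate:
  fixes \<kappa> :: real and m :: nat
  assumes \<kappa>: "\<kappa> > 0" and m: "m \<ge> 3"
  obtains C where "C \<ge> 0" "\<And>a b x0 g f0 f1 f2.
    \<lbrakk>a < x0 - 2 * \<kappa>; x0 + 2 * \<kappa> < b; g \<in> sobolev 2 2 {a<..<b};
     primitive (x0 - 2 * \<kappa>) (x0 + 2 * \<kappa>) f0 f1; primitive (x0 - 2 * \<kappa>) (x0 + 2 * \<kappa>) f1 f2;
     \<And>x. x \<in> {x0 - 2 * \<kappa>..x0 + 2 * \<kappa>} \<Longrightarrow> \<bar>f0 x\<bar> \<le> 1\<rbrakk> \<Longrightarrow>
     \<bar>LINT x:{a..b}|lebesgue. g x * test_fn m \<kappa> x0 f1 f2 x\<bar> \<le> C * sobolev_norm 2 2 {a<..<b} g"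
proof -
  \<comment> \<open>1 and m/\<kappa> bound \<psi> and \<psi>'; the factor 2 sqrt(4\<kappa>) compares
    L_1 with L_2 on an interval of length 4\<kappa>, the 2 coming from
    \<open>integral_powr_le_powr_integral\<close>.\<close>
  define C where "C = (1 + real m / \<kappa>) * (2 * sqrt (4 * \<kappa>))"
  have "C \<ge> 0" using \<kappa> by (simp add: C_def)
  moreover have "\<bar>LINT x:{a..b}|lebesgue. g x * test_fn m \<kappa> x0 f1 f2 x\<bar> \<le> C * sobolev_norm 2 2 {a<..<b} g"
    if ab: "a < x0 - 2 * \<kappa>" "x0 + 2 * \<kappa> < b" and g: "g \<in> sobolev 2 2 {a<..<b}"
      and f: "primitive (x0 - 2 * \<kappa>) (x0 + 2 * \<kappa>) f0 f1" "primitive (x0 - 2 * \<kappa>) (x0 + 2 * \<kappa>) f1 f2"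
      and f0: "\<And>x. x \<in> {x0 - 2 * \<kappa>..x0 + 2 * \<kappa>} \<Longrightarrow> \<bar>f0 x\<bar> \<le> 1" for a b x0 g f0 f1 f2
  proof -
    let ?c = "x0 - 2 * \<kappa>" and ?d = "x0 + 2 * \<kappa>" and ?A = "{a<..<b}"
    define N where "N = sobolev_norm 2 2 ?A g"
    have N0: "N \<ge> 0" by (simp add: N_def sobolev_norm_def)
    have cd: "?c \<le> ?d" "?c < ?d" and ab': "a < b" and sub: "{?c..?d} \<subseteq> ?A" using \<kappa> ab by auto
    define g1 g2 where "g1 = weak_deriv 1 ?A g" and "g2 = weak_deriv 2 ?A g"
    have w1: "has_weak_deriv 1 ?A g g1" and w2: "has_weak_deriv (Suc 1) ?A g g2"
      and L1: "in_Lp 2 ?A g1" and L2: "in_Lp 2 ?A g2"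
      using sobolev_weak_deriv[OF g _ ab', of 1] sobolev_weak_deriv[OF g _ ab', of 2]
      by (auto simp: g1_def g2_def numeral_2_eq_2)
    obtain h0 where h0: "primitive ?c ?d h0 g1" "AE x in lebesgue. x \<in> {?c..?d} \<longrightarrow> g x = h0 x"
      using du_bois_reymond[OF w1 ab(1) cd(1) ab(2)] .
    obtain h1 where h1: "primitive ?c ?d h1 g2" "AE x in lebesgue. x \<in> {?c..?d} \<longrightarrow> g1 x = h1 x"
      using du_bois_reymond[OF has_weak_deriv_Suc[OF w1 w2 ab'] ab(1) cd(1) ab(2)] .
    have h1i: "h1 absolutely_integrable_on {?c..?d}"
      using primitive_continuous_on[OF h1(1)] by (rule absolutely_integrable_continuous_real)
    have h01: "primitive ?c ?d h0 h1"
      by (rule primitive_cong_AE[OF h0(1) h1i]) (use h1(2) in \<open>eventually_elim, auto\<close>)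
    note g2i = primitive_abs_integrable[OF h1(1)]
    have bound: "integral {?c..?d} (\<lambda>x. \<bar>u x\<bar>) \<le> 2 * sqrt (4 * \<kappa>) * N"
      if u: "u absolutely_integrable_on {?c..?d}" and uu: "AE x in lebesgue. x \<in> {?c..?d} \<longrightarrow> weak_deriv j ?A g x = u x"
        and L: "in_Lp 2 ?A (weak_deriv j ?A g)" and j: "j \<le> 2" for u j
    proof -
      have Li: "set_integrable lebesgue ?A (\<lambda>x. \<bar>weak_deriv j ?A g x\<bar> powr 2)"
        using L by (simp add: in_Lp_def integrable_restrict_space set_integrable_def)
      have Lj: "(\<lambda>x. \<bar>weak_deriv j ?A g x\<bar> powr 2) absolutely_integrable_on {?c..?d}"
        using Li by (rule set_integrable_subset) (use sub in auto)
      have up: "(\<lambda>x. \<bar>u x\<bar> powr 2) absolutely_integrable_on {?c..?d}"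
        using Lj by (rule absolutely_integrable_cong_AE) (use uu in \<open>eventually_elim, auto\<close>)
      have "integral {?c..?d} (\<lambda>x. \<bar>u x\<bar> powr 2) = (LINT x:{?c..?d}|lebesgue. \<bar>u x\<bar> powr 2)"
        using set_lebesgue_integral_eq_integral(2)[OF up] by simp
      also have "\<dots> \<le> (LINT x:?A|lebesgue. \<bar>weak_deriv j ?A g x\<bar> powr 2)"
        unfolding set_lebesgue_integral_def
      proof (rule integral_mono_AE)
        show "AE x in lebesgue. indicator {?c..?d} x *\<^sub>R \<bar>u x\<bar> powr 2 \<le> indicator ?A x *\<^sub>R \<bar>weak_deriv j ?A g x\<bar> powr 2"
          using uu
        proof eventually_elim
          case (elim x)
          then show ?case using sub by (cases "x \<in> {?c..?d}") (auto simp: indicator_def)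
        qed
      qed (use up Li in \<open>simp_all add: set_integrable_def\<close>)
      also have "\<dots> \<le> N powr 2" unfolding N_def using sobolev_norm_powr_ge(1)[of 2 j 2] j by simp
      finally have A: "integral {?c..?d} (\<lambda>x. \<bar>u x\<bar> powr 2) \<le> N powr 2" .
      define T where "T = integral {?c..?d} (\<lambda>x. \<bar>u x\<bar>)"
      have un: "(\<lambda>x. \<bar>u x\<bar>) integrable_on {?c..?d}"
        using set_lebesgue_integral_eq_integral(1)[OF set_integrable_abs[OF u]] .
      have T0: "T \<ge> 0" unfolding T_def using un by (intro integral_nonneg) auto
      have d: "?d = ?c + 4 * \<kappa>" by simp
      have "T powr 2 \<le> 2 powr 2 * ((4 * \<kappa>) powr (2 - 1) * integral {?c..?d} (\<lambda>x. \<bar>u x\<bar> powr 2))"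
        unfolding T_def d
        by (rule integral_powr_le_powr_integral[OF _ _ un[unfolded d] set_lebesgue_integral_eq_integral(1)[OF up, unfolded d]])
          (use \<kappa> in auto)
      also have "\<dots> \<le> 2 powr 2 * ((4 * \<kappa>) powr (2 - 1) * N powr 2)" using A by (intro mult_left_mono) auto
      also have "\<dots> = (2 * sqrt (4 * \<kappa>) * N)\<^sup>2"
        using \<kappa> N0 by (simp add: power_mult_distrib)
      finally have "T powr 2 \<le> (2 * sqrt (4 * \<kappa>) * N)\<^sup>2" .
      moreover have "T powr 2 = T\<^sup>2" using T0 by simp
      ultimately have "T\<^sup>2 \<le> (2 * sqrt (4 * \<kappa>) * N)\<^sup>2" by (simp only:)
      moreover have "0 \<le> 2 * sqrt (4 * \<kappa>) * N" using N0 \<kappa> by simp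
      ultimately show ?thesis unfolding T_def by (rule power2_le_imp_le)
    qed
    have b1: "integral {?c..?d} (\<lambda>x. \<bar>h1 x\<bar>) \<le> 2 * sqrt (4 * \<kappa>) * N"
      using bound[OF h1i, of 1] h1(2) L1 by (simp add: g1_def)
    have b2: "integral {?c..?d} (\<lambda>x. \<bar>g2 x\<bar>) \<le> 2 * sqrt (4 * \<kappa>) * N"
      using bound[OF g2i, of 2] L2 by (simp add: g2_def)
    have p: "primitive ?c ?d (\<lambda>x. cutoff m \<kappa> x0 x * h1 x) (\<lambda>x. cutoff1 m \<kappa> x0 x * h1 x + cutoff m \<kappa> x0 x * g2 x)"
      by (intro primitive_mult primitive_cutoff \<kappa> h1(1))
    let ?q = "\<lambda>x. (cutoff1 m \<kappa> x0 x * h1 x + cutoff m \<kappa> x0 x * g2 x) * f0 x"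
    have qi: "?q absolutely_integrable_on {?c..?d}"
      using absolutely_integrable_mult_continuous[OF primitive_abs_integrable[OF p] primitive_continuous_on[OF f(1)]] .
    have "(LINT x:{a..b}|lebesgue. g x * test_fn m \<kappa> x0 f1 f2 x) = integral {?c..?d} (\<lambda>x. (cutoff m \<kappa> x0 x * h1 x) * f1 x)"
      using pairing_by_parts[OF \<kappa> m ab f(2) h01 h0(2)] by (simp add: mult_ac)
    also have "\<dots> = - integral {?c..?d} ?q"
      using primitive_by_parts[OF p f(1) cd(1)] cutoff_boundary[OF \<kappa> m, of x0] by simp
    finally have "\<bar>LINT x:{a..b}|lebesgue. g x * test_fn m \<kappa> x0 f1 f2 x\<bar> = \<bar>integral {?c..?d} ?q\<bar>" by simp
    also have "\<dots> \<le> integral {?c..?d} (\<lambda>x. (real m / \<kappa>) * \<bar>h1 x\<bar> + \<bar>g2 x\<bar>)"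
    proof -
      have n1: "(\<lambda>x. \<bar>h1 x\<bar>) integrable_on {?c..?d}" "(\<lambda>x. \<bar>g2 x\<bar>) integrable_on {?c..?d}"
        using set_lebesgue_integral_eq_integral(1)[OF set_integrable_abs[OF h1i]]
          set_lebesgue_integral_eq_integral(1)[OF set_integrable_abs[OF g2i]] .
      have "norm (integral {?c..?d} ?q) \<le> integral {?c..?d} (\<lambda>x. (real m / \<kappa>) * \<bar>h1 x\<bar> + \<bar>g2 x\<bar>)"
      proof (rule integral_norm_bound_integral)
        show "?q integrable_on {?c..?d}" using set_lebesgue_integral_eq_integral(1)[OF qi] .
        show "(\<lambda>x. (real m / \<kappa>) * \<bar>h1 x\<bar> + \<bar>g2 x\<bar>) integrable_on {?c..?d}"
          using n1 by (intro integrable_add integrable_on_mult_right)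
        fix x assume x: "x \<in> {?c..?d}"
        have "parab \<kappa> x0 x ^ (m - 1) \<le> 1"
          using parab_nonneg[OF \<kappa> x] parab_le_1[of \<kappa> x0 x] by (intro power_le_one)
        then have "real m / \<kappa> * parab \<kappa> x0 x ^ (m - 1) \<le> real m / \<kappa> * 1" using \<kappa> by (intro mult_left_mono) auto
        then have c1: "\<bar>cutoff1 m \<kappa> x0 x\<bar> \<le> real m / \<kappa>"
          using cutoff_deriv_bounds(1)[OF \<kappa> x m] by simp
        have c0: "\<bar>cutoff m \<kappa> x0 x\<bar> \<le> 1" using cutoff_bounds[OF \<kappa> x, of m] by simp
        have "norm (?q x) \<le> (\<bar>cutoff1 m \<kappa> x0 x\<bar> * \<bar>h1 x\<bar> + \<bar>cutoff m \<kappa> x0 x\<bar> * \<bar>g2 x\<bar>) * \<bar>f0 x\<bar>"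
          unfolding real_norm_def abs_mult using abs_triangle_ineq[of "cutoff1 m \<kappa> x0 x * h1 x" "cutoff m \<kappa> x0 x * g2 x"]
          by (intro mult_right_mono) (auto simp: abs_mult)
        also have "\<dots> \<le> (real m / \<kappa> * \<bar>h1 x\<bar> + 1 * \<bar>g2 x\<bar>) * 1"
          using c0 c1 f0[OF x] \<kappa> by (intro mult_mono add_mono mult_right_mono) auto
        finally show "norm (?q x) \<le> (real m / \<kappa>) * \<bar>h1 x\<bar> + \<bar>g2 x\<bar>" by simp
      qed
      then show ?thesis by simp
    qed
    also have "\<dots> = (real m / \<kappa>) * integral {?c..?d} (\<lambda>x. \<bar>h1 x\<bar>) + integral {?c..?d} (\<lambda>x. \<bar>g2 x\<bar>)"
      using set_lebesgue_integral_eq_integral(1)[OF set_integrable_abs[OF h1i]]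
          set_lebesgue_integral_eq_integral(1)[OF set_integrable_abs[OF g2i]]
      by (subst Henstock_Kurzweil_Integration.integral_add) (auto intro: integrable_on_mult_right simp del: times_divide_eq_left)
    also have "\<dots> \<le> (real m / \<kappa>) * (2 * sqrt (4 * \<kappa>) * N) + 2 * sqrt (4 * \<kappa>) * N"
      using b1 b2 \<kappa> by (intro add_mono mult_left_mono) auto
    also have "\<dots> = C * N" unfolding C_def by (simp only: algebra_simps)
    finally show ?thesis unfolding N_def .
  qed
  ultimately show thesis by (rule that)
qed

section \<open>Borel data of a solution\<close>

text \<open>What a good time slice provides: f0, f1, f2 are continuous versions of v and its first
  two derivatives, while the third derivative stays the function w3, of which only p-th power
  integrability is known. The bound on f0 holds at every point of the interval, as pointwise
  interpolation requires.\<close>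

definition regular_slice ::
    "real \<Rightarrow> real \<Rightarrow> real \<Rightarrow> (real \<Rightarrow> real) \<Rightarrow> (real \<Rightarrow> real) \<Rightarrow> (real \<Rightarrow> real) \<Rightarrow> (real \<Rightarrow> real)
      \<Rightarrow> (real \<Rightarrow> real) \<Rightarrow> (real \<Rightarrow> real) \<Rightarrow> (real \<Rightarrow> real) \<Rightarrow> bool" where
  "regular_slice p c d v w1 w2 w3 f0 f1 f2 \<longleftrightarrow>
     primitive c d f0 f1 \<and> primitive c d f1 f2 \<and> primitive c d f2 w3 \<and> (\<forall>x\<in>{c..d}. \<bar>f0 x\<bar> \<le> 1) \<and>
     (AE x in lebesgue. x \<in> {c..d} \<longrightarrow> v x = f0 x \<and> w1 x = f1 x \<and> w2 x = f2 x) \<and>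
     (\<lambda>x. \<bar>w3 x\<bar> powr p) absolutely_integrable_on {c..d}"

text \<open>Tonelli's theorem reduces the claim to the slices. The majorant \<open>M\<close> is only
  Lebesgue measurable in time, hence the passage to the completed measure in the middle.\<close>

lemma slicewise_integrable:
  fixes W :: "real \<times> real \<Rightarrow> real" and M :: "real \<Rightarrow> real"
  assumes W[measurable]: "W \<in> borel_measurable borel" and W0: "\<And>z. z \<notin> I \<times> J \<Longrightarrow> W z = 0" and p: "p > 0"
    and I: "I \<in> sets borel" and M: "integrable (lebesgue_on I) M"
    and le: "AE t in lebesgue_on I. integrable lborel (\<lambda>x. \<bar>W (t, x)\<bar> powr p) \<and> (LBINT x. \<bar>W (t, x)\<bar> powr p) \<le> M t"
  shows "integrable lborel (\<lambda>z. \<bar>W z\<bar> powr p)"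
proof (rule integrableI_bounded)
  show "(\<lambda>z. \<bar>W z\<bar> powr p) \<in> borel_measurable lborel" by measurable
  have [measurable]: "W \<in> borel_measurable (borel \<Otimes>\<^sub>M borel)" using W by (simp add: borel_prod)
  have le': "AE t in lborel. t \<in> I \<longrightarrow> integrable lborel (\<lambda>x. \<bar>W (t, x)\<bar> powr p) \<and> (LBINT x. \<bar>W (t, x)\<bar> powr p) \<le> M t"
    using le I by (subst (asm) AE_lebesgue_on) (auto simp: AE_completion_iff)
  have "(\<integral>\<^sup>+z. norm (\<bar>W z\<bar> powr p) \<partial>lborel) = (\<integral>\<^sup>+z. norm (\<bar>W z\<bar> powr p) \<partial>(lborel \<Otimes>\<^sub>M lborel))"
    by (simp add: lborel_prod)
  also have "\<dots> = (\<integral>\<^sup>+t. \<integral>\<^sup>+x. norm (\<bar>W (t, x)\<bar> powr p) \<partial>lborel \<partial>lborel)"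
    by (intro lborel.nn_integral_fst[symmetric]) measurable
  also have "\<dots> \<le> (\<integral>\<^sup>+t. ennreal (indicator I t * M t) \<partial>lebesgue)"
    unfolding nn_integral_completion
  proof (rule nn_integral_mono_AE)
    show "AE t in lborel. (\<integral>\<^sup>+x. norm (\<bar>W (t, x)\<bar> powr p) \<partial>lborel) \<le> ennreal (indicator I t * M t)"
      using le'
    proof eventually_elim
      case (elim t)
      show ?case
      proof (cases "t \<in> I")
        case True
        then have i: "integrable lborel (\<lambda>x. \<bar>W (t, x)\<bar> powr p)" and b: "(LBINT x. \<bar>W (t, x)\<bar> powr p) \<le> M t"
          using elim by auto
        have "(\<integral>\<^sup>+x. norm (\<bar>W (t, x)\<bar> powr p) \<partial>lborel) = ennreal (LBINT x. \<bar>W (t, x)\<bar> powr p)"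
          using nn_integral_eq_integral[OF i] by simp
        then show ?thesis using b True by (simp add: ennreal_leI)
      next
        case False
        then have "W (t, x) = 0" for x by (intro W0) auto
        then show ?thesis by simp
      qed
    qed
  qed
  also have "\<dots> < \<infinity>"
  proof -
    have "integrable lebesgue (\<lambda>t. indicator I t * M t)"
      using M I by (simp add: integrable_restrict_space)
    then have "(\<integral>\<^sup>+t. ennreal (norm (indicator I t * M t)) \<partial>lebesgue) < \<infinity>"
      by (simp add: integrable_iff_bounded)
    moreover have "(\<integral>\<^sup>+t. ennreal (indicator I t * M t) \<partial>lebesgue) \<le> (\<integral>\<^sup>+t. ennreal (norm (indicator I t * M t)) \<partial>lebesgue)"
      by (intro nn_integral_mono ennreal_leI) simp
    ultimately show ?thesis by (rule le_less_trans[rotated])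
  qed
  finally show "(\<integral>\<^sup>+z. norm (\<bar>W z\<bar> powr p) \<partial>lborel) < \<infinity>" .
qed

lemma borel_slice_measurable:
  fixes W :: "real \<times> real \<Rightarrow> real"
  assumes "W \<in> borel_measurable borel" shows "(\<lambda>x. W (t, x)) \<in> borel_measurable borel"
proof -
  have [measurable]: "W \<in> borel_measurable (borel \<Otimes>\<^sub>M borel)" using assms by (simp add: borel_prod)
  show ?thesis by measurable
qed

lemma lebesgue_slice_integrable:
  fixes h :: "real \<Rightarrow> real"
  assumes h: "h \<in> borel_measurable borel" "\<And>x. x \<notin> K \<Longrightarrow> h x = 0" and K: "K \<in> sets borel"
  shows "integrable lborel h \<longleftrightarrow> h absolutely_integrable_on K"
    and "h absolutely_integrable_on K \<Longrightarrow> (LBINT x. h x) = integral K h"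
proof -
  have e: "(\<lambda>x. indicator K x *\<^sub>R h x) = h" using h(2) by (auto simp: indicator_def fun_eq_iff)
  show "integrable lborel h \<longleftrightarrow> h absolutely_integrable_on K"
    unfolding set_integrable_def e using h(1) by (simp add: integrable_completion)
  assume "h absolutely_integrable_on K"
  then have "integral K h = (LINT x|lebesgue. h x)"
    using set_lebesgue_integral_eq_integral(2)[of K h] unfolding set_lebesgue_integral_def e by simp
  also have "\<dots> = (LBINT x. h x)" using h(1) by (intro integral_completion) simp
  finally show "(LBINT x. h x) = integral K h" by simp
qed

lemma Linf_AE_bound:
  assumes v: "in_Linf D v" "Linf_norm D v \<le> 1" and D: "D \<in> sets lebesgue"
  shows "AE z in lebesgue. z \<in> D \<longrightarrow> \<bar>v (fst z) (snd z)\<bar> \<le> 1"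
proof -
  have m: "(\<lambda>(\<tau>, x). ereal \<bar>v \<tau> x\<bar>) \<in> borel_measurable (lebesgue_on D)"
    using v(1) unfolding in_Linf_def by (auto simp: split_beta')
  have "AE z in lebesgue_on D. (case z of (\<tau>, x) \<Rightarrow> ereal \<bar>v \<tau> x\<bar>) \<le> esssup (lebesgue_on D) (\<lambda>(\<tau>, x). ereal \<bar>v \<tau> x\<bar>)"
    by (rule esssup_AE)
  then have "AE z in lebesgue_on D. \<bar>v (fst z) (snd z)\<bar> \<le> 1"
  proof eventually_elim
    case (elim z)
    then have "ereal \<bar>v (fst z) (snd z)\<bar> \<le> 1" using v(2) unfolding Linf_norm_def split_beta' by (rule order_trans)
    then show ?case by simp
  qed
  then show ?thesis using D by (simp add: AE_restrict_space_iff)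
qed

text \<open>Replaces flux and derivatives by Borel functions supported in one compact rectangle, so
  that the plane integrals below are integrals of Borel functions. \<open>W3\<close> is tied to
  \<open>v_dx 3\<close> because the final bound is stated for the latter.\<close>

lemma solution_borel_data:
  fixes \<alpha> a b :: real and v :: "real \<Rightarrow> real \<Rightarrow> real"
  assumes \<alpha>: "\<alpha> > 1" and C: "Cs > 0" "C0 > 0" "C1 > 0" "C2 > 0" "C3 > 0"
    and ws: "weak_solution \<alpha> a b \<Phi> S v" and st: "structural_ineqs \<alpha> Cs C0 C1 C2 C3 \<Phi>"
    and vL: "in_Linf ({1/4..1} \<times> {a..b}) v" "Linf_norm ({1/4..1} \<times> {a..b}) v \<le> 1"
    and ab: "a < c" "c < d" "d < b"
  obtains W1 W2 W3 F :: "real \<times> real \<Rightarrow> real" where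
    "W1 \<in> borel_measurable borel" "W2 \<in> borel_measurable borel" "W3 \<in> borel_measurable borel" "F \<in> borel_measurable borel"
    "\<And>z. z \<notin> time_interval \<times> {c..d} \<Longrightarrow> W1 z = 0 \<and> W2 z = 0 \<and> W3 z = 0 \<and> F z = 0"
    "integrable lborel (\<lambda>z. \<bar>W1 z\<bar> powr (\<alpha> + 1))" "integrable lborel (\<lambda>z. \<bar>W2 z\<bar> powr (\<alpha> + 1))"
    "integrable lborel (\<lambda>z. \<bar>W3 z\<bar> powr (\<alpha> + 1))" "integrable lborel (\<lambda>z. \<bar>F z\<bar> powr ((\<alpha> + 1) / \<alpha>))"
    "AE t in lborel. t \<in> time_interval \<longrightarrow> (\<exists>f0 f1 f2. regular_slice (\<alpha> + 1) c d (v t) (\<lambda>x. W1 (t, x)) (\<lambda>x. W2 (t, x)) (\<lambda>x. W3 (t, x)) f0 f1 f2)"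
    "AE t in lborel. t \<in> time_interval \<longrightarrow> (AE x in lborel. x \<in> {c..d} \<longrightarrow>
       F (t, x) = flux \<Phi> a b v t x \<and> F (t, x) = \<Phi> (v t x) (W1 (t, x)) (W2 (t, x)) (W3 (t, x)) \<and> W3 (t, x) = v_dx 3 a b v t x)"
proof -
  let ?I = time_interval and ?A = "{a<..<b}" and ?J = "{c..d}" and ?p = "\<alpha> + 1"
  have ab': "a < b" using ab by simp
  have p: "?p > 0" "?p \<ge> 1" using \<alpha> by auto
  have bo: "\<And>c d. a < c \<Longrightarrow> c < d \<Longrightarrow> d < b \<Longrightarrow>
      bochner_Lp (lebesgue_on ?I) (sobolev 3 ?p {c<..<d}) (sobolev_norm 3 ?p {c<..<d}) ?p v"
    using ws unfolding weak_solution_def by blast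
  have Im: "?I \<in> lmeasurable" by simp
  have wd: "case_prod (v_dx j a b v) \<in> borel_measurable (lebesgue_on (?I \<times> ?A))"
    "AE \<tau> in lebesgue_on ?I. has_weak_deriv j ?A (v \<tau>) (v_dx j a b v \<tau>)" if "j \<le> 3" for j
    using weak_dx_props[OF ab' Im that p(2) bo] by auto
  have fm: "(\<lambda>z. flux \<Phi> a b v (fst z) (snd z)) \<in> borel_measurable (lebesgue_on (?I \<times> ?A))"
    using ws unfolding weak_solution_def by (simp add: split_beta')
  have wm: "(\<lambda>z. v_dx j a b v (fst z) (snd z)) \<in> borel_measurable (lebesgue_on (?I \<times> ?A))" if "j \<le> 3" for j
    using wd(1)[OF that] by (simp add: split_beta')
  have JA: "?J \<in> sets borel" "?J \<subseteq> ?A" "?I \<in> sets borel" "?A \<in> sets borel" using ab by auto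
  have ver: "\<exists>g. g \<in> borel_measurable borel \<and> (\<forall>z. z \<notin> ?I \<times> ?J \<longrightarrow> g z = 0) \<and>
    (AE t in lborel. AE x in lborel. t \<in> ?I \<longrightarrow> x \<in> ?J \<longrightarrow> g (t, x) = f (t, x))"
    if fM: "f \<in> borel_measurable (lebesgue_on (?I \<times> ?A))" for f :: "real \<times> real \<Rightarrow> real"
  proof (rule borel_version_rectangle[OF fM JA(3,4,1,2)])
    fix g :: "real \<times> real \<Rightarrow> real"
    assume g: "g \<in> borel_measurable borel" "\<And>z. z \<notin> ?I \<times> ?J \<Longrightarrow> g z = 0"
      "AE t in lborel. AE x in lborel. t \<in> ?I \<longrightarrow> x \<in> ?J \<longrightarrow> g (t, x) = f (t, x)"
    show ?thesis by (rule exI[of _ g], intro conjI allI impI g(1) g(3)) (rule g(2))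
  qed
  obtain W1 where W1: "W1 \<in> borel_measurable borel" "\<And>z. z \<notin> ?I \<times> ?J \<Longrightarrow> W1 z = 0"
    "AE t in lborel. AE x in lborel. t \<in> ?I \<longrightarrow> x \<in> ?J \<longrightarrow> W1 (t, x) = v_dx 1 a b v t x"
    using ver[OF wm[of 1]] by auto
  obtain W2 where W2: "W2 \<in> borel_measurable borel" "\<And>z. z \<notin> ?I \<times> ?J \<Longrightarrow> W2 z = 0"
    "AE t in lborel. AE x in lborel. t \<in> ?I \<longrightarrow> x \<in> ?J \<longrightarrow> W2 (t, x) = v_dx 2 a b v t x"
    using ver[OF wm[of 2]] by auto
  obtain W3 where W3: "W3 \<in> borel_measurable borel" "\<And>z. z \<notin> ?I \<times> ?J \<Longrightarrow> W3 z = 0"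
    "AE t in lborel. AE x in lborel. t \<in> ?I \<longrightarrow> x \<in> ?J \<longrightarrow> W3 (t, x) = v_dx 3 a b v t x"
    using ver[OF wm[of 3]] by auto
  obtain F where F: "F \<in> borel_measurable borel" "\<And>z. z \<notin> ?I \<times> ?J \<Longrightarrow> F z = 0"
    "AE t in lborel. AE x in lborel. t \<in> ?I \<longrightarrow> x \<in> ?J \<longrightarrow> F (t, x) = flux \<Phi> a b v t x"
    using ver[OF fm] by auto
  define M where "M = (\<lambda>t. sobolev_norm 3 ?p {c<..<d} (v t) powr ?p)"
  have Mi: "integrable (lebesgue_on ?I) M" and vX: "AE t in lebesgue_on ?I. v t \<in> sobolev 3 ?p {c<..<d}"
    using bo[OF ab] unfolding bochner_Lp_def M_def by blast+
  \<comment> \<open>The norm on the inner interval is formed with the weak derivatives of that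
    interval, which agree there with \<open>v_dx\<close> by uniqueness; closing the interval adds
    only two points.\<close>
  have slice_p: "AE t in lebesgue_on ?I. (\<lambda>x. \<bar>v_dx j a b v t x\<bar> powr ?p) absolutely_integrable_on ?J \<and>
      integral ?J (\<lambda>x. \<bar>v_dx j a b v t x\<bar> powr ?p) \<le> M t" if j: "j \<le> 3" for j
    using wd(2)[OF j] vX
  proof eventually_elim
    case (elim t)
    let ?B = "{c<..<d}"
    note s = sobolev_weak_deriv[OF elim(2) j ab(2)]
    have sub: "has_weak_deriv j ?B (v t) (v_dx j a b v t)"
      using elim(1) by (rule has_weak_deriv_subinterval) (use ab in auto)
    have u: "AE x in lebesgue. x \<in> ?B \<longrightarrow> weak_deriv j ?B (v t) x = v_dx j a b v t x"
      using has_weak_deriv_unique[OF s(1) sub ab(2)] .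
    have Li: "set_integrable lebesgue ?B (\<lambda>x. \<bar>weak_deriv j ?B (v t) x\<bar> powr ?p)"
      using s(2) by (simp add: in_Lp_def integrable_restrict_space set_integrable_def)
    have i1: "(\<lambda>x. \<bar>v_dx j a b v t x\<bar> powr ?p) absolutely_integrable_on ?B"
      using Li by (rule absolutely_integrable_cong_AE) (use u in \<open>eventually_elim, auto\<close>)
    have neg: "negligible {c, d}" by simp
    have i2: "(\<lambda>x. \<bar>v_dx j a b v t x\<bar> powr ?p) absolutely_integrable_on ?J"
      using i1 by (rule absolutely_integrable_spike_set) (auto intro: negligible_subset[OF neg])
    have "integral ?J (\<lambda>x. \<bar>v_dx j a b v t x\<bar> powr ?p) = integral ?B (\<lambda>x. \<bar>v_dx j a b v t x\<bar> powr ?p)"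
      by (rule integral_spike_set) (auto intro: negligible_subset[OF neg])
    also have "\<dots> = (LINT x:?B|lebesgue. \<bar>weak_deriv j ?B (v t) x\<bar> powr ?p)"
      unfolding set_lebesgue_integral_eq_integral(2)[OF i1, symmetric] set_lebesgue_integral_def
      by (rule integral_lebesgue_cong_AE) (use u in \<open>eventually_elim, auto simp: indicator_def\<close>)
    also have "\<dots> \<le> M t" unfolding M_def by (rule sobolev_norm_powr_ge(1)[OF p(1) j])
    finally show ?case using i2 by blast
  qed
  have to_lb: "(AE t in lebesgue_on ?I. Q t) \<longleftrightarrow> (AE t in lborel. t \<in> ?I \<longrightarrow> Q t)" for Q
    by (subst AE_lebesgue_on) (auto simp: AE_completion_iff)
  have Wp: "integrable lborel (\<lambda>z. \<bar>W z\<bar> powr ?p)"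
    if W: "W \<in> borel_measurable borel" "\<And>z. z \<notin> ?I \<times> ?J \<Longrightarrow> W z = 0"
      "AE t in lborel. AE x in lborel. t \<in> ?I \<longrightarrow> x \<in> ?J \<longrightarrow> W (t, x) = v_dx j a b v t x" and j: "j \<le> 3" for W j
  proof (rule slicewise_integrable[OF W(1,2) p(1) JA(3) Mi])
    have "AE t in lborel. t \<in> ?I \<longrightarrow> integrable lborel (\<lambda>x. \<bar>W (t, x)\<bar> powr ?p) \<and> (LBINT x. \<bar>W (t, x)\<bar> powr ?p) \<le> M t"
      using W(3) slice_p[OF j, unfolded to_lb]
    proof eventually_elim
      case (elim t)
      show ?case
      proof
        assume t: "t \<in> ?I"
        have "AE x in lborel. x \<in> ?J \<longrightarrow> W (t, x) = v_dx j a b v t x" using elim(1) t by (auto elim!: eventually_mono)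
        then have ae: "AE x in lebesgue. x \<in> ?J \<longrightarrow> W (t, x) = v_dx j a b v t x" by (rule AE_completion)
        have i: "(\<lambda>x. \<bar>W (t, x)\<bar> powr ?p) absolutely_integrable_on ?J"
          by (rule absolutely_integrable_cong_AE[where f="\<lambda>x. \<bar>v_dx j a b v t x\<bar> powr ?p"]) (use elim(2) t ae in \<open>auto elim!: eventually_mono\<close>)
        have m: "(\<lambda>x. \<bar>W (t, x)\<bar> powr ?p) \<in> borel_measurable borel"
          using borel_slice_measurable[OF W(1), of t] by measurable
        have z: "\<bar>W (t, x)\<bar> powr ?p = 0" if "x \<notin> ?J" for x using W(2)[of "(t, x)"] that by auto
        have "(LBINT x. \<bar>W (t, x)\<bar> powr ?p) = integral ?J (\<lambda>x. \<bar>W (t, x)\<bar> powr ?p)"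
          using lebesgue_slice_integrable(2)[OF m z JA(1) i] .
        also have "\<dots> = integral ?J (\<lambda>x. \<bar>v_dx j a b v t x\<bar> powr ?p)"
          by (rule integral_spike[OF AE_imp_negligible[OF ae]]) auto
        also have "\<dots> \<le> M t" using elim(2) t by blast
        finally show "integrable lborel (\<lambda>x. \<bar>W (t, x)\<bar> powr ?p) \<and> (LBINT x. \<bar>W (t, x)\<bar> powr ?p) \<le> M t"
          using lebesgue_slice_integrable(1)[OF m z JA(1)] i by blast
      qed
    qed
    then show "AE t in lebesgue_on ?I. integrable lborel (\<lambda>x. \<bar>W (t, x)\<bar> powr ?p) \<and> (LBINT x. \<bar>W (t, x)\<bar> powr ?p) \<le> M t"
      unfolding to_lb .
  qed
  have W1p: "integrable lborel (\<lambda>z. \<bar>W1 z\<bar> powr ?p)" using Wp[OF W1] by simp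
  have W2p: "integrable lborel (\<lambda>z. \<bar>W2 z\<bar> powr ?p)" using Wp[OF W2] by simp
  have W3p: "integrable lborel (\<lambda>z. \<bar>W3 z\<bar> powr ?p)" using Wp[OF W3] by simp
  have vb: "AE t in lborel. AE x in lborel. t \<in> ?I \<longrightarrow> x \<in> ?J \<longrightarrow> \<bar>v t x\<bar> \<le> 1"
  proof -
    have "?I \<times> {a..b} \<in> sets lebesgue" by (intro sets_completionI_sets) (auto intro: borel_Times)
    from lborel_pair_AE_of_lebesgue[OF Linf_AE_bound[OF vL this]]
    show ?thesis
    proof eventually_elim
      case (elim t)
      then show ?case by eventually_elim (use ab in auto)
    qed
  qed
  have Fflux: "AE t in lborel. t \<in> ?I \<longrightarrow> (AE x in lborel. x \<in> ?J \<longrightarrow>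
       F (t, x) = flux \<Phi> a b v t x \<and> F (t, x) = \<Phi> (v t x) (W1 (t, x)) (W2 (t, x)) (W3 (t, x)) \<and> W3 (t, x) = v_dx 3 a b v t x)"
    using W1(3) W2(3) W3(3) F(3)
  proof eventually_elim
    case (elim t)
    show ?case
    proof
      assume t: "t \<in> ?I"
      show "AE x in lborel. x \<in> ?J \<longrightarrow> F (t, x) = flux \<Phi> a b v t x \<and> F (t, x) = \<Phi> (v t x) (W1 (t, x)) (W2 (t, x)) (W3 (t, x)) \<and> W3 (t, x) = v_dx 3 a b v t x"
        using elim by eventually_elim (use t in \<open>simp add: flux_def\<close>)
    qed
  qed
  have reg: "AE t in lborel. t \<in> ?I \<longrightarrow> (\<exists>f0 f1 f2. regular_slice ?p c d (v t) (\<lambda>x. W1 (t, x)) (\<lambda>x. W2 (t, x)) (\<lambda>x. W3 (t, x)) f0 f1 f2)"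
    using W1(3) W2(3) W3(3) vb wd(2)[of 1, unfolded to_lb, simplified] wd(2)[of 2, unfolded to_lb, simplified] wd(2)[of 3, unfolded to_lb, simplified]
      slice_p[of 3, unfolded to_lb, simplified]
  proof eventually_elim
    case (elim t)
    show ?case
    proof
      assume t: "t \<in> ?I"
      have w: "has_weak_deriv 1 ?A (v t) (v_dx 1 a b v t)" "has_weak_deriv 2 ?A (v t) (v_dx 2 a b v t)" "has_weak_deriv 3 ?A (v t) (v_dx 3 a b v t)"
        using elim(5,6,7) t by auto
      obtain f0 f1 f2 where f: "primitive c d f0 f1" "primitive c d f1 f2" "primitive c d f2 (v_dx 3 a b v t)"
        "AE x in lebesgue. x \<in> {c..d} \<longrightarrow> v t x = f0 x" "AE x in lebesgue. x \<in> {c..d} \<longrightarrow> v_dx 1 a b v t x = f1 x"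
        "AE x in lebesgue. x \<in> {c..d} \<longrightarrow> v_dx 2 a b v t x = f2 x"
        using sobolev_slice_representatives[OF w ab] .
      have e: "AE x in lebesgue. x \<in> ?J \<longrightarrow> W1 (t, x) = v_dx 1 a b v t x" "AE x in lebesgue. x \<in> ?J \<longrightarrow> W2 (t, x) = v_dx 2 a b v t x"
        "AE x in lebesgue. x \<in> ?J \<longrightarrow> W3 (t, x) = v_dx 3 a b v t x" "AE x in lebesgue. x \<in> ?J \<longrightarrow> \<bar>v t x\<bar> \<le> 1"
        using elim(1,2,3,4) t by (auto intro!: AE_completion elim!: eventually_mono)
      have i3: "(\<lambda>x. W3 (t, x)) absolutely_integrable_on ?J"
        using primitive_abs_integrable[OF f(3)] e(3) by (rule absolutely_integrable_cong_AE)
      have p3: "primitive c d f2 (\<lambda>x. W3 (t, x))" using primitive_cong_AE[OF f(3) i3 e(3)] .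
      have f0b: "AE x in lebesgue. x \<in> ?J \<longrightarrow> \<bar>f0 x\<bar> \<le> 1" using f(4) e(4) by eventually_elim auto
      have b: "\<forall>x\<in>?J. \<bar>f0 x\<bar> \<le> 1"
        using continuous_AE_bound[OF primitive_continuous_on[OF f(1)] ab(2) f0b] by blast
      have ae: "AE x in lebesgue. x \<in> ?J \<longrightarrow> v t x = f0 x \<and> W1 (t, x) = f1 x \<and> W2 (t, x) = f2 x"
        using f(4,5,6) e(1,2) by eventually_elim auto
      have pp: "(\<lambda>x. \<bar>W3 (t, x)\<bar> powr ?p) absolutely_integrable_on ?J"
        by (rule absolutely_integrable_cong_AE[where f="\<lambda>x. \<bar>v_dx 3 a b v t x\<bar> powr ?p"]) (use elim(8) t e(3) in \<open>auto elim!: eventually_mono\<close>)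
      show "\<exists>f0 f1 f2. regular_slice ?p c d (v t) (\<lambda>x. W1 (t, x)) (\<lambda>x. W2 (t, x)) (\<lambda>x. W3 (t, x)) f0 f1 f2"
        using f(1,2) p3 b ae pp unfolding regular_slice_def by blast
    qed
  qed
  \<comment> \<open>The exponent (\<alpha>+1)/\<alpha> turns the growth of order \<alpha> of the
    flux into order \<alpha> + 1, the order to which the derivatives of v are integrable.\<close>
  have Fq: "integrable lborel (\<lambda>z. \<bar>F z\<bar> powr (?p / \<alpha>))"
  proof -
    note [measurable] = W1(1) W2(1) W3(1) F(1)
    define Ct where "Ct = C0 + C1 + C2 + C3 + Cs"
    let ?R = "?I \<times> ?J"
    have R: "?R \<in> sets borel" by (auto intro: borel_Times)
    have R'[measurable]: "?R \<in> sets (borel :: (real \<times> real) measure)" using R .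
    have iR: "integrable lborel (indicator ?R :: real \<times> real \<Rightarrow> real)"
    proof -
      have "?R = cbox (1/4, c) (1, d)" by (auto simp: cbox_Pair_eq)
      then show ?thesis using emeasure_lborel_cbox_finite[of "(1/4, c)" "(1, d)"] R by (simp add: integrable_indicator_iff)
    qed
    have i: "integrable lborel (\<lambda>z. Ct powr (?p / \<alpha>) * (indicator ?R z + \<bar>W1 z\<bar> powr ?p + \<bar>W2 z\<bar> powr ?p + \<bar>W3 z\<bar> powr ?p))"
      using iR W1p W2p W3p by (intro integrable_mult_right Bochner_Integration.integrable_add)
    let ?P = "\<lambda>z. \<bar>F z\<bar> powr (?p / \<alpha>) \<le> Ct powr (?p / \<alpha>) * (indicator ?R z + \<bar>W1 z\<bar> powr ?p + \<bar>W2 z\<bar> powr ?p + \<bar>W3 z\<bar> powr ?p)"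
    have "AE z in lborel \<Otimes>\<^sub>M lborel. ?P z"
    proof (rule lborel_pair.AE_pair_measure)
      have m1: "(\<lambda>z. \<bar>F z\<bar> powr (?p / \<alpha>)) \<in> borel_measurable lborel" by measurable
      show "{z \<in> space (lborel \<Otimes>\<^sub>M lborel). ?P z} \<in> sets (lborel \<Otimes>\<^sub>M lborel)"
        unfolding lborel_prod by (rule borel_measurable_le[OF m1 borel_measurable_integrable[OF i]])
      show "AE t in lborel. AE x in lborel. ?P (t, x)"
        using Fflux vb
      proof eventually_elim
        case (elim t)
        show ?case
        proof (cases "t \<in> ?I")
          case False
          then have "F (t, x) = 0" for x by (intro F(2)) auto
          then show ?thesis using \<alpha> by simp
        next
          case True
          with elim(1) have "AE x in lborel. x \<in> ?J \<longrightarrow> F (t, x) = \<Phi> (v t x) (W1 (t, x)) (W2 (t, x)) (W3 (t, x))"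
            by (auto elim!: eventually_mono)
          then show ?thesis using elim(2)
          proof eventually_elim
            case (elim x)
            show ?case
            proof (cases "x \<in> ?J")
              case False
              then have "F (t, x) = 0" by (intro F(2)) auto
              then show ?thesis using \<alpha> by simp
            next
              case xJ: True
              \<comment> \<open>A maximum that is at least 1 majorises \<bar>v\<bar> as well and
                absorbs the constant Cs, so all five terms are bounded by multiples of
                m^\<alpha>.\<close>
              define m where "m = max 1 (max \<bar>W1 (t, x)\<bar> (max \<bar>W2 (t, x)\<bar> \<bar>W3 (t, x)\<bar>))"
              have mb: "1 \<le> m" "\<bar>W1 (t, x)\<bar> \<le> m" "\<bar>W2 (t, x)\<bar> \<le> m" "\<bar>W3 (t, x)\<bar> \<le> m"
                by (auto simp: m_def le_max_iff_disj)
              have vle: "\<bar>v t x\<bar> \<le> m" using elim(2) True xJ mb(1) by auto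
              have le: "C0 * \<bar>v t x\<bar> powr \<alpha> \<le> C0 * m powr \<alpha>" "C1 * \<bar>W1 (t, x)\<bar> powr \<alpha> \<le> C1 * m powr \<alpha>"
                "C2 * \<bar>W2 (t, x)\<bar> powr \<alpha> \<le> C2 * m powr \<alpha>" "C3 * \<bar>W3 (t, x)\<bar> powr \<alpha> \<le> C3 * m powr \<alpha>"
                using C \<alpha> vle mb by (auto intro!: mult_left_mono powr_mono2)
              have "Cs * 1 \<le> Cs * m powr \<alpha>" using C \<alpha> mb(1) by (intro mult_left_mono ge_one_powr_ge_zero) auto
              moreover have "\<bar>F (t, x)\<bar> \<le> C0 * \<bar>v t x\<bar> powr \<alpha> + C1 * \<bar>W1 (t, x)\<bar> powr \<alpha> + C2 * \<bar>W2 (t, x)\<bar> powr \<alpha> + C3 * \<bar>W3 (t, x)\<bar> powr \<alpha> + Cs"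
                using st elim(1) xJ unfolding structural_ineqs_def by auto
              ultimately have "\<bar>F (t, x)\<bar> \<le> Ct * m powr \<alpha>" using le by (simp add: Ct_def algebra_simps)
              then have "\<bar>F (t, x)\<bar> powr (?p / \<alpha>) \<le> (Ct * m powr \<alpha>) powr (?p / \<alpha>)"
                using \<alpha> by (intro powr_mono2) auto
              also have "\<dots> = Ct powr (?p / \<alpha>) * m powr ?p"
                using C \<alpha> by (simp add: powr_mult powr_powr Ct_def)
              also have "m powr ?p \<le> 1 + \<bar>W1 (t, x)\<bar> powr ?p + \<bar>W2 (t, x)\<bar> powr ?p + \<bar>W3 (t, x)\<bar> powr ?p"
                by (auto simp: m_def max_def add_increasing add_increasing2)
              finally show ?thesis using True xJ by (simp add: mult_left_mono)
            qed
          qed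
        qed
      qed
    qed
    then have "AE z in lborel. ?P z" unfolding lborel_prod .
    then have "AE z in lborel. norm (\<bar>F z\<bar> powr (?p / \<alpha>)) \<le> norm (Ct powr (?p / \<alpha>) * (indicator ?R z + \<bar>W1 z\<bar> powr ?p + \<bar>W2 z\<bar> powr ?p + \<bar>W3 z\<bar> powr ?p))"
      by eventually_elim (auto intro: order_trans[OF _ abs_ge_self])
    then show ?thesis by (intro Bochner_Integration.integrable_bound[OF i]) measurable
  qed
  show thesis
    by (rule that[OF W1(1) W2(1) W3(1) F(1) _ W1p W2p W3p Fq reg Fflux]) (use W1(2) W2(2) W3(2) F(2) in blast)
qed

section \<open>The equation tested at a frozen time\<close>

text \<open>The root of the cutoff makes the pairing of v(s) with the test function frozen at \<tau>
  equal to the symmetric product of w(s) and w(\<tau>), the form in which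
  \<open>mollified_energy_inequality\<close> takes it.\<close>

definition weighted_slope :: "nat \<Rightarrow> real \<Rightarrow> real \<Rightarrow> (real \<times> real \<Rightarrow> real) \<Rightarrow> real \<times> real \<Rightarrow> real" where
  "weighted_slope m \<kappa> x0 W1 z = sqrt (cutoff m \<kappa> x0 (snd z)) * W1 z"

text \<open>The second space derivative of \<psi> times the first derivative of v; it is what
  multiplies the flux.\<close>

definition weighted_third :: "nat \<Rightarrow> real \<Rightarrow> real \<Rightarrow> (real \<times> real \<Rightarrow> real) \<Rightarrow> (real \<times> real \<Rightarrow> real)
    \<Rightarrow> (real \<times> real \<Rightarrow> real) \<Rightarrow> real \<times> real \<Rightarrow> real" where
  "weighted_third m \<kappa> x0 W1 W2 W3 z =
     cutoff m \<kappa> x0 (snd z) * W3 z + 2 * cutoff1 m \<kappa> x0 (snd z) * W2 z + cutoff2 m \<kappa> x0 (snd z) * W1 z"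

lemma cutoff_measurable:
  assumes "\<kappa> \<noteq> 0"
  shows "cutoff m \<kappa> x0 \<in> borel_measurable borel" "cutoff1 m \<kappa> x0 \<in> borel_measurable borel"
    "cutoff2 m \<kappa> x0 \<in> borel_measurable borel"
  using continuous_on_cutoff[OF assms] by (auto intro: borel_measurable_continuous_onI)

lemma snd_fst_measurable:
  "fst \<in> borel_measurable (borel :: (real \<times> real) measure)" "snd \<in> borel_measurable (borel :: (real \<times> real) measure)"
  by (intro borel_measurable_continuous_onI continuous_intros)+

lemma weighted_measurable:
  assumes [measurable]: "W1 \<in> borel_measurable borel" "W2 \<in> borel_measurable borel" "W3 \<in> borel_measurable borel" and \<kappa>: "\<kappa> \<noteq> 0"
  shows "weighted_slope m \<kappa> x0 W1 \<in> borel_measurable borel" "weighted_third m \<kappa> x0 W1 W2 W3 \<in> borel_measurable borel"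
proof -
  note [measurable] = cutoff_measurable[OF \<kappa>] snd_fst_measurable
  show "weighted_slope m \<kappa> x0 W1 \<in> borel_measurable borel" unfolding weighted_slope_def[abs_def] by measurable
  show "weighted_third m \<kappa> x0 W1 W2 W3 \<in> borel_measurable borel" unfolding weighted_third_def[abs_def] by measurable
qed

lemma slice_pairing_measurable:
  fixes F U :: "real \<times> real \<Rightarrow> real"
  assumes "F \<in> borel_measurable borel" "U \<in> borel_measurable borel"
  shows "(\<lambda>s. LBINT x. F (s, x) * U (t, x)) \<in> borel_measurable borel"
proof -
  have [measurable]: "F \<in> borel_measurable (borel \<Otimes>\<^sub>M borel)" "U \<in> borel_measurable (borel \<Otimes>\<^sub>M borel)"
    using assms by (simp_all add: borel_prod)
  show ?thesis by measurable
qed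

lemma set_integral_eq_LBINT_AE:
  fixes f g :: "real \<Rightarrow> real"
  assumes eq: "AE x in lebesgue. indicator K x * f x = g x" and g: "g \<in> borel_measurable borel"
  shows "(LINT x:K|lebesgue. f x) = (LBINT x. g x)"
proof -
  have "(LINT x:K|lebesgue. f x) = (LINT x|lebesgue. g x)"
    unfolding set_lebesgue_integral_def by (rule integral_lebesgue_cong_AE) (use eq in \<open>simp\<close>)
  also have "\<dots> = (LBINT x. g x)" using g by (intro integral_completion) simp
  finally show ?thesis .
qed

lemma LBINT_eq_integral_AE:
  fixes f g :: "real \<Rightarrow> real"
  assumes g: "g \<in> borel_measurable borel" "\<And>x. x \<notin> K \<Longrightarrow> g x = 0" and K: "K \<in> sets borel"
    and f: "f absolutely_integrable_on K" and eq: "AE x in lebesgue. x \<in> K \<longrightarrow> g x = f x"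
  shows "integrable lborel g" "(LBINT x. g x) = integral K f"
proof -
  have i: "g absolutely_integrable_on K" using f eq by (rule absolutely_integrable_cong_AE)
  show "integrable lborel g" using lebesgue_slice_integrable(1)[OF g K] i by simp
  have "(LBINT x. g x) = integral K g" using lebesgue_slice_integrable(2)[OF g K i] .
  also have "\<dots> = integral K f" by (rule integral_spike[OF AE_imp_negligible[OF eq]]) auto
  finally show "(LBINT x. g x) = integral K f" .
qed

lemma LBINT_reflect_scale:
  fixes g P :: "real \<Rightarrow> real"
  assumes "\<epsilon> > 0"
  shows "(LBINT s. g ((t - s) / \<epsilon>) * P s) = \<epsilon> * (LBINT y. g y * P (t - \<epsilon> * y))"
proof -
  have "(t - (t + - \<epsilon> * y)) / \<epsilon> = y" for y using assms by simp
  then show ?thesis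
    using lborel_integral_real_affine[of "-\<epsilon>" "\<lambda>s. g ((t - s) / \<epsilon>) * P s" t] assms by simp
qed

text \<open>The function \<theta>(s) = \<rho>((\<tau> - s)/\<epsilon>), times the spatial test
  function built from the slice at \<tau>, goes into the product form of the equation; the
  substitution s = \<tau> - \<epsilon> y then turns \<theta>' into \<rho>' with a factor
  1/\<epsilon>. The conditions on \<tau> and \<epsilon> keep the support of \<theta> inside the open
  time interval.\<close>

lemma tested_equation:
  assumes ws: "weak_solution \<alpha> a b \<Phi> S v" and \<alpha>: "\<alpha> > 1" and \<kappa>: "\<kappa> > 0" and m: "m \<ge> 3"
    and ab: "a < x0 - 2 * \<kappa>" "x0 + 2 * \<kappa> < b"
    and meas: "W1 \<in> borel_measurable borel" "W2 \<in> borel_measurable borel" "W3 \<in> borel_measurable borel" "F \<in> borel_measurable borel"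
    and zero: "\<And>z. z \<notin> time_interval \<times> {x0 - 2 * \<kappa>..x0 + 2 * \<kappa>} \<Longrightarrow> W1 z = 0 \<and> W2 z = 0 \<and> W3 z = 0 \<and> F z = 0"
    and reg: "AE t in lborel. t \<in> time_interval \<longrightarrow> (\<exists>f0 f1 f2. regular_slice (\<alpha> + 1) (x0 - 2 * \<kappa>) (x0 + 2 * \<kappa>)
       (v t) (\<lambda>x. W1 (t, x)) (\<lambda>x. W2 (t, x)) (\<lambda>x. W3 (t, x)) f0 f1 f2)"
    and flux: "AE t in lborel. t \<in> time_interval \<longrightarrow> (AE x in lborel. x \<in> {x0 - 2 * \<kappa>..x0 + 2 * \<kappa>} \<longrightarrow> F (t, x) = flux \<Phi> a b v t x)"
    and n: "integrable lborel n" "\<And>t. 0 \<le> n t"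
    and reg_\<tau>: "regular_slice (\<alpha> + 1) (x0 - 2 * \<kappa>) (x0 + 2 * \<kappa>) (v \<tau>) (\<lambda>x. W1 (\<tau>, x)) (\<lambda>x. W2 (\<tau>, x)) (\<lambda>x. W3 (\<tau>, x)) f0 f1 f2"
    and source: "AE s in lebesgue. s \<in> {1/4<..<1} \<longrightarrow> \<bar>LINT x:{a..b}|lebesgue. S s x * test_fn m \<kappa> x0 f1 f2 x\<bar> \<le> n s"
    and \<rho>: "smooth \<rho>" "\<And>x. x \<notin> {-1..1} \<Longrightarrow> \<rho> x = 0" "\<And>x. 0 \<le> \<rho> x" "\<And>x. x \<notin> {-1..1} \<Longrightarrow> deriv \<rho> x = 0"
    and \<epsilon>: "\<epsilon> > 0" "1/4 < \<tau> - \<epsilon>" "\<tau> + \<epsilon> < 1"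
  defines "w \<equiv> weighted_slope m \<kappa> x0 W1" and "U \<equiv> weighted_third m \<kappa> x0 W1 W2 W3"
  shows "\<bar>(LBINT y. \<rho> y * (LBINT x. F (\<tau> - \<epsilon> * y, x) * U (\<tau>, x)))
         + (LBINT y. deriv \<rho> y * (LBINT x. w (\<tau> - \<epsilon> * y, x) * w (\<tau>, x))) / \<epsilon>\<bar>
       \<le> (LBINT y. \<rho> y * n (\<tau> - \<epsilon> * y))"
proof -
  let ?c = "x0 - 2 * \<kappa>" and ?d = "x0 + 2 * \<kappa>" and ?p = "\<alpha> + 1" and ?I = time_interval
  let ?J = "{?c..?d}"
  have cd: "?c < ?d" and J: "?J \<in> sets borel" and sub: "?J \<subseteq> {a..b}" and p: "?p > 0" and \<kappa>0: "\<kappa> \<noteq> 0"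
    using \<kappa> ab \<alpha> by auto
  note wU = weighted_measurable[OF meas(1-3) \<kappa>0, of m x0, folded w_def U_def]
  have p1: "primitive ?c ?d f1 f2" and p2: "primitive ?c ?d f2 (\<lambda>x. W3 (\<tau>, x))"
    and f3: "(\<lambda>x. \<bar>W3 (\<tau>, x)\<bar> powr ?p) absolutely_integrable_on ?J"
    and f12: "AE x in lebesgue. x \<in> ?J \<longrightarrow> v \<tau> x = f0 x \<and> W1 (\<tau>, x) = f1 x \<and> W2 (\<tau>, x) = f2 x"
    using reg_\<tau> unfolding regular_slice_def by auto
  let ?\<phi> = "test_fn m \<kappa> x0 f1 f2" and ?\<phi>' = "test_fn_deriv m \<kappa> x0 f1 f2 (\<lambda>x. W3 (\<tau>, x))"
  note \<phi> = test_fn_props[OF \<kappa> m p ab p1 p2 f3]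
  define \<theta> where "\<theta> = (\<lambda>s. \<rho> ((\<tau> - s) / \<epsilon>))"
  have \<theta>e: "\<theta> = (\<lambda>s. \<rho> (\<tau> / \<epsilon> + (- 1 / \<epsilon>) * s))" by (simp add: \<theta>_def diff_divide_distrib)
  have \<theta>s: "smooth \<theta>" unfolding \<theta>e by (rule smooth_affine[OF \<rho>(1)])
  have \<theta>0: "s \<in> {\<tau> - \<epsilon>..\<tau> + \<epsilon>}" if "\<theta> s \<noteq> 0" for s
  proof -
    have "(\<tau> - s) / \<epsilon> \<in> {-1..1}" using that \<rho>(2) unfolding \<theta>_def by blast
    then show ?thesis using \<epsilon>(1) by (simp add: field_simps)
  qed
  have \<theta>t: "test_function {1/4<..<1} \<theta>" by (rule test_functionI[OF \<theta>s \<theta>0]) (use \<epsilon> in auto)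
  have d\<theta>: "deriv \<theta> s = - (1 / \<epsilon>) * deriv \<rho> ((\<tau> - s) / \<epsilon>)" for s
  proof -
    have "((\<lambda>s. (\<tau> - s) / \<epsilon>) has_real_derivative - (1 / \<epsilon>)) (at s)"
      using \<epsilon>(1) by (auto intro!: derivative_eq_intros)
    from DERIV_chain2[OF smooth_imp_deriv[OF \<rho>(1)] this]
    show ?thesis unfolding \<theta>_def by (intro DERIV_imp_deriv) (simp add: mult.commute)
  qed
  define P where "P = (\<lambda>s. LBINT x. w (s, x) * w (\<tau>, x))"
  define Q where "Q = (\<lambda>s. LBINT x. F (s, x) * U (\<tau>, x))"
  have PQm: "P \<in> borel_measurable borel" "Q \<in> borel_measurable borel"
    unfolding P_def Q_def by (intro slice_pairing_measurable wU meas)+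
  have w0: "w (s, x) = 0" "U (s, x) = 0" if "x \<notin> ?J \<or> s \<notin> ?I" for s x
    using zero[of "(s, x)"] that by (auto simp: w_def U_def weighted_slope_def weighted_third_def)
  have PQ0: "P s = 0" "Q s = 0" if "s \<notin> ?I" for s
  proof -
    have "w (s, x) = 0" "F (s, x) = 0" for x using w0(1) zero[of "(s, x)"] that by auto
    then show "P s = 0" "Q s = 0" by (simp_all add: P_def Q_def)
  qed
  have Pv: "(LINT x:{a..b}|lebesgue. v s x * ?\<phi> x) = P s"
    if r: "regular_slice ?p ?c ?d (v s) (\<lambda>x. W1 (s, x)) (\<lambda>x. W2 (s, x)) (\<lambda>x. W3 (s, x)) h0 h1 h2" for s h0 h1 h2
  proof -
    have h: "primitive ?c ?d h0 h1" "primitive ?c ?d h1 h2"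
      and hv: "AE x in lebesgue. x \<in> ?J \<longrightarrow> v s x = h0 x \<and> W1 (s, x) = h1 x \<and> W2 (s, x) = h2 x"
      using r unfolding regular_slice_def by auto
    have "AE x in lebesgue. x \<in> ?J \<longrightarrow> v s x = h0 x" using hv by eventually_elim auto
    note e1 = pairing_by_parts[OF \<kappa> m ab p1 h(1) this]
    have i: "(\<lambda>x. cutoff m \<kappa> x0 x * f1 x * h1 x) absolutely_integrable_on ?J"
      using primitive_continuous_on[OF p1] primitive_continuous_on[OF h(2)]
      by (intro absolutely_integrable_continuous_real continuous_on_mult continuous_on_cutoff \<kappa>0)
    have ae: "AE x in lebesgue. x \<in> ?J \<longrightarrow> w (s, x) * w (\<tau>, x) = cutoff m \<kappa> x0 x * f1 x * h1 x"
      using hv f12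
    proof eventually_elim
      case (elim x)
      show ?case
      proof
        assume x: "x \<in> ?J"
        have "sqrt (cutoff m \<kappa> x0 x) * sqrt (cutoff m \<kappa> x0 x) = cutoff m \<kappa> x0 x"
          using cutoff_bounds(1)[OF \<kappa> x] by simp
        then have "(sqrt (cutoff m \<kappa> x0 x) * sqrt (cutoff m \<kappa> x0 x)) * (h1 x * f1 x) = cutoff m \<kappa> x0 x * f1 x * h1 x" by simp
        then show "w (s, x) * w (\<tau>, x) = cutoff m \<kappa> x0 x * f1 x * h1 x"
          using elim x by (simp add: w_def weighted_slope_def mult_ac)
      qed
    qed
    have "P s = integral ?J (\<lambda>x. cutoff m \<kappa> x0 x * f1 x * h1 x)"
      unfolding P_def by (rule LBINT_eq_integral_AE(2)[OF _ _ J i ae])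
        (use borel_slice_measurable[OF wU(1)] w0 in \<open>auto intro!: borel_measurable_times\<close>)
    with e1 show ?thesis by simp
  qed
  have Qv: "(LINT x:{a..b}|lebesgue. flux \<Phi> a b v s x * ?\<phi>' x) = - Q s"
    if f: "AE x in lborel. x \<in> ?J \<longrightarrow> F (s, x) = flux \<Phi> a b v s x" for s
  proof -
    have f': "AE x in lebesgue. x \<in> ?J \<longrightarrow> F (s, x) = flux \<Phi> a b v s x" using f by (rule AE_completion)
    have "(LINT x:{a..b}|lebesgue. flux \<Phi> a b v s x * ?\<phi>' x) = (LBINT x. - (F (s, x) * U (\<tau>, x)))"
    proof (rule set_integral_eq_LBINT_AE)
      show "(\<lambda>x. - (F (s, x) * U (\<tau>, x))) \<in> borel_measurable borel"
        using borel_slice_measurable[OF meas(4)] borel_slice_measurable[OF wU(2)] by measurable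
      show "AE x in lebesgue. indicator {a..b} x * (flux \<Phi> a b v s x * ?\<phi>' x) = - (F (s, x) * U (\<tau>, x))"
        using f' f12
      proof eventually_elim
        case (elim x)
        show ?case
        proof (cases "x \<in> ?J")
          case True
          then have "x \<in> {a..b}" using sub by blast
          moreover have "?\<phi>' x = - U (\<tau>, x)" using True elim by (simp add: test_fn_deriv_def U_def weighted_third_def)
          ultimately show ?thesis using True elim by simp
        next
          case False
          then have "?\<phi>' x = 0" unfolding test_fn_deriv_def by argo
          then show ?thesis using w0(2)[of x \<tau>] False by simp
        qed
      qed
    qed
    then show ?thesis by (simp add: Q_def)
  qed
  define R where "R = (\<lambda>s. LINT x:{a..b}|lebesgue. S s x * ?\<phi> x)"
  define RR where "RR = (LINT s:?I|lebesgue. \<theta> s * R s)"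
  have tensor: "(LINT s:?I|lebesgue. deriv \<theta> s * (LINT x:{a..b}|lebesgue. v s x * ?\<phi> x))
    = - (LINT s:?I|lebesgue. \<theta> s * (LINT x:{a..b}|lebesgue. flux \<Phi> a b v s x * ?\<phi>' x)) + RR"
    unfolding RR_def R_def by (rule weak_solution_tensor[OF ws ab(1) cd ab(2) \<alpha> \<theta>t \<phi>])
  have \<theta>m: "\<theta> \<in> borel_measurable borel" "deriv \<theta> \<in> borel_measurable borel"
    by (intro borel_measurable_continuous_onI smooth_continuous_on smooth_deriv \<theta>s)+
  have lhs: "(LINT s:?I|lebesgue. deriv \<theta> s * (LINT x:{a..b}|lebesgue. v s x * ?\<phi> x)) = (LBINT s. deriv \<theta> s * P s)"
  proof (rule set_integral_eq_LBINT_AE)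
    show "(\<lambda>s. deriv \<theta> s * P s) \<in> borel_measurable borel" using \<theta>m PQm by (intro borel_measurable_times)
    show "AE s in lebesgue. indicator ?I s * (deriv \<theta> s * (LINT x:{a..b}|lebesgue. v s x * ?\<phi> x)) = deriv \<theta> s * P s"
      using AE_completion[OF reg]
    proof eventually_elim
      case (elim s)
      then show ?case using Pv PQ0(1)[of s] by (cases "s \<in> ?I") auto
    qed
  qed
  have rhs: "(LINT s:?I|lebesgue. \<theta> s * (LINT x:{a..b}|lebesgue. flux \<Phi> a b v s x * ?\<phi>' x)) = (LBINT s. - (\<theta> s * Q s))"
  proof (rule set_integral_eq_LBINT_AE)
    show "(\<lambda>s. - (\<theta> s * Q s)) \<in> borel_measurable borel" using \<theta>m PQm by measurable
    show "AE s in lebesgue. indicator ?I s * (\<theta> s * (LINT x:{a..b}|lebesgue. flux \<Phi> a b v s x * ?\<phi>' x)) = - (\<theta> s * Q s)"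
      using AE_completion[OF flux]
    proof eventually_elim
      case (elim s)
      then show ?case using Qv PQ0(2)[of s] by (cases "s \<in> ?I") auto
    qed
  qed
  define X1 X2 where "X1 = (LBINT y. deriv \<rho> y * P (\<tau> - \<epsilon> * y))" and "X2 = (LBINT y. \<rho> y * Q (\<tau> - \<epsilon> * y))"
  have "(LBINT s. deriv \<theta> s * P s) = - (1 / \<epsilon>) * (LBINT s. deriv \<rho> ((\<tau> - s) / \<epsilon>) * P s)"
    unfolding d\<theta> by (simp add: mult.assoc)
  also have "\<dots> = - X1" using \<epsilon>(1) by (simp add: LBINT_reflect_scale X1_def)
  finally have e1: "(LBINT s. deriv \<theta> s * P s) = - X1" .
  have e2: "(LBINT s. - (\<theta> s * Q s)) = - (\<epsilon> * X2)"
    unfolding \<theta>_def X2_def using LBINT_reflect_scale[OF \<epsilon>(1), of \<rho> \<tau> Q] by simp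
  have RRe: "X2 + X1 / \<epsilon> = - RR / \<epsilon>"
  proof -
    have "X1 = - RR - \<epsilon> * X2" using tensor unfolding lhs rhs e1 e2 by simp
    then show ?thesis using \<epsilon>(1) by (simp add: diff_divide_distrib)
  qed
  have \<theta>n: "integrable lborel (\<lambda>s. \<theta> s * n s)"
  proof -
    have "bounded (\<theta> ` {\<tau> - \<epsilon>..\<tau> + \<epsilon>})"
      by (intro compact_imp_bounded compact_continuous_image smooth_continuous_on \<theta>s) simp
    then obtain B where B: "B > 0" "\<And>s. s \<in> {\<tau> - \<epsilon>..\<tau> + \<epsilon>} \<Longrightarrow> \<bar>\<theta> s\<bar> \<le> B" by (auto simp: bounded_pos)
    have "\<bar>\<theta> s\<bar> \<le> B" for s using B \<theta>0[of s] by (cases "\<theta> s = 0") auto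
    then have b: "norm (\<theta> s * n s) \<le> norm (B * n s)" for s
      using n(2)[of s] B(1) by (simp add: abs_mult mult_right_mono)
    have "integrable lborel (\<lambda>s. B * n s)" using n(1) by simp
    then show ?thesis
      by (rule Bochner_Integration.integrable_bound) (use b \<theta>m(1) n(1) in auto)
  qed
  have \<theta>nn: "0 \<le> \<theta> s" for s using \<rho>(3) by (simp add: \<theta>_def)
  \<comment> \<open>Integrability in time of the source term is not known here; if it fails, the
    integral has the default value 0 and the bound holds trivially.\<close>
  have RRb: "\<bar>RR\<bar> \<le> (LBINT s. \<theta> s * n s)"
  proof (cases "integrable lebesgue (\<lambda>s. indicator ?I s * (\<theta> s * R s))")
    case False
    then have "RR = 0" unfolding RR_def set_lebesgue_integral_def by (simp add: not_integrable_integral_eq)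
    moreover have "0 \<le> (LBINT s. \<theta> s * n s)" using \<theta>nn n(2) by (intro Bochner_Integration.integral_nonneg) simp
    ultimately show ?thesis by simp
  next
    case True
    have "\<bar>RR\<bar> \<le> (LINT s|lebesgue. \<bar>indicator ?I s * (\<theta> s * R s)\<bar>)"
      unfolding RR_def set_lebesgue_integral_def using integral_abs_bound[of lebesgue "\<lambda>s. indicator ?I s * (\<theta> s * R s)"] by simp
    also have "\<dots> \<le> (LINT s|lebesgue. \<theta> s * n s)"
    proof (rule integral_mono_AE)
      show "integrable lebesgue (\<lambda>s. \<bar>indicator ?I s * (\<theta> s * R s)\<bar>)" using True by (rule integrable_abs)
      show "integrable lebesgue (\<lambda>s. \<theta> s * n s)" using \<theta>n by (simp add: integrable_completion borel_measurable_integrable)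
      show "AE s in lebesgue. \<bar>indicator ?I s * (\<theta> s * R s)\<bar> \<le> \<theta> s * n s"
        using source
      proof eventually_elim
        case (elim s)
        show ?case
        proof (cases "s \<in> {1/4<..<1}")
          case True
          then have "\<bar>R s\<bar> \<le> n s" using elim by (simp add: R_def)
          then show ?thesis using True \<theta>nn[of s] by (simp add: abs_mult mult_left_mono)
        next
          case False
          have "\<theta> s = 0"
          proof (rule ccontr)
            assume "\<theta> s \<noteq> 0"
            from \<theta>0[OF this] show False using False \<epsilon> by auto
          qed
          then show ?thesis by simp
        qed
      qed
    qed
    also have "\<dots> = (LBINT s. \<theta> s * n s)"
      by (rule integral_completion) (use borel_measurable_integrable[OF \<theta>n] in simp)
    finally show ?thesis .
  qed
  have e3: "(LBINT s. \<theta> s * n s) = \<epsilon> * (LBINT y. \<rho> y * n (\<tau> - \<epsilon> * y))"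
    unfolding \<theta>_def by (rule LBINT_reflect_scale[OF \<epsilon>(1)])
  have "\<bar>X2 + X1 / \<epsilon>\<bar> = \<bar>RR\<bar> / \<epsilon>" unfolding RRe using \<epsilon>(1) by (simp add: abs_divide)
  also have "\<dots> \<le> (\<epsilon> * (LBINT y. \<rho> y * n (\<tau> - \<epsilon> * y))) / \<epsilon>"
    using RRb \<epsilon>(1) unfolding e3 by (intro divide_right_mono) auto
  also have "\<dots> = (LBINT y. \<rho> y * n (\<tau> - \<epsilon> * y))" using \<epsilon>(1) by simp
  finally show ?thesis unfolding X1_def X2_def P_def Q_def .
qed

section \<open>The energy estimate\<close>

text \<open>The start at 3/8 leaves a distance of 1/8 to the initial time 1/4 for the mollification;
  the value at time 1/2 is 1/8, the origin of the factor 8^k in the final constant.\<close>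

definition ramp_up :: "real \<Rightarrow> real" where
  "ramp_up t = max 0 (min 1 (t - 3/8))"

text \<open>Equal to 1 up to 1 - 2\<beta> and to 0 from 1 - \<beta> on, which leaves a margin
  \<beta> for the mollification before the final time.\<close>

definition ramp_down :: "real \<Rightarrow> real \<Rightarrow> real" where
  "ramp_down \<beta> t = max 0 (min 1 ((1 - \<beta> - t) / \<beta>))"

definition time_weight :: "nat \<Rightarrow> real \<Rightarrow> real \<Rightarrow> real" where
  "time_weight k \<beta> t = ramp_up t ^ k * ramp_down \<beta> t"

text \<open>An upper bound for the slope of \<open>time_weight\<close>: only the increasing factor
  is differentiated, as the decreasing one contributes with a favourable sign.\<close>

definition time_slope :: "nat \<Rightarrow> real \<Rightarrow> real \<Rightarrow> real" where
  "time_slope k \<beta> t = ramp_down \<beta> t * (real k * ramp_up t ^ (k - 1))"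

lemma ramp_bounds: "0 \<le> ramp_up t" "ramp_up t \<le> 1" "0 \<le> ramp_down \<beta> t" "ramp_down \<beta> t \<le> 1"
  by (auto simp: ramp_up_def ramp_down_def)

lemma power_diff_le:
  fixes a b :: real
  assumes "0 \<le> b" "b \<le> a"
  shows "a ^ k - b ^ k \<le> real k * a ^ (k - 1) * (a - b)"
proof (induction k)
  case (Suc k)
  have "a ^ Suc k - b ^ Suc k = a * (a ^ k - b ^ k) + b ^ k * (a - b)" by (simp add: algebra_simps)
  also have "\<dots> \<le> a * (real k * a ^ (k - 1) * (a - b)) + a ^ k * (a - b)"
    using assms by (intro add_mono mult_left_mono mult_right_mono Suc power_mono) auto
  also have "\<dots> = real (Suc k) * a ^ (Suc k - 1) * (a - b)"
    by (cases k) (auto simp: algebra_simps)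
  finally show ?case .
qed simp

text \<open>The two bounds on increments have different roles. The two-sided one has the constant k
  + 1/\<beta> but enters only an error that disappears in the limit; the one-sided one, with slope
  at most k, is uniform in \<beta> and enters the energy.\<close>

lemma time_weight_props:
  fixes k :: nat and \<beta> :: real
  assumes \<beta>: "\<beta> > 0"
  shows "time_weight k \<beta> \<in> borel_measurable borel" "time_slope k \<beta> \<in> borel_measurable borel"
    and "0 \<le> time_weight k \<beta> t" "time_weight k \<beta> t \<le> 1" "0 \<le> time_slope k \<beta> t" "time_slope k \<beta> t \<le> real k"
    and "\<bar>time_weight k \<beta> t - time_weight k \<beta> (t - h)\<bar> \<le> (real k + 1 / \<beta>) * \<bar>h\<bar>"
    and "h > 0 \<Longrightarrow> time_weight k \<beta> t - time_weight k \<beta> (t - h) \<le> h * time_slope k \<beta> t"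
proof -
  note b = ramp_bounds
  have c: "continuous_on UNIV ramp_up" "continuous_on UNIV (ramp_down \<beta>)"
    unfolding ramp_up_def[abs_def] ramp_down_def[abs_def] using \<beta> by (auto intro!: continuous_intros)
  show "time_weight k \<beta> \<in> borel_measurable borel" "time_slope k \<beta> \<in> borel_measurable borel"
    unfolding time_weight_def[abs_def] time_slope_def[abs_def]
    by (intro borel_measurable_continuous_onI continuous_intros c)+
  have pk: "0 \<le> ramp_up t ^ j" "ramp_up t ^ j \<le> 1" for t j using b by (auto intro: power_le_one)
  show "0 \<le> time_weight k \<beta> t" "time_weight k \<beta> t \<le> 1"
    unfolding time_weight_def using pk b by (auto intro: mult_le_one)
  show "0 \<le> time_slope k \<beta> t" unfolding time_slope_def using pk b by auto
  have "ramp_down \<beta> t * (real k * ramp_up t ^ (k - 1)) \<le> 1 * (real k * 1)"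
    using b pk by (intro mult_mono) auto
  then show "time_slope k \<beta> t \<le> real k" unfolding time_slope_def by simp
  have u1: "\<bar>ramp_up t - ramp_up s\<bar> \<le> \<bar>t - s\<bar>" for t s by (auto simp: ramp_up_def max_def min_def)
  have clamp: "\<bar>max 0 (min 1 x) - max 0 (min 1 y)\<bar> \<le> \<bar>x - y\<bar>" for x y :: real by (auto simp: max_def min_def)
  have d1: "\<bar>ramp_down \<beta> t - ramp_down \<beta> s\<bar> \<le> 1 / \<beta> * \<bar>t - s\<bar>" for t s
  proof -
    have "\<bar>ramp_down \<beta> t - ramp_down \<beta> s\<bar> \<le> \<bar>(1 - \<beta> - t) / \<beta> - (1 - \<beta> - s) / \<beta>\<bar>"
      unfolding ramp_down_def by (rule clamp)
    also have "(1 - \<beta> - t) / \<beta> - (1 - \<beta> - s) / \<beta> = (s - t) / \<beta>" by (simp add: diff_divide_distrib)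
    finally show ?thesis using \<beta> by (simp add: abs_divide abs_minus_commute)
  qed
  have pd: "\<bar>ramp_up t ^ k - ramp_up s ^ k\<bar> \<le> real k * \<bar>t - s\<bar>" for t s
  proof -
    have "\<bar>ramp_up t ^ k - ramp_up s ^ k\<bar> \<le> real k * \<bar>ramp_up t - ramp_up s\<bar>"
      using norm_power_diff[of "ramp_up t" "ramp_up s" k] b by simp
    also have "\<dots> \<le> real k * \<bar>t - s\<bar>" using u1 by (intro mult_left_mono) auto
    finally show ?thesis .
  qed
  have "time_weight k \<beta> t - time_weight k \<beta> (t - h)
    = (ramp_up t ^ k - ramp_up (t - h) ^ k) * ramp_down \<beta> t + ramp_up (t - h) ^ k * (ramp_down \<beta> t - ramp_down \<beta> (t - h))"
    by (simp add: time_weight_def algebra_simps)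
  also have "\<bar>\<dots>\<bar> \<le> \<bar>ramp_up t ^ k - ramp_up (t - h) ^ k\<bar> * \<bar>ramp_down \<beta> t\<bar> + \<bar>ramp_up (t - h) ^ k\<bar> * \<bar>ramp_down \<beta> t - ramp_down \<beta> (t - h)\<bar>"
    by (rule order_trans[OF abs_triangle_ineq]) (simp add: abs_mult)
  also have "\<dots> \<le> real k * \<bar>t - (t - h)\<bar> * 1 + 1 * (1 / \<beta> * \<bar>t - (t - h)\<bar>)"
    using b pk by (intro add_mono mult_mono pd d1) auto
  finally show "\<bar>time_weight k \<beta> t - time_weight k \<beta> (t - h)\<bar> \<le> (real k + 1 / \<beta>) * \<bar>h\<bar>"
    by (simp add: algebra_simps)
  assume h: "h > 0"
  have dm: "ramp_down \<beta> t \<le> ramp_down \<beta> (t - h)"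
    unfolding ramp_down_def using h \<beta> by (intro max.mono min.mono divide_right_mono) auto
  have um: "ramp_up (t - h) \<le> ramp_up t" unfolding ramp_up_def using h by (intro max.mono min.mono) auto
  have "ramp_up t ^ k * ramp_down \<beta> t - ramp_up (t - h) ^ k * ramp_down \<beta> (t - h)
    \<le> ramp_up t ^ k * ramp_down \<beta> t - ramp_up (t - h) ^ k * ramp_down \<beta> t"
    using dm pk by (intro diff_left_mono mult_left_mono) auto
  also have "\<dots> = ramp_down \<beta> t * (ramp_up t ^ k - ramp_up (t - h) ^ k)" by (simp add: algebra_simps)
  also have "\<dots> \<le> ramp_down \<beta> t * (real k * ramp_up t ^ (k - 1) * (ramp_up t - ramp_up (t - h)))"
    using b um by (intro mult_left_mono power_diff_le) auto
  also have "\<dots> \<le> ramp_down \<beta> t * (real k * ramp_up t ^ (k - 1) * h)"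
    using b pk u1[of t "t - h"] h by (intro mult_left_mono) auto
  finally show "time_weight k \<beta> t - time_weight k \<beta> (t - h) \<le> h * time_slope k \<beta> t"
    by (simp add: time_weight_def time_slope_def mult_ac)
qed

lemma time_weight_support:
  assumes "\<beta> > 0" "k \<ge> 1" "time_weight k \<beta> t \<noteq> 0"
  shows "3/8 < t" "t < 1 - \<beta>"
proof -
  have "ramp_up t \<noteq> 0" "ramp_down \<beta> t \<noteq> 0" using assms(2,3) by (auto simp: time_weight_def)
  then show "3/8 < t" by (auto simp: ramp_up_def max_def min_def split: if_splits)
  show "t < 1 - \<beta>"
  proof (rule ccontr)
    assume "\<not> t < 1 - \<beta>"
    then have "(1 - \<beta> - t) / \<beta> \<le> 0" using assms(1) by (intro divide_nonpos_pos) auto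
    then have "ramp_down \<beta> t = 0" by (simp add: ramp_down_def)
    with \<open>ramp_down \<beta> t \<noteq> 0\<close> show False ..
  qed
qed

lemma time_slope_support:
  assumes "\<beta> > 0" "k \<ge> 2" "time_slope k \<beta> t \<noteq> 0"
  shows "3/8 < t" "t < 1 - \<beta>"
proof -
  have "time_weight k \<beta> t \<noteq> 0" using assms(2,3) by (auto simp: time_weight_def time_slope_def)
  then show "3/8 < t" "t < 1 - \<beta>" using time_weight_support[OF assms(1), of k t] assms(2) by auto
qed

lemma time_weight_ge:
  assumes "\<beta> > 0" "t \<in> {1/2..1 - 2 * \<beta>}"
  shows "(1/8) ^ k \<le> time_weight k \<beta> t"
proof -
  have "1 \<le> (1 - \<beta> - t) / \<beta>" using assms by (simp add: field_simps)
  then have "ramp_down \<beta> t = 1" by (simp add: ramp_down_def)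
  moreover have "(1/8) ^ k \<le> ramp_up t ^ k" using assms by (intro power_mono) (auto simp: ramp_up_def)
  ultimately show ?thesis by (simp add: time_weight_def)
qed

section \<open>Integrating the slice estimates in time\<close>

lemma lborel_integral_slices:
  fixes f :: "real \<times> real \<Rightarrow> real"
  assumes "integrable lborel f"
  shows "AE t in lborel. integrable lborel (\<lambda>x. f (t, x))" "integrable lborel (\<lambda>t. LBINT x. f (t, x))"
    "(LBINT t. LBINT x. f (t, x)) = (\<integral>z. f z \<partial>lborel)"
proof -
  have "integrable (lborel \<Otimes>\<^sub>M lborel) f" using assms by (simp add: lborel_prod)
  from lborel_pair.AE_integrable_fst'[OF this] lborel_pair.integrable_fst'[OF this] lborel_pair.integral_fst'[OF this]
  show "AE t in lborel. integrable lborel (\<lambda>x. f (t, x))" "integrable lborel (\<lambda>t. LBINT x. f (t, x))"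
    "(LBINT t. LBINT x. f (t, x)) = (\<integral>z. f z \<partial>lborel)" by (simp_all add: lborel_prod)
qed

text \<open>All functions live on a bounded rectangle, where the cutoff and its derivatives are
  bounded and y^2 \<le> 1 + \<bar>y\<bar>^p.\<close>

lemma weighted_energy_integrable:
  assumes meas: "W1 \<in> borel_measurable borel" "W2 \<in> borel_measurable borel" "W3 \<in> borel_measurable borel"
    and zero: "\<And>z. z \<notin> time_interval \<times> {x0 - 2 * \<kappa>..x0 + 2 * \<kappa>} \<Longrightarrow> W1 z = 0 \<and> W2 z = 0 \<and> W3 z = 0"
    and int: "integrable lborel (\<lambda>z. \<bar>W1 z\<bar> powr p)" "integrable lborel (\<lambda>z. \<bar>W2 z\<bar> powr p)"
      "integrable lborel (\<lambda>z. \<bar>W3 z\<bar> powr p)"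
    and p: "p \<ge> 2" and \<kappa>: "\<kappa> > 0"
  shows "integrable lborel (\<lambda>z. (weighted_slope m \<kappa> x0 W1 z)\<^sup>2)"
    and "integrable lborel (\<lambda>z. \<bar>weighted_third m \<kappa> x0 W1 W2 W3 z\<bar> powr p)"
    and "integrable lborel (\<lambda>z. cutoff m \<kappa> x0 (snd z) * \<bar>W3 z\<bar> powr p)"
proof -
  let ?J = "{x0 - 2 * \<kappa>..x0 + 2 * \<kappa>}"
  let ?R = "time_interval \<times> ?J"
  have \<kappa>0: "\<kappa> \<noteq> 0" using \<kappa> by simp
  note [measurable] = meas cutoff_measurable[OF \<kappa>0] snd_fst_measurable weighted_measurable[OF meas \<kappa>0]
  have iR: "integrable lborel (indicator ?R :: real \<times> real \<Rightarrow> real)"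
  proof -
    have "?R = cbox (1/4, x0 - 2 * \<kappa>) (1, x0 + 2 * \<kappa>)" by (auto simp: cbox_Pair_eq)
    moreover have "?R \<in> sets borel" by (auto intro: borel_Times)
    ultimately show ?thesis using emeasure_lborel_cbox_finite[of "(1/4, x0 - 2 * \<kappa>)" "(1, x0 + 2 * \<kappa>)"]
      by (simp add: integrable_indicator_iff)
  qed
  have cb: "0 \<le> cutoff m \<kappa> x0 (snd z)" "cutoff m \<kappa> x0 (snd z) \<le> 1" if "z \<in> ?R" for z
    using cutoff_bounds[OF \<kappa>, of "snd z" x0 m] that by auto
  show "integrable lborel (\<lambda>z. (weighted_slope m \<kappa> x0 W1 z)\<^sup>2)"
  proof (rule Bochner_Integration.integrable_bound[OF Bochner_Integration.integrable_add[OF iR int(1)]])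
    show "AE z in lborel. norm ((weighted_slope m \<kappa> x0 W1 z)\<^sup>2) \<le> norm (indicator ?R z + \<bar>W1 z\<bar> powr p)"
    proof (rule AE_I2)
      fix z
      show "norm ((weighted_slope m \<kappa> x0 W1 z)\<^sup>2) \<le> norm (indicator ?R z + \<bar>W1 z\<bar> powr p)"
      proof (cases "z \<in> ?R")
        case True
        have sq: "\<bar>W1 z\<bar> powr 2 = (W1 z)\<^sup>2" by (cases "W1 z = 0") auto
        have "\<bar>W1 z\<bar> powr 2 \<le> 1 + \<bar>W1 z\<bar> powr p"
        proof (cases "\<bar>W1 z\<bar> \<le> 1")
          case True
          then have "\<bar>W1 z\<bar> powr 2 \<le> 1" unfolding sq by (simp add: abs_square_le_1)
          then show ?thesis by (simp add: add_increasing2)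
        next
          case False
          then have "\<bar>W1 z\<bar> powr 2 \<le> \<bar>W1 z\<bar> powr p" using p by (intro powr_mono) auto
          then show ?thesis by simp
        qed
        moreover have "(weighted_slope m \<kappa> x0 W1 z)\<^sup>2 \<le> (W1 z)\<^sup>2"
          using cb[OF True] by (simp add: weighted_slope_def power_mult_distrib mult_left_le_one_le)
        ultimately show ?thesis using True sq by simp
      next
        case False
        then show ?thesis using zero[OF False] by (simp add: weighted_slope_def)
      qed
    qed
  qed simp
  show "integrable lborel (\<lambda>z. cutoff m \<kappa> x0 (snd z) * \<bar>W3 z\<bar> powr p)"
  proof (rule Bochner_Integration.integrable_bound[OF int(3)])
    show "AE z in lborel. norm (cutoff m \<kappa> x0 (snd z) * \<bar>W3 z\<bar> powr p) \<le> norm (\<bar>W3 z\<bar> powr p)"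
    proof (rule AE_I2)
      fix z show "norm (cutoff m \<kappa> x0 (snd z) * \<bar>W3 z\<bar> powr p) \<le> norm (\<bar>W3 z\<bar> powr p)"
        using cb[of z] zero[of z] by (cases "z \<in> ?R") (auto simp: abs_mult mult_left_le_one_le)
    qed
  qed simp
  obtain L where L: "L > 0" "\<And>x. x \<in> ?J \<Longrightarrow> \<bar>cutoff m \<kappa> x0 x\<bar> \<le> L \<and> \<bar>2 * cutoff1 m \<kappa> x0 x\<bar> \<le> L \<and> \<bar>cutoff2 m \<kappa> x0 x\<bar> \<le> L"
  proof -
    have bd: "\<exists>B. \<forall>x\<in>?J. \<bar>g x\<bar> \<le> B" if g: "continuous_on ?J g" for g :: "real \<Rightarrow> real"
      using compact_imp_bounded[OF compact_continuous_image[OF g]] by (simp add: bounded_iff)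
    obtain L0 where L0: "\<And>x. x \<in> ?J \<Longrightarrow> \<bar>cutoff m \<kappa> x0 x\<bar> \<le> L0"
      using bd[OF continuous_on_cutoff(1)[OF \<kappa>0, of _ m x0]] by blast
    obtain L1 where L1: "\<And>x. x \<in> ?J \<Longrightarrow> \<bar>cutoff1 m \<kappa> x0 x\<bar> \<le> L1"
      using bd[OF continuous_on_cutoff(2)[OF \<kappa>0, of _ m x0]] by blast
    obtain L2 where L2: "\<And>x. x \<in> ?J \<Longrightarrow> \<bar>cutoff2 m \<kappa> x0 x\<bar> \<le> L2"
      using bd[OF continuous_on_cutoff(3)[OF \<kappa>0, of _ m x0]] by blast
    show thesis
    proof (rule that[of "1 + \<bar>L0\<bar> + 2 * \<bar>L1\<bar> + \<bar>L2\<bar>"])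
      fix x assume x: "x \<in> ?J"
      show "\<bar>cutoff m \<kappa> x0 x\<bar> \<le> 1 + \<bar>L0\<bar> + 2 * \<bar>L1\<bar> + \<bar>L2\<bar> \<and> \<bar>2 * cutoff1 m \<kappa> x0 x\<bar> \<le> 1 + \<bar>L0\<bar> + 2 * \<bar>L1\<bar> + \<bar>L2\<bar>
        \<and> \<bar>cutoff2 m \<kappa> x0 x\<bar> \<le> 1 + \<bar>L0\<bar> + 2 * \<bar>L1\<bar> + \<bar>L2\<bar>"
        using L0[OF x] L1[OF x] L2[OF x] by (auto simp: abs_mult)
    qed auto
  qed
  have iB: "integrable lborel (\<lambda>z. (3 * L) powr p * (\<bar>W1 z\<bar> powr p + \<bar>W2 z\<bar> powr p + \<bar>W3 z\<bar> powr p))"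
    using int by (intro integrable_mult_right Bochner_Integration.integrable_add)
  show "integrable lborel (\<lambda>z. \<bar>weighted_third m \<kappa> x0 W1 W2 W3 z\<bar> powr p)"
  proof (rule Bochner_Integration.integrable_bound[OF iB])
    show "AE z in lborel. norm (\<bar>weighted_third m \<kappa> x0 W1 W2 W3 z\<bar> powr p)
       \<le> norm ((3 * L) powr p * (\<bar>W1 z\<bar> powr p + \<bar>W2 z\<bar> powr p + \<bar>W3 z\<bar> powr p))"
    proof (rule AE_I2)
      fix z
      show "norm (\<bar>weighted_third m \<kappa> x0 W1 W2 W3 z\<bar> powr p)
       \<le> norm ((3 * L) powr p * (\<bar>W1 z\<bar> powr p + \<bar>W2 z\<bar> powr p + \<bar>W3 z\<bar> powr p))"
      proof (cases "z \<in> ?R")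
        case False
        then show ?thesis using zero[OF False] by (simp add: weighted_third_def)
      next
        case True
        then have x: "snd z \<in> ?J" by auto
        define M where "M = max \<bar>W1 z\<bar> (max \<bar>W2 z\<bar> \<bar>W3 z\<bar>)"
        have M: "\<bar>W1 z\<bar> \<le> M" "\<bar>W2 z\<bar> \<le> M" "\<bar>W3 z\<bar> \<le> M" "0 \<le> M" by (auto simp: M_def le_max_iff_disj)
        have "\<bar>weighted_third m \<kappa> x0 W1 W2 W3 z\<bar>
           \<le> \<bar>cutoff m \<kappa> x0 (snd z)\<bar> * \<bar>W3 z\<bar> + \<bar>2 * cutoff1 m \<kappa> x0 (snd z)\<bar> * \<bar>W2 z\<bar> + \<bar>cutoff2 m \<kappa> x0 (snd z)\<bar> * \<bar>W1 z\<bar>"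
          unfolding weighted_third_def abs_mult[symmetric] by linarith
        also have "\<dots> \<le> L * M + L * M + L * M"
          using L(1) L(2)[OF x] M by (intro add_mono mult_mono) auto
        finally have "\<bar>weighted_third m \<kappa> x0 W1 W2 W3 z\<bar> \<le> (3 * L) * M" by simp
        then have "\<bar>weighted_third m \<kappa> x0 W1 W2 W3 z\<bar> powr p \<le> ((3 * L) * M) powr p"
          using p by (intro powr_mono2) auto
        also have "\<dots> = (3 * L) powr p * M powr p" using L(1) M(4) by (simp add: powr_mult)
        also have "\<dots> \<le> (3 * L) powr p * (\<bar>W1 z\<bar> powr p + \<bar>W2 z\<bar> powr p + \<bar>W3 z\<bar> powr p)"
          by (intro mult_left_mono) (auto simp: M_def max_def)
        finally show ?thesis by (auto intro: order_trans[OF _ abs_ge_self])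
      qed
    qed
  qed simp
qed

text \<open>Combines the mollified energy inequality with the slice estimates integrated in time.
  The two conclusions of \<open>slice_estimate\<close> are taken as hypotheses, so that K is fixed
  before the solution is given; the bound is uniform in \<beta>.\<close>

lemma energy_estimate:
  fixes \<alpha> \<kappa> Cs C0 C1 C2 C3 K x0 \<beta> :: real and m k :: nat
  assumes ws: "weak_solution \<alpha> a b \<Phi> S v" and st: "structural_ineqs \<alpha> Cs C0 C1 C2 C3 \<Phi>"
    and \<alpha>: "\<alpha> > 1" and \<kappa>: "\<kappa> > 0" and m: "m \<ge> 3" and k: "k \<ge> 2" and \<beta>: "0 < \<beta>" "\<beta> \<le> 1/8"
    and ab: "a < x0 - 2 * \<kappa>" "x0 + 2 * \<kappa> < b"
    and meas: "W1 \<in> borel_measurable borel" "W2 \<in> borel_measurable borel" "W3 \<in> borel_measurable borel" "F \<in> borel_measurable borel"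
    and zero: "\<And>z. z \<notin> time_interval \<times> {x0 - 2 * \<kappa>..x0 + 2 * \<kappa>} \<Longrightarrow> W1 z = 0 \<and> W2 z = 0 \<and> W3 z = 0 \<and> F z = 0"
    and int: "integrable lborel (\<lambda>z. \<bar>W1 z\<bar> powr (\<alpha> + 1))" "integrable lborel (\<lambda>z. \<bar>W2 z\<bar> powr (\<alpha> + 1))"
      "integrable lborel (\<lambda>z. \<bar>W3 z\<bar> powr (\<alpha> + 1))" "integrable lborel (\<lambda>z. \<bar>F z\<bar> powr ((\<alpha> + 1) / \<alpha>))"
    and reg: "AE t in lborel. t \<in> time_interval \<longrightarrow> (\<exists>f0 f1 f2. regular_slice (\<alpha> + 1) (x0 - 2 * \<kappa>) (x0 + 2 * \<kappa>)
       (v t) (\<lambda>x. W1 (t, x)) (\<lambda>x. W2 (t, x)) (\<lambda>x. W3 (t, x)) f0 f1 f2)"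
    and flux: "AE t in lborel. t \<in> time_interval \<longrightarrow> (AE x in lborel. x \<in> {x0 - 2 * \<kappa>..x0 + 2 * \<kappa>} \<longrightarrow>
       F (t, x) = flux \<Phi> a b v t x \<and> F (t, x) = \<Phi> (v t x) (W1 (t, x)) (W2 (t, x)) (W3 (t, x)))"
    and n: "integrable lborel n" "\<And>t. 0 \<le> n t"
    and source: "\<And>f0 f1 f2. \<lbrakk>primitive (x0 - 2 * \<kappa>) (x0 + 2 * \<kappa>) f0 f1; primitive (x0 - 2 * \<kappa>) (x0 + 2 * \<kappa>) f1 f2;
       \<forall>x\<in>{x0 - 2 * \<kappa>..x0 + 2 * \<kappa>}. \<bar>f0 x\<bar> \<le> 1\<rbrakk> \<Longrightarrow>
       AE s in lebesgue. s \<in> {1/4<..<1} \<longrightarrow> \<bar>LINT x:{a..b}|lebesgue. S s x * test_fn m \<kappa> x0 f1 f2 x\<bar> \<le> n s"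
    and K: "K \<ge> 0"
    and K1: "\<And>x0 f0 f1 f2 f3 F.
      \<lbrakk>primitive (x0 - 2 * \<kappa>) (x0 + 2 * \<kappa>) f0 f1; primitive (x0 - 2 * \<kappa>) (x0 + 2 * \<kappa>) f1 f2;
       primitive (x0 - 2 * \<kappa>) (x0 + 2 * \<kappa>) f2 f3;
       \<And>y. y \<in> {x0 - 2 * \<kappa>..x0 + 2 * \<kappa>} \<Longrightarrow> \<bar>f0 y\<bar> \<le> 1;
       (\<lambda>y. \<bar>f3 y\<bar> powr (\<alpha> + 1)) integrable_on {x0 - 2 * \<kappa>..x0 + 2 * \<kappa>};
       (\<lambda>x. F x * (cutoff m \<kappa> x0 x * f3 x + 2 * cutoff1 m \<kappa> x0 x * f2 x + cutoff2 m \<kappa> x0 x * f1 x))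
         absolutely_integrable_on {x0 - 2 * \<kappa>..x0 + 2 * \<kappa>};
       AE x in lebesgue. x \<in> {x0 - 2 * \<kappa>..x0 + 2 * \<kappa>} \<longrightarrow>
         \<bar>F x\<bar> \<le> C0 * \<bar>f0 x\<bar> powr \<alpha> + C1 * \<bar>f1 x\<bar> powr \<alpha> + C2 * \<bar>f2 x\<bar> powr \<alpha> + C3 * \<bar>f3 x\<bar> powr \<alpha> + Cs \<and>
         F x * f3 x \<ge> C3 * \<bar>f3 x\<bar> powr (\<alpha> + 1)
           - (C0 * \<bar>F x\<bar> * \<bar>f0 x\<bar> + C1 * \<bar>F x\<bar> * \<bar>f1 x\<bar> + C2 * \<bar>F x\<bar> * \<bar>f2 x\<bar>)\<rbrakk> \<Longrightarrow>
      3 / 8 * C3 * integral {x0 - 2 * \<kappa>..x0 + 2 * \<kappa>} (\<lambda>y. cutoff m \<kappa> x0 y * \<bar>f3 y\<bar> powr (\<alpha> + 1))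
        \<le> integral {x0 - 2 * \<kappa>..x0 + 2 * \<kappa>}
            (\<lambda>x. F x * (cutoff m \<kappa> x0 x * f3 x + 2 * cutoff1 m \<kappa> x0 x * f2 x + cutoff2 m \<kappa> x0 x * f1 x)) + K"
    and K2: "\<And>x0 f0 f1 f2 f3 \<sigma>.
      \<lbrakk>primitive (x0 - 2 * \<kappa>) (x0 + 2 * \<kappa>) f0 f1; primitive (x0 - 2 * \<kappa>) (x0 + 2 * \<kappa>) f1 f2;
       primitive (x0 - 2 * \<kappa>) (x0 + 2 * \<kappa>) f2 f3;
       \<And>y. y \<in> {x0 - 2 * \<kappa>..x0 + 2 * \<kappa>} \<Longrightarrow> \<bar>f0 y\<bar> \<le> 1;
       (\<lambda>y. \<bar>f3 y\<bar> powr (\<alpha> + 1)) integrable_on {x0 - 2 * \<kappa>..x0 + 2 * \<kappa>}; 0 \<le> \<sigma>; \<sigma> \<le> 1\<rbrakk> \<Longrightarrow>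
      real k * \<sigma> ^ (k - 1) * integral {x0 - 2 * \<kappa>..x0 + 2 * \<kappa>} (\<lambda>y. cutoff m \<kappa> x0 y * (f1 y)\<^sup>2)
        \<le> C3 / 4 * \<sigma> ^ k * integral {x0 - 2 * \<kappa>..x0 + 2 * \<kappa>} (\<lambda>y. cutoff m \<kappa> x0 y * \<bar>f3 y\<bar> powr (\<alpha> + 1)) + K"
  defines "V \<equiv> \<lambda>z. cutoff m \<kappa> x0 (snd z) * \<bar>W3 z\<bar> powr (\<alpha> + 1)"
  shows "C3 / 4 * (\<integral>z. time_weight k \<beta> (fst z) * V z \<partial>lborel) \<le> K + (LBINT t. n t)"
    and "integrable lborel (\<lambda>z. time_weight k \<beta> (fst z) * V z)"
proof -
  let ?c = "x0 - 2 * \<kappa>" and ?d = "x0 + 2 * \<kappa>" and ?p = "\<alpha> + 1" and ?q = "(\<alpha> + 1) / \<alpha>" and ?I = time_interval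
  let ?J = "{?c..?d}" and ?\<eta> = "time_weight k \<beta>" and ?lam = "time_slope k \<beta>"
  define w U where "w = weighted_slope m \<kappa> x0 W1" and "U = weighted_third m \<kappa> x0 W1 W2 W3"
  have \<kappa>0: "\<kappa> \<noteq> 0" and J: "?J \<in> sets borel" and k1: "k \<ge> 1" and p2: "?p \<ge> 2" using \<kappa> k \<alpha> by auto
  have pq: "?p > 1" "?q > 1" "1 / ?p + 1 / ?q = 1" using \<alpha> by (auto simp: field_simps)
  have zero': "\<And>z. z \<notin> time_interval \<times> ?J \<Longrightarrow> W1 z = 0 \<and> W2 z = 0 \<and> W3 z = 0" using zero by blast
  note wU = weighted_measurable[OF meas(1-3) \<kappa>0, of m x0, folded w_def U_def]
  note wi = weighted_energy_integrable[where m=m and ?x0.0=x0 and \<kappa>=\<kappa>, OF meas(1-3) zero' int(1-3) p2 \<kappa>, folded w_def U_def]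
  have Vi: "integrable lborel V" unfolding V_def by (rule wi(3))
  have FU: "integrable lborel (\<lambda>z. F z * U z)"
    using pairing_integrable[OF meas(4) wU(2) pq int(4) wi(2), of 0] by simp
  note tw = time_weight_props[OF \<beta>(1), where k=k]
  note [measurable] = snd_fst_measurable tw(1,2)
  have \<eta>i: "integrable lborel (\<lambda>z. ?\<eta> (fst z) * g z)" and lami: "integrable lborel (\<lambda>z. ?lam (fst z) * g z)"
    if g: "integrable lborel g" for g :: "real \<times> real \<Rightarrow> real"
  proof -
    have gm[measurable]: "g \<in> borel_measurable borel" using borel_measurable_integrable[OF g] by simp
    show "integrable lborel (\<lambda>z. ?\<eta> (fst z) * g z)"
    proof (rule Bochner_Integration.integrable_bound[OF g])
      show "(\<lambda>z. ?\<eta> (fst z) * g z) \<in> borel_measurable lborel" by measurable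
      show "AE z in lborel. norm (?\<eta> (fst z) * g z) \<le> norm (g z)"
        by (rule AE_I2) (simp add: abs_mult tw(3,4) mult_left_le_one_le)
    qed
    have g': "integrable lborel (\<lambda>z. real k * g z)" using g by simp
    show "integrable lborel (\<lambda>z. ?lam (fst z) * g z)"
    proof (rule Bochner_Integration.integrable_bound[OF g'])
      show "(\<lambda>z. ?lam (fst z) * g z) \<in> borel_measurable lborel" by measurable
      show "AE z in lborel. norm (?lam (fst z) * g z) \<le> norm (real k * g z)"
        by (rule AE_I2) (simp add: abs_mult tw(5,6) mult_right_mono)
    qed
  qed
  note iV = \<eta>i[OF Vi] and iZ = \<eta>i[OF FU] and iG = lami[OF wi(1)]
  show "integrable lborel (\<lambda>z. ?\<eta> (fst z) * V z)" by (rule iV)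
  define Y Z G where "Y = (\<integral>z. ?\<eta> (fst z) * V z \<partial>lborel)" and "Z = (\<integral>z. ?\<eta> (fst z) * (F z * U z) \<partial>lborel)"
    and "G = (\<integral>z. ?lam (fst z) * (w z)\<^sup>2 \<partial>lborel)"
  have flux1: "AE t in lborel. t \<in> time_interval \<longrightarrow> (AE x in lborel. x \<in> ?J \<longrightarrow> F (t, x) = flux \<Phi> a b v t x)"
    using flux
  proof eventually_elim
    case (elim t)
    show ?case
    proof
      assume "t \<in> ?I"
      with elim have "AE x in lborel. x \<in> ?J \<longrightarrow> F (t, x) = flux \<Phi> a b v t x \<and> F (t, x) = \<Phi> (v t x) (W1 (t, x)) (W2 (t, x)) (W3 (t, x))" by blast
      then show "AE x in lborel. x \<in> ?J \<longrightarrow> F (t, x) = flux \<Phi> a b v t x" by eventually_elim blast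
    qed
  qed
  have energy: "Z \<le> 1 / 2 * G + (LBINT t. n t)"
  proof (rule mollifier_exists)
    fix \<rho> :: "real \<Rightarrow> real"
    assume \<rho>: "smooth \<rho>" "\<And>x. x \<notin> {-1..1} \<Longrightarrow> \<rho> x = 0" "\<And>x. 0 \<le> \<rho> x"
      "\<And>x. deriv \<rho> (- x) = - deriv \<rho> x" "\<And>x. x > 0 \<Longrightarrow> deriv \<rho> x \<le> 0"
      "\<And>x. x \<notin> {-1..1} \<Longrightarrow> deriv \<rho> x = 0"
      "(LBINT x. \<rho> x) = 1" "(LBINT x. x * deriv \<rho> x) = -1"
    show ?thesis unfolding Z_def G_def
    proof (rule mollified_energy_inequality[OF wU(1) meas(4) wU(2) tw(1,2) pq wi(1) int(4) wi(2) tw(3,4,7,5,6,8) n \<rho> \<beta>(1)])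
      fix \<epsilon> :: real assume \<epsilon>: "0 < \<epsilon>" "\<epsilon> < \<beta>"
      show "AE t in lborel. ?\<eta> t \<noteq> 0 \<longrightarrow>
         \<bar>(LBINT y. \<rho> y * (LBINT x. F (t - \<epsilon> * y, x) * U (t, x)))
           + (LBINT y. deriv \<rho> y * (LBINT x. w (t - \<epsilon> * y, x) * w (t, x))) / \<epsilon>\<bar>
         \<le> (LBINT y. \<rho> y * n (t - \<epsilon> * y))"
        using reg
      proof eventually_elim
        case (elim t)
        show ?case
        proof
          assume t: "?\<eta> t \<noteq> 0"
          have t1: "3/8 < t" "t < 1 - \<beta>" using time_weight_support[OF \<beta>(1) k1 t] .
          then have "t \<in> ?I" using \<beta> by auto
          then obtain f0 f1 f2 where r: "regular_slice ?p ?c ?d (v t) (\<lambda>x. W1 (t, x)) (\<lambda>x. W2 (t, x)) (\<lambda>x. W3 (t, x)) f0 f1 f2"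
            using elim by blast
          have so: "AE s in lebesgue. s \<in> {1/4<..<1} \<longrightarrow> \<bar>LINT x:{a..b}|lebesgue. S s x * test_fn m \<kappa> x0 f1 f2 x\<bar> \<le> n s"
            using r unfolding regular_slice_def by (intro source) auto
          have e1: "1/4 < t - \<epsilon>" "t + \<epsilon> < 1" using t1 \<epsilon> \<beta> by auto
          show "\<bar>(LBINT y. \<rho> y * (LBINT x. F (t - \<epsilon> * y, x) * U (t, x)))
           + (LBINT y. deriv \<rho> y * (LBINT x. w (t - \<epsilon> * y, x) * w (t, x))) / \<epsilon>\<bar>
         \<le> (LBINT y. \<rho> y * n (t - \<epsilon> * y))"
            unfolding w_def U_def
            by (rule tested_equation[OF ws \<alpha> \<kappa> m ab meas zero reg flux1 n r so \<rho>(1,2,3,6) \<epsilon>(1) e1])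
        qed
      qed
    qed
  qed
  \<comment> \<open>The constant K is paid only at times where a weight may be active, an interval
    of length 5/8.\<close>
  define ind :: "real \<Rightarrow> real" where "ind = indicator {3/8..1}"
  have indi: "integrable lborel ind" "(LBINT t. ind t) = 5/8" unfolding ind_def by simp_all
  note sV = lborel_integral_slices[OF iV] and sZ = lborel_integral_slices[OF iZ] and sG = lborel_integral_slices[OF iG]
  have slices: "AE t in lborel. 3 / 8 * C3 * (LBINT x. ?\<eta> t * V (t, x)) \<le> (LBINT x. ?\<eta> t * (F (t, x) * U (t, x))) + K * ind t \<and>
     (LBINT x. ?lam t * (w (t, x))\<^sup>2) \<le> C3 / 4 * (LBINT x. ?\<eta> t * V (t, x)) + K * ind t"
    using reg flux lborel_integral_slices(1)[OF FU]
  proof eventually_elim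
    case (elim t)
    show ?case
    \<comment> \<open>Where both weights vanish the inequalities are trivial; otherwise t lies
      between 3/8 and 1 - \<beta>, inside the time interval, and the slice is regular.\<close>
    proof (cases "?\<eta> t = 0 \<and> ?lam t = 0")
      case True
      then show ?thesis using K by (simp add: ind_def)
    next
      case False
      then have t1: "3/8 < t" "t < 1 - \<beta>"
        using time_weight_support[OF \<beta>(1) k1, of t] time_slope_support[OF \<beta>(1) k, of t] by blast+
      then have tI: "t \<in> ?I" and it: "ind t = 1" using \<beta> by (auto simp: ind_def)
      obtain f0 f1 f2 where r: "regular_slice ?p ?c ?d (v t) (\<lambda>x. W1 (t, x)) (\<lambda>x. W2 (t, x)) (\<lambda>x. W3 (t, x)) f0 f1 f2"
        using elim(1) tI by blast
      have f: "primitive ?c ?d f0 f1" "primitive ?c ?d f1 f2" "primitive ?c ?d f2 (\<lambda>x. W3 (t, x))"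
        and f0: "\<And>y. y \<in> ?J \<Longrightarrow> \<bar>f0 y\<bar> \<le> 1"
        and fe: "AE x in lebesgue. x \<in> ?J \<longrightarrow> v t x = f0 x \<and> W1 (t, x) = f1 x \<and> W2 (t, x) = f2 x"
        and f3: "(\<lambda>x. \<bar>W3 (t, x)\<bar> powr ?p) absolutely_integrable_on ?J"
        using r unfolding regular_slice_def by auto
      have f3': "(\<lambda>x. \<bar>W3 (t, x)\<bar> powr ?p) integrable_on ?J" using f3 by (rule absolutely_integrable_on_def[THEN iffD1, THEN conjunct1])
      have fl: "AE x in lebesgue. x \<in> ?J \<longrightarrow> F (t, x) = \<Phi> (v t x) (W1 (t, x)) (W2 (t, x)) (W3 (t, x))"
      proof -
        have "AE x in lborel. x \<in> ?J \<longrightarrow> F (t, x) = flux \<Phi> a b v t x \<and> F (t, x) = \<Phi> (v t x) (W1 (t, x)) (W2 (t, x)) (W3 (t, x))"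
          using elim(2) tI by blast
        from AE_completion[OF this] show ?thesis by eventually_elim blast
      qed
      let ?D = "\<lambda>x. F (t, x) * (cutoff m \<kappa> x0 x * W3 (t, x) + 2 * cutoff1 m \<kappa> x0 x * f2 x + cutoff2 m \<kappa> x0 x * f1 x)"
      define Yt where "Yt = integral ?J (\<lambda>y. cutoff m \<kappa> x0 y * \<bar>W3 (t, y)\<bar> powr ?p)"
      define Gt where "Gt = integral ?J (\<lambda>y. cutoff m \<kappa> x0 y * (f1 y)\<^sup>2)"
      have FUm: "(\<lambda>x. F (t, x) * U (t, x)) \<in> borel_measurable borel"
        using borel_slice_measurable[OF meas(4)] borel_slice_measurable[OF wU(2)] by (intro borel_measurable_times)
      have FU0: "F (t, x) * U (t, x) = 0" if "x \<notin> ?J" for x using zero[of "(t, x)"] that by auto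
      have FUi: "(\<lambda>x. F (t, x) * U (t, x)) absolutely_integrable_on ?J"
        using elim(3) lebesgue_slice_integrable(1)[OF FUm FU0 J] by simp
      have De: "AE x in lebesgue. x \<in> ?J \<longrightarrow> ?D x = F (t, x) * U (t, x)"
        using fe by eventually_elim (simp add: U_def weighted_third_def)
      have Di: "?D absolutely_integrable_on ?J" using FUi De by (rule absolutely_integrable_cong_AE)
      have "(LBINT x. F (t, x) * U (t, x)) = integral ?J (\<lambda>x. F (t, x) * U (t, x))"
        using lebesgue_slice_integrable(2)[OF FUm FU0 J FUi] .
      also have "\<dots> = integral ?J ?D"
        by (rule integral_spike[OF AE_imp_negligible[OF De], symmetric]) auto
      finally have Ze: "(LBINT x. F (t, x) * U (t, x)) = integral ?J ?D" .
      have W3m: "(\<lambda>x. W3 (t, x)) \<in> borel_measurable borel" using borel_slice_measurable[OF meas(3)] .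
      have Vm: "(\<lambda>x. V (t, x)) \<in> borel_measurable borel"
      proof -
        note [measurable] = W3m cutoff_measurable(1)[OF \<kappa>0]
        show ?thesis unfolding V_def by simp
      qed
      have V0: "V (t, x) = 0" if "x \<notin> ?J" for x using zero[of "(t, x)"] that by (auto simp: V_def)
      have Vint: "(\<lambda>x. cutoff m \<kappa> x0 x * \<bar>W3 (t, x)\<bar> powr ?p) absolutely_integrable_on ?J"
        using absolutely_integrable_mult_continuous[OF f3 continuous_on_cutoff(1)[OF \<kappa>0]] by (simp add: mult.commute)
      have Ye: "(LBINT x. V (t, x)) = Yt"
        unfolding Yt_def by (rule LBINT_eq_integral_AE(2)[OF Vm V0 J Vint]) (simp_all add: V_def)
      have wm: "(\<lambda>x. (w (t, x))\<^sup>2) \<in> borel_measurable borel" using borel_slice_measurable[OF wU(1)] by (intro borel_measurable_power)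
      have w0: "(w (t, x))\<^sup>2 = 0" if "x \<notin> ?J" for x using zero[of "(t, x)"] that by (auto simp: w_def weighted_slope_def)
      have Gint: "(\<lambda>y. cutoff m \<kappa> x0 y * (f1 y)\<^sup>2) absolutely_integrable_on ?J"
        using primitive_continuous_on[OF f(2)]
        by (intro absolutely_integrable_continuous_real continuous_on_mult continuous_on_power continuous_on_cutoff \<kappa>0)
      have wG: "AE x in lebesgue. x \<in> ?J \<longrightarrow> (w (t, x))\<^sup>2 = cutoff m \<kappa> x0 x * (f1 x)\<^sup>2"
        using fe
      proof eventually_elim
        case (elim x)
        then show ?case using cutoff_bounds(1)[OF \<kappa>, of x x0 m] by (simp add: w_def weighted_slope_def power_mult_distrib)
      qed
      have Ge: "(LBINT x. (w (t, x))\<^sup>2) = Gt"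
        unfolding Gt_def by (rule LBINT_eq_integral_AE(2)[OF wm w0 J Gint wG])
      have structural: "AE x in lebesgue. x \<in> ?J \<longrightarrow>
         \<bar>F (t, x)\<bar> \<le> C0 * \<bar>f0 x\<bar> powr \<alpha> + C1 * \<bar>f1 x\<bar> powr \<alpha> + C2 * \<bar>f2 x\<bar> powr \<alpha> + C3 * \<bar>W3 (t, x)\<bar> powr \<alpha> + Cs \<and>
         F (t, x) * W3 (t, x) \<ge> C3 * \<bar>W3 (t, x)\<bar> powr (\<alpha> + 1)
           - (C0 * \<bar>F (t, x)\<bar> * \<bar>f0 x\<bar> + C1 * \<bar>F (t, x)\<bar> * \<bar>f1 x\<bar> + C2 * \<bar>F (t, x)\<bar> * \<bar>f2 x\<bar>)"
        using fl fe
      proof eventually_elim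
        case (elim x)
        show ?case
        proof
          assume "x \<in> ?J"
          then have e: "F (t, x) = \<Phi> (f0 x) (f1 x) (f2 x) (W3 (t, x))" using elim by simp
          show "\<bar>F (t, x)\<bar> \<le> C0 * \<bar>f0 x\<bar> powr \<alpha> + C1 * \<bar>f1 x\<bar> powr \<alpha> + C2 * \<bar>f2 x\<bar> powr \<alpha> + C3 * \<bar>W3 (t, x)\<bar> powr \<alpha> + Cs \<and>
         F (t, x) * W3 (t, x) \<ge> C3 * \<bar>W3 (t, x)\<bar> powr (\<alpha> + 1)
           - (C0 * \<bar>F (t, x)\<bar> * \<bar>f0 x\<bar> + C1 * \<bar>F (t, x)\<bar> * \<bar>f1 x\<bar> + C2 * \<bar>F (t, x)\<bar> * \<bar>f2 x\<bar>)"
            unfolding e using st unfolding structural_ineqs_def by blast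
        qed
      qed
      have A: "3 / 8 * C3 * Yt \<le> integral ?J ?D + K"
        unfolding Yt_def by (rule K1[OF f f0 f3' Di structural])
      have rb: "0 \<le> ramp_down \<beta> t" "ramp_down \<beta> t \<le> 1" using ramp_bounds by auto
      have B: "real k * ramp_up t ^ (k - 1) * Gt \<le> C3 / 4 * ramp_up t ^ k * Yt + K"
        unfolding Gt_def Yt_def by (rule K2[OF f f0 f3' ramp_bounds(1,2)])
      have A': "3 / 8 * C3 * (?\<eta> t * Yt) \<le> ?\<eta> t * integral ?J ?D + K"
      proof -
        have "?\<eta> t * (3 / 8 * C3 * Yt) \<le> ?\<eta> t * (integral ?J ?D + K)" by (rule mult_left_mono[OF A tw(3)])
        moreover have "?\<eta> t * K \<le> K" using K tw(3,4) by (simp add: mult_left_le_one_le)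
        ultimately show ?thesis by (simp add: algebra_simps)
      qed
      have B': "?lam t * Gt \<le> C3 / 4 * (?\<eta> t * Yt) + K"
      proof -
        have "ramp_down \<beta> t * (real k * ramp_up t ^ (k - 1) * Gt) \<le> ramp_down \<beta> t * (C3 / 4 * ramp_up t ^ k * Yt + K)"
          by (rule mult_left_mono[OF B rb(1)])
        moreover have "ramp_down \<beta> t * K \<le> K" using K rb by (simp add: mult_left_le_one_le)
        ultimately show ?thesis by (simp add: time_weight_def time_slope_def algebra_simps)
      qed
      show ?thesis using A' B' by (simp add: Ye Ze Ge it)
    qed
  qed
  have A: "3 / 8 * C3 * Y \<le> Z + 5/8 * K"
  proof -
    have "(LBINT t. 3 / 8 * C3 * (LBINT x. ?\<eta> t * V (t, x))) \<le> (LBINT t. (LBINT x. ?\<eta> t * (F (t, x) * U (t, x))) + K * ind t)"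
      using slices sV(2) sZ(2) indi(1) by (intro integral_mono_AE) (auto elim!: eventually_mono)
    also have "\<dots> = Z + 5/8 * K" using sZ(2,3) indi by (simp add: Z_def)
    finally show ?thesis using sV(3) by (simp add: Y_def)
  qed
  have B: "G \<le> C3 / 4 * Y + 5/8 * K"
  proof -
    have "(LBINT t. LBINT x. ?lam t * (w (t, x))\<^sup>2) \<le> (LBINT t. C3 / 4 * (LBINT x. ?\<eta> t * V (t, x)) + K * ind t)"
      using slices sV(2) sG(2) indi(1) by (intro integral_mono_AE) (auto elim!: eventually_mono)
    also have "\<dots> = C3 / 4 * Y + 5/8 * K" using sV(2,3) indi by (simp add: Y_def)
    finally show ?thesis using sG(3) by (simp add: G_def)
  qed
  \<comment> \<open>Inserting the bound for G into half of G spends C3 Y / 8 and leaves (3/8 - 1/8)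
    C3 Y; the constants add up to (5/8 + 5/16) K, which is at most K.\<close>
  have "C3 / 4 * Y \<le> K + (LBINT t. n t)" using A B energy K by argo
  then show "C3 / 4 * (\<integral>z. ?\<eta> (fst z) * V z \<partial>lborel) \<le> K + (LBINT t. n t)" by (simp add: Y_def)
qed

section \<open>From the weighted bound to the theorem\<close>

lemma cutoff_ge:
  assumes "\<kappa> > 0" "x \<in> {x0 - \<kappa>..x0 + \<kappa>}"
  shows "(3/4) ^ m \<le> cutoff m \<kappa> x0 x"
proof -
  have "\<bar>(x - x0) / (2 * \<kappa>)\<bar> \<le> 1/2" using assms by (simp add: abs_divide field_simps abs_le_iff)
  from power_mono[OF this, of 2] have "((x - x0) / (2 * \<kappa>))\<^sup>2 \<le> 1/4" by (simp add: power2_eq_square)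
  then have "3/4 \<le> parab \<kappa> x0 x" by (simp add: parab_def)
  then show ?thesis unfolding cutoff_def by (intro power_mono) auto
qed

text \<open>The norm of the source as a function of time is only Lebesgue measurable; the absolute
  value of a Borel version of it is nonnegative everywhere and has the same integral.\<close>

lemma L1_H2_borel_bound:
  assumes S: "in_L1_H2 a b S" and C: "C \<ge> 0"
  obtains n where "integrable lborel n" "\<forall>t. 0 \<le> n t" "(LBINT t. n t) = C * L1_H2_norm a b S"
    "AE s in lebesgue. s \<in> {1/4<..<1} \<longrightarrow> S s \<in> sobolev 2 2 {a<..<b} \<and> n s = C * sobolev_norm 2 2 {a<..<b} (S s)"
proof -
  let ?T = "{1/4<..<1::real}" and ?N = "\<lambda>t. sobolev_norm 2 2 {a<..<b} (S t)"
  have T: "?T \<in> sets lebesgue" by simp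
  have N0: "?N t \<ge> 0" for t by (simp add: sobolev_norm_def)
  have i0: "integrable (lebesgue_on ?T) (\<lambda>t. ?N t)" and SX: "AE t in lebesgue. t \<in> ?T \<longrightarrow> S t \<in> sobolev 2 2 {a<..<b}"
    using S N0 unfolding in_L1_H2_def bochner_Lp_def AE_lebesgue_on[OF T] by simp_all
  have "integrable (lebesgue_on ?T) (\<lambda>t. C * ?N t)" using i0 by (rule integrable_mult_right)
  then have i: "(\<lambda>t. C * ?N t) absolutely_integrable_on ?T"
    unfolding set_integrable_def by (subst (asm) integrable_restrict_space) (use T in simp_all)
  obtain g where g: "integrable lborel g" "AE t in lebesgue. g t = indicator ?T t * (C * ?N t)"
    using absolutely_integrable_borel_version[OF i] by blast
  have ae: "AE t in lebesgue. \<bar>g t\<bar> = indicator ?T t * (C * ?N t)"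
    using g(2) by eventually_elim (simp add: abs_mult C N0)
  have "(LBINT t. \<bar>g t\<bar>) = (LINT t:?T|lebesgue. C * ?N t)"
  proof (rule set_integral_eq_LBINT_AE[symmetric])
    show "AE t in lebesgue. indicator ?T t * (C * ?N t) = \<bar>g t\<bar>" using ae by eventually_elim simp
    show "(\<lambda>t. \<bar>g t\<bar>) \<in> borel_measurable borel" using borel_measurable_integrable[OF g(1)] by simp
  qed
  also have "\<dots> = C * (LINT t|lebesgue_on ?T. ?N t)" by (simp add: set_integral_lebesgue_on[OF T])
  also have "(LINT t|lebesgue_on ?T. ?N t) = L1_H2_norm a b S"
    using N0 by (simp add: L1_H2_norm_def bochner_norm_def Bochner_Integration.integral_nonneg)
  finally have e: "(LBINT t. \<bar>g t\<bar>) = C * L1_H2_norm a b S" .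
  show thesis
  proof (rule that[of "\<lambda>t. \<bar>g t\<bar>"])
    show "AE s in lebesgue. s \<in> ?T \<longrightarrow> S s \<in> sobolev 2 2 {a<..<b} \<and> \<bar>g s\<bar> = C * ?N s"
      using SX ae by eventually_elim simp
  qed (use g(1) e in auto)
qed

text \<open>The weighted bound stops short of the final time by 2\<beta>, with a constant
  independent of \<beta>; dominated convergence closes the gap.\<close>

lemma integral_up_to_final_time:
  fixes g :: "real \<times> real \<Rightarrow> real"
  assumes g: "integrable lborel g" and B: "B \<in> sets borel"
    and le: "\<And>\<beta>. 0 < \<beta> \<Longrightarrow> \<beta> \<le> 1/8 \<Longrightarrow> (\<integral>z. indicator ({1/2..1 - 2 * \<beta>} \<times> B) z * g z \<partial>lborel) \<le> M"
  shows "(\<integral>z. indicator ({1/2..<1} \<times> B) z * g z \<partial>lborel) \<le> M"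
proof (rule LIMSEQ_le_const2)
  define \<beta> where "\<beta> = (\<lambda>j::nat. 1 / (8 * real (Suc j)))"
  have \<beta>: "0 < \<beta> j" "\<beta> j \<le> 1/8" for j by (auto simp: \<beta>_def field_simps)
  have \<beta>0: "(\<lambda>j. 2 * \<beta> j) \<longlonglongrightarrow> 0"
  proof -
    have "(\<lambda>j. 1/4 * (1 / real (Suc j))) \<longlonglongrightarrow> 1/4 * 0"
      by (intro tendsto_mult tendsto_const LIMSEQ_Suc lim_1_over_n)
    moreover have "2 * \<beta> j = 1/4 * (1 / real (Suc j))" for j by (simp add: \<beta>_def field_simps)
    ultimately show ?thesis by simp
  qed
  have gm: "g \<in> borel_measurable lborel" using borel_measurable_integrable[OF g] .
  have sets: "I \<times> B \<in> sets lborel" if "I \<in> sets borel" for I using that B by (auto intro: borel_Times)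
  show "(\<lambda>j. \<integral>z. indicator ({1/2..1 - 2 * \<beta> j} \<times> B) z * g z \<partial>lborel)
      \<longlonglongrightarrow> (\<integral>z. indicator ({1/2..<1} \<times> B) z * g z \<partial>lborel)"
  proof (rule integral_dominated_convergence[where w="\<lambda>z. \<bar>g z\<bar>"])
    show "(\<lambda>z. indicator ({1/2..<1} \<times> B) z * g z) \<in> borel_measurable lborel"
      by (intro borel_measurable_times borel_measurable_indicator sets gm) simp
    show "(\<lambda>z. indicator ({1/2..1 - 2 * \<beta> j} \<times> B) z * g z) \<in> borel_measurable lborel" for j
      by (intro borel_measurable_times borel_measurable_indicator sets gm) simp
    show "integrable lborel (\<lambda>z. \<bar>g z\<bar>)" using g by simp
    show "AE z in lborel. norm (indicator ({1/2..1 - 2 * \<beta> j} \<times> B) z * g z) \<le> \<bar>g z\<bar>" for j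
      by (rule AE_I2) (simp add: indicator_def)
    show "AE z in lborel. (\<lambda>j. indicator ({1/2..1 - 2 * \<beta> j} \<times> B) z * g z) \<longlonglongrightarrow> indicator ({1/2..<1} \<times> B) z * g z"
    proof (rule AE_I2)
      fix z :: "real \<times> real"
      have "eventually (\<lambda>j. indicator ({1/2..1 - 2 * \<beta> j} \<times> B) z = (indicator ({1/2..<1} \<times> B) z :: real)) sequentially"
      proof (cases "fst z < 1")
        case True
        then have "eventually (\<lambda>j. 2 * \<beta> j < 1 - fst z) sequentially"
          using order_tendstoD(2)[OF \<beta>0, of "1 - fst z"] by simp
        then show ?thesis by eventually_elim (use True in \<open>auto simp: indicator_def mem_Times_iff\<close>)
      next
        case False
        have "indicator ({1/2..1 - 2 * \<beta> j} \<times> B) z = (indicator ({1/2..<1} \<times> B) z :: real)" for j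
          using False \<beta>(1)[of j] by (auto simp: indicator_def mem_Times_iff)
        then show ?thesis by simp
      qed
      then have "eventually (\<lambda>j. indicator ({1/2..1 - 2 * \<beta> j} \<times> B) z * g z = indicator ({1/2..<1} \<times> B) z * g z) sequentially"
        by eventually_elim simp
      then show "(\<lambda>j. indicator ({1/2..1 - 2 * \<beta> j} \<times> B) z * g z) \<longlonglongrightarrow> indicator ({1/2..<1} \<times> B) z * g z"
        by (rule tendsto_eventually)
    qed
  qed
  show "\<exists>N. \<forall>j\<ge>N. (\<integral>z. indicator ({1/2..1 - 2 * \<beta> j} \<times> B) z * g z \<partial>lborel) \<le> M"
    using le \<beta> by blast
qed

text \<open>The inner integrals of \<open>f\<close> are not known to be measurable in time, so they
  are compared almost everywhere with those of the Borel function \<open>g\<close>; the single time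
  t = 1 is a null set.\<close>

lemma iterated_set_integral_eq:
  fixes g :: "real \<times> real \<Rightarrow> real" and f :: "real \<Rightarrow> real \<Rightarrow> real"
  assumes g: "integrable lborel g" and B: "B \<in> sets borel"
    and eq: "AE t in lborel. t \<in> {1/2..1} \<longrightarrow> (AE x in lborel. x \<in> B \<longrightarrow> g (t, x) = f t x)"
  shows "(LINT t:{1/2..1}|lebesgue. LINT x:B|lebesgue. f t x) = (\<integral>z. indicator ({1/2..<1} \<times> B) z * g z \<partial>lborel)"
proof -
  let ?h = "\<lambda>z. indicator ({1/2..<1} \<times> B) z * g z"
  have gm: "g \<in> borel_measurable lborel" using borel_measurable_integrable[OF g] .
  have sets: "{1/2..<1::real} \<times> B \<in> sets lborel" using B by (auto intro: borel_Times)
  have hm: "?h \<in> borel_measurable lborel" by (intro borel_measurable_times borel_measurable_indicator sets gm)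
  have h: "integrable lborel ?h"
    by (rule Bochner_Integration.integrable_bound[OF g hm]) (auto simp: indicator_def)
  note hs = lborel_integral_slices[OF h]
  have hm': "?h \<in> borel_measurable borel" using hm by simp
  have "(LINT t:{1/2..1}|lebesgue. LINT x:B|lebesgue. f t x) = (LBINT t. LBINT x. ?h (t, x))"
  proof (rule set_integral_eq_LBINT_AE)
    show "(\<lambda>t. LBINT x. ?h (t, x)) \<in> borel_measurable borel" using borel_measurable_integrable[OF hs(2)] by simp
    have "AE t in lborel. indicator {1/2..1} t * (LINT x:B|lebesgue. f t x) = (LBINT x. ?h (t, x))"
      using eq AE_lborel_singleton[of "1::real"]
    proof eventually_elim
      case (elim t)
      show ?case
      proof (cases "t \<in> {1/2..1}")
        case True
        have "(LINT x:B|lebesgue. f t x) = (LBINT x. ?h (t, x))"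
        proof (rule set_integral_eq_LBINT_AE)
          show "(\<lambda>x. ?h (t, x)) \<in> borel_measurable borel" by (rule borel_slice_measurable[OF hm'])
          have "AE x in lborel. x \<in> B \<longrightarrow> g (t, x) = f t x" using elim(1) True by blast
          from AE_completion[OF this] show "AE x in lebesgue. indicator B x * f t x = ?h (t, x)"
            by eventually_elim (use True elim(2) in \<open>auto simp: indicator_def\<close>)
        qed
        then show ?thesis using True by simp
      next
        case False
        then have z: "?h (t, x) = 0" for x by (auto simp: indicator_def)
        show ?thesis unfolding z using False by simp
      qed
    qed
    then show "AE t in lebesgue. indicator {1/2..1} t * (LINT x:B|lebesgue. f t x) = (LBINT x. ?h (t, x))"
      by (rule AE_completion)
  qed
  then show ?thesis using hs(3) by simp
qed

theorem theorem4p3: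
  fixes \<alpha> a b \<kappa> Cs C0 C1 C2 C3 :: real
  assumes "\<alpha> > 1" and "a < b" and "\<kappa> > 0"
    and "Cs > 0" and "C0 > 0" and "C1 > 0" and "C2 > 0" and "C3 > 0"
  shows "\<exists>C>0. \<forall>(\<Phi> :: real \<Rightarrow> real \<Rightarrow> real \<Rightarrow> real \<Rightarrow> real)
             (S :: real \<Rightarrow> real \<Rightarrow> real) (v :: real \<Rightarrow> real \<Rightarrow> real) (x0 :: real).
           in_L1_H2 a b S \<and>
           structural_ineqs \<alpha> Cs C0 C1 C2 C3 \<Phi> \<and>
           in_Linf ({1/4..1} \<times> {a..b}) v \<and> Linf_norm ({1/4..1} \<times> {a..b}) v \<le> 1 \<and>
           weak_solution \<alpha> a b \<Phi> S v \<and>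
           x0 \<in> {a..b} \<and> a < x0 - 2 * \<kappa> \<and> x0 + 2 * \<kappa> < b \<longrightarrow>
           (LINT \<tau>:{1/2..1}|lebesgue. LINT x:{x0 - \<kappa>..x0 + \<kappa>}|lebesgue.
              \<bar>v_dx 3 a b v \<tau> x\<bar> powr (\<alpha> + 1))
             \<le> C + C * L1_H2_norm a b S"
proof -
  let ?p = "\<alpha> + 1"
  \<comment> \<open>The thresholds come from the weighted interpolation and from the absorption of
    the slope of the time weight.\<close>
  define m k where "m = nat \<lceil>5 * ?p\<rceil>" and "k = nat \<lceil>?p / (\<alpha> - 1)\<rceil>"
  have m: "real m \<ge> 5 * ?p" and k: "real k \<ge> ?p / (\<alpha> - 1)" unfolding m_def k_def by linarith+
  have m3: "m \<ge> 3"
  proof -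
    have "real m \<ge> 3" by (rule order_trans[OF _ m]) (use assms(1) in simp)
    then show ?thesis by simp
  qed
  have k2: "k \<ge> 2"
  proof -
    have "?p / (\<alpha> - 1) > 1" using assms(1) by (simp add: field_simps)
    then have "real k > 1" by (rule less_le_trans[OF _ k])
    then show ?thesis by simp
  qed
  show ?thesis
  \<comment> \<open>K and afterwards \<open>CS\<close> are obtained before \<Phi>, S, v and x0 are
    introduced, which gives the claimed uniformity.\<close>
  proof (rule slice_estimate[OF assms(1,3,4,5,6,7,8) m k], goal_cases)
    case (1 K)
    note K = 1
    show ?case
    proof (rule source_estimate[OF assms(3) m3], goal_cases)
      case (1 CS)
      note CS = 1
      \<comment> \<open>8^k and (4/3)^m undo the lower bounds (1/8)^k and (3/4)^m of the weights on
        the inner rectangle; 4/C3 undoes the coefficient in the energy estimate.\<close>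
      define D where "D = 8 ^ k * (4/3) ^ m * (4 / C3)"
      have D: "D > 0" using assms(8) by (simp add: D_def)
      show ?case
      \<comment> \<open>K and \<open>CS\<close> are only known to be nonnegative; the added 1 makes
        the constant positive.\<close>
      proof (intro exI[of _ "D * (K + CS + 1)"] conjI allI impI)
        show "0 < D * (K + CS + 1)" using D K(1) CS(1) by simp
        fix \<Phi> :: "real \<Rightarrow> real \<Rightarrow> real \<Rightarrow> real \<Rightarrow> real" and S v :: "real \<Rightarrow> real \<Rightarrow> real" and x0 :: real
        assume asm: "in_L1_H2 a b S \<and>
           structural_ineqs \<alpha> Cs C0 C1 C2 C3 \<Phi> \<and>
           in_Linf ({1/4..1} \<times> {a..b}) v \<and> Linf_norm ({1/4..1} \<times> {a..b}) v \<le> 1 \<and>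
           weak_solution \<alpha> a b \<Phi> S v \<and>
           x0 \<in> {a..b} \<and> a < x0 - 2 * \<kappa> \<and> x0 + 2 * \<kappa> < b"
        let ?c = "x0 - 2 * \<kappa>" and ?d = "x0 + 2 * \<kappa>" and ?B = "{x0 - \<kappa>..x0 + \<kappa>}"
        have S: "in_L1_H2 a b S" and st: "structural_ineqs \<alpha> Cs C0 C1 C2 C3 \<Phi>"
          and vL: "in_Linf ({1/4..1} \<times> {a..b}) v" "Linf_norm ({1/4..1} \<times> {a..b}) v \<le> 1"
          and ws: "weak_solution \<alpha> a b \<Phi> S v" and ab: "a < ?c" "?d < b" and cd: "?c < ?d"
          using asm assms(3) by auto
        have N0: "L1_H2_norm a b S \<ge> 0" by (simp add: L1_H2_norm_def bochner_norm_def)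
        obtain n where n: "integrable lborel n" "\<forall>t. 0 \<le> n t" "(LBINT t. n t) = CS * L1_H2_norm a b S"
          "AE s in lebesgue. s \<in> {1/4<..<1} \<longrightarrow> S s \<in> sobolev 2 2 {a<..<b} \<and> n s = CS * sobolev_norm 2 2 {a<..<b} (S s)"
          using L1_H2_borel_bound[OF S CS(1)] .
        have n0: "\<And>t. 0 \<le> n t" using n(2) by blast
        have source: "AE s in lebesgue. s \<in> {1/4<..<1} \<longrightarrow> \<bar>LINT x:{a..b}|lebesgue. S s x * test_fn m \<kappa> x0 f1 f2 x\<bar> \<le> n s"
          if f: "primitive ?c ?d f0 f1" "primitive ?c ?d f1 f2" "\<forall>x\<in>{?c..?d}. \<bar>f0 x\<bar> \<le> 1" for f0 f1 f2
          using n(4)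
        proof eventually_elim
          case (elim s)
          then show ?case using CS(2)[OF ab _ f(1,2)] f(3) by auto
        qed
        show "(LINT \<tau>:{1/2..1}|lebesgue. LINT x:?B|lebesgue. \<bar>v_dx 3 a b v \<tau> x\<bar> powr ?p)
             \<le> D * (K + CS + 1) + D * (K + CS + 1) * L1_H2_norm a b S"
        proof (rule solution_borel_data[OF assms(1,4,5,6,7,8) ws st vL ab(1) cd ab(2)], goal_cases)
          case (1 W1 W2 W3 F)
          note W = 1
          have flux: "AE t in lborel. t \<in> time_interval \<longrightarrow> (AE x in lborel. x \<in> {?c..?d} \<longrightarrow>
             F (t, x) = flux \<Phi> a b v t x \<and> F (t, x) = \<Phi> (v t x) (W1 (t, x)) (W2 (t, x)) (W3 (t, x)))"
            using W(11)
          proof eventually_elim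
            case (elim t)
            then show ?case by (auto elim: eventually_mono)
          qed
          have eq3: "AE t in lborel. t \<in> {1/2..1} \<longrightarrow> (AE x in lborel. x \<in> ?B \<longrightarrow> \<bar>W3 (t, x)\<bar> powr ?p = \<bar>v_dx 3 a b v t x\<bar> powr ?p)"
            using W(11)
          proof eventually_elim
            case (elim t)
            show ?case
            proof
              assume "t \<in> {1/2..1}"
              then have "AE x in lborel. x \<in> {?c..?d} \<longrightarrow>
                F (t, x) = flux \<Phi> a b v t x \<and> F (t, x) = \<Phi> (v t x) (W1 (t, x)) (W2 (t, x)) (W3 (t, x)) \<and> W3 (t, x) = v_dx 3 a b v t x"
                using elim by auto
              then show "AE x in lborel. x \<in> ?B \<longrightarrow> \<bar>W3 (t, x)\<bar> powr ?p = \<bar>v_dx 3 a b v t x\<bar> powr ?p"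
                by eventually_elim (use assms(3) in auto)
            qed
          qed
          have B: "?B \<in> sets borel" by simp
          let ?g = "\<lambda>z. \<bar>W3 z\<bar> powr ?p"
          have bound: "(\<integral>z. indicator ({1/2..1 - 2 * \<beta>} \<times> ?B) z * ?g z \<partial>lborel) \<le> D * (K + CS * L1_H2_norm a b S)"
            if \<beta>: "0 < \<beta>" "\<beta> \<le> 1/8" for \<beta>
          proof -
            define h where "h = (\<lambda>z. time_weight k \<beta> (fst z) * (cutoff m \<kappa> x0 (snd z) * \<bar>W3 z\<bar> powr ?p))"
            note E = energy_estimate[OF ws st assms(1,3) m3 k2 \<beta> ab W(1-4) W(5) W(6-9) W(10) flux n(1) n0 source K(1) K(2) K(3)]
            have hi: "integrable lborel h" unfolding h_def by (rule E(2))
            have e: "C3 / 4 * (\<integral>z. h z \<partial>lborel) \<le> K + CS * L1_H2_norm a b S"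
              using E(1) unfolding n(3) h_def .
            have h0: "0 \<le> h z" for z
            proof (cases "z \<in> time_interval \<times> {?c..?d}")
              case True
              then have "snd z \<in> {?c..?d}" by auto
              then show ?thesis using cutoff_bounds(1)[OF assms(3), of "snd z" x0 m] time_weight_props(3)[OF \<beta>(1), of k "fst z"]
                by (simp add: h_def)
            next
              case False
              then show ?thesis using W(5)[OF False] by (simp add: h_def)
            qed
            have "(\<integral>z. indicator ({1/2..1 - 2 * \<beta>} \<times> ?B) z * ?g z \<partial>lborel) \<le> (\<integral>z. 8 ^ k * (4/3) ^ m * h z \<partial>lborel)"
            proof (rule integral_mono_AE')
              show "integrable lborel (\<lambda>z. 8 ^ k * (4/3) ^ m * h z)" using hi by simp
              show "AE z in lborel. indicator ({1/2..1 - 2 * \<beta>} \<times> ?B) z * ?g z \<le> 8 ^ k * (4/3) ^ m * h z"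
              proof (rule AE_I2)
                fix z
                show "indicator ({1/2..1 - 2 * \<beta>} \<times> ?B) z * ?g z \<le> 8 ^ k * (4/3) ^ m * h z"
                proof (cases "z \<in> {1/2..1 - 2 * \<beta>} \<times> ?B")
                  case False
                  then show ?thesis using h0[of z] by simp
                next
                  case True
                  then have tx: "fst z \<in> {1/2..1 - 2 * \<beta>}" "snd z \<in> ?B" by auto
                  have "(1/8) ^ k * ((3/4) ^ m * ?g z) \<le> h z"
                    unfolding h_def
                    using time_weight_ge[OF \<beta>(1) tx(1), of k] cutoff_ge[OF assms(3) tx(2), of m]
                      time_weight_props(3)[OF \<beta>(1), of k "fst z"]
                    by (intro mult_mono mult_right_mono) auto
                  then have "8 ^ k * (4/3) ^ m * ((1/8) ^ k * ((3/4) ^ m * ?g z)) \<le> 8 ^ k * (4/3) ^ m * h z"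
                    by (intro mult_left_mono) auto
                  moreover have "8 ^ k * (4/3) ^ m * ((1/8) ^ k * ((3/4) ^ m * ?g z)) = (8 * (1/8)) ^ k * ((4/3) * (3/4)) ^ m * ?g z"
                    unfolding power_mult_distrib by (simp only: mult_ac)
                  ultimately show ?thesis using True by simp
                qed
              qed
              show "AE z in lborel. 0 \<le> 8 ^ k * (4/3) ^ m * h z" using h0 by simp
            qed
            also have "\<dots> = D * (C3 / 4 * (\<integral>z. h z \<partial>lborel))" using assms(8) by (simp add: D_def)
            also have "\<dots> \<le> D * (K + CS * L1_H2_norm a b S)" using e D by (intro mult_left_mono) auto
            finally show ?thesis .
          qed
          have "(LINT \<tau>:{1/2..1}|lebesgue. LINT x:?B|lebesgue. \<bar>v_dx 3 a b v \<tau> x\<bar> powr ?p)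
            = (\<integral>z. indicator ({1/2..<1} \<times> ?B) z * ?g z \<partial>lborel)"
            by (rule iterated_set_integral_eq[OF W(8) B eq3])
          also have "\<dots> \<le> D * (K + CS * L1_H2_norm a b S)"
            by (rule integral_up_to_final_time[OF W(8) B bound])
          also have "\<dots> \<le> D * ((K + CS + 1) + (K + CS + 1) * L1_H2_norm a b S)"
          proof (rule mult_left_mono)
            have "CS * L1_H2_norm a b S \<le> (K + CS + 1) * L1_H2_norm a b S" using K(1) N0 by (intro mult_right_mono) auto
            then show "K + CS * L1_H2_norm a b S \<le> (K + CS + 1) + (K + CS + 1) * L1_H2_norm a b S" using CS(1) by linarith
          qed (use D in simp)
          finally show ?case by (simp add: algebra_simps)
        qed
      qed
    qed
  qed
qed

end
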